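(* Let $k$ be a field of characteristic $\operatorname{char}(k)\ge 0$. Let $m,p,d,n$ be positive integers with $m=pd$ and $n\ge 2$, and let $\delta=(\delta_0,\delta_p,\dots,\delta_{(d-1)p})\in k^d$. If $n$ is even, suppose $\delta\neq 0$. Then the algebra $B_{m,p,n}(\delta)$ is quasi-hereditary if and only if either $\operatorname{char}(k)=0$, or $\operatorname{char}(k)>n$ and $\operatorname{char}(k)\nmid m$.
   Context: Diagrams: a reduced diagram on $n$ strands has $n$ northern nodes and $n$ southern nodes; each node is joined to precisely one other by a strand, and each strand is labelled by an element of $\mathbb{Z}/m\mathbb{Z}$. Two diagrams are equal if their strands connect the same pairs of nodes with the same labels. The Brauer algebra $B_{m,p,n}(\delta)$ of type $G(m,p,n)$ is the $k$-vector space with basis the reduced diagrams whose labels sum to a multiple of $p$. The product $x\cdot y$ of two diagrams is obtained by placing $x$ above $y$ and identifying the southern nodes of $x$ with the northern nodes of $y$; the label of each resulting strand is the sum of the labels of the strands composing it; each closed loop is removed, multiplying by $\delta_{ip}$ if its label is $ip$, and the product is zero if some closed loop has label not divisible by $p$. *)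

theory Defs
  imports "HOL-Algebra.Module" "HOL-Algebra.QuotRing" "HOL-Algebra.Ideal_Product"
begin

section \<open>Projective left modules\<close>

text \<open>
  The locale \<^locale>\<open>module\<close> of the library requires a commutative ring of scalars.  For a
  ring \<open>R\<close> that need not be commutative only the underlying record is used; its fields
  \<open>mult\<close> and \<open>one\<close> carry no information.
\<close>

definition left_module_hom ::
    "('a, 'r) ring_scheme \<Rightarrow> ('a, 'b, 's) module_scheme \<Rightarrow> ('a, 'c, 't) module_scheme \<Rightarrow> ('b \<Rightarrow> 'c) set"
  where
    "left_module_hom R M N =
      {h \<in> carrier M \<rightarrow> carrier N.
        (\<forall>x\<in>carrier M. \<forall>y\<in>carrier M. h (x \<oplus>\<^bsub>M\<^esub> y) = h x \<oplus>\<^bsub>N\<^esub> h y) \<and>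
        (\<forall>a\<in>carrier R. \<forall>x\<in>carrier M. h (a \<odot>\<^bsub>M\<^esub> x) = a \<odot>\<^bsub>N\<^esub> h x)}"

definition free_left_module :: "('a, 'r) ring_scheme \<Rightarrow> 'i set \<Rightarrow> ('a, 'i \<Rightarrow> 'a) module"
  where
    "free_left_module R I =
      \<lparr>carrier = {f. (\<forall>i\<in>I. f i \<in> carrier R) \<and> (\<forall>i. i \<notin> I \<longrightarrow> f i = \<zero>\<^bsub>R\<^esub>)
                    \<and> finite {i. f i \<noteq> \<zero>\<^bsub>R\<^esub>}},
       mult = undefined, one = undefined,
       zero = (\<lambda>i. \<zero>\<^bsub>R\<^esub>),
       add = (\<lambda>f g i. f i \<oplus>\<^bsub>R\<^esub> g i),
       smult = (\<lambda>a f i. a \<otimes>\<^bsub>R\<^esub> f i)\<rparr>"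

text \<open>
  A module is projective if it is a direct summand of a free module.  It suffices to consider
  bases indexed by sets of elements of the type of \<open>M\<close>: if \<open>M\<close> is projective,
  then the canonical surjection onto \<open>M\<close> from the free module with basis
  \<open>carrier M\<close> splits.
\<close>

definition projective_left_module :: "('a, 'r) ring_scheme \<Rightarrow> ('a, 'b, 's) module_scheme \<Rightarrow> bool"
  where
    "projective_left_module R M \<longleftrightarrow>
      (\<exists>I :: 'b set.
        \<exists>\<iota> \<in> left_module_hom R M (free_left_module R I).
        \<exists>\<pi> \<in> left_module_hom R (free_left_module R I) M.
          \<forall>x\<in>carrier M. \<pi> (\<iota> x) = x)"

definition ideal_as_left_module :: "('a, 'r) ring_scheme \<Rightarrow> 'a set \<Rightarrow> ('a, 'a) module"
  where
    "ideal_as_left_module R J =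
      \<lparr>carrier = J, mult = undefined, one = undefined,
       zero = \<zero>\<^bsub>R\<^esub>, add = (\<oplus>\<^bsub>R\<^esub>), smult = (\<otimes>\<^bsub>R\<^esub>)\<rparr>"


section \<open>Quasi-hereditary algebras\<close>

locale left_ideal = additive_subgroup I R + ring R for I and R (structure) +
  assumes left_closed: "\<lbrakk>a \<in> carrier R; x \<in> I\<rbrakk> \<Longrightarrow> a \<otimes> x \<in> I"

definition maximal_left_ideal :: "'a set \<Rightarrow> ('a, 'r) ring_scheme \<Rightarrow> bool"
  where
    "maximal_left_ideal I R \<longleftrightarrow>
      left_ideal I R \<and> I \<noteq> carrier R \<and>
      (\<forall>L. left_ideal L R \<and> I \<subseteq> L \<longrightarrow> L = I \<or> L = carrier R)"

definition jacobson_radical :: "('a, 'r) ring_scheme \<Rightarrow> 'a set"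
  where "jacobson_radical R = carrier R \<inter> \<Inter> {L. maximal_left_ideal L R}"

text \<open>
  Heredity ideals in the sense of Cline, Parshall and Scott: \<open>J J = J\<close>,
  \<open>J N J = 0\<close> for the radical \<open>N\<close>, and \<open>J\<close> is projective on one side (for an
  idempotent ideal with \<open>J N J = 0\<close> in a finite-dimensional algebra, being projective as a
  left module and as a right module are equivalent).
\<close>

definition heredity_ideal :: "'a set \<Rightarrow> ('a, 'r) ring_scheme \<Rightarrow> bool"
  where
    "heredity_ideal J R \<longleftrightarrow>
      ideal J R \<and>
      J \<cdot>\<^bsub>R\<^esub> J = J \<and>
      (\<forall>x\<in>J. \<forall>r\<in>jacobson_radical R. \<forall>y\<in>J. x \<otimes>\<^bsub>R\<^esub> r \<otimes>\<^bsub>R\<^esub> y = \<zero>\<^bsub>R\<^esub>) \<and>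
      projective_left_module R (ideal_as_left_module R J)"

text \<open>
  The set \<open>(\<lambda>x. J i +> x) ` J (Suc i)\<close> is the ideal \<open>J (Suc i) / J i\<close> of the quotient by
  \<open>J i\<close>.  Allowing repetitions in the chain makes no difference, the zero ideal being a
  heredity ideal.  The ideals of a unital algebra over a field are automatically subspaces, so
  only the ring structure of the algebra enters.
\<close>

definition quasi_hereditary :: "('a, 'r) ring_scheme \<Rightarrow> bool"
  where
    "quasi_hereditary R \<longleftrightarrow>
      (\<exists>(t::nat) J.
        J 0 = {\<zero>\<^bsub>R\<^esub>} \<and> J t = carrier R \<and>
        (\<forall>i\<le>t. ideal (J i) R) \<and>
        (\<forall>i<t. J i \<subseteq> J (Suc i) \<and>
          heredity_ideal ((\<lambda>x. J i +>\<^bsub>R\<^esub> x) ` J (Suc i)) (R Quot (J i))))"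


section \<open>Labelled Brauer diagrams\<close>

datatype node = North nat | South nat

text \<open>
  A strand is given by its two end points and its label; labels in the integers modulo
  \<open>m\<close> are represented by their residues in \<open>{..<m}\<close>.
\<close>

type_synonym diagram = "(node set \<times> nat) set"

definition nodes :: "nat \<Rightarrow> node set"
  where "nodes n = North ` {..<n} \<union> South ` {..<n}"

definition reduced_diagrams :: "nat \<Rightarrow> nat \<Rightarrow> diagram set"
  where
    "reduced_diagrams m n =
      {x. (\<forall>(e, a)\<in>x. e \<subseteq> nodes n \<and> card e = 2 \<and> a < m) \<and>
          (\<forall>v\<in>nodes n. \<exists>!s. s \<in> x \<and> v \<in> fst s)}"

text \<open>As \<open>p\<close> divides \<open>m\<close>, divisibility by \<open>p\<close> does not depend on representatives.\<close>

definition brauer_diagrams :: "nat \<Rightarrow> nat \<Rightarrow> nat \<Rightarrow> diagram set"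
  where
    "brauer_diagrams m p n = {x \<in> reduced_diagrams m n. p dvd (\<Sum>s\<in>x. snd s)}"

definition identity_diagram :: "nat \<Rightarrow> diagram"
  where "identity_diagram n = (\<lambda>i. ({North i, South i}, 0)) ` {..<n}"


subsection \<open>Concatenation\<close>

text \<open>
  When \<open>x\<close> is placed above \<open>y\<close>, the southern nodes of \<open>x\<close> are identified with the
  northern nodes of \<open>y\<close>; these become the points \<open>Middle i\<close>.
\<close>

datatype point = Outer node | Middle nat

fun above :: "node \<Rightarrow> point" where
  "above (North i) = Outer (North i)"
| "above (South i) = Middle i"

fun below :: "node \<Rightarrow> point" where
  "below (North i) = Middle i"
| "below (South i) = Outer (South i)"

definition placed :: "(node \<Rightarrow> point) \<Rightarrow> diagram \<Rightarrow> (point set \<times> nat) set"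
  where "placed f x = (\<lambda>(e, a). (f ` e, a)) ` x"

definition components :: "diagram \<Rightarrow> diagram \<Rightarrow> point set set"
  where
    "components x y =
      (let S = placed above x \<union> placed below y
       in (\<Union>(e, a)\<in>S. e) // {(u, v). \<exists>(e, a)\<in>S. u \<in> e \<and> v \<in> e}\<^sup>*)"

text \<open>
  The strands of \<open>x\<close> and of \<open>y\<close> are summed separately, because a strand of \<open>x\<close>
  and one of \<open>y\<close> with the same label may join the same two middle points.
\<close>

definition label :: "nat \<Rightarrow> diagram \<Rightarrow> diagram \<Rightarrow> point set \<Rightarrow> nat"
  where
    "label m x y C =
      ((\<Sum>(e, a)\<in>{s \<in> placed above x. fst s \<subseteq> C}. a) +
       (\<Sum>(e, a)\<in>{s \<in> placed below y. fst s \<subseteq> C}. a)) mod m"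

definition closed_loops :: "diagram \<Rightarrow> diagram \<Rightarrow> point set set"
  where "closed_loops x y = {C \<in> components x y. Outer -` C = {}}"

text \<open>
  A component that is not a closed loop is a path; its two end points are the outer nodes it
  contains.
\<close>

definition concat_diagram :: "nat \<Rightarrow> diagram \<Rightarrow> diagram \<Rightarrow> diagram"
  where
    "concat_diagram m x y =
      (\<lambda>C. (Outer -` C, label m x y C)) ` (components x y - closed_loops x y)"

definition loop_factor :: "nat \<Rightarrow> nat \<Rightarrow> (nat \<Rightarrow> 'k) \<Rightarrow> diagram \<Rightarrow> diagram \<Rightarrow> 'k::field"
  where
    "loop_factor m p \<delta> x y =
      (\<Prod>C\<in>closed_loops x y. if p dvd label m x y C then \<delta> (label m x y C) else 0)"


section \<open>The Brauer algebra of type \<open>G(m,p,n)\<close>\<close>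

text \<open>
  An element is the family of its coordinates with respect to the (finite) basis of diagrams.
  The parameter \<open>\<delta>\<close> is indexed by the loop labels: only its values at
  \<open>0, p, \<dots>, (d - 1) p\<close> are used.
\<close>

definition brauer_algebra ::
    "nat \<Rightarrow> nat \<Rightarrow> nat \<Rightarrow> (nat \<Rightarrow> 'k) \<Rightarrow> ('k::field, diagram \<Rightarrow> 'k) module"
  where
    "brauer_algebra m p n \<delta> =
      \<lparr>carrier = {f. \<forall>x. x \<notin> brauer_diagrams m p n \<longrightarrow> f x = 0},
       mult = (\<lambda>f g z. \<Sum>x\<in>brauer_diagrams m p n. \<Sum>y\<in>brauer_diagrams m p n.
                 if concat_diagram m x y = z then f x * g y * loop_factor m p \<delta> x y else 0),
       one = (\<lambda>z. if z = identity_diagram n then 1 else 0),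
       zero = (\<lambda>z. 0),
       add = (\<lambda>f g z. f z + g z),
       smult = (\<lambda>c f z. c * f z)\<rparr>"

end

theory Submission
  imports Defs "HOL-Combinatorics.Permutations" "HOL-Number_Theory.Cong" "HOL-Library.FuncSet"
    "HOL-Library.Function_Algebras" "HOL.Vector_Spaces"
begin

text \<open>
  Let \<open>\<Gamma>\<close> be the group of the diagrams without arcs joining two northern nodes; its order is \<open>n! m^(n-1) d\<close>,
  and the theorem says that the algebra is quasi-hereditary iff this is invertible in \<open>k\<close>.  The diagrams
  with at least \<open>r\<close> northern arcs span an ideal; \<open>\<delta> \<noteq> 0\<close>, or a free node if \<open>n\<close> is odd, gives elements that act
  as one-sided units on the diagrams with a prescribed set of northern (or southern) arcs.  If the order of \<open>\<Gamma>\<close>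
  is invertible, these units split the layers of the chain into projective modules, and averaging over
  the stabilisers of arc sets in \<open>\<Gamma>\<close>, as in Maschke's theorem, shows that \<open>J N J = 0\<close> in each layer.

  Conversely, if the order of \<open>\<Gamma>\<close> vanishes in \<open>k\<close>, there is an element \<open>z\<close> that acts as \<open>1\<close> in the trivial
  representation of \<open>\<Gamma>\<close> while \<open>x \<mapsto> z x a\<close> is traceless for all \<open>a\<close>: start with the identity, whose traces
  are multiples of the order of \<open>\<Gamma>\<close>, and correct it rank by rank with the one-sided units.  In a
  quasi-hereditary algebra the tracelessness descends along the chain by dual bases, and then to every
  composition factor, as a factor that lives in a layer is the head of a projective left ideal of it
  whose radical belongs to the layers above.  So \<open>z\<close> would be traceless on the trivial representation.
\<close>


section \<open>Connected components\<close>

text \<open>For an idempotent \<open>a\<close>, the trace of \<open>x \<mapsto> z x a\<close> is the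
  trace of \<open>z\<close> on the projective module \<open>R a\<close>; and over a quasi-hereditary
  algebra every finite-dimensional module is an integral combination of projectives in the
  Grothendieck group. That is why tracelessness for all \<open>a\<close> must reach the trivial
  representation. The proof avoids homological algebra: arbitrary \<open>a\<close> replace
  idempotents, which fits computations with dual bases, and a module occurs only as a pair
  \<open>U \<subseteq> V\<close> of left ideals, its trace being the trace on \<open>V\<close> minus
  the trace on \<open>U\<close>. The group algebra shows where the order of \<open>\<Gamma>\<close>
  comes from: there \<open>x \<mapsto> x a\<close> has trace \<open>card \<Gamma>\<close> times the
  coefficient of \<open>a\<close> at the unit. The algebraic part uses diagrams only through axioms
  on two sets of arcs. These axioms are stable under passing to the opposite algebra, so one-sided
  facts are proved on one side only. The combinatorial obstacle is associativity with labels and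
  loop factors, which is reduced to contracting a part of a graph.\<close>

text \<open>Edges are sets of any size, since contraction replaces edges by traces of whole
  components. A point on no edge is related to itself, so \<open>comps\<close> takes only the
  classes of points of \<open>\<Union>E\<close>.\<close>

definition conn :: "'v set set \<Rightarrow> ('v \<times> 'v) set"
  where "conn E = {(u, v). \<exists>e\<in>E. u \<in> e \<and> v \<in> e}\<^sup>*"

definition comps :: "'v set set \<Rightarrow> 'v set set"
  where "comps E = \<Union>E // conn E"

lemma conn_refl [simp]: "(u, u) \<in> conn E"
  by (simp add: conn_def)

lemma conn_edge: "e \<in> E \<Longrightarrow> u \<in> e \<Longrightarrow> v \<in> e \<Longrightarrow> (u, v) \<in> conn E"
  by (auto simp: conn_def)

lemma conn_trans: "(u, v) \<in> conn E \<Longrightarrow> (v, w) \<in> conn E \<Longrightarrow> (u, w) \<in> conn E"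
  by (auto simp: conn_def)

lemma conn_sym: "(u, v) \<in> conn E \<Longrightarrow> (v, u) \<in> conn E"
  unfolding conn_def by (rule symD[OF sym_rtrancl]) (auto intro: symI)

text \<open>The induction principle behind most connectivity arguments: they reduce to exhibiting a
  set that no edge leaves.\<close>

lemma conn_closed:
  assumes "(u, v) \<in> conn E" "u \<in> S" "\<And>e. e \<in> E \<Longrightarrow> e \<inter> S \<noteq> {} \<Longrightarrow> e \<subseteq> S"
  shows "v \<in> S"
  using assms(1) unfolding conn_def
  by (induction rule: rtrancl_induct) (use assms(2,3) in blast)+

lemma conn_mono: "(\<And>e u v. e \<in> E \<Longrightarrow> u \<in> e \<Longrightarrow> v \<in> e \<Longrightarrow> (u, v) \<in> conn F) \<Longrightarrow> conn E \<subseteq> conn F"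
proof
  fix p assume a: "\<And>e u v. e \<in> E \<Longrightarrow> u \<in> e \<Longrightarrow> v \<in> e \<Longrightarrow> (u, v) \<in> conn F" and "p \<in> conn E"
  then obtain u v where p: "p = (u, v)" and "(u, v) \<in> conn E" by (cases p) auto
  then have "(u, v) \<in> {(u, v). \<exists>e\<in>E. u \<in> e \<and> v \<in> e}\<^sup>*" by (simp add: conn_def)
  then have "(u, v) \<in> conn F"
  proof (induction rule: rtrancl_induct)
    case (step y z) then show ?case using a conn_trans by fast
  qed simp
  then show "p \<in> conn F" using p by simp
qed

lemma conn_in_Union: "(u, v) \<in> conn E \<Longrightarrow> u \<in> \<Union>E \<Longrightarrow> v \<in> \<Union>E"
  by (rule conn_closed[of u v E]) auto

lemma compsE:
  assumes "C \<in> comps E"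
  obtains u where "u \<in> \<Union>E" "C = {v. (u, v) \<in> conn E}"
  using assms unfolding comps_def quotient_def by auto

lemma comps_subset: "C \<in> comps E \<Longrightarrow> C \<subseteq> \<Union>E"
  by (elim compsE) (use conn_in_Union in fast)

lemma comps_nonempty: "C \<in> comps E \<Longrightarrow> C \<noteq> {}"
  by (elim compsE) (use conn_refl in fast)

lemma comps_closed: "C \<in> comps E \<Longrightarrow> e \<in> E \<Longrightarrow> e \<inter> C \<noteq> {} \<Longrightarrow> e \<subseteq> C"
  by (elim compsE) (use conn_edge conn_trans in fast)

lemma comps_conn: "C \<in> comps E \<Longrightarrow> u \<in> C \<Longrightarrow> v \<in> C \<Longrightarrow> (u, v) \<in> conn E"
  by (elim compsE) (use conn_sym conn_trans in fast)

lemma comps_conn_mem: "C \<in> comps E \<Longrightarrow> u \<in> C \<Longrightarrow> (u, v) \<in> conn E \<Longrightarrow> v \<in> C"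
  by (elim compsE) (use conn_trans in fast)

lemma comps_disjoint: "C \<in> comps E \<Longrightarrow> C' \<in> comps E \<Longrightarrow> u \<in> C \<Longrightarrow> u \<in> C' \<Longrightarrow> C = C'"
  by (intro equalityI subsetI) (blast intro: comps_conn_mem[OF _ _ comps_conn])+

lemma comps_cover: "u \<in> \<Union>E \<Longrightarrow> \<exists>C\<in>comps E. u \<in> C"
  unfolding comps_def quotient_def by (rule bexI[of _ "conn E `` {u}"]) auto

lemma compsI:
  assumes "C \<noteq> {}" "C \<subseteq> \<Union>E" "\<And>e. e \<in> E \<Longrightarrow> e \<inter> C \<noteq> {} \<Longrightarrow> e \<subseteq> C"
    "\<And>u v. u \<in> C \<Longrightarrow> v \<in> C \<Longrightarrow> (u, v) \<in> conn E"
  shows "C \<in> comps E"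
proof -
  obtain u where u: "u \<in> C" using assms(1) by auto
  have "C = {v. (u, v) \<in> conn E}"
    using u assms(3,4) conn_closed[of u _ E C] by blast
  then have "C = conn E `` {u}" by auto
  then show ?thesis using u assms(2) unfolding comps_def quotient_def by blast
qed

lemma conn_image: "inj g \<Longrightarrow> (g u, g v) \<in> conn ((`) g ` E) \<longleftrightarrow> (u, v) \<in> conn E"
proof
  assume g: "inj g" and "(g u, g v) \<in> conn ((`) g ` E)"
  then have "g v \<in> g ` {v. (u, v) \<in> conn E}"
    by (rule_tac conn_closed) (auto simp: inj_eq intro!: imageI intro: conn_trans[OF _ conn_edge])
  then show "(u, v) \<in> conn E" using g by (simp add: inj_image_mem_iff)
next
  assume "(u, v) \<in> conn E"
  then have "v \<in> {v. (g u, g v) \<in> conn ((`) g ` E)}"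
    by (rule conn_closed) (auto intro: conn_trans[OF _ conn_edge])
  then show "(g u, g v) \<in> conn ((`) g ` E)" by simp
qed

lemma comps_image:
  assumes g: "inj g" shows "comps ((`) g ` E) = (`) g ` comps E"
proof
  have *: "g ` C \<in> comps ((`) g ` E)" if C: "C \<in> comps E" for C
  proof (rule compsI)
    show "g ` C \<noteq> {}" using comps_nonempty[OF C] by simp
    show "g ` C \<subseteq> \<Union> ((`) g ` E)" using comps_subset[OF C] by auto
    show "e \<subseteq> g ` C" if e: "e \<in> (`) g ` E" "e \<inter> g ` C \<noteq> {}" for e
    proof -
      obtain e' where e': "e' \<in> E" "e = g ` e'" using e(1) by blast
      then have "e' \<inter> C \<noteq> {}" using e g by (auto simp: inj_eq)
      then show ?thesis using comps_closed[OF C e'(1)] e' by auto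
    qed
    show "(u, v) \<in> conn ((`) g ` E)" if "u \<in> g ` C" "v \<in> g ` C" for u v
      using that comps_conn[OF C] conn_image[OF g] by blast
  qed
  then show "(`) g ` comps E \<subseteq> comps ((`) g ` E)" by auto
  show "comps ((`) g ` E) \<subseteq> (`) g ` comps E"
  proof
    fix K assume K: "K \<in> comps ((`) g ` E)"
    obtain w where w: "w \<in> K" using comps_nonempty[OF K] by auto
    then have "w \<in> \<Union> ((`) g ` E)" using comps_subset[OF K] by (rule subsetD[rotated])
    then obtain u where u: "w = g u" "u \<in> \<Union>E" by auto
    obtain C where C: "C \<in> comps E" "u \<in> C" using comps_cover[OF u(2)] by auto
    have "K = g ` C" using comps_disjoint[OF K *[OF C(1)] w] u C by auto
    then show "K \<in> (`) g ` comps E" using C by auto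
  qed
qed

text \<open>A part \<open>A\<close> of the edges may be replaced by the traces \<open>A'\<close> of its components on the set \<open>Q\<close> through
  which it communicates with the rest.\<close>

lemma conn_contract:
  assumes AB: "\<Union>B \<inter> \<Union>A \<subseteq> Q" and QA: "Q \<subseteq> \<Union>A"
    and A': "A' = {C \<inter> Q | C. C \<in> comps A \<and> C \<inter> Q \<noteq> {}}"
    and u: "u \<in> Q \<union> \<Union>B" and v: "v \<in> Q \<union> \<Union>B"
  shows "(u, v) \<in> conn (A \<union> B) \<longleftrightarrow> (u, v) \<in> conn (A' \<union> B)"
proof
  have "conn (A' \<union> B) \<subseteq> conn (A \<union> B)"
  proof (rule conn_mono)
    fix e u v assume e: "e \<in> A' \<union> B" "u \<in> e" "v \<in> e"
    have "conn A \<subseteq> conn (A \<union> B)" by (rule conn_mono) (auto intro: conn_edge)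
    then show "(u, v) \<in> conn (A \<union> B)"
      using e comps_conn[of _ A] conn_edge[of e "A \<union> B" u v] by (auto simp: A')
  qed
  then show "(u, v) \<in> conn (A' \<union> B) \<Longrightarrow> (u, v) \<in> conn (A \<union> B)" by auto
  \<comment> \<open>A nontrivial connection inside \<open>A\<close> between two points of
    \<open>Q \<union> \<Union>B\<close> has both ends in \<open>Q\<close>, as \<open>A\<close> meets
    \<open>\<Union>B\<close> only there; so it is recorded by an edge of \<open>A'\<close>.\<close>
  have key: "(v', w) \<in> conn (A' \<union> B)" if "v' \<in> Q \<union> \<Union>B" "w \<in> Q \<union> \<Union>B" "(v', w) \<in> conn A" for v' w
  proof (cases "v' = w")
    case False
    have "v' \<in> \<Union>A"
    proof (rule ccontr)
      assume "v' \<notin> \<Union>A"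
      then have "w \<in> {v'}" by (intro conn_closed[OF that(3)]) auto
      then show False using False by simp
    qed
    then have "w \<in> \<Union>A" using conn_in_Union that(3) by fast
    have vw: "v' \<in> Q" "w \<in> Q" using that \<open>v' \<in> \<Union>A\<close> \<open>w \<in> \<Union>A\<close> AB by auto
    obtain C where C: "C \<in> comps A" "v' \<in> C" using comps_cover[OF \<open>v' \<in> \<Union>A\<close>] by auto
    then have "w \<in> C" using comps_conn_mem that(3) by fast
    then show ?thesis using C vw by (intro conn_edge[of "C \<inter> Q"]) (auto simp: A')
  qed simp
  assume uv: "(u, v) \<in> conn (A \<union> B)"
  \<comment> \<open>The points reached by one \<open>A\<close>-connection from a point of
    \<open>Q \<union> \<Union>B\<close> that the contracted graph already joins to \<open>u\<close>.
    No edge of \<open>A\<close> or of \<open>B\<close> leaves this set.\<close>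
  define S where "S = {w. \<exists>v'\<in>Q \<union> \<Union>B. (u, v') \<in> conn (A' \<union> B) \<and> (v', w) \<in> conn A}"
  have "v \<in> S"
  proof (rule conn_closed[OF uv])
    show "u \<in> S" using u by (auto simp: S_def intro!: bexI[of _ u])
    fix e assume e: "e \<in> A \<union> B" "e \<inter> S \<noteq> {}"
    then obtain w v' where w: "w \<in> e" "v' \<in> Q \<union> \<Union>B" "(u, v') \<in> conn (A' \<union> B)" "(v', w) \<in> conn A"
      by (auto simp: S_def)
    show "e \<subseteq> S"
    proof
      fix w2 assume w2: "w2 \<in> e"
      show "w2 \<in> S"
      proof (cases "e \<in> A")
        case True
        then have "(v', w2) \<in> conn A" using w w2 conn_edge conn_trans by fast
        then show ?thesis using w by (auto simp: S_def)
      next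
        case False
        then have eB: "e \<in> B" using e by auto
        then have "(v', w) \<in> conn (A' \<union> B)" using w key by blast
        then have "(u, w2) \<in> conn (A' \<union> B)"
          using conn_trans[OF conn_trans[OF w(3)] conn_edge[of e "A' \<union> B" w w2]] eB w(1) w2 by blast
        then show ?thesis using eB w2 by (auto simp: S_def intro!: bexI[of _ w2])
      qed
    qed
  qed
  then obtain v' where "v' \<in> Q \<union> \<Union>B" "(u, v') \<in> conn (A' \<union> B)" "(v', v) \<in> conn A"
    by (auto simp: S_def)
  then show "(u, v) \<in> conn (A' \<union> B)" by (blast intro: conn_trans[OF _ key[OF _ v]])
qed

text \<open>On \<open>P\<close> the full and the contracted graph have the same connectivity, so
  intersecting with \<open>P\<close> matches their components. A component that avoids
  \<open>P\<close> can use no edge of \<open>B\<close> and stays inside \<open>A\<close>; in the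
  application these are the closed loops of the first product.\<close>

lemma comps_contract:
  assumes AB: "\<Union>B \<inter> \<Union>A \<subseteq> Q" and QA: "Q \<subseteq> \<Union>A"
    and A': "A' = {C \<inter> Q | C. C \<in> comps A \<and> C \<inter> Q \<noteq> {}}"
    and P: "P = Q \<union> \<Union>B"
  shows comps_contract_meet: "bij_betw (\<lambda>C. C \<inter> P) {C \<in> comps (A \<union> B). C \<inter> P \<noteq> {}} (comps (A' \<union> B))"
    and comps_contract_avoid: "{C \<in> comps (A \<union> B). C \<inter> P = {}} = {C \<in> comps A. C \<inter> Q = {}}"
proof -
  note cc = conn_contract[OF AB QA A', folded P]
  have UA': "\<Union>A' = Q"
  proof -
    have "Q \<subseteq> \<Union>A'"
    proof
      fix v assume "v \<in> Q"
      moreover then obtain C where "C \<in> comps A" "v \<in> C" using comps_cover QA by (metis subsetD)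
      ultimately show "v \<in> \<Union>A'" by (auto simp: A')
    qed
    then show ?thesis by (auto simp: A')
  qed
  then have UP: "\<Union>(A' \<union> B) = P" by (simp add: P)
  have PU: "P \<subseteq> \<Union>(A \<union> B)" using QA P by auto
  have mem: "C \<inter> P \<in> comps (A' \<union> B)" if C: "C \<in> comps (A \<union> B)" and ne: "C \<inter> P \<noteq> {}" for C
  proof (rule compsI[OF ne])
    show "C \<inter> P \<subseteq> \<Union> (A' \<union> B)" using UP by auto
    fix e assume e: "e \<in> A' \<union> B" "e \<inter> (C \<inter> P) \<noteq> {}"
    then obtain u where u: "u \<in> e" "u \<in> C" "u \<in> P" by auto
    show "e \<subseteq> C \<inter> P"
    proof
      fix v assume v: "v \<in> e"
      then have vP: "v \<in> P" using e(1) UP by auto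
      have "(u, v) \<in> conn (A' \<union> B)" using conn_edge[OF e(1) u(1) v] .
      then have "(u, v) \<in> conn (A \<union> B)" using cc u vP by blast
      then show "v \<in> C \<inter> P" using comps_conn_mem[OF C u(2)] vP by auto
    qed
  next
    fix u v assume "u \<in> C \<inter> P" "v \<in> C \<inter> P"
    then show "(u, v) \<in> conn (A' \<union> B)" using cc comps_conn[OF C] by blast
  qed
  show "bij_betw (\<lambda>C. C \<inter> P) {C \<in> comps (A \<union> B). C \<inter> P \<noteq> {}} (comps (A' \<union> B))"
  proof (rule bij_betw_imageI)
    show "inj_on (\<lambda>C. C \<inter> P) {C \<in> comps (A \<union> B). C \<inter> P \<noteq> {}}"
      by (rule inj_onI) (use comps_disjoint[of _ "A \<union> B"] in blast)
    show "(\<lambda>C. C \<inter> P) ` {C \<in> comps (A \<union> B). C \<inter> P \<noteq> {}} = comps (A' \<union> B)"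
    proof
      show "(\<lambda>C. C \<inter> P) ` {C \<in> comps (A \<union> B). C \<inter> P \<noteq> {}} \<subseteq> comps (A' \<union> B)" using mem by auto
      show "comps (A' \<union> B) \<subseteq> (\<lambda>C. C \<inter> P) ` {C \<in> comps (A \<union> B). C \<inter> P \<noteq> {}}"
      proof
        fix K assume K: "K \<in> comps (A' \<union> B)"
        then obtain u where u: "u \<in> K" "u \<in> P" using comps_nonempty comps_subset UP by (metis ex_in_conv subsetD)
        then obtain C where C: "C \<in> comps (A \<union> B)" "u \<in> C" using comps_cover PU by (metis subsetD)
        have "K = C \<inter> P" using comps_disjoint[OF K mem[OF C(1)]] u C by blast
        then show "K \<in> (\<lambda>C. C \<inter> P) ` {C \<in> comps (A \<union> B). C \<inter> P \<noteq> {}}" using C u by blast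
      qed
    qed
  qed
  show "{C \<in> comps (A \<union> B). C \<inter> P = {}} = {C \<in> comps A. C \<inter> Q = {}}"
  proof (intro equalityI subsetI; clarify)
    fix C assume C: "C \<in> comps A" "C \<inter> Q = {}"
    have "conn A \<subseteq> conn (A \<union> B)" by (rule conn_mono) (auto intro: conn_edge)
    have CP: "C \<inter> P = {}" using C comps_subset[OF C(1)] AB P by auto
    have "C \<in> comps (A \<union> B)"
    proof (rule compsI[OF comps_nonempty[OF C(1)]])
      show "C \<subseteq> \<Union> (A \<union> B)" using comps_subset[OF C(1)] by auto
      show "e \<subseteq> C" if "e \<in> A \<union> B" "e \<inter> C \<noteq> {}" for e
        using that comps_closed[OF C(1)] CP P by blast
      show "(u, v) \<in> conn (A \<union> B)" if "u \<in> C" "v \<in> C" for u v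
        using that comps_conn[OF C(1)] \<open>conn A \<subseteq> conn (A \<union> B)\<close> by blast
    qed
    then show "C \<in> comps (A \<union> B) \<and> C \<inter> P = {}" using CP by simp
  next
    fix C assume C: "C \<in> comps (A \<union> B)" "C \<inter> P = {}"
    have sub: "C \<subseteq> \<Union>A" using comps_subset[OF C(1)] C(2) P by auto
    obtain u where u: "u \<in> C" using comps_nonempty[OF C(1)] by auto
    obtain K where K: "K \<in> comps A" "u \<in> K" using comps_cover u sub by (metis subsetD)
    have "conn A \<subseteq> conn (A \<union> B)" by (rule conn_mono) (auto intro: conn_edge)
    then have KC: "K \<subseteq> C" using comps_conn[OF K] comps_conn_mem[OF C(1) u] by blast
    have "C \<subseteq> K"
    proof
      fix v assume "v \<in> C"
      then have "(u, v) \<in> conn (A \<union> B)" using comps_conn[OF C(1) u] by simp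
      then show "v \<in> K"
      proof (rule conn_closed)
        show "u \<in> K" by fact
        show "e \<subseteq> K" if "e \<in> A \<union> B" "e \<inter> K \<noteq> {}" for e
          using that comps_closed[OF K(1)] KC C(2) P by blast
      qed
    qed
    then have "C = K" using KC by auto
    then show "C \<in> comps A \<and> C \<inter> Q = {}" using K C(2) P by auto
  qed
qed

text \<open>A proper nonempty subset of a component is left by some edge; adding the new end gains
  one vertex and at least one edge inside. This tree bound is what limits a component of a
  concatenation to two outer nodes.\<close>

lemma comp_card_le:
  assumes C: "C \<in> comps E" and fin: "finite C" "finite E" and two: "\<And>e. e \<in> E \<Longrightarrow> card e = 2"
  shows "card C \<le> card {e \<in> E. e \<subseteq> C} + 1"
proof -
  have "\<exists>W\<subseteq>C. card W = Suc k \<and> k \<le> card {e \<in> E. e \<subseteq> W}" if "Suc k \<le> card C" for k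
    using that
  proof (induction k)
    case 0
    obtain u where "u \<in> C" using comps_nonempty[OF C] by auto
    then show ?case by (intro exI[of _ "{u}"]) auto
  next
    case (Suc k)
    then obtain W where W: "W \<subseteq> C" "card W = Suc k" "k \<le> card {e \<in> E. e \<subseteq> W}" by auto
    have "W \<noteq> C" using W Suc.prems by auto
    then obtain v where v: "v \<in> C" "v \<notin> W" using W by auto
    obtain u where u: "u \<in> W" using W(2) by fastforce
    have "\<exists>e\<in>E. e \<inter> W \<noteq> {} \<and> \<not> e \<subseteq> W"
      using conn_closed[OF comps_conn[OF C, of u v] u] v u W by blast
    then obtain e where e: "e \<in> E" "e \<inter> W \<noteq> {}" "\<not> e \<subseteq> W" by auto
    then have eC: "e \<subseteq> C" using comps_closed[OF C e(1)] W by blast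
    obtain a b where ab: "e = {a, b}" using two[OF e(1)] by (auto simp: card_2_iff)
    then obtain b where b: "b \<in> e" "b \<notin> W" "e \<subseteq> insert b W" using e by auto
    have fW: "finite W" using W fin finite_subset by blast
    have "card (insert e {e \<in> E. e \<subseteq> W}) \<le> card {e \<in> E. e \<subseteq> insert b W}"
      by (rule card_mono) (use fin e b in auto)
    then have "Suc k \<le> card {e \<in> E. e \<subseteq> insert b W}" using W(3) e(3) fin by simp
    then show ?case using W b eC fW by (intro exI[of _ "insert b W"]) auto
  qed
  from this[of "card C - 1"] obtain W where W: "W \<subseteq> C" "card W = card C" "card C - 1 \<le> card {e \<in> E. e \<subseteq> W}"
    using comps_nonempty[OF C] fin card_gt_0_iff[of C] by fastforce
  then have "W = C" using card_subset_eq fin by metis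
  then show ?thesis using W by simp
qed


section \<open>Diagrams and their arcs\<close>

text \<open>The placement \<open>f\<close> of the nodes is a parameter because the same diagram is
  drawn between two rows of points in a product and between any two of four rows in a triple
  product.\<close>

definition edges :: "diagram \<Rightarrow> (node \<Rightarrow> 'v) \<Rightarrow> 'v set set"
  where "edges x f = (\<lambda>s. f ` fst s) ` x"

definition label_within :: "diagram \<Rightarrow> (node \<Rightarrow> 'v) \<Rightarrow> 'v set \<Rightarrow> nat"
  where "label_within x f C = (\<Sum>s | s \<in> x \<and> f ` fst s \<subseteq> C. snd s)"

lemma inj_above: "inj above"
proof (rule injI)
  fix u v show "above u = above v \<Longrightarrow> u = v" by (cases u; cases v) auto
qed

lemma inj_below: "inj below"
proof (rule injI)
  fix u v show "below u = below v \<Longrightarrow> u = v" by (cases u; cases v) auto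
qed

lemma components_eq: "components x y = comps (edges x above \<union> edges y below)"
proof -
  have E: "(\<Union>(e, a)\<in>S. e) // {(u, v). \<exists>(e, a)\<in>S. u \<in> e \<and> v \<in> e}\<^sup>* = comps (fst ` S)" for S :: "(point set \<times> nat) set"
  proof -
    have "{(u, v). \<exists>(e, a)\<in>S. u \<in> e \<and> v \<in> e} = {(u, v). \<exists>e\<in>fst ` S. u \<in> e \<and> v \<in> e}" by force
    moreover have "(\<Union>(e, a)\<in>S. e) = \<Union>(fst ` S)" by force
    ultimately show ?thesis by (simp add: comps_def conn_def)
  qed
  have "fst ` (placed above x \<union> placed below y) = edges x above \<union> edges y below"
    by (force simp: placed_def edges_def image_Un image_image case_prod_beta)
  then show ?thesis by (simp add: components_def Let_def E del: placed_def)
qed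

lemma sum_placed:
  assumes "inj f"
  shows "(\<Sum>(e, a)\<in>{s \<in> placed f x. fst s \<subseteq> C}. a) = label_within x f C"
proof -
  have inj: "inj_on (\<lambda>(e, a). (f ` e, a)) A" for A :: diagram
    using assms by (auto simp: inj_on_def inj_image_eq_iff)
  have eq: "{s \<in> placed f x. fst s \<subseteq> C} = (\<lambda>(e, a). (f ` e, a)) ` {s \<in> x. f ` fst s \<subseteq> C}"
    by (force simp: placed_def)
  show ?thesis
    unfolding eq label_within_def by (subst sum.reindex[OF inj]) (auto intro!: sum.cong)
qed

lemma label_eq: "label m x y C = (label_within x above C + label_within y below C) mod m"
  by (simp add: label_def sum_placed inj_above inj_below)

lemma finite_nodes [simp]: "finite (nodes n)"
  by (simp add: nodes_def)

lemma North_in_nodes [simp]: "North i \<in> nodes n \<longleftrightarrow> i < n"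
  and South_in_nodes [simp]: "South i \<in> nodes n \<longleftrightarrow> i < n"
  by (auto simp: nodes_def)

lemma reduced_strand:
  assumes "x \<in> reduced_diagrams m n" "s \<in> x"
  shows "fst s \<subseteq> nodes n" "card (fst s) = 2" "snd s < m"
  using assms by (cases s; force simp: reduced_diagrams_def)+

lemma reduced_unique:
  assumes "x \<in> reduced_diagrams m n" "s \<in> x" "s' \<in> x" "v \<in> fst s" "v \<in> fst s'"
  shows "s = s'"
proof -
  have "v \<in> nodes n" using reduced_strand(1)[OF assms(1,2)] assms(4) by auto
  then show ?thesis using assms unfolding reduced_diagrams_def by blast
qed

lemma reduced_cover:
  assumes "x \<in> reduced_diagrams m n" "v \<in> nodes n"
  obtains s where "s \<in> x" "v \<in> fst s"
  using assms unfolding reduced_diagrams_def by blast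

lemma reduced_subset: "x \<in> reduced_diagrams m n \<Longrightarrow> x \<subseteq> Pow (nodes n) \<times> {..<m}"
proof
  fix s assume "x \<in> reduced_diagrams m n" "s \<in> x"
  then show "s \<in> Pow (nodes n) \<times> {..<m}" using reduced_strand[of x m n s] by (simp add: mem_Times_iff)
qed

lemma reduced_finite [simp]: "x \<in> reduced_diagrams m n \<Longrightarrow> finite x"
  by (rule finite_subset[OF reduced_subset]) auto

lemma finite_reduced: "finite (reduced_diagrams m n)"
  by (rule finite_subset[of _ "Pow (Pow (nodes n) \<times> {..<m})"]) (blast dest: reduced_subset, simp)

lemma reduced_nonempty: "x \<in> reduced_diagrams m n \<Longrightarrow> s \<in> x \<Longrightarrow> fst s \<noteq> {}"
  using reduced_strand(2) by fastforce

lemma reducedI: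
  assumes "\<And>s. s \<in> x \<Longrightarrow> fst s \<subseteq> nodes n \<and> card (fst s) = 2 \<and> snd s < m"
    and "\<And>v. v \<in> nodes n \<Longrightarrow> \<exists>s\<in>x. v \<in> fst s"
    and "\<And>s s' v. s \<in> x \<Longrightarrow> s' \<in> x \<Longrightarrow> v \<in> fst s \<Longrightarrow> v \<in> fst s' \<Longrightarrow> s = s'"
  shows "x \<in> reduced_diagrams m n"
proof -
  have "\<forall>(e, a)\<in>x. e \<subseteq> nodes n \<and> card e = 2 \<and> a < m" using assms(1) by force
  moreover have "\<exists>!s. s \<in> x \<and> v \<in> fst s" if "v \<in> nodes n" for v
    using assms(2)[OF that] assms(3) by blast
  ultimately show ?thesis unfolding reduced_diagrams_def by blast
qed

lemma Union_edges:
  assumes "x \<in> reduced_diagrams m n" shows "\<Union>(edges x f) = f ` nodes n"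
proof -
  have "\<Union>(fst ` x) = nodes n"
    using reduced_strand(1)[OF assms] by (auto elim: reduced_cover[OF assms])
  moreover have "\<Union>(edges x f) = f ` \<Union>(fst ` x)" by (auto simp: edges_def)
  ultimately show ?thesis by simp
qed

text \<open>Diagrams are labelled perfect matchings of the same nodes, so inclusion forces equality.
  Many identities between diagrams are proved by one inclusion in this way.\<close>

lemma reduced_subset_eq:
  assumes "x \<in> reduced_diagrams m n" "y \<in> reduced_diagrams m n" "x \<subseteq> y"
  shows "x = y"
proof -
  have "s \<in> x" if s: "s \<in> y" for s
  proof -
    obtain v where v: "v \<in> fst s" using reduced_nonempty[OF assms(2) s] by auto
    then have "v \<in> nodes n" using reduced_strand(1)[OF assms(2) s] by auto
    then obtain s' where "s' \<in> x" "v \<in> fst s'" using reduced_cover[OF assms(1)] by metis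
    then show ?thesis using reduced_unique[OF assms(2) s, of s' v] v assms(3) by auto
  qed
  then show ?thesis using assms(3) by auto
qed

text \<open>Each strand lies in exactly one component, so exchanging the summations leaves one term
  per strand. \<open>K\<close> is a union of components: everything in
  \<open>sum_labels_cong\<close>, one component of a larger graph in
  \<open>concat_contract\<close>.\<close>

lemma label_within_split:
  assumes "finite x" "finite (comps E)" "edges x f \<subseteq> E" "{} \<notin> edges x f"
    and K: "\<And>A. A \<in> comps E \<Longrightarrow> A \<inter> K \<noteq> {} \<Longrightarrow> A \<subseteq> K"
  shows "(\<Sum>A | A \<in> comps E \<and> A \<subseteq> K. label_within x f A) = label_within x f K"
proof -
  let ?X = "{s \<in> x. f ` fst s \<subseteq> K}" and ?A = "{A \<in> comps E. A \<subseteq> K}"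
  have "(\<Sum>A\<in>?A. label_within x f A) = (\<Sum>A\<in>?A. \<Sum>s | s \<in> ?X \<and> f ` fst s \<subseteq> A. snd s)"
    unfolding label_within_def by (intro sum.cong refl) auto
  also have "\<dots> = (\<Sum>s\<in>?X. \<Sum>A | A \<in> ?A \<and> f ` fst s \<subseteq> A. snd s)"
    by (rule sum.swap_restrict) (use assms in auto)
  also have "\<dots> = (\<Sum>s\<in>?X. snd s)"
  proof (rule sum.cong[OF refl])
    fix s assume s: "s \<in> ?X"
    then have "f ` fst s \<in> edges x f" by (simp add: edges_def)
    then have e: "f ` fst s \<in> E" "f ` fst s \<noteq> {}" using assms(3,4) by auto
    then obtain v where v: "v \<in> f ` fst s" by auto
    then obtain A where A: "A \<in> comps E" "v \<in> A" using comps_cover e by (metis UnionI)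
    then have sub: "f ` fst s \<subseteq> A" using comps_closed e v by blast
    have "A \<subseteq> K" using K[OF A(1)] A(2) v s by auto
    moreover have "A' = A" if "A' \<in> ?A" "f ` fst s \<subseteq> A'" for A'
    proof (rule comps_disjoint)
      show "A' \<in> comps E" "v \<in> A'" using that v by blast+
    qed (use A in auto)
    ultimately have "{A. A \<in> ?A \<and> f ` fst s \<subseteq> A} = {A}" using A(1) sub by blast
    then show "(\<Sum>A | A \<in> ?A \<and> f ` fst s \<subseteq> A. snd s) = snd s" by simp
  qed
  finally show ?thesis by (simp add: label_within_def)
qed

lemma edges_nonempty: "x \<in> reduced_diagrams m n \<Longrightarrow> {} \<notin> edges x f"
  by (auto simp: edges_def dest: reduced_nonempty)

lemma finite_edges: "x \<in> reduced_diagrams m n \<Longrightarrow> finite (edges x f)"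
  by (simp add: edges_def)

lemma finite_comps: "finite (\<Union>E) \<Longrightarrow> finite (comps E)"
  by (rule finite_subset[of _ "Pow (\<Union>E)"]) (auto dest: comps_subset)

lemma finite_components:
  assumes "x \<in> reduced_diagrams m n" "y \<in> reduced_diagrams m n"
  shows "finite (components x y)"
  unfolding components_eq by (rule finite_comps) (use assms in \<open>simp add: Union_edges\<close>)

lemma finite_closed_loops:
  "x \<in> reduced_diagrams m n \<Longrightarrow> y \<in> reduced_diagrams m n \<Longrightarrow> finite (closed_loops x y)"
  using finite_components by (auto simp: closed_loops_def)

lemma concat_diagram_iff:
  "(e, a) \<in> concat_diagram m x y \<longleftrightarrow>
    (\<exists>C\<in>components x y. Outer -` C = e \<and> e \<noteq> {} \<and> label m x y C = a)"
  by (auto simp: concat_diagram_def closed_loops_def)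

lemma component_disjoint:
  "C \<in> components x y \<Longrightarrow> C' \<in> components x y \<Longrightarrow> u \<in> C \<Longrightarrow> u \<in> C' \<Longrightarrow> C = C'"
  unfolding components_eq by (rule comps_disjoint)

lemma sum_concat:
  "(\<Sum>s\<in>concat_diagram m x y. snd s) = (\<Sum>C\<in>components x y - closed_loops x y. label m x y C)"
proof -
  have "inj_on (\<lambda>C. (Outer -` C, label m x y C)) (components x y - closed_loops x y)"
  proof (rule inj_onI)
    fix C C' assume C: "C \<in> components x y - closed_loops x y" "C' \<in> components x y - closed_loops x y"
      "(Outer -` C, label m x y C) = (Outer -` C', label m x y C')"
    then obtain v where "Outer v \<in> C" by (auto simp: closed_loops_def)
    moreover then have "Outer v \<in> C'" using C(3) by auto
    ultimately show "C = C'" using C component_disjoint by (metis DiffD1)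
  qed
  then show ?thesis unfolding concat_diagram_def by (simp add: sum.reindex)
qed

text \<open>The components partition the strands of both diagrams, so the total label is preserved
  modulo \<open>m\<close> once the loops are counted. This controls divisibility by \<open>p\<close>
  and recovers the label of a last strand from the others.\<close>

lemma sum_labels_cong:
  assumes x: "x \<in> reduced_diagrams m n" and y: "y \<in> reduced_diagrams m n"
  shows "((\<Sum>s\<in>concat_diagram m x y. snd s) + (\<Sum>C\<in>closed_loops x y. label m x y C)) mod m
       = ((\<Sum>s\<in>x. snd s) + (\<Sum>s\<in>y. snd s)) mod m"
proof -
  let ?E = "edges x above \<union> edges y below"
  have fin: "finite (components x y)" by (rule finite_components[OF x y])
  have sub: "closed_loops x y \<subseteq> components x y" by (auto simp: closed_loops_def)
  have "(\<Sum>s\<in>concat_diagram m x y. snd s) + (\<Sum>C\<in>closed_loops x y. label m x y C)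
      = (\<Sum>C\<in>components x y. label m x y C)"
    unfolding sum_concat by (simp add: sum.subset_diff[OF sub fin])
  also have "\<dots> mod m = (\<Sum>C\<in>components x y. label_within x above C + label_within y below C) mod m"
    unfolding label_eq by (simp add: mod_sum_eq)
  also have "(\<Sum>C\<in>components x y. label_within x above C + label_within y below C)
      = (\<Sum>s\<in>x. snd s) + (\<Sum>s\<in>y. snd s)"
  proof -
    have "(\<Sum>C\<in>components x y. label_within x above C) = (\<Sum>s\<in>x. snd s)"
      using label_within_split[of x ?E above UNIV] fin x edges_nonempty[OF x, of above]
      by (simp add: components_eq label_within_def)
    moreover have "(\<Sum>C\<in>components x y. label_within y below C) = (\<Sum>s\<in>y. snd s)"
      using label_within_split[of y ?E below UNIV] fin y edges_nonempty[OF y, of below]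
      by (simp add: components_eq label_within_def)
    ultimately show ?thesis by (simp add: sum.distrib)
  qed
  finally show ?thesis .
qed

text \<open>\<open>C\<close> swallows every strand it meets, and the strands are disjoint with two
  ends each.\<close>

lemma card_meet:
  assumes x: "x \<in> reduced_diagrams m n" and f: "inj f"
    and C: "\<And>e. e \<in> edges x f \<Longrightarrow> e \<inter> C \<noteq> {} \<Longrightarrow> e \<subseteq> C"
  shows "card (C \<inter> f ` nodes n) = 2 * card {s \<in> x. f ` fst s \<subseteq> C}"
proof -
  let ?X = "{s \<in> x. f ` fst s \<subseteq> C}"
  have "C \<inter> f ` nodes n = (\<Union>s\<in>?X. f ` fst s)"
  proof
    show "C \<inter> f ` nodes n \<subseteq> (\<Union>s\<in>?X. f ` fst s)"
    proof
      fix u assume u: "u \<in> C \<inter> f ` nodes n"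
      then obtain v where v: "u = f v" "v \<in> nodes n" by auto
      then obtain s where s: "s \<in> x" "v \<in> fst s" using reduced_cover[OF x] by metis
      then have "f ` fst s \<subseteq> C" using C[of "f ` fst s"] u v by (auto simp: edges_def)
      then have "s \<in> ?X" using s by simp
      then show "u \<in> (\<Union>s\<in>?X. f ` fst s)" using s(2) v(1) by blast
    qed
    show "(\<Union>s\<in>?X. f ` fst s) \<subseteq> C \<inter> f ` nodes n" using reduced_strand(1)[OF x] by fastforce
  qed
  also have "card \<dots> = (\<Sum>s\<in>?X. card (f ` fst s))"
  proof (rule card_UN_disjoint)
    show "finite ?X" using x by simp
    show "\<forall>s\<in>?X. finite (f ` fst s)" using reduced_strand(1)[OF x] finite_subset by fastforce
    show "\<forall>s\<in>?X. \<forall>s'\<in>?X. s \<noteq> s' \<longrightarrow> f ` fst s \<inter> f ` fst s' = {}"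
    proof (intro ballI impI)
      fix s s' assume "s \<in> ?X" "s' \<in> ?X" "s \<noteq> s'"
      then have "fst s \<inter> fst s' = {}" using reduced_unique[OF x] by blast
      then show "f ` fst s \<inter> f ` fst s' = {}" using f by (auto simp: inj_eq)
    qed
  qed
  also have "\<dots> = (\<Sum>s\<in>?X. 2)"
    by (rule sum.cong) (use reduced_strand(2)[OF x] f in \<open>auto simp: card_image inj_on_subset\<close>)
  finally show ?thesis by simp
qed

text \<open>Let a component have \<open>a\<close> middle points, \<open>o\<close> outer points and
  \<open>E\<close> strands. Middle points lie on a strand of each diagram and outer points on one
  strand, so \<open>2 a + o = 2 E\<close>; the tree bound gives \<open>a + o \<le> E + 1\<close>.
  Hence \<open>o\<close> is even and at most 2.\<close>

lemma outer_card:
  assumes x: "x \<in> reduced_diagrams m n" and y: "y \<in> reduced_diagrams m n" and C: "C \<in> components x y"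
  shows "Outer -` C = {} \<or> card (Outer -` C) = 2" "Outer -` C \<subseteq> nodes n"
proof -
  let ?E = "edges x above \<union> edges y below"
  let ?X = "{s \<in> x. above ` fst s \<subseteq> C}" and ?Y = "{s \<in> y. below ` fst s \<subseteq> C}"
  note C' = C[unfolded components_eq]
  have cl: "e \<in> ?E \<Longrightarrow> e \<inter> C \<noteq> {} \<Longrightarrow> e \<subseteq> C" for e by (rule comps_closed[OF C'])
  have sub: "C \<subseteq> above ` nodes n \<union> below ` nodes n"
    using comps_subset[OF C'] by (simp add: Union_edges[OF x] Union_edges[OF y])
  then have finC: "finite C" by (rule finite_subset) simp
  have cx: "card (C \<inter> above ` nodes n) = 2 * card ?X" by (rule card_meet[OF x inj_above]) (use cl in auto)
  have cy: "card (C \<inter> below ` nodes n) = 2 * card ?Y" by (rule card_meet[OF y inj_below]) (use cl in auto)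
  have mid: "(C \<inter> above ` nodes n) \<inter> (C \<inter> below ` nodes n) = C \<inter> range Middle"
  proof -
    have "above ` nodes n \<inter> below ` nodes n = Middle ` {..<n}"
      unfolding nodes_def by (auto simp: image_Un image_image)
    moreover have "C \<inter> range Middle \<subseteq> Middle ` {..<n}"
      using sub by (auto simp: nodes_def image_Un image_image)
    ultimately show ?thesis by blast
  qed
  have all: "(C \<inter> above ` nodes n) \<union> (C \<inter> below ` nodes n) = C" using sub by auto
  have h1: "card C + card (C \<inter> range Middle) = 2 * card ?X + 2 * card ?Y"
    using card_Un_Int[of "C \<inter> above ` nodes n" "C \<inter> below ` nodes n"] finC cx cy mid all by simp
  have h2: "card C = card (C \<inter> range Middle) + card (C \<inter> range Outer)"
  proof -
    have "C = (C \<inter> range Middle) \<union> (C \<inter> range Outer)" using point.exhaust by blast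
    then show ?thesis using card_Un_disjoint[of "C \<inter> range Middle" "C \<inter> range Outer"] finC by auto
  qed
  have h3: "card C \<le> card ?X + card ?Y + 1"
  proof -
    have "card C \<le> card {e \<in> ?E. e \<subseteq> C} + 1"
    proof (rule comp_card_le[OF C' finC])
      show "finite ?E" using x y by (simp add: finite_edges)
      show "card e = 2" if "e \<in> ?E" for e
        using that reduced_strand(2)[OF x] reduced_strand(2)[OF y]
        by (auto simp: edges_def card_image inj_on_subset[OF inj_above] inj_on_subset[OF inj_below])
    qed
    also have "{e \<in> ?E. e \<subseteq> C} = (\<lambda>s. above ` fst s) ` ?X \<union> (\<lambda>s. below ` fst s) ` ?Y"
      by (auto simp: edges_def)
    also have "card \<dots> \<le> card ?X + card ?Y"
      by (rule order_trans[OF card_Un_le]) (intro add_mono card_image_le; use x y in simp)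
    finally show ?thesis by simp
  qed
  have o: "card (C \<inter> range Outer) \<le> 2" using h1 h2 h3 by simp
  have e: "2 * card (C \<inter> range Middle) + card (C \<inter> range Outer) = 2 * (card ?X + card ?Y)"
    using h1 unfolding h2 by simp
  have "even (2 * card (C \<inter> range Middle) + card (C \<inter> range Outer))" unfolding e by simp
  then have ev: "even (card (C \<inter> range Outer))" by simp
  have "card (C \<inter> range Outer) = card (Outer -` C)"
  proof -
    have "Outer ` (Outer -` C) = C \<inter> range Outer" by auto
    then show ?thesis using card_image[of Outer "Outer -` C"] by (simp add: inj_on_def)
  qed
  moreover have "finite (Outer -` C)" using finC by (rule finite_vimageI) (simp add: inj_def)
  moreover have "card (C \<inter> range Outer) = 0 \<or> card (C \<inter> range Outer) = 2"
    using o ev by (cases "card (C \<inter> range Outer) = 1") (auto simp: le_Suc_eq numeral_2_eq_2)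
  ultimately show "Outer -` C = {} \<or> card (Outer -` C) = 2" by simp
  show "Outer -` C \<subseteq> nodes n" using sub by (auto simp: nodes_def image_Un image_image)
qed

lemma concat_reduced:
  assumes m: "m > 0" and x: "x \<in> reduced_diagrams m n" and y: "y \<in> reduced_diagrams m n"
  shows "concat_diagram m x y \<in> reduced_diagrams m n"
proof (rule reducedI)
  fix s assume "s \<in> concat_diagram m x y"
  then obtain C where "C \<in> components x y" "Outer -` C = fst s" "fst s \<noteq> {}" "label m x y C = snd s"
    using concat_diagram_iff[of "fst s" "snd s" m x y] by auto
  then show "fst s \<subseteq> nodes n \<and> card (fst s) = 2 \<and> snd s < m"
    using outer_card[OF x y, of C] m label_eq[of m x y C] by (metis mod_less_divisor)
next
  fix v assume v: "v \<in> nodes n"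
  have "Outer v \<in> \<Union>(edges x above \<union> edges y below)"
    using v by (cases v) (auto simp: Union_edges[OF x] Union_edges[OF y] image_iff intro: bexI[of _ v])
  then obtain C where "C \<in> components x y" "Outer v \<in> C" using comps_cover unfolding components_eq by metis
  then show "\<exists>s\<in>concat_diagram m x y. v \<in> fst s"
    by (intro bexI[of _ "(Outer -` C, label m x y C)"]) (auto simp: concat_diagram_iff)
next
  fix s s' v assume s: "s \<in> concat_diagram m x y" "s' \<in> concat_diagram m x y" "v \<in> fst s" "v \<in> fst s'"
  then obtain C C' where C: "C \<in> components x y" "Outer -` C = fst s" "label m x y C = snd s"
    "C' \<in> components x y" "Outer -` C' = fst s'" "label m x y C' = snd s'"
    using concat_diagram_iff[of "fst s" "snd s" m x y] concat_diagram_iff[of "fst s'" "snd s'" m x y] by auto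
  have "Outer v \<in> C" "Outer v \<in> C'" using s(3,4) C(2,5) by (simp_all flip: vimage_eq)
  then have "C = C'" using component_disjoint C(1,4) by metis
  then show "s = s'" using C by (simp add: prod_eq_iff)
qed

section \<open>Reflection of diagrams, exchanging north and south\<close>

fun flip_node :: "node \<Rightarrow> node" where
  "flip_node (North i) = South i"
| "flip_node (South i) = North i"

fun flip_point :: "point \<Rightarrow> point" where
  "flip_point (Outer v) = Outer (flip_node v)"
| "flip_point (Middle i) = Middle i"

text \<open>This reflection reverses concatenation and keeps loop factors and label sums; southern
  and right-hand statements are obtained from northern and left-hand ones by it.\<close>

definition flip :: "diagram \<Rightarrow> diagram"
  where "flip x = (\<lambda>s. (flip_node ` fst s, snd s)) ` x"

lemma flip_node_flip_node [simp]: "flip_node (flip_node v) = v"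
  by (cases v) auto

lemma flip_point_flip_point [simp]: "flip_point (flip_point v) = v"
  by (cases v) auto

lemma inj_flip_node: "inj flip_node"
  by (rule inj_on_inverseI[of _ flip_node]) simp

lemma inj_flip_point: "inj flip_point"
  by (rule inj_on_inverseI[of _ flip_point]) simp

lemma flip_flip [simp]: "flip (flip x) = x"
  by (force simp: flip_def image_image)

lemma above_flip: "above \<circ> flip_node = flip_point \<circ> below"
proof
  fix v show "(above \<circ> flip_node) v = (flip_point \<circ> below) v" by (cases v) auto
qed

lemma below_flip: "below \<circ> flip_node = flip_point \<circ> above"
proof
  fix v show "(below \<circ> flip_node) v = (flip_point \<circ> above) v" by (cases v) auto
qed

lemma edges_flip: "edges (flip x) f = edges x (f \<circ> flip_node)"
  by (simp add: edges_def flip_def image_image)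

lemma edges_comp: "edges x (g \<circ> f) = (`) g ` edges x f"
  by (simp add: edges_def image_image)

lemma filter_image: "{b \<in> f ` A. P b} = f ` {a \<in> A. P (f a)}"
  by auto

lemma label_within_flip: "label_within (flip x) f C = label_within x (f \<circ> flip_node) C"
proof -
  have eq: "{s \<in> flip x. f ` fst s \<subseteq> C} = (\<lambda>s. (flip_node ` fst s, snd s)) ` {s \<in> x. (f \<circ> flip_node) ` fst s \<subseteq> C}"
    by (simp add: flip_def filter_image image_image)
  have "inj_on (\<lambda>s. (flip_node ` fst s, snd s)) A" for A :: diagram
    by (auto simp: inj_on_def inj_image_eq_iff[OF inj_flip_node])
  then show ?thesis unfolding label_within_def eq by (simp add: sum.reindex)
qed

lemma label_within_comp:
  assumes "inj g" shows "label_within x (g \<circ> f) (g ` C) = label_within x f C"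
proof -
  have "(g \<circ> f) ` A \<subseteq> g ` C \<longleftrightarrow> f ` A \<subseteq> C" for A
    unfolding image_comp[symmetric] using assms by (simp add: inj_image_subset_iff)
  then show ?thesis by (simp add: label_within_def)
qed

lemma components_flip: "components (flip y) (flip x) = (`) flip_point ` components x y"
  unfolding components_eq edges_flip above_flip below_flip edges_comp
  by (simp add: comps_image[OF inj_flip_point, symmetric] image_Un Un_commute)

lemma label_flip: "label m (flip y) (flip x) (flip_point ` C) = label m x y C"
  unfolding label_eq label_within_flip above_flip below_flip
  by (simp add: label_within_comp[OF inj_flip_point] add.commute)

lemma outer_flip: "Outer -` (flip_point ` C) = flip_node ` (Outer -` C)"
proof (intro equalityI subsetI)
  fix v assume "v \<in> Outer -` (flip_point ` C)"
  then obtain u where u: "u \<in> C" "Outer v = flip_point u" by auto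
  then show "v \<in> flip_node ` (Outer -` C)"
    by (cases u) (auto intro!: rev_image_eqI)
next
  fix v assume "v \<in> flip_node ` (Outer -` C)"
  then show "v \<in> Outer -` (flip_point ` C)" by (auto intro!: rev_image_eqI)
qed

lemma concat_flip: "concat_diagram m (flip y) (flip x) = flip (concat_diagram m x y)"
proof (rule Set.set_eqI)
  fix s :: "node set \<times> nat"
  obtain e a where s: "s = (e, a)" by (cases s)
  have "s \<in> concat_diagram m (flip y) (flip x) \<longleftrightarrow>
    (\<exists>C\<in>components x y. flip_node ` (Outer -` C) = e \<and> e \<noteq> {} \<and> label m x y C = a)"
    unfolding s concat_diagram_iff components_flip by (simp add: outer_flip label_flip)
  also have "\<dots> \<longleftrightarrow> (\<exists>e'. flip_node ` e' = e \<and> (e', a) \<in> concat_diagram m x y)"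
    unfolding concat_diagram_iff by auto
  also have "\<dots> \<longleftrightarrow> (\<exists>t\<in>concat_diagram m x y. flip_node ` fst t = e \<and> snd t = a)"
    by (metis fst_conv snd_conv prod.collapse)
  also have "\<dots> \<longleftrightarrow> s \<in> flip (concat_diagram m x y)"
    unfolding flip_def s image_iff by auto
  finally show "s \<in> concat_diagram m (flip y) (flip x) \<longleftrightarrow> s \<in> flip (concat_diagram m x y)" .
qed

lemma closed_loops_flip: "closed_loops (flip y) (flip x) = (`) flip_point ` closed_loops x y"
proof -
  have "Outer -` (flip_point ` C) = {} \<longleftrightarrow> Outer -` C = {}" for C unfolding outer_flip by simp
  then show ?thesis unfolding closed_loops_def components_flip filter_image by simp
qed

lemma loop_factor_flip: "loop_factor m p \<delta> (flip y) (flip x) = loop_factor m p \<delta> x y"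
proof -
  have "inj_on ((`) flip_point) (closed_loops x y)"
    by (auto simp: inj_on_def inj_image_eq_iff[OF inj_flip_point])
  then show ?thesis
    by (simp add: loop_factor_def closed_loops_flip prod.reindex label_flip cong: if_cong)
qed

lemma flip_nodes: "flip_node ` nodes n = nodes n"
  by (force simp: nodes_def image_Un image_image)

lemma flip_reduced: 
  assumes x: "x \<in> reduced_diagrams m n" shows "flip x \<in> reduced_diagrams m n"
proof (rule reducedI)
  fix s assume "s \<in> flip x"
  then obtain t where t: "t \<in> x" "s = (flip_node ` fst t, snd t)" by (auto simp: flip_def)
  have "flip_node ` fst t \<subseteq> nodes n" using reduced_strand(1)[OF x t(1)] flip_nodes[of n] by blast
  then show "fst s \<subseteq> nodes n \<and> card (fst s) = 2 \<and> snd s < m"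
    using reduced_strand[OF x t(1)] t(2) by (simp add: card_image inj_on_subset[OF inj_flip_node])
next
  fix v assume "v \<in> nodes n"
  then have "flip_node v \<in> nodes n" using flip_nodes[of n] by blast
  then obtain s where "s \<in> x" "flip_node v \<in> fst s" using reduced_cover[OF x] by metis
  then show "\<exists>s\<in>flip x. v \<in> fst s"
    by (intro bexI[of _ "(flip_node ` fst s, snd s)"]) (auto simp: flip_def intro: rev_image_eqI)
next
  fix s s' v assume "s \<in> flip x" "s' \<in> flip x" and v: "v \<in> fst s" "v \<in> fst s'"
  then obtain t t' where t: "t \<in> x" "s = (flip_node ` fst t, snd t)" "t' \<in> x" "s' = (flip_node ` fst t', snd t')"
    by (auto simp: flip_def)
  have "flip_node v \<in> fst t" using v(1) unfolding t(2) by auto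
  moreover have "flip_node v \<in> fst t'" using v(2) unfolding t(4) by auto
  ultimately have tt: "flip_node v \<in> fst t" "flip_node v \<in> fst t'" .
  then have "t = t'" using reduced_unique[OF x t(1,3) tt] by simp
  then show "s = s'" using t by simp
qed

lemma sum_flip: "(\<Sum>s\<in>flip x. snd s) = (\<Sum>s\<in>x. snd s)"
proof -
  have "inj_on (\<lambda>s. (flip_node ` fst s, snd s)) x"
    by (auto simp: inj_on_def inj_image_eq_iff[OF inj_flip_node])
  then show ?thesis by (simp add: flip_def sum.reindex)
qed

section \<open>Arcs with both ends on the same side\<close>

definition top_arcs :: "diagram \<Rightarrow> diagram"
  where "top_arcs x = {s \<in> x. fst s \<subseteq> range North}"

definition bottom_arcs :: "diagram \<Rightarrow> diagram"
  where "bottom_arcs x = {s \<in> x. fst s \<subseteq> range South}"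

lemma flip_range [simp]: "flip_node ` e \<subseteq> range South \<longleftrightarrow> e \<subseteq> range North"
    "flip_node ` e \<subseteq> range North \<longleftrightarrow> e \<subseteq> range South"
proof -
  have "flip_node v \<in> range South \<longleftrightarrow> v \<in> range North" "flip_node v \<in> range North \<longleftrightarrow> v \<in> range South" for v
    by (cases v; simp add: image_iff)+
  then show "flip_node ` e \<subseteq> range South \<longleftrightarrow> e \<subseteq> range North"
    "flip_node ` e \<subseteq> range North \<longleftrightarrow> e \<subseteq> range South" by blast+
qed

lemma top_arcs_flip: "top_arcs (flip x) = flip (bottom_arcs x)"
  by (simp add: top_arcs_def bottom_arcs_def flip_def filter_image)

lemma bottom_arcs_flip: "bottom_arcs (flip x) = flip (top_arcs x)"
  by (simp add: top_arcs_def bottom_arcs_def flip_def filter_image)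

text \<open>Connectivity is needed only towards one base point \<open>w\<close>. The two closure
  assumptions are stated strand by strand, which suits explicitly given diagrams.\<close>

lemma concatI:
  assumes "C \<noteq> {}" "C \<subseteq> \<Union>(edges x above \<union> edges y below)"
    and "\<And>t. t \<in> x \<Longrightarrow> above ` fst t \<inter> C \<noteq> {} \<Longrightarrow> above ` fst t \<subseteq> C"
    and "\<And>t. t \<in> y \<Longrightarrow> below ` fst t \<inter> C \<noteq> {} \<Longrightarrow> below ` fst t \<subseteq> C"
    and "\<And>u. u \<in> C \<Longrightarrow> (u, w) \<in> conn (edges x above \<union> edges y below)"
  shows componentI: "C \<in> components x y"
    and "Outer -` C = e \<Longrightarrow> e \<noteq> {} \<Longrightarrow> label m x y C = a \<Longrightarrow> (e, a) \<in> concat_diagram m x y"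
proof -
  show "C \<in> components x y" unfolding components_eq
  proof (rule compsI)
    fix e assume "e \<in> edges x above \<union> edges y below" "e \<inter> C \<noteq> {}"
    then show "e \<subseteq> C" using assms(3,4) unfolding edges_def by blast
  next
    fix u v assume "u \<in> C" "v \<in> C"
    then show "(u, v) \<in> conn (edges x above \<union> edges y below)"
      using conn_trans[OF assms(5) conn_sym[OF assms(5)]] by blast
  qed (use assms in auto)
  then show "Outer -` C = e \<Longrightarrow> e \<noteq> {} \<Longrightarrow> label m x y C = a \<Longrightarrow> (e, a) \<in> concat_diagram m x y"
    by (auto simp: concat_diagram_iff)
qed

text \<open>If each northern end of \<open>s\<close> is continued by a strand of \<open>k\<close>
  that runs up to the top, then \<open>s\<close> and these strands form a whole component. The map
  \<open>case_node (North \<circ> \<sigma>) South\<close> moves the northern ends and fixes the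
  southern ones. Both the action of permutation diagrams and the preservation of arcs by the
  one-sided units are instances.\<close>

lemma transport:
  assumes k: "k \<in> reduced_diagrams m n" and y: "y \<in> reduced_diagrams m n" and s: "s \<in> y"
    and ks: "\<And>i. North i \<in> fst s \<Longrightarrow> ({North (\<sigma> i), South i}, c i) \<in> k"
  shows "(case_node (North \<circ> \<sigma>) South ` fst s, (snd s + (\<Sum>i | North i \<in> fst s. c i)) mod m)
           \<in> concat_diagram m k y"
proof -
  define I where "I = {i. North i \<in> fst s}"
  define st where "st = (\<lambda>i. ({North (\<sigma> i), South i}, c i))"
  define C where "C = below ` fst s \<union> (\<Union>i\<in>I. above ` fst (st i))"
  let ?E = "edges k above \<union> edges y below"
  have st: "i \<in> I \<Longrightarrow> st i \<in> k" for i using ks by (simp add: I_def st_def)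
  obtain w where w: "w \<in> fst s" using reduced_nonempty[OF y s] by auto
  have kC: "\<exists>i\<in>I. t = st i" if t: "t \<in> k" "above ` fst t \<inter> C \<noteq> {}" for t
  proof -
    obtain u where u: "u \<in> fst t" "above u \<in> C" using t(2) by auto
    consider v where "v \<in> fst s" "above u = below v" | i v where "i \<in> I" "v \<in> fst (st i)" "above u = above v"
      using u(2) unfolding C_def by blast
    then show ?thesis
    proof cases
      case 1
      then obtain i where "u = South i" "v = North i" by (cases u; cases v) auto
      then have "i \<in> I" "u \<in> fst (st i)" using 1 by (auto simp: I_def st_def)
      then show ?thesis using reduced_unique[OF k t(1) st u(1)] by blast
    next
      case 2
      then have "u = v" using inj_above by (simp add: inj_eq)
      then show ?thesis using reduced_unique[OF k t(1) st u(1)] 2 by blast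
    qed
  qed
  have yC: "t = s" if t: "t \<in> y" "below ` fst t \<inter> C \<noteq> {}" for t
  proof -
    obtain u where u: "u \<in> fst t" "below u \<in> C" using t(2) by auto
    consider v where "v \<in> fst s" "below u = below v" | i v where "i \<in> I" "v \<in> fst (st i)" "below u = above v"
      using u(2) unfolding C_def by blast
    then show ?thesis
    proof cases
      case 1
      then have "u = v" using inj_below by (simp add: inj_eq)
      then show ?thesis using reduced_unique[OF y t(1) s u(1)] 1 by blast
    next
      case 2
      then obtain j where "u = North j" "v = South j" by (cases u; cases v) auto
      then have "u \<in> fst s" using 2 by (auto simp: I_def st_def)
      then show ?thesis using reduced_unique[OF y t(1) s u(1)] by blast
    qed
  qed
  have stC: "i \<in> I \<Longrightarrow> above ` fst (st i) \<subseteq> C" for i by (auto simp: C_def)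
  have sC: "below ` fst s \<subseteq> C" by (auto simp: C_def)
  have conn: "(u, below w) \<in> conn ?E" if u: "u \<in> C" for u
  proof -
    have e: "v \<in> fst s \<Longrightarrow> (below v, below w) \<in> conn ?E" for v
      by (rule conn_edge[of "below ` fst s"]) (use s w in \<open>auto simp: edges_def\<close>)
    consider v where "v \<in> fst s" "u = below v" | i v where "i \<in> I" "v \<in> fst (st i)" "u = above v"
      using u unfolding C_def by blast
    then show ?thesis
    proof cases
      case 1
      then show ?thesis using e by simp
    next
      case 2
      have ei: "above ` fst (st i) \<in> ?E" using st[OF 2(1)] unfolding edges_def by blast
      have "South i \<in> fst (st i)" by (simp add: st_def)
      then have "(above v, above (South i)) \<in> conn ?E"
        by (rule conn_edge[OF ei imageI[OF 2(2)] imageI])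
      moreover have "(below (North i), below w) \<in> conn ?E" using e[of "North i"] 2(1) by (simp add: I_def)
      ultimately show ?thesis using conn_trans 2(3) by fastforce
    qed
  qed
  have kset: "{t \<in> k. above ` fst t \<subseteq> C} = st ` I"
  proof (intro equalityI subsetI)
    fix t assume "t \<in> {t \<in> k. above ` fst t \<subseteq> C}"
    then have t: "t \<in> k" "above ` fst t \<subseteq> C" by auto
    then have "above ` fst t \<inter> C \<noteq> {}" using reduced_nonempty[OF k t(1)] by blast
    then show "t \<in> st ` I" using kC[OF t(1)] by blast
  next
    fix t assume "t \<in> st ` I"
    then obtain i where "t = st i" "i \<in> I" by blast
    then show "t \<in> {t \<in> k. above ` fst t \<subseteq> C}" using st[of i] stC[of i] by simp
  qed
  have yset: "{t \<in> y. below ` fst t \<subseteq> C} = {s}"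
  proof (intro equalityI subsetI)
    fix t assume "t \<in> {t \<in> y. below ` fst t \<subseteq> C}"
    then have t: "t \<in> y" "below ` fst t \<subseteq> C" by auto
    then have "below ` fst t \<inter> C \<noteq> {}" using reduced_nonempty[OF y t(1)] by blast
    then show "t \<in> {s}" using yC[OF t(1)] by blast
  qed (use s sC in auto)
  have inj: "inj_on st I" by (auto simp: inj_on_def st_def doubleton_eq_iff)
  have lab: "label m k y C = (snd s + (\<Sum>i\<in>I. c i)) mod m"
    unfolding label_eq label_within_def kset yset by (simp add: sum.reindex[OF inj]) (simp add: st_def add.commute)
  have out: "Outer -` C = case_node (North \<circ> \<sigma>) South ` fst s"
  proof (intro equalityI subsetI)
    fix v assume "v \<in> Outer -` C"
    then consider u where "u \<in> fst s" "Outer v = below u" | i u where "i \<in> I" "u \<in> fst (st i)" "Outer v = above u"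
      unfolding C_def by blast
    then show "v \<in> case_node (North \<circ> \<sigma>) South ` fst s"
    proof cases
      case 1
      then show ?thesis by (cases u) (auto intro: rev_image_eqI)
    next
      case 2
      then have "v = North (\<sigma> i)" by (cases u) (auto simp: st_def)
      then show ?thesis using 2(1) by (auto simp: I_def intro: rev_image_eqI)
    qed
  next
    fix v assume "v \<in> case_node (North \<circ> \<sigma>) South ` fst s"
    then obtain u where u: "u \<in> fst s" "v = case_node (North \<circ> \<sigma>) South u" by auto
    show "v \<in> Outer -` C"
    proof (cases u)
      case (North i)
      then have "i \<in> I" "v = North (\<sigma> i)" using u by (auto simp: I_def)
      then show ?thesis using stC[of i] by (auto simp: st_def)
    next
      case (South i)
      then show ?thesis using sC u by force
    qed
  qed
  show ?thesis
  proof (rule concatI(2)[where C = C and w = "below w"])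
    show "C \<noteq> {}" using w by (auto simp: C_def)
    show "C \<subseteq> \<Union>?E" using st s by (force simp: C_def edges_def)
    show "above ` fst t \<subseteq> C" if "t \<in> k" "above ` fst t \<inter> C \<noteq> {}" for t
      using kC[OF that] stC by blast
    show "below ` fst t \<subseteq> C" if "t \<in> y" "below ` fst t \<inter> C \<noteq> {}" for t
      using yC[OF that] sC by blast
    show "(u, below w) \<in> conn ?E" if "u \<in> C" for u using conn[OF that] .
    show "Outer -` C = case_node (North \<circ> \<sigma>) South ` fst s" by (rule out)
    show "case_node (North \<circ> \<sigma>) South ` fst s \<noteq> {}" using w by auto
    show "label m k y C = (snd s + (\<Sum>i | North i \<in> fst s. c i)) mod m" using lab by (simp add: I_def)
  qed
qed

text \<open>A northern arc of the upper diagram does not touch the middle row, so it is a component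
  by itself.\<close>

lemma top_arcs_concat:
  assumes x: "x \<in> reduced_diagrams m n" and y: "y \<in> reduced_diagrams m n"
  shows "top_arcs x \<subseteq> top_arcs (concat_diagram m x y)"
proof
  fix s assume "s \<in> top_arcs x"
  then have s: "s \<in> x" "fst s \<subseteq> range North" by (auto simp: top_arcs_def)
  let ?C = "above ` fst s"
  obtain w where w: "w \<in> fst s" using reduced_nonempty[OF x s(1)] by auto
  have xC: "t = s" if t: "t \<in> x" "above ` fst t \<inter> ?C \<noteq> {}" for t
  proof -
    obtain u where "u \<in> fst t" "u \<in> fst s" using t(2) inj_above by (auto simp: inj_eq)
    then show ?thesis using reduced_unique[OF x t(1) s(1)] by blast
  qed
  have NB: "below u \<notin> ?C" for u using s(2) by (cases u) auto
  have out: "Outer -` ?C = fst s" using s(2) by force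
  have xs: "{t \<in> x. above ` fst t \<subseteq> ?C} = {s}"
  proof -
    have "t = s" if "t \<in> x" "above ` fst t \<subseteq> ?C" for t
    proof (rule xC[OF that(1)])
      show "above ` fst t \<inter> ?C \<noteq> {}" using that(2) reduced_nonempty[OF x that(1)] by blast
    qed
    then show ?thesis using s(1) by auto
  qed
  have ys: "{t \<in> y. below ` fst t \<subseteq> ?C} = {}"
  proof -
    have "\<not> below ` fst t \<subseteq> ?C" if "t \<in> y" for t
      using NB reduced_nonempty[OF y that] by blast
    then show ?thesis by blast
  qed
  have "(fst s, snd s) \<in> concat_diagram m x y"
  proof (rule concatI(2)[where C = ?C and w = "above w"])
    show "label m x y ?C = snd s"
      unfolding label_eq label_within_def xs ys using reduced_strand(3)[OF x s(1)] by simp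
    show "(u, above w) \<in> conn (edges x above \<union> edges y below)" if "u \<in> ?C" for u
      by (rule conn_edge[of ?C]) (use that w s in \<open>auto simp: edges_def\<close>)
    show "below ` fst t \<subseteq> ?C" if "t \<in> y" "below ` fst t \<inter> ?C \<noteq> {}" for t
      using that NB by blast
    show "above ` fst t \<subseteq> ?C" if "t \<in> x" "above ` fst t \<inter> ?C \<noteq> {}" for t
      using xC[OF that] by simp
  qed (use out w s in \<open>auto simp: edges_def\<close>)
  then show "s \<in> top_arcs (concat_diagram m x y)" using s(2) by (simp add: top_arcs_def)
qed

lemma flip_mono: "x \<subseteq> y \<Longrightarrow> flip x \<subseteq> flip y"
  by (auto simp: flip_def)

lemma bottom_arcs_concat:
  assumes x: "x \<in> reduced_diagrams m n" and y: "y \<in> reduced_diagrams m n"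
  shows "bottom_arcs y \<subseteq> bottom_arcs (concat_diagram m x y)"
proof -
  have "flip (bottom_arcs y) \<subseteq> flip (bottom_arcs (concat_diagram m x y))"
    using top_arcs_concat[OF flip_reduced[OF y] flip_reduced[OF x]]
    by (simp add: top_arcs_flip concat_flip)
  from flip_mono[OF this] show ?thesis by simp
qed

text \<open>A northern end of a strand of \<open>x\<close> would be an outer node of the
  loop.\<close>

lemma closed_loop_bottom:
  assumes x: "x \<in> reduced_diagrams m n" and C: "C \<in> closed_loops x y"
    and s: "s \<in> x" "above ` fst s \<inter> C \<noteq> {}"
  shows "s \<in> bottom_arcs x" "above ` fst s \<subseteq> C"
proof -
  have C': "C \<in> comps (edges x above \<union> edges y below)" "Outer -` C = {}"
    using C by (auto simp: closed_loops_def components_eq)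
  show sub: "above ` fst s \<subseteq> C" using comps_closed[OF C'(1)] s by (simp add: edges_def)
  have "v \<in> range South" if "v \<in> fst s" for v
  proof (cases v)
    case (North i)
    then have "Outer (North i) \<in> C" using that sub by force
    then show ?thesis using C'(2) by auto
  qed simp
  then show "s \<in> bottom_arcs x" using s(1) by (auto simp: bottom_arcs_def)
qed

lemma closed_loop_ex:
  assumes x: "x \<in> reduced_diagrams m n" and y: "y \<in> reduced_diagrams m n" and C: "C \<in> closed_loops x y"
  shows "\<exists>i s. Middle i \<in> C \<and> s \<in> bottom_arcs x \<and> South i \<in> fst s"
proof -
  have C': "C \<in> comps (edges x above \<union> edges y below)" "Outer -` C = {}"
    using C by (auto simp: closed_loops_def components_eq)
  obtain u where u: "u \<in> C" using comps_nonempty[OF C'(1)] by auto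
  then obtain i where i: "u = Middle i" using C'(2) by (cases u) auto
  have "u \<in> above ` nodes n \<union> below ` nodes n"
    using comps_subset[OF C'(1)] u by (auto simp: Union_edges[OF x] Union_edges[OF y])
  then have "South i \<in> nodes n" using i by (auto simp: nodes_def)
  then obtain s where s: "s \<in> x" "South i \<in> fst s" using reduced_cover[OF x] by metis
  then have "above ` fst s \<inter> C \<noteq> {}" using u i by force
  then show ?thesis using closed_loop_bottom[OF x C s(1)] s(2) u i by blast
qed

lemma no_loops_bottom:
  assumes "x \<in> reduced_diagrams m n" "y \<in> reduced_diagrams m n" "bottom_arcs x = {}"
  shows "closed_loops x y = {}"
  using closed_loop_ex[OF assms(1,2)] assms(3) by blast

lemma no_loops_top:
  assumes "x \<in> reduced_diagrams m n" "y \<in> reduced_diagrams m n" "top_arcs y = {}"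
  shows "closed_loops x y = {}"
proof -
  have "bottom_arcs (flip y) = {}" using assms(3) unfolding bottom_arcs_flip by (simp add: flip_def)
  then have "closed_loops (flip y) (flip x) = {}"
    using assms by (intro no_loops_bottom flip_reduced)
  then show ?thesis by (simp add: closed_loops_flip)
qed

lemma sum_card_part:
  assumes x: "x \<in> reduced_diagrams m n" and A: "A \<subseteq> nodes n"
  shows "(\<Sum>s\<in>x. card (fst s \<inter> A)) = card A"
proof -
  have "card A = card (\<Union>s\<in>x. fst s \<inter> A)"
  proof (rule arg_cong[of _ _ card])
    show "A = (\<Union>s\<in>x. fst s \<inter> A)" using A by (auto elim: reduced_cover[OF x])
  qed
  also have "\<dots> = (\<Sum>s\<in>x. card (fst s \<inter> A))"
  proof (rule card_UN_disjoint)
    show "\<forall>s\<in>x. finite (fst s \<inter> A)" using finite_subset[OF A] by auto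
    show "\<forall>s\<in>x. \<forall>t\<in>x. s \<noteq> t \<longrightarrow> fst s \<inter> A \<inter> (fst t \<inter> A) = {}" using reduced_unique[OF x] by blast
  qed (use x in simp)
  finally show ?thesis by simp
qed

text \<open>A strand has one northern end if it runs through, two if it is a northern arc, none if
  it is a southern arc. The correction for southern arcs stands on the left to avoid truncated
  subtraction.\<close>

lemma card_North_part:
  assumes x: "x \<in> reduced_diagrams m n" and s: "s \<in> x"
  shows "card (fst s \<inter> North ` {..<n}) + (if s \<in> bottom_arcs x then 1 else 0)
       = 1 + (if s \<in> top_arcs x then 1 else 0)"
proof -
  obtain u v where uv: "fst s = {u, v}" "u \<noteq> v" using reduced_strand(2)[OF x s] by (auto simp: card_2_iff)
  have "u \<in> nodes n" "v \<in> nodes n" using reduced_strand(1)[OF x s] uv by auto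
  then show ?thesis using uv s
    by (cases u; cases v) (auto simp: bottom_arcs_def top_arcs_def Int_insert_left)
qed

lemma card_South_part:
  assumes x: "x \<in> reduced_diagrams m n" and s: "s \<in> x"
  shows "card (fst s \<inter> South ` {..<n}) + (if s \<in> top_arcs x then 1 else 0)
       = 1 + (if s \<in> bottom_arcs x then 1 else 0)"
proof -
  obtain u v where uv: "fst s = {u, v}" "u \<noteq> v" using reduced_strand(2)[OF x s] by (auto simp: card_2_iff)
  have "u \<in> nodes n" "v \<in> nodes n" using reduced_strand(1)[OF x s] uv by auto
  then show ?thesis using uv s
    by (cases u; cases v) (auto simp: bottom_arcs_def top_arcs_def Int_insert_left)
qed

text \<open>Both rows have \<open>n\<close> nodes; counting the ends of all strands in each row
  gives two equations that differ by exchanging the two numbers of arcs.\<close>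

lemma card_top_bottom:
  assumes x: "x \<in> reduced_diagrams m n"
  shows "card (top_arcs x) = card (bottom_arcs x)"
proof -
  have T: "(\<Sum>s\<in>x. if s \<in> top_arcs x then 1 else 0) = card (top_arcs x)"
    and B: "(\<Sum>s\<in>x. if s \<in> bottom_arcs x then 1 else 0) = card (bottom_arcs x)"
    using x by (simp_all add: sum.If_cases top_arcs_def bottom_arcs_def Int_def)
  have "(\<Sum>s\<in>x. card (fst s \<inter> North ` {..<n}) + (if s \<in> bottom_arcs x then 1 else 0))
      = (\<Sum>s\<in>x. 1 + (if s \<in> top_arcs x then 1 else 0))"
    by (rule sum.cong[OF refl]) (rule card_North_part[OF x])
  then have "n + card (bottom_arcs x) = card x + card (top_arcs x)"
    unfolding sum.distrib T B using sum_card_part[OF x, of "North ` {..<n}"] 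
    by (simp add: nodes_def card_image inj_on_def)
  moreover have "(\<Sum>s\<in>x. card (fst s \<inter> South ` {..<n}) + (if s \<in> top_arcs x then 1 else 0))
      = (\<Sum>s\<in>x. 1 + (if s \<in> bottom_arcs x then 1 else 0))"
    by (rule sum.cong[OF refl]) (rule card_South_part[OF x])
  then have "n + card (top_arcs x) = card x + card (bottom_arcs x)"
    unfolding sum.distrib T B using sum_card_part[OF x, of "South ` {..<n}"] 
    by (simp add: nodes_def card_image inj_on_def)
  ultimately show ?thesis by simp
qed


section \<open>Associativity of concatenation\<close>

text \<open>The first two diagrams, drawn by \<open>g\<close>, form the part \<open>A\<close> to be
  contracted, and the outer nodes are its interface: by \<open>gk\<close> the third diagram, drawn
  by \<open>k\<close>, touches \<open>A\<close> only there. The traces of the components of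
  \<open>A\<close> on the interface are the strands of the product, and the components missing it
  are its loops. Labels agree because a component of the large graph is made of components of
  \<open>A\<close> and strands of \<open>w\<close>.\<close>

lemma concat_contract:
  fixes g :: "point \<Rightarrow> 'v" and k :: "node \<Rightarrow> 'v"
  assumes x: "x \<in> reduced_diagrams m n" and y: "y \<in> reduced_diagrams m n" and w: "w \<in> reduced_diagrams m n"
    and g: "inj g" and gk: "\<forall>u v. g u = k v \<longrightarrow> u \<in> range Outer"
    and A: "A = edges x (g \<circ> above) \<union> edges y (g \<circ> below)" and B: "B = edges w k"
    and P: "P = g ` Outer ` nodes n \<union> k ` nodes n"
  shows concat_contract_meet: "bij_betw (\<lambda>C. C \<inter> P) {C \<in> comps (A \<union> B). C \<inter> P \<noteq> {}}
      (comps (edges (concat_diagram m x y) (g \<circ> Outer) \<union> B))"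
    and concat_contract_avoid: "{C \<in> comps (A \<union> B). C \<inter> P = {}} = (`) g ` closed_loops x y"
    and concat_contract_label: "\<And>C. C \<in> comps (A \<union> B) \<Longrightarrow> C \<inter> P \<noteq> {} \<Longrightarrow>
      label_within (concat_diagram m x y) (g \<circ> Outer) (C \<inter> P) mod m
        = (label_within x (g \<circ> above) C + label_within y (g \<circ> below) C) mod m"
    and concat_contract_label': "\<And>C. label_within w k (C \<inter> P) = label_within w k C"
proof -
  let ?c = "concat_diagram m x y"
  define Q where "Q = g ` Outer ` nodes n"
  define A' where "A' = {C \<inter> Q | C. C \<in> comps A \<and> C \<inter> Q \<noteq> {}}"
  have A_image: "A = (`) g ` (edges x above \<union> edges y below)"
    by (simp add: A edges_comp image_Un)
  have compsA: "comps A = (`) g ` components x y"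
    by (simp add: A_image comps_image[OF g] components_eq)
  have meetQ: "g ` C \<inter> Q = g ` Outer ` (Outer -` C)" if "C \<in> components x y" for C
  proof -
    have "g ` C \<inter> Q = g ` (C \<inter> Outer ` nodes n)" unfolding Q_def by (rule image_Int[OF g, symmetric])
    also have "C \<inter> Outer ` nodes n = Outer ` (Outer -` C)" using outer_card(2)[OF x y that] by auto
    finally show ?thesis .
  qed
  have emptyQ: "g ` C \<inter> Q = {} \<longleftrightarrow> Outer -` C = {}" if "C \<in> components x y" for C
    unfolding meetQ[OF that] image_is_empty ..
  have UA: "\<Union>A = g ` (above ` nodes n \<union> below ` nodes n)"
    unfolding A using Union_edges[OF x, of "g \<circ> above"] Union_edges[OF y, of "g \<circ> below"]
    by (simp add: image_Un image_comp)
  have UB: "\<Union>B = k ` nodes n" by (simp add: B Union_edges[OF w])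
  have AB: "\<Union>B \<inter> \<Union>A \<subseteq> Q"
  proof
    fix q assume q: "q \<in> \<Union>B \<inter> \<Union>A"
    then obtain u v where uv: "q = g u" "u \<in> above ` nodes n \<union> below ` nodes n" "q = k v" unfolding UA UB by blast
    then obtain v' where v': "u = Outer v'" using gk by (metis imageE)
    then have "v' \<in> nodes n" using uv(2) by (auto simp: nodes_def image_Un image_image)
    then show "q \<in> Q" using uv(1) v' by (simp add: Q_def)
  qed
  have QA: "Q \<subseteq> \<Union>A"
  proof -
    have "Outer ` nodes n \<subseteq> above ` nodes n \<union> below ` nodes n"
      by (auto simp: nodes_def image_Un image_image)
    then show ?thesis unfolding UA Q_def by (rule image_mono)
  qed
  have P': "P = Q \<union> \<Union>B" by (simp add: P Q_def UB)
  have A'_eq: "A' = edges ?c (g \<circ> Outer)"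
  proof -
    have "A' = {g ` Outer ` (Outer -` C) | C. C \<in> components x y \<and> Outer -` C \<noteq> {}}"
    proof -
      have "A' = (\<lambda>C. C \<inter> Q) ` {C \<in> comps A. C \<inter> Q \<noteq> {}}" by (auto simp: A'_def)
      also have "\<dots> = (\<lambda>C. g ` C \<inter> Q) ` {C \<in> components x y. g ` C \<inter> Q \<noteq> {}}"
        unfolding compsA filter_image by (simp add: image_image)
      also have "\<dots> = (\<lambda>C. g ` Outer ` (Outer -` C)) ` {C \<in> components x y. Outer -` C \<noteq> {}}"
      proof (rule image_cong)
        show "{C \<in> components x y. g ` C \<inter> Q \<noteq> {}} = {C \<in> components x y. Outer -` C \<noteq> {}}"
          using emptyQ by blast
      qed (use meetQ in blast)
      finally show ?thesis by blast
    qed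
    also have "\<dots> = (\<lambda>C. g ` Outer ` (Outer -` C)) ` (components x y - closed_loops x y)"
      by (auto simp: closed_loops_def)
    also have "\<dots> = edges ?c (g \<circ> Outer)"
      unfolding edges_def concat_diagram_def image_comp[symmetric] image_image by simp
    finally show ?thesis .
  qed
  note ct = comps_contract[OF AB QA A'_def P', unfolded A'_eq]
  show "bij_betw (\<lambda>C. C \<inter> P) {C \<in> comps (A \<union> B). C \<inter> P \<noteq> {}} (comps (edges ?c (g \<circ> Outer) \<union> B))"
    by (rule ct(1))
  have "{C \<in> comps A. C \<inter> Q = {}} = (`) g ` {C \<in> components x y. g ` C \<inter> Q = {}}"
    unfolding compsA by (rule filter_image)
  also have "{C \<in> components x y. g ` C \<inter> Q = {}} = closed_loops x y"
    unfolding closed_loops_def using emptyQ by blast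
  finally show av: "{C \<in> comps (A \<union> B). C \<inter> P = {}} = (`) g ` closed_loops x y"
    using ct(2) by simp
  show "label_within w k (C \<inter> P) = label_within w k C" for C
  proof -
    have "k ` fst s \<subseteq> P" if "s \<in> w" for s using reduced_strand(1)[OF w that] by (auto simp: P)
    then have "{s \<in> w. k ` fst s \<subseteq> C \<inter> P} = {s \<in> w. k ` fst s \<subseteq> C}" by auto
    then show ?thesis by (simp add: label_within_def)
  qed
  show "label_within ?c (g \<circ> Outer) (C \<inter> P) mod m
      = (label_within x (g \<circ> above) C + label_within y (g \<circ> below) C) mod m"
    if C: "C \<in> comps (A \<union> B)" "C \<inter> P \<noteq> {}" for C
  proof -
    let ?K = "{C0 \<in> components x y. g ` C0 \<subseteq> C}"
    have "conn A \<subseteq> conn (A \<union> B)" by (rule conn_mono) (auto intro: conn_edge)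
    then have cl: "A0 \<subseteq> C" if A0: "A0 \<in> comps A" "A0 \<inter> C \<noteq> {}" for A0
    proof -
      obtain u where u: "u \<in> A0" "u \<in> C" using A0(2) by auto
      show ?thesis
      proof
        fix v assume "v \<in> A0"
        then have "(u, v) \<in> conn (A \<union> B)" using comps_conn[OF A0(1) u(1)] \<open>conn A \<subseteq> conn (A \<union> B)\<close> by blast
        then show "v \<in> C" by (rule comps_conn_mem[OF C(1) u(2)])
      qed
    qed
    \<comment> \<open>A loop of the first product is a component of the large graph by itself and
      avoids \<open>P\<close>, so it cannot lie inside a component that meets
      \<open>P\<close>.\<close>
    have nl: "C0 \<notin> closed_loops x y" if C0: "C0 \<in> ?K" for C0
    proof
      assume "C0 \<in> closed_loops x y"
      then have g0: "g ` C0 \<in> comps (A \<union> B)" "g ` C0 \<inter> P = {}" using av by auto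
      obtain u where "u \<in> g ` C0" using comps_nonempty[OF g0(1)] by auto
      then have "g ` C0 = C" using comps_disjoint[OF g0(1) C(1)] C0 by auto
      then show False using g0(2) C(2) by simp
    qed
    have iff: "g ` Outer ` (Outer -` C0) \<subseteq> C \<inter> P \<longleftrightarrow> g ` C0 \<subseteq> C"
      if C0: "C0 \<in> components x y - closed_loops x y" for C0
    proof
      obtain v where v: "Outer v \<in> C0" using C0 by (auto simp: closed_loops_def)
      assume "g ` Outer ` (Outer -` C0) \<subseteq> C \<inter> P"
      then have "g (Outer v) \<in> C" using v by auto
      then have "g ` C0 \<inter> C \<noteq> {}" using v by auto
      moreover have "g ` C0 \<in> comps A" using C0 compsA by simp
      ultimately show "g ` C0 \<subseteq> C" using cl by simp
    next
      assume "g ` C0 \<subseteq> C"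
      moreover have "g ` Outer ` (Outer -` C0) \<subseteq> Q" using meetQ[of C0] C0 by auto
      ultimately show "g ` Outer ` (Outer -` C0) \<subseteq> C \<inter> P" using P' by auto
    qed
    have "{s \<in> ?c. (g \<circ> Outer) ` fst s \<subseteq> C \<inter> P}
        = (\<lambda>C0. (Outer -` C0, label m x y C0)) ` {C0 \<in> components x y - closed_loops x y. g ` Outer ` (Outer -` C0) \<subseteq> C \<inter> P}"
      unfolding concat_diagram_def filter_image image_comp[symmetric] fst_conv ..
    also have "{C0 \<in> components x y - closed_loops x y. g ` Outer ` (Outer -` C0) \<subseteq> C \<inter> P} = ?K"
    proof (intro equalityI subsetI)
      fix C0 assume "C0 \<in> {C0 \<in> components x y - closed_loops x y. g ` Outer ` (Outer -` C0) \<subseteq> C \<inter> P}"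
      then have "C0 \<in> components x y - closed_loops x y" "g ` Outer ` (Outer -` C0) \<subseteq> C \<inter> P" by blast+
      then show "C0 \<in> ?K" using iff[of C0] by blast
    next
      fix C0 assume "C0 \<in> ?K"
      then have "C0 \<in> components x y - closed_loops x y" "g ` C0 \<subseteq> C" using nl[of C0] by blast+
      then show "C0 \<in> {C0 \<in> components x y - closed_loops x y. g ` Outer ` (Outer -` C0) \<subseteq> C \<inter> P}"
        using iff[of C0] by blast
    qed
    finally have set_eq: "{s \<in> ?c. (g \<circ> Outer) ` fst s \<subseteq> C \<inter> P} = (\<lambda>C0. (Outer -` C0, label m x y C0)) ` ?K" .
    have inj: "inj_on (\<lambda>C0. (Outer -` C0, label m x y C0)) ?K"
    proof (rule inj_onI)
      fix C0 C1 assume C01: "C0 \<in> ?K" "C1 \<in> ?K" "(Outer -` C0, label m x y C0) = (Outer -` C1, label m x y C1)"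
      have "Outer -` C0 \<noteq> {}" using nl[OF C01(1)] C01(1) by (simp add: closed_loops_def)
      then obtain v where "Outer v \<in> C0" by blast
      moreover then have "Outer v \<in> C1" using C01(3) by auto
      ultimately show "C0 = C1" using component_disjoint[of C0 x y C1 "Outer v"] C01 by simp
    qed
    have "label_within ?c (g \<circ> Outer) (C \<inter> P) = (\<Sum>C0\<in>?K. label m x y C0)"
      unfolding label_within_def set_eq by (simp add: sum.reindex[OF inj])
    also have "\<dots> mod m = (\<Sum>C0\<in>?K. label_within x above C0 + label_within y below C0) mod m"
      unfolding label_eq by (simp add: mod_sum_eq)
    also have "(\<Sum>C0\<in>?K. label_within x above C0 + label_within y below C0)
        = (\<Sum>A0 | A0 \<in> comps A \<and> A0 \<subseteq> C. label_within x (g \<circ> above) A0 + label_within y (g \<circ> below) A0)"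
    proof -
      have "{A0 \<in> comps A. A0 \<subseteq> C} = (`) g ` ?K" unfolding compsA by (rule filter_image)
      moreover have "inj_on ((`) g) ?K" using g by (auto simp: inj_on_def inj_image_eq_iff)
      ultimately show ?thesis by (simp add: sum.reindex label_within_comp[OF g])
    qed
    also have "\<dots> = label_within x (g \<circ> above) C + label_within y (g \<circ> below) C"
    proof -
      have fin: "finite (comps A)" unfolding compsA using finite_components[OF x y] by simp
      have "(\<Sum>A0 | A0 \<in> comps A \<and> A0 \<subseteq> C. label_within x (g \<circ> above) A0) = label_within x (g \<circ> above) C"
        by (rule label_within_split) (use x fin cl A edges_nonempty[OF x] in auto)
      moreover have "(\<Sum>A0 | A0 \<in> comps A \<and> A0 \<subseteq> C. label_within y (g \<circ> below) A0) = label_within y (g \<circ> below) C"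
        by (rule label_within_split) (use y fin cl A edges_nonempty[OF y] in auto)
      ultimately show ?thesis by (simp add: sum.distrib)
    qed
    finally show ?thesis .
  qed
qed

text \<open>Both bracketings of a triple product are contractions of the graph in which the three diagrams are
  placed on top of each other with their nodes on four levels.\<close>

lemma concat_triple:
  fixes g h :: "point \<Rightarrow> 'v" and k :: "node \<Rightarrow> 'v"
  assumes m: "m > 0" and x: "x \<in> reduced_diagrams m n" and y: "y \<in> reduced_diagrams m n" and w: "w \<in> reduced_diagrams m n"
    and g: "inj g" and gk: "\<forall>u v. g u = k v \<longrightarrow> u \<in> range Outer" and h: "inj h"
    and gh: "\<forall>u v. g u = h (Outer v) \<longrightarrow> u \<in> range Outer"
    and E: "E = edges x (g \<circ> above) \<union> edges y (g \<circ> below) \<union> edges w k"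
    and lab: "lab = (\<lambda>C. (label_within x (g \<circ> above) C + label_within y (g \<circ> below) C + label_within w k C) mod m)"
    and c12: "c1 = concat_diagram m x y \<and> c2 = w \<and> g \<circ> Outer = h \<circ> above \<and> k = h \<circ> below
      \<or> c2 = concat_diagram m x y \<and> c1 = w \<and> g \<circ> Outer = h \<circ> below \<and> k = h \<circ> above"
  shows concat_triple_diagram: "concat_diagram m c1 c2 = (\<lambda>C. ((h \<circ> Outer) -` C, lab C)) ` {C \<in> comps E. (h \<circ> Outer) -` C \<noteq> {}}"
    and concat_triple_factor: "loop_factor m p \<delta> x y * loop_factor m p \<delta> c1 c2
      = (\<Prod>C | C \<in> comps E \<and> (h \<circ> Outer) -` C = {}. if p dvd lab C then \<delta> (lab C) else 0)"
proof -
  let ?c = "concat_diagram m x y"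
  define P where "P = g ` Outer ` nodes n \<union> k ` nodes n"
  define B where "B = edges w k"
  define A where "A = edges x (g \<circ> above) \<union> edges y (g \<circ> below)"
  note cc = concat_contract[where k = k, OF x y w g gk A_def B_def P_def]
  have E: "E = A \<union> B" by (simp add: E A_def B_def)
  have c: "?c \<in> reduced_diagrams m n" by (rule concat_reduced[OF m x y])
  have comps12: "comps (edges ?c (g \<circ> Outer) \<union> B) = (`) h ` components c1 c2"
  proof -
    have "edges ?c (g \<circ> Outer) \<union> B = (`) h ` (edges c1 above \<union> edges c2 below)"
      using c12 unfolding B_def image_Un edges_comp[symmetric]
      by (elim disjE conjE) (simp_all add: Un_commute)
    then show ?thesis unfolding components_eq by (simp add: comps_image[OF h])
  qed
  have P: "P = h ` (above ` nodes n \<union> below ` nodes n)"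
  proof -
    have "P = (g \<circ> Outer) ` nodes n \<union> k ` nodes n" by (simp add: P_def image_comp)
    then show ?thesis using c12 unfolding image_Un image_comp
      by (elim disjE conjE) (simp_all add: Un_commute)
  qed
  have c1: "c1 \<in> reduced_diagrams m n" and c2: "c2 \<in> reduced_diagrams m n" using c12 c w by auto
  have lab12: "label m c1 c2 C' = lab C" if C: "C \<in> comps E" "C \<inter> P \<noteq> {}" "h ` C' = C \<inter> P" for C C'
  proof -
    have "label_within c1 above C' + label_within c2 below C'
        = label_within ?c (g \<circ> Outer) (h ` C') + label_within w k (h ` C')"
      using c12 by (auto simp: label_within_comp[OF h])
    then have "label m c1 c2 C' = (label_within ?c (g \<circ> Outer) (C \<inter> P) + label_within w k C) mod m"
      unfolding label_eq C(3) using cc(4)[where C = C] by simp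
    also have "\<dots> = (label_within ?c (g \<circ> Outer) (C \<inter> P) mod m + label_within w k C) mod m"
      by (simp add: mod_add_left_eq)
    also have "\<dots> = lab C" unfolding cc(3)[OF C(1,2)[unfolded E]] by (simp add: lab mod_add_left_eq)
    finally show ?thesis .
  qed
  have outer12: "Outer -` C' = (h \<circ> Outer) -` C" if C: "C \<in> comps E" "h ` C' = C \<inter> P" for C C'
  proof -
    have "C \<subseteq> \<Union>E" by (rule comps_subset[OF C(1)])
    have UE: "\<Union>E = (g \<circ> above) ` nodes n \<union> (g \<circ> below) ` nodes n \<union> k ` nodes n"
      by (simp add: E A_def B_def Union_edges[OF x] Union_edges[OF y] Union_edges[OF w])
    have "h (Outer v) \<in> P" if v: "h (Outer v) \<in> C" for v
    proof (cases "h (Outer v) \<in> k ` nodes n")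
      case False
      then obtain u where u: "u \<in> above ` nodes n \<union> below ` nodes n" "g u = h (Outer v)"
      proof -
        have "h (Outer v) \<in> (g \<circ> above) ` nodes n \<union> (g \<circ> below) ` nodes n"
          using False v \<open>C \<subseteq> \<Union>E\<close> unfolding UE by blast
        then show thesis using that unfolding image_comp[symmetric] by (metis UnE UnI1 UnI2 imageE)
      qed
      then obtain v' where v': "u = Outer v'" using gh by (metis imageE)
      then have "v' \<in> nodes n" using u(1) by (auto simp: nodes_def image_Un image_image)
      then have "g u \<in> P" unfolding P_def v' by blast
      then show ?thesis using u(2) by simp
    qed (simp add: P_def)
    then have "Outer v \<in> C' \<longleftrightarrow> h (Outer v) \<in> C" for v
      using C(2) h by (metis IntD1 IntI inj_image_mem_iff)
    then show ?thesis by auto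
  qed
  have avoid: "(h \<circ> Outer) -` C = {}" if "C \<in> comps E" "C \<inter> P = {}" for C
    using outer12[of C "{}"] that by simp
  define M where "M = {C \<in> comps E. C \<inter> P \<noteq> {}}"
  have bij: "bij_betw (\<lambda>C. C \<inter> P) M ((`) h ` components c1 c2)"
    using cc(1) unfolding E[symmetric] comps12 M_def .
  have img: "(\<lambda>C. C \<inter> P) ` M = (`) h ` components c1 c2" using bij by (rule bij_betw_imp_surj_on)
  have ex1: "\<exists>C'\<in>components c1 c2. h ` C' = C \<inter> P" if "C \<in> M" for C
  proof -
    have "C \<inter> P \<in> (`) h ` components c1 c2" using img imageI[OF that, of "\<lambda>C. C \<inter> P"] by simp
    then show ?thesis by (metis imageE)
  qed
  have ex2: "\<exists>C\<in>M. h ` C' = C \<inter> P" if "C' \<in> components c1 c2" for C'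
  proof -
    have "h ` C' \<in> (\<lambda>C. C \<inter> P) ` M" using img imageI[OF that, of "(`) h"] by simp
    then show ?thesis by (metis imageE)
  qed
  show "concat_diagram m c1 c2 = (\<lambda>C. ((h \<circ> Outer) -` C, lab C)) ` {C \<in> comps E. (h \<circ> Outer) -` C \<noteq> {}}"
  proof (intro equalityI subsetI)
    fix s assume s: "s \<in> concat_diagram m c1 c2"
    then obtain C' where C': "C' \<in> components c1 c2" "Outer -` C' \<noteq> {}" "s = (Outer -` C', label m c1 c2 C')"
      by (auto simp: concat_diagram_def closed_loops_def)
    obtain C where C: "C \<in> M" "h ` C' = C \<inter> P" using ex2[OF C'(1)] by blast
    then have "C \<in> comps E" "s = ((h \<circ> Outer) -` C, lab C)" "(h \<circ> Outer) -` C \<noteq> {}"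
      using outer12[of C C'] lab12[of C C'] C' by (auto simp: M_def)
    then show "s \<in> (\<lambda>C. ((h \<circ> Outer) -` C, lab C)) ` {C \<in> comps E. (h \<circ> Outer) -` C \<noteq> {}}" by blast
  next
    fix s assume "s \<in> (\<lambda>C. ((h \<circ> Outer) -` C, lab C)) ` {C \<in> comps E. (h \<circ> Outer) -` C \<noteq> {}}"
    then obtain C where C: "C \<in> comps E" "(h \<circ> Outer) -` C \<noteq> {}" "s = ((h \<circ> Outer) -` C, lab C)" by auto
    then have CM: "C \<in> M" using avoid[of C] by (auto simp: M_def)
    obtain C' where C': "C' \<in> components c1 c2" "h ` C' = C \<inter> P" using ex1[OF CM] by blast
    have "s = (Outer -` C', label m c1 c2 C')"
      using outer12[OF C(1) C'(2)] lab12[OF C(1) _ C'(2)] C(3) CM by (simp add: M_def)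
    moreover have "C' \<in> components c1 c2 - closed_loops c1 c2"
      using C'(1) C(2) outer12[OF C(1) C'(2)] by (simp add: closed_loops_def)
    ultimately show "s \<in> concat_diagram m c1 c2" unfolding concat_diagram_def by blast
  qed
  let ?H = "\<lambda>C. if p dvd lab C then \<delta> (lab C) else 0"
  let ?D = "{C \<in> M. (h \<circ> Outer) -` C = {}}"
  have finE: "finite (comps E)"
    by (rule finite_comps) (simp add: E A_def B_def Union_edges[OF x] Union_edges[OF y] Union_edges[OF w])
  \<comment> \<open>A component without final outer node either was closed in the first product or
    closes only in the second one; these two kinds give the two loop factors.\<close>
  have "{C \<in> comps E. (h \<circ> Outer) -` C = {}} = {C \<in> comps (A \<union> B). C \<inter> P = {}} \<union> ?D"
    using avoid by (auto simp: M_def E)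
  also have "\<dots> = (`) g ` closed_loops x y \<union> ?D" by (simp add: cc(2))
  finally have split: "{C \<in> comps E. (h \<circ> Outer) -` C = {}} = (`) g ` closed_loops x y \<union> ?D" .
  have loops1: "(\<Prod>C\<in>(`) g ` closed_loops x y. ?H C) = loop_factor m p \<delta> x y"
  proof -
    have inj: "inj_on ((`) g) (closed_loops x y)" using g by (auto simp: inj_on_def inj_image_eq_iff)
    have "lab (g ` C) = label m x y C" if C: "C \<in> closed_loops x y" for C
    proof -
      have "g ` C \<inter> P = {}" using cc(2) C by blast
      then have "{s \<in> w. k ` fst s \<subseteq> g ` C} = {}"
        using reduced_strand(1)[OF w] reduced_nonempty[OF w] unfolding P_def by fast
      then have "label_within w k (g ` C) = 0" unfolding label_within_def by (metis sum.empty)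
      then show ?thesis unfolding lab label_eq by (simp add: label_within_comp[OF g])
    qed
    then show ?thesis by (simp add: prod.reindex[OF inj] loop_factor_def cong: prod.cong if_cong)
  qed
  have loops2: "(\<Prod>C\<in>?D. ?H C) = loop_factor m p \<delta> c1 c2"
  proof -
    let ?\<psi> = "\<lambda>C. h -` (C \<inter> P)"
    have hh: "h ` (?\<psi> C) = C \<inter> P" for C unfolding P by auto
    have \<psi>: "?\<psi> C = C'" if "h ` C' = C \<inter> P" for C C' using that h by (metis inj_vimage_image_eq)
    have "bij_betw ?\<psi> ?D (closed_loops c1 c2)"
    proof (rule bij_betw_imageI)
      show "inj_on ?\<psi> ?D"
      proof (rule inj_onI)
        fix C0 C1 assume a: "C0 \<in> ?D" "C1 \<in> ?D" "?\<psi> C0 = ?\<psi> C1"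
        then have "C0 \<inter> P = C1 \<inter> P" using hh by metis
        then show "C0 = C1" using inj_onD[OF bij_betw_imp_inj_on[OF bij], of C0 C1] a(1,2) by simp
      qed
      show "?\<psi> ` ?D = closed_loops c1 c2"
      proof (intro equalityI subsetI)
        fix C' assume "C' \<in> ?\<psi> ` ?D"
        then obtain C where C: "C \<in> ?D" "C' = ?\<psi> C" by blast
        then obtain C'' where "C'' \<in> components c1 c2" "h ` C'' = C \<inter> P" using ex1 by blast
        then show "C' \<in> closed_loops c1 c2"
          using \<psi> C outer12[of C C''] by (auto simp: closed_loops_def M_def)
      next
        fix C' assume C': "C' \<in> closed_loops c1 c2"
        then have "C' \<in> components c1 c2" by (simp add: closed_loops_def)
        then obtain C where C: "C \<in> M" "h ` C' = C \<inter> P" using ex2 by blast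
        then have "C \<in> ?D" using outer12[of C C'] C' by (auto simp: closed_loops_def M_def)
        then show "C' \<in> ?\<psi> ` ?D" using \<psi>[OF C(2)] by blast
      qed
    qed
    from prod.reindex_bij_betw[OF this, of "\<lambda>C. if p dvd label m c1 c2 C then \<delta> (label m c1 c2 C) else 0"]
    have "loop_factor m p \<delta> c1 c2 = (\<Prod>C\<in>?D. if p dvd label m c1 c2 (?\<psi> C) then \<delta> (label m c1 c2 (?\<psi> C)) else 0)"
      by (simp add: loop_factor_def)
    also have "\<dots> = (\<Prod>C\<in>?D. ?H C)"
    proof (rule prod.cong[OF refl])
      fix C assume "C \<in> ?D"
      then have "label m c1 c2 (?\<psi> C) = lab C" by (intro lab12 hh) (auto simp: M_def)
      then show "(if p dvd label m c1 c2 (?\<psi> C) then \<delta> (label m c1 c2 (?\<psi> C)) else 0) = ?H C" by (simp only:)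
    qed
    finally show ?thesis by simp
  qed
  have "(`) g ` closed_loops x y \<inter> ?D = {}" using cc(2) by (auto simp: M_def)
  moreover have "finite ((`) g ` closed_loops x y)" using finite_closed_loops[OF x y] by simp
  moreover have "finite ?D" using finE by (simp add: M_def)
  ultimately show "loop_factor m p \<delta> x y * loop_factor m p \<delta> c1 c2
      = (\<Prod>C | C \<in> comps E \<and> (h \<circ> Outer) -` C = {}. ?H C)"
    unfolding split by (simp add: prod.union_disjoint loops1 loops2)
qed

text \<open>Rows 0 to 3 are the four rows of nodes of a triple product. \<open>level 0 1 2\<close>
  and \<open>level 1 2 3\<close> draw the product of the first or last two diagrams;
  \<open>level 0 2 3\<close> and \<open>level 0 1 3\<close> draw the second multiplication of each
  bracketing. The final outer nodes are rows 0 and 3 in both cases.\<close>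

fun level :: "nat \<Rightarrow> nat \<Rightarrow> nat \<Rightarrow> point \<Rightarrow> nat \<times> nat" where
  "level a b c (Outer (North i)) = (a, i)"
| "level a b c (Middle i) = (b, i)"
| "level a b c (Outer (South i)) = (c, i)"

lemma inj_level: 
  assumes "a \<noteq> b" "a \<noteq> c" "b \<noteq> c" shows "inj (level a b c)"
proof (rule injI)
  fix u v show "level a b c u = level a b c v \<Longrightarrow> u = v"
    using assms by (cases "(a, b, c, u)" rule: level.cases; cases "(a, b, c, v)" rule: level.cases) auto
qed

lemma level_not_Middle: "b \<noteq> fst q \<Longrightarrow> level a b c u = q \<Longrightarrow> u \<in> range Outer"
  by (cases u) auto

lemma level_eqs:
  "level 0 1 2 \<circ> Outer = level 0 2 3 \<circ> above" "level 1 2 3 \<circ> Outer = level 0 1 3 \<circ> below"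
  "level 0 1 2 \<circ> above = level 0 1 3 \<circ> above" "level 0 1 2 \<circ> below = level 1 2 3 \<circ> above"
  "level 0 2 3 \<circ> below = level 1 2 3 \<circ> below" "level 0 2 3 \<circ> Outer = level 0 1 3 \<circ> Outer"
  by (rule ext; rename_tac v; case_tac v; simp)+

lemma
  assumes m: "m > 0" and x: "x \<in> reduced_diagrams m n" and y: "y \<in> reduced_diagrams m n" and z: "z \<in> reduced_diagrams m n"
  shows concat_assoc: "concat_diagram m (concat_diagram m x y) z = concat_diagram m x (concat_diagram m y z)"
    and loop_factor_assoc: "loop_factor m p \<delta> x y * loop_factor m p \<delta> (concat_diagram m x y) z
      = loop_factor m p \<delta> y z * loop_factor m p \<delta> x (concat_diagram m y z)"
proof -
  have 1: "\<forall>u v. level 0 1 2 u = (level 0 2 3 \<circ> below) v \<longrightarrow> u \<in> range Outer"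
  proof (intro allI impI)
    fix u v assume "level 0 1 2 u = (level 0 2 3 \<circ> below) v"
    then show "u \<in> range Outer" by (rule level_not_Middle[rotated]) (cases v; simp)
  qed
  have 2: "\<forall>u v. level 0 1 2 u = level 0 2 3 (Outer v) \<longrightarrow> u \<in> range Outer"
  proof (intro allI impI)
    fix u v assume "level 0 1 2 u = level 0 2 3 (Outer v)"
    then show "u \<in> range Outer" by (rule level_not_Middle[rotated]) (cases v; simp)
  qed
  have 3: "\<forall>u v. level 1 2 3 u = (level 0 1 3 \<circ> above) v \<longrightarrow> u \<in> range Outer"
  proof (intro allI impI)
    fix u v assume "level 1 2 3 u = (level 0 1 3 \<circ> above) v"
    then show "u \<in> range Outer" by (rule level_not_Middle[rotated]) (cases v; simp)
  qed
  have 4: "\<forall>u v. level 1 2 3 u = level 0 1 3 (Outer v) \<longrightarrow> u \<in> range Outer"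
  proof (intro allI impI)
    fix u v assume "level 1 2 3 u = level 0 1 3 (Outer v)"
    then show "u \<in> range Outer" by (rule level_not_Middle[rotated]) (cases v; simp)
  qed
  have i: "inj (level 0 1 2)" "inj (level 1 2 3)" "inj (level 0 2 3)" "inj (level 0 1 3)"
    by (simp_all add: inj_level)
  note left = concat_triple[where k = "level 0 2 3 \<circ> below", OF m x y z i(1) 1 i(3) 2 refl refl
      disjI1[OF conjI[OF refl conjI[OF refl conjI[OF level_eqs(1) refl]]]]]
  note right = concat_triple[where k = "level 0 1 3 \<circ> above", OF m y z x i(2) 3 i(4) 4 refl refl
      disjI2[OF conjI[OF refl conjI[OF refl conjI[OF level_eqs(2) refl]]]]]
  have E: "edges y (level 1 2 3 \<circ> above) \<union> edges z (level 1 2 3 \<circ> below) \<union> edges x (level 0 1 3 \<circ> above)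
      = edges x (level 0 1 2 \<circ> above) \<union> edges y (level 0 1 2 \<circ> below) \<union> edges z (level 0 2 3 \<circ> below)"
    unfolding level_eqs by blast
  have L: "(label_within y (level 1 2 3 \<circ> above) C + label_within z (level 1 2 3 \<circ> below) C
        + label_within x (level 0 1 3 \<circ> above) C) mod m
      = (label_within x (level 0 1 2 \<circ> above) C + label_within y (level 0 1 2 \<circ> below) C
        + label_within z (level 0 2 3 \<circ> below) C) mod m" for C
    unfolding level_eqs by (simp add: add_ac)
  show "concat_diagram m (concat_diagram m x y) z = concat_diagram m x (concat_diagram m y z)"
    unfolding left(1) right(1) E L level_eqs(6) ..
  show "loop_factor m p \<delta> x y * loop_factor m p \<delta> (concat_diagram m x y) z
      = loop_factor m p \<delta> y z * loop_factor m p \<delta> x (concat_diagram m y z)"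
    unfolding left(2) right(2) E L level_eqs(6) ..
qed


section \<open>Invertible diagrams\<close>

lemma reduced_cover_eq:
  assumes z: "z \<in> reduced_diagrams m n" and sub: "X \<subseteq> z" and cov: "\<And>v. v \<in> nodes n \<Longrightarrow> \<exists>s\<in>X. v \<in> fst s"
  shows "X = z"
proof -
  have "s \<in> X" if s: "s \<in> z" for s
  proof -
    obtain v where v: "v \<in> fst s" using reduced_nonempty[OF z s] by auto
    then have "v \<in> nodes n" using reduced_strand(1)[OF z s] by auto
    then obtain s' where s': "s' \<in> X" "v \<in> fst s'" using cov by blast
    then have "s = s'" using reduced_unique[OF z s _ v] sub by blast
    then show ?thesis using s' by simp
  qed
  then show ?thesis using sub by auto
qed

text \<open>All strands but one determine the two ends of the missing strand, and the total label
  modulo \<open>m\<close> then determines its label.\<close>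

lemma reduced_all_but_one:
  assumes z: "z \<in> reduced_diagrams m n" and z': "z' \<in> reduced_diagrams m n"
    and r: "r \<in> z" and sub: "z - {r} \<subseteq> z'"
    and sum: "(\<Sum>s\<in>z. snd s) mod m = (\<Sum>s\<in>z'. snd s) mod m"
  shows "z = z'"
proof -
  obtain v where v: "v \<in> fst r" using reduced_nonempty[OF z r] by auto
  then have "v \<in> nodes n" using reduced_strand(1)[OF z r] by auto
  then obtain r' where r': "r' \<in> z'" "v \<in> fst r'" using reduced_cover[OF z'] by metis
  have r'n: "r' \<notin> z - {r}" using reduced_unique[OF z r _ v r'(2)] by blast
  have "fst r' \<subseteq> fst r"
  proof
    fix u assume u: "u \<in> fst r'"
    then have "u \<in> nodes n" using reduced_strand(1)[OF z' r'(1)] by auto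
    then obtain t where t: "t \<in> z" "u \<in> fst t" using reduced_cover[OF z] by metis
    have "t = r"
    proof (rule ccontr)
      assume "t \<noteq> r"
      then have "t \<in> z - {r}" using t by simp
      moreover from this have "t = r'" using reduced_unique[OF z' _ r'(1) t(2) u] sub by blast
      ultimately show False using r'n by simp
    qed
    then show "u \<in> fst r" using t by simp
  qed
  then have e: "fst r' = fst r"
    using reduced_strand[OF z r] reduced_strand[OF z' r'(1)] by (metis card_subset_eq finite_nodes finite_subset)
  have z'_eq: "insert r' (z - {r}) = z'"
  proof (rule reduced_cover_eq[OF z'])
    show "insert r' (z - {r}) \<subseteq> z'" using sub r' by auto
    fix u assume "u \<in> nodes n"
    then obtain t where "t \<in> z" "u \<in> fst t" using reduced_cover[OF z] by metis
    then show "\<exists>s\<in>insert r' (z - {r}). u \<in> fst s" using e by (cases "t = r") auto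
  qed
  have "(\<Sum>s\<in>z'. snd s) = snd r' + (\<Sum>s\<in>z - {r}. snd s)"
    unfolding z'_eq[symmetric] using z r'n by (subst sum.insert) auto
  moreover have "(\<Sum>s\<in>z. snd s) = snd r + (\<Sum>s\<in>z - {r}. snd s)"
    using z r by (simp add: sum.remove)
  ultimately have "[snd r + (\<Sum>s\<in>z - {r}. snd s) = snd r' + (\<Sum>s\<in>z - {r}. snd s)] (mod m)"
    using sum by (simp add: cong_def)
  then have "snd r mod m = snd r' mod m" by (simp add: cong_add_rcancel_nat cong_def[symmetric])
  then have "r = r'" using e reduced_strand(3)[OF z r] reduced_strand(3)[OF z' r'(1)] by (simp add: prod_eq_iff)
  then show ?thesis using z'_eq r by auto
qed

section \<open>Permutation diagrams and their action\<close>

text \<open>The monomial matrix with permutation \<open>\<sigma>\<close> and the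
  \<open>c i\<close>-th powers of a primitive \<open>m\<close>-th root of unity as entries. The
  condition that \<open>p\<close> divides the sum of \<open>c\<close> cuts out the reflection group
  \<open>G(m,p,n)\<close>.\<close>

definition perm_diagram :: "nat \<Rightarrow> (nat \<Rightarrow> nat) \<Rightarrow> (nat \<Rightarrow> nat) \<Rightarrow> diagram"
  where "perm_diagram n \<sigma> c = (\<lambda>i. ({North (\<sigma> i), South i}, c i)) ` {..<n}"

lemma perm_diagram_reduced:
  assumes \<sigma>: "inj_on \<sigma> {..<n}" "\<sigma> ` {..<n} = {..<n}" and c: "\<And>i. i < n \<Longrightarrow> c i < m"
  shows "perm_diagram n \<sigma> c \<in> reduced_diagrams m n"
proof (rule reducedI)
  fix s assume "s \<in> perm_diagram n \<sigma> c"
  then obtain i where "i < n" "s = ({North (\<sigma> i), South i}, c i)" by (auto simp: perm_diagram_def)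
  moreover then have "\<sigma> i < n" using \<sigma>(2) by auto
  ultimately show "fst s \<subseteq> nodes n \<and> card (fst s) = 2 \<and> snd s < m" using c by auto
next
  fix v assume v: "v \<in> nodes n"
  show "\<exists>s\<in>perm_diagram n \<sigma> c. v \<in> fst s"
  proof (cases v)
    case (North j)
    then have "j \<in> \<sigma> ` {..<n}" using v \<sigma>(2) by simp
    then show ?thesis using North by (auto simp: perm_diagram_def)
  qed (use v in \<open>auto simp: perm_diagram_def\<close>)
next
  fix s s' v assume "s \<in> perm_diagram n \<sigma> c" "s' \<in> perm_diagram n \<sigma> c" "v \<in> fst s" "v \<in> fst s'"
  then obtain i j where ij: "i < n" "j < n" "s = ({North (\<sigma> i), South i}, c i)" "s' = ({North (\<sigma> j), South j}, c j)"
      "v \<in> {North (\<sigma> i), South i}" "v \<in> {North (\<sigma> j), South j}"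
    by (auto simp: perm_diagram_def)
  then have "i = j" using inj_onD[OF \<sigma>(1), of i j] by auto
  then show "s = s'" using ij by simp
qed

lemma perm_diagram_arcs:
  "top_arcs (perm_diagram n \<sigma> c) = {}" "bottom_arcs (perm_diagram n \<sigma> c) = {}"
  by (auto simp: perm_diagram_def top_arcs_def bottom_arcs_def)

lemma perm_diagram_act:
  assumes m: "m > 0" and g: "perm_diagram n \<sigma> c \<in> reduced_diagrams m n" and x: "x \<in> reduced_diagrams m n"
    and \<sigma>: "\<sigma> ` {..<n} = {..<n}"
  shows "concat_diagram m (perm_diagram n \<sigma> c) x
    = (\<lambda>s. (case_node (North \<circ> \<sigma>) South ` fst s, (snd s + (\<Sum>i | North i \<in> fst s. c i)) mod m)) ` x"
proof (rule sym, rule reduced_cover_eq[OF concat_reduced[OF m g x]])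
  show "(\<lambda>s. (case_node (North \<circ> \<sigma>) South ` fst s, (snd s + (\<Sum>i | North i \<in> fst s. c i)) mod m)) ` x
    \<subseteq> concat_diagram m (perm_diagram n \<sigma> c) x"
  proof (rule image_subsetI)
    fix s assume s: "s \<in> x"
    show "(case_node (North \<circ> \<sigma>) South ` fst s, (snd s + (\<Sum>i | North i \<in> fst s. c i)) mod m)
      \<in> concat_diagram m (perm_diagram n \<sigma> c) x"
    proof (rule transport[OF g x s])
      fix i assume "North i \<in> fst s"
      then have "i < n" using reduced_strand(1)[OF x s] by auto
      then show "({North (\<sigma> i), South i}, c i) \<in> perm_diagram n \<sigma> c" by (simp add: perm_diagram_def)
    qed
  qed
next
  fix v assume v: "v \<in> nodes n"
  obtain u where u: "u \<in> nodes n" "v = case_node (North \<circ> \<sigma>) South u"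
  proof (cases v)
    case (North j)
    then have "j \<in> \<sigma> ` {..<n}" using v \<sigma> by simp
    then obtain i where "i < n" "j = \<sigma> i" by auto
    then show ?thesis using that[of "North i"] North by simp
  qed (use v that[of v] in auto)
  then obtain s where "s \<in> x" "u \<in> fst s" using reduced_cover[OF x] by metis
  then show "\<exists>s\<in>(\<lambda>s. (case_node (North \<circ> \<sigma>) South ` fst s, (snd s + (\<Sum>i | North i \<in> fst s. c i)) mod m)) ` x. v \<in> fst s"
    using u(2) by auto
qed

lemma identity_perm: "identity_diagram n = perm_diagram n id (\<lambda>_. 0)"
  by (simp add: identity_diagram_def perm_diagram_def)

lemma identity_reduced: "m > 0 \<Longrightarrow> identity_diagram n \<in> reduced_diagrams m n"
  unfolding identity_perm by (rule perm_diagram_reduced) auto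

lemma identity_arcs: "top_arcs (identity_diagram n) = {}" "bottom_arcs (identity_diagram n) = {}"
  unfolding identity_perm by (rule perm_diagram_arcs)+

lemma case_node_id: "case_node (North \<circ> id) South = id"
proof
  fix v show "case_node (North \<circ> id) South v = id v" by (cases v) simp_all
qed

lemma id_image: "id ` A = A"
  by simp

lemma concat_identity_left:
  assumes m: "m > 0" and x: "x \<in> reduced_diagrams m n"
  shows "concat_diagram m (identity_diagram n) x = x"
proof -
  have "concat_diagram m (identity_diagram n) x = (\<lambda>s. (fst s, snd s mod m)) ` x"
    unfolding identity_perm perm_diagram_act[OF m identity_reduced[OF m, unfolded identity_perm] x id_image] case_node_id
    by simp
  also have "\<dots> = (\<lambda>s. s) ` x"
    by (rule image_cong) (use reduced_strand(3)[OF x] in auto)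
  finally show ?thesis by simp
qed

lemma flip_identity: "flip (identity_diagram n) = identity_diagram n"
  by (simp add: flip_def identity_diagram_def image_image insert_commute)

lemma concat_identity_right:
  assumes m: "m > 0" and x: "x \<in> reduced_diagrams m n"
  shows "concat_diagram m x (identity_diagram n) = x"
proof -
  have "flip (concat_diagram m x (identity_diagram n)) = flip x"
    using concat_identity_left[OF m flip_reduced[OF x]] by (metis concat_flip flip_identity)
  then show ?thesis by (metis flip_flip)
qed

lemma through_strand:
  assumes x: "x \<in> reduced_diagrams m n" and s: "s \<in> x" "s \<notin> top_arcs x" "s \<notin> bottom_arcs x"
  obtains i j where "fst s = {North i, South j}" "i < n" "j < n"
proof -
  obtain u v where uv: "fst s = {u, v}" using reduced_strand(2)[OF x s(1)] by (auto simp: card_2_iff)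
  then have "u \<in> nodes n" "v \<in> nodes n" using reduced_strand(1)[OF x s(1)] by auto
  then show ?thesis using uv s that
    by (cases u; cases v) (auto simp: top_arcs_def bottom_arcs_def insert_commute)
qed

lemma card_reduced:
  assumes x: "x \<in> reduced_diagrams m n" shows "card x = n"
proof -
  have "(\<Sum>s\<in>x. card (fst s \<inter> nodes n)) = (\<Sum>s\<in>x. 2)"
  proof (rule sum.cong[OF refl])
    fix s assume "s \<in> x"
    then show "card (fst s \<inter> nodes n) = 2" using reduced_strand[OF x] by (simp add: Int_absorb2)
  qed
  then have "2 * card x = card (nodes n)" using sum_card_part[OF x, of "nodes n"] by simp
  also have "card (nodes n) = 2 * n"
    unfolding nodes_def by (subst card_Un_disjoint) (auto simp: card_image inj_on_def)
  finally show ?thesis by simp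
qed

text \<open>Equal southern arcs leave the same southern nodes for through strands and force equal
  numbers of northern arcs. So southern arcs are matched identically, northern arcs arbitrarily and
  through strands by their southern ends; surjectivity follows since both diagrams have
  \<open>n\<close> strands.\<close>

lemma strand_bijection:
  assumes x: "x \<in> reduced_diagrams m n" and y: "y \<in> reduced_diagrams m n" and B: "bottom_arcs x = bottom_arcs y"
  obtains \<psi> where "bij_betw \<psi> x y" "\<And>s. s \<in> bottom_arcs x \<Longrightarrow> \<psi> s = s"
    "\<And>s. s \<in> x \<Longrightarrow> fst (\<psi> s) \<inter> range South = fst s \<inter> range South"
proof -
  have fin: "finite (top_arcs x)" "finite (top_arcs y)" using x y by (auto simp: top_arcs_def)
  have "card (top_arcs x) = card (top_arcs y)" using card_top_bottom[OF x] card_top_bottom[OF y] B by simp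
  then obtain \<beta> where \<beta>: "bij_betw \<beta> (top_arcs x) (top_arcs y)" using finite_same_card_bij[OF fin] by blast
  have \<beta>T: "\<beta> s \<in> top_arcs y" if "s \<in> top_arcs x" for s using bij_betwE[OF \<beta>] that by blast
  define \<psi> where "\<psi> s = (if s \<in> bottom_arcs x then s else if s \<in> top_arcs x then \<beta> s
      else (SOME t. t \<in> y \<and> fst t \<inter> fst s \<inter> range South \<noteq> {}))" for s
  have disj: "s \<notin> top_arcs x" if "s \<in> bottom_arcs x" for s
  proof
    assume "s \<in> top_arcs x"
    moreover have "s \<in> x" using that by (simp add: bottom_arcs_def)
    then obtain v where "v \<in> fst s" using reduced_nonempty[OF x] by blast
    ultimately show False using that by (auto simp: top_arcs_def bottom_arcs_def)
  qed
  have thr: "\<exists>i j. \<psi> s \<in> y \<and> \<psi> s \<notin> bottom_arcs y \<and> fst (\<psi> s) = {North i, South j} \<and> South j \<in> fst s \<and> fst s \<inter> range South = {South j}"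
    if s: "s \<in> x" "s \<notin> top_arcs x" "s \<notin> bottom_arcs x" for s
  proof -
    obtain i j where ij: "fst s = {North i, South j}" "i < n" "j < n" using through_strand[OF x s] .
    obtain t where t: "t \<in> y" "South j \<in> fst t" using reduced_cover[OF y, of "South j"] ij(3) by auto
    then have "South j \<in> fst t \<inter> fst s \<inter> range South" using ij by simp
    then have "\<exists>t. t \<in> y \<and> fst t \<inter> fst s \<inter> range South \<noteq> {}" using t(1) by blast
    then have "\<psi> s \<in> y \<and> fst (\<psi> s) \<inter> fst s \<inter> range South \<noteq> {}"
      unfolding \<psi>_def using s by (simp, rule_tac someI_ex)
    then have \<psi>s: "\<psi> s \<in> y" "South j \<in> fst (\<psi> s)" using ij(1) by auto
    have nb: "\<psi> s \<notin> bottom_arcs y"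
    proof
      assume b: "\<psi> s \<in> bottom_arcs y"
      then have "\<psi> s \<in> x" using B by (auto simp: bottom_arcs_def)
      then have "\<psi> s = s" using reduced_unique[OF x _ s(1) \<psi>s(2)] ij by auto
      then show False using b B s(3) by simp
    qed
    moreover have "\<psi> s \<notin> top_arcs y" using \<psi>s(2) by (auto simp: top_arcs_def)
    ultimately obtain i' j' where "fst (\<psi> s) = {North i', South j'}" using through_strand[OF y \<psi>s(1)] by metis
    then have "fst (\<psi> s) = {North i', South j}" using \<psi>s(2) by auto
    moreover have "South j \<in> fst s" "fst s \<inter> range South = {South j}" unfolding ij(1) by auto
    ultimately show ?thesis using \<psi>s(1) nb by blast
  qed
  have in_y: "\<psi> s \<in> y" if "s \<in> x" for s
  proof -
    consider "s \<in> bottom_arcs x" | "s \<in> top_arcs x" "s \<notin> bottom_arcs x" | "s \<notin> top_arcs x" "s \<notin> bottom_arcs x" by blast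
    then show ?thesis
    proof cases
      case 1 then show ?thesis using B by (auto simp: \<psi>_def bottom_arcs_def)
    next
      case 2 then show ?thesis using \<beta>T[of s] by (auto simp: \<psi>_def top_arcs_def)
    next
      case 3 then show ?thesis using thr[OF that] by blast
    qed
  qed
  have bot: "\<psi> s \<in> bottom_arcs y \<longleftrightarrow> s \<in> bottom_arcs x" if "s \<in> x" for s
  proof -
    have "\<beta> s \<notin> bottom_arcs y" if "s \<in> top_arcs x"
    proof
      assume "\<beta> s \<in> bottom_arcs y"
      then have "\<beta> s \<in> bottom_arcs x" "\<beta> s \<in> y" using B by (auto simp: bottom_arcs_def)
      then obtain v where "v \<in> fst (\<beta> s)" using reduced_nonempty[OF y] by blast
      then show False using \<open>\<beta> s \<in> bottom_arcs y\<close> \<beta>T[OF that] by (auto simp: top_arcs_def bottom_arcs_def)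
    qed
    then show ?thesis using B thr[OF that] by (cases "s \<in> bottom_arcs x"; cases "s \<in> top_arcs x") (auto simp: \<psi>_def)
  qed
  have top: "\<psi> s \<in> top_arcs y \<longleftrightarrow> s \<in> top_arcs x" if "s \<in> x" "s \<notin> bottom_arcs x" for s
    using thr[OF that(1)] \<beta>T[of s] that by (cases "s \<in> top_arcs x") (auto simp: \<psi>_def top_arcs_def)
  have inj: "inj_on \<psi> x"
  proof (rule inj_onI)
    fix s s' assume s: "s \<in> x" "s' \<in> x" "\<psi> s = \<psi> s'"
    consider "s \<in> bottom_arcs x" "s' \<in> bottom_arcs x" 
      | "s \<in> top_arcs x" "s \<notin> bottom_arcs x" "s' \<in> top_arcs x" "s' \<notin> bottom_arcs x"
      | "s \<notin> top_arcs x" "s \<notin> bottom_arcs x" "s' \<notin> top_arcs x" "s' \<notin> bottom_arcs x"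
      using bot[OF s(1)] bot[OF s(2)] top[OF s(1)] top[OF s(2)] s(3) by metis
    then show "s = s'"
    proof cases
      case 1 then show ?thesis using s by (simp add: \<psi>_def)
    next
      case 2 then show ?thesis using s inj_onD[OF bij_betw_imp_inj_on[OF \<beta>]] by (simp add: \<psi>_def)
    next
      case 3
      obtain i j where 1: "fst (\<psi> s) = {North i, South j}" "South j \<in> fst s" using thr[OF s(1) 3(1,2)] by blast
      obtain i' j' where 2: "fst (\<psi> s') = {North i', South j'}" "South j' \<in> fst s'" using thr[OF s(2) 3(3,4)] by blast
      have "j = j'" using 1 2 s(3) by (auto simp: doubleton_eq_iff)
      then show ?thesis using reduced_unique[OF x s(1,2)] 1 2 by blast
    qed
  qed
  have "card (\<psi> ` x) = card y" using inj card_image card_reduced[OF x] card_reduced[OF y] by metis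
  then have "\<psi> ` x = y" using in_y y by (intro card_subset_eq) auto
  then have 1: "bij_betw \<psi> x y" using inj by (simp add: bij_betw_def)
  have 3: "fst (\<psi> s) \<inter> range South = fst s \<inter> range South" if s: "s \<in> x" for s
  proof -
    consider "s \<in> bottom_arcs x" | "s \<in> top_arcs x" "s \<notin> bottom_arcs x" | "s \<notin> top_arcs x" "s \<notin> bottom_arcs x" by blast
    then show ?thesis
    proof cases
      case 1 then show ?thesis by (simp add: \<psi>_def)
    next
      case 2
      then have "fst (\<psi> s) \<subseteq> range North" "fst s \<subseteq> range North" using \<beta>T[of s] by (auto simp: \<psi>_def top_arcs_def)
      then show ?thesis by fast
    next
      case 3
      obtain i j where "fst (\<psi> s) = {North i, South j}" "fst s \<inter> range South = {South j}"
        using thr[OF s 3] by blast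
      then show ?thesis by auto
    qed
  qed
  show ?thesis by (rule that[OF 1 _ 3]) (auto simp: \<psi>_def)
qed

text \<open>A permutation diagram multiplied from above moves northern ends and changes the labels
  of strands having such ends; southern arcs stay fixed. So it remains to refine the bijection of
  strands to one of northern ends (\<open>\<tau>\<close>, then \<open>\<sigma>\<close>) and to
  correct the labels.\<close>

lemma perm_diagram_transitive:
  assumes m: "m > 0" and x: "x \<in> reduced_diagrams m n" and y: "y \<in> reduced_diagrams m n" and B: "bottom_arcs x = bottom_arcs y"
  shows "\<exists>g\<in>reduced_diagrams m n. top_arcs g = {} \<and> bottom_arcs g = {} \<and> concat_diagram m g x = y"
proof -
  obtain \<psi> where \<psi>: "bij_betw \<psi> x y" and \<psi>B: "\<And>s. s \<in> bottom_arcs x \<Longrightarrow> \<psi> s = s"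
    and \<psi>S: "\<And>s. s \<in> x \<Longrightarrow> fst (\<psi> s) \<inter> range South = fst s \<inter> range South"
    using strand_bijection[OF x y B] by metis
  define N where "N e = {i. North i \<in> e}" for e
  have \<psi>y: "\<psi> s \<in> y" if "s \<in> x" for s using bij_betwE[OF \<psi>] that by blast
  have split: "e = North ` N e \<union> (e \<inter> range South)" for e
  proof (rule Set.set_eqI)
    fix v show "v \<in> e \<longleftrightarrow> v \<in> North ` N e \<union> (e \<inter> range South)" by (cases v) (auto simp: N_def)
  qed
  have finN: "finite (N (fst s))" if "s \<in> z" "z \<in> reduced_diagrams m n" for s z
    using reduced_strand(1)[OF that(2,1)] finite_vimageI[of "fst s" North] finite_subset[of "fst s" "nodes n"]
    by (simp add: N_def vimage_def inj_def)
  have cardN: "card (N (fst s)) = card (N (fst (\<psi> s)))" if s: "s \<in> x" for s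
  proof -
    have *: "card (N (fst t)) + card (fst t \<inter> range South) = 2" if "t \<in> z" "z \<in> reduced_diagrams m n" for t z
    proof -
      have "card (fst t) = card (North ` N (fst t)) + card (fst t \<inter> range South)"
        by (subst split, rule card_Un_disjoint)
          (use finN[OF that] finite_subset[OF reduced_strand(1)[OF that(2,1)]] in auto)
      then show ?thesis using reduced_strand(2)[OF that(2,1)] by (simp add: card_image inj_on_def)
    qed
    show ?thesis using *[OF s x] *[OF \<psi>y[OF s] y] \<psi>S[OF s] by simp
  qed
  then have "\<forall>s\<in>x. \<exists>f. bij_betw f (N (fst s)) (N (fst (\<psi> s)))"
    using finite_same_card_bij finN x y \<psi>y by metis
  then obtain \<tau> where \<tau>: "\<And>s. s \<in> x \<Longrightarrow> bij_betw (\<tau> s) (N (fst s)) (N (fst (\<psi> s)))" by metis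
  define st where "st i = (THE s. s \<in> x \<and> North i \<in> fst s)" for i
  have st: "st i = s" if "s \<in> x" "North i \<in> fst s" for i s
    unfolding st_def using that reduced_unique[OF x] by blast
  have st_ex: "st i \<in> x \<and> North i \<in> fst (st i)" if i: "i < n" for i
  proof -
    obtain s where "s \<in> x" "North i \<in> fst s" using reduced_cover[OF x, of "North i"] i by auto
    then show ?thesis using st by simp
  qed
  define \<sigma> where "\<sigma> i = \<tau> (st i) i" for i
  \<comment> \<open>The action adds \<open>c\<close> over all northern ends of a strand, so the
    whole correction is put on one chosen end. Adding \<open>m\<close> keeps the subtraction from
    being truncated.\<close>
  define c where "c i = (if i = (SOME j. j \<in> N (fst (st i))) then (snd (\<psi> (st i)) + m - snd (st i)) mod m else 0)" for i
  have \<sigma>N: "\<sigma> ` N (fst s) = N (fst (\<psi> s))" if s: "s \<in> x" for s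
  proof -
    have "\<sigma> i = \<tau> s i" if "i \<in> N (fst s)" for i using st[OF s] that by (simp add: \<sigma>_def N_def)
    then have "\<sigma> ` N (fst s) = \<tau> s ` N (fst s)" by (rule image_cong[OF refl])
    then show ?thesis using bij_betw_imp_surj_on[OF \<tau>[OF s]] by simp
  qed
  have \<sigma>in: "\<sigma> i \<in> N (fst (\<psi> (st i)))" if "i < n" for i
    using \<sigma>N[of "st i"] st_ex[OF that] by (auto simp: N_def)
  have \<sigma>inj: "inj_on \<sigma> {..<n}"
  proof (rule inj_onI)
    fix i j assume ij: "i \<in> {..<n}" "j \<in> {..<n}" "\<sigma> i = \<sigma> j"
    have sx: "st i \<in> x" "st j \<in> x" using st_ex ij by auto
    have "North (\<sigma> i) \<in> fst (\<psi> (st i))" "North (\<sigma> i) \<in> fst (\<psi> (st j))"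
      using \<sigma>in[of i] \<sigma>in[of j] ij by (auto simp: N_def)
    then have "\<psi> (st i) = \<psi> (st j)" using reduced_unique[OF y \<psi>y[OF sx(1)] \<psi>y[OF sx(2)]] by blast
    then have e: "st i = st j" using inj_onD[OF bij_betw_imp_inj_on[OF \<psi>]] sx by blast
    have "i \<in> N (fst (st i))" "j \<in> N (fst (st i))" using st_ex[of i] st_ex[of j] e ij by (auto simp: N_def)
    moreover have "\<tau> (st i) i = \<tau> (st i) j" using ij(3) e by (simp add: \<sigma>_def)
    ultimately show "i = j" using inj_onD[OF bij_betw_imp_inj_on[OF \<tau>[OF sx(1)]]] by blast
  qed
  have "\<sigma> ` {..<n} \<subseteq> {..<n}"
  proof
    fix j assume "j \<in> \<sigma> ` {..<n}"
    then obtain i where i: "i < n" "j = \<sigma> i" by auto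
    then have "North j \<in> fst (\<psi> (st i))" using \<sigma>in by (simp add: N_def)
    then show "j \<in> {..<n}" using reduced_strand(1)[OF y \<psi>y] st_ex[OF i(1)] by fastforce
  qed
  then have \<sigma>surj: "\<sigma> ` {..<n} = {..<n}" using \<sigma>inj by (simp add: endo_inj_surj)
  define g where "g = perm_diagram n \<sigma> c"
  have g: "g \<in> reduced_diagrams m n"
    unfolding g_def by (rule perm_diagram_reduced[OF \<sigma>inj \<sigma>surj]) (use m in \<open>simp add: c_def\<close>)
  have act: "(case_node (North \<circ> \<sigma>) South ` fst s, (snd s + (\<Sum>i | North i \<in> fst s. c i)) mod m) = \<psi> s"
    if s: "s \<in> x" for s
  proof (rule prod_eqI)
    let ?f = "case_node (\<lambda>i. North (\<sigma> i)) South"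
    have "?f ` fst s = ?f ` North ` N (fst s) \<union> ?f ` (fst s \<inter> range South)"
      by (subst split) (simp add: image_Un)
    also have "?f ` North ` N (fst s) = North ` \<sigma> ` N (fst s)" by (simp add: image_image)
    also have "?f ` (fst s \<inter> range South) = fst s \<inter> range South" by force
    also have "North ` \<sigma> ` N (fst s) \<union> (fst s \<inter> range South) = fst (\<psi> s)"
      unfolding \<sigma>N[OF s] \<psi>S[OF s, symmetric] by (rule split[symmetric])
    finally show "fst (case_node (North \<circ> \<sigma>) South ` fst s, (snd s + (\<Sum>i | North i \<in> fst s. c i)) mod m) = fst (\<psi> s)"
      unfolding fst_conv comp_def .
    have "(snd s + (\<Sum>i | North i \<in> fst s. c i)) mod m = snd (\<psi> s)"
    proof (cases "N (fst s) = {}")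
      case True
      then have "fst s \<subseteq> range South" using split[of "fst s"] by blast
      then have "\<psi> s = s" using s \<psi>B by (simp add: bottom_arcs_def)
      then show ?thesis using True reduced_strand(3)[OF x s] by (simp add: N_def)
    next
      case False
      define j where "j = (SOME j. j \<in> N (fst s))"
      have j: "j \<in> N (fst s)" unfolding j_def using False by (simp add: some_in_eq)
      have "c i = (if i = j then (snd (\<psi> s) + m - snd s) mod m else 0)" if "i \<in> N (fst s)" for i
      proof -
        have "st i = s" using st[OF s] that by (simp add: N_def)
        then show ?thesis unfolding c_def j_def by (simp only:)
      qed
      then have "(\<Sum>i\<in>N (fst s). c i) = (\<Sum>i\<in>N (fst s). if i = j then (snd (\<psi> s) + m - snd s) mod m else 0)"
        by (rule sum.cong[OF refl])
      also have "\<dots> = (snd (\<psi> s) + m - snd s) mod m" using finN[OF s x] j by simp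
      finally have "(snd s + (\<Sum>i\<in>N (fst s). c i)) mod m = (snd s + (snd (\<psi> s) + m - snd s)) mod m"
        by (simp add: mod_add_right_eq)
      also have "\<dots> = snd (\<psi> s)"
        using reduced_strand(3)[OF x s] reduced_strand(3)[OF y \<psi>y[OF s]] by simp
      finally show ?thesis by (simp add: N_def)
    qed
    then show "snd (case_node (North \<circ> \<sigma>) South ` fst s, (snd s + (\<Sum>i | North i \<in> fst s. c i)) mod m) = snd (\<psi> s)"
      unfolding snd_conv .
  qed
  have "concat_diagram m g x = \<psi> ` x"
    unfolding g_def perm_diagram_act[OF m g[unfolded g_def] x \<sigma>surj] by (rule image_cong[OF refl act])
  then have "concat_diagram m g x = y" using bij_betw_imp_surj_on[OF \<psi>] by simp
  then show ?thesis using g perm_diagram_arcs[of n \<sigma> c] unfolding g_def[symmetric] by blast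
qed

section \<open>Diagrams whose labels sum to a multiple of \<open>p\<close>\<close>

lemma brauer_reduced: "x \<in> brauer_diagrams m p n \<Longrightarrow> x \<in> reduced_diagrams m n"
  by (simp add: brauer_diagrams_def)

lemma finite_brauer: "finite (brauer_diagrams m p n)"
  by (rule finite_subset[OF _ finite_reduced[of m n]]) (auto simp: brauer_diagrams_def)

lemma dvd_sum_concat:
  assumes pm: "p dvd m" and x: "x \<in> reduced_diagrams m n" and y: "y \<in> reduced_diagrams m n"
    and l: "\<And>C. C \<in> closed_loops x y \<Longrightarrow> p dvd label m x y C"
  shows "p dvd (\<Sum>s\<in>concat_diagram m x y. snd s) \<longleftrightarrow> p dvd (\<Sum>s\<in>x. snd s) + (\<Sum>s\<in>y. snd s)"
proof -
  have "p dvd (\<Sum>C\<in>closed_loops x y. label m x y C)" using l by (rule dvd_sum)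
  then have "p dvd (\<Sum>s\<in>concat_diagram m x y. snd s) \<longleftrightarrow>
      p dvd (\<Sum>s\<in>concat_diagram m x y. snd s) + (\<Sum>C\<in>closed_loops x y. label m x y C)"
    by (simp add: dvd_add_left_iff)
  also have "\<dots> \<longleftrightarrow> p dvd (\<Sum>s\<in>x. snd s) + (\<Sum>s\<in>y. snd s)"
    using sum_labels_cong[OF x y] pm by (metis dvd_mod_iff)
  finally show ?thesis .
qed

lemma loop_factor_nonzero:
  assumes "x \<in> reduced_diagrams m n" "y \<in> reduced_diagrams m n"
    and "loop_factor m p \<delta> x y \<noteq> 0" "C \<in> closed_loops x y"
  shows "p dvd label m x y C"
  using assms(3,4) finite_closed_loops[OF assms(1,2)]
  by (auto simp: loop_factor_def split: if_splits)

lemma concat_brauer: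
  assumes m: "m > 0" and pm: "p dvd m" and x: "x \<in> brauer_diagrams m p n" and y: "y \<in> brauer_diagrams m p n"
    and l: "loop_factor m p \<delta> x y \<noteq> 0"
  shows "concat_diagram m x y \<in> brauer_diagrams m p n"
proof -
  note xr = brauer_reduced[OF x] and yr = brauer_reduced[OF y]
  have "p dvd (\<Sum>s\<in>concat_diagram m x y. snd s) \<longleftrightarrow> p dvd (\<Sum>s\<in>x. snd s) + (\<Sum>s\<in>y. snd s)"
    by (rule dvd_sum_concat[OF pm xr yr loop_factor_nonzero[OF xr yr l]])
  then have "p dvd (\<Sum>s\<in>concat_diagram m x y. snd s)"
    using x y by (simp add: brauer_diagrams_def)
  then show ?thesis using concat_reduced[OF m xr yr] by (simp add: brauer_diagrams_def)
qed

lemma flip_brauer: "x \<in> brauer_diagrams m p n \<Longrightarrow> flip x \<in> brauer_diagrams m p n"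
  by (simp add: brauer_diagrams_def flip_reduced sum_flip)

lemma identity_brauer: "m > 0 \<Longrightarrow> identity_diagram n \<in> brauer_diagrams m p n"
proof -
  have "(\<Sum>s\<in>identity_diagram n. snd s) = 0" by (auto simp: identity_diagram_def)
  then show "m > 0 \<Longrightarrow> identity_diagram n \<in> brauer_diagrams m p n"
    by (simp add: brauer_diagrams_def identity_reduced)
qed

lemma loop_factor_no_loops: "closed_loops x y = {} \<Longrightarrow> loop_factor m p \<delta> x y = 1"
  by (simp add: loop_factor_def)

text \<open>The diagram \<open>g\<close> found among all reduced diagrams lies in the basis
  automatically: no loops arise, so its label sum is divisible by \<open>p\<close> because those of
  \<open>x\<close> and \<open>y\<close> are.\<close>

lemma brauer_transitive_left:
  assumes m: "m > 0" and pm: "p dvd m" and x: "x \<in> brauer_diagrams m p n" and y: "y \<in> brauer_diagrams m p n"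
    and B: "bottom_arcs x = bottom_arcs y"
  shows "\<exists>g\<in>brauer_diagrams m p n. top_arcs g = {} \<and> concat_diagram m g x = y"
proof -
  note xr = brauer_reduced[OF x] and yr = brauer_reduced[OF y]
  obtain g where g: "g \<in> reduced_diagrams m n" "top_arcs g = {}" "bottom_arcs g = {}" "concat_diagram m g x = y"
    using perm_diagram_transitive[OF m xr yr B] by blast
  have "closed_loops g x = {}" by (rule no_loops_bottom[OF g(1) xr g(3)])
  then have "p dvd (\<Sum>s\<in>y. snd s) \<longleftrightarrow> p dvd (\<Sum>s\<in>g. snd s) + (\<Sum>s\<in>x. snd s)"
    using dvd_sum_concat[OF pm g(1) xr] g(4) by simp
  then have "p dvd (\<Sum>s\<in>g. snd s)" using x y by (simp add: brauer_diagrams_def dvd_add_left_iff)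
  then show ?thesis using g by (auto simp: brauer_diagrams_def)
qed

lemma brauer_transitive_right:
  assumes m: "m > 0" and pm: "p dvd m" and x: "x \<in> brauer_diagrams m p n" and y: "y \<in> brauer_diagrams m p n"
    and T: "top_arcs x = top_arcs y"
  shows "\<exists>g\<in>brauer_diagrams m p n. top_arcs g = {} \<and> concat_diagram m x g = y"
proof -
  have "bottom_arcs (flip x) = bottom_arcs (flip y)" using T by (simp add: bottom_arcs_flip)
  then obtain g where g: "g \<in> brauer_diagrams m p n" "top_arcs g = {}" "concat_diagram m g (flip x) = flip y"
    using brauer_transitive_left[OF m pm flip_brauer[OF x] flip_brauer[OF y]] by blast
  have "bottom_arcs g = {}"
    using card_top_bottom[OF brauer_reduced[OF g(1)]] g(2) brauer_reduced[OF g(1)]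
    by (simp add: bottom_arcs_def)
  then have "top_arcs (flip g) = {}" unfolding top_arcs_flip by (simp add: flip_def)
  moreover have "concat_diagram m x (flip g) = y"
    using g(3) concat_flip[of m "flip g" x] by (metis concat_flip flip_flip)
  ultimately show ?thesis using flip_brauer[OF g(1)] by blast
qed

section \<open>One-sided units for a single arc\<close>

lemma transport_identity:
  assumes k: "k \<in> reduced_diagrams m n" and y: "y \<in> reduced_diagrams m n" and s: "s \<in> y"
    and ks: "\<And>i. North i \<in> fst s \<Longrightarrow> ({North i, South i}, 0) \<in> k"
  shows "s \<in> concat_diagram m k y"
  using transport[OF k y s, of id "\<lambda>_. 0"] ks reduced_strand(3)[OF y s] unfolding case_node_id by simp

lemma top_strand:
  assumes x: "x \<in> reduced_diagrams m n" and s: "s \<in> top_arcs x"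
  obtains a b \<alpha> where "s = ({North a, North b}, \<alpha>)" "a \<noteq> b" "a < n" "b < n" "\<alpha> < m"
proof -
  have sx: "s \<in> x" using s by (simp add: top_arcs_def)
  obtain u v where uv: "fst s = {u, v}" "u \<noteq> v" using reduced_strand(2)[OF x sx] by (auto simp: card_2_iff)
  then obtain a b where "u = North a" "v = North b" using s by (auto simp: top_arcs_def)
  then show ?thesis using that[of a b "snd s"] uv reduced_strand(1,3)[OF x sx] by (auto simp: prod_eq_iff)
qed

text \<open>\<open>k\<close> has the arc \<open>s\<close> at the top, an arc between the same
  positions at the bottom and identity strands elsewhere. Multiplied onto a diagram containing
  \<open>s\<close> it creates one loop, whose factor \<open>\<delta> (i * p)\<close> is the constant
  \<open>c\<close>; all other strands pass unchanged.\<close>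

lemma unit_step_even:
  fixes \<delta> :: "nat \<Rightarrow> 'k::field"
  assumes m: "m > 0" and pm: "m = p * d" and i: "i < d" "\<delta> (i * p) \<noteq> 0"
    and w: "w \<in> reduced_diagrams m n" and s: "s \<in> top_arcs w"
  shows "\<exists>k\<in>brauer_diagrams m p n. \<exists>c. c \<noteq> 0 \<and> s \<in> top_arcs k
    \<and> (\<forall>x\<in>reduced_diagrams m n. s \<in> x \<longrightarrow> concat_diagram m k x = x \<and> loop_factor m p \<delta> k x = c)
    \<and> (\<forall>y\<in>reduced_diagrams m n. \<forall>t\<in>top_arcs w. t \<in> y \<longrightarrow> t \<in> concat_diagram m k y)"
proof -
  obtain a b \<alpha> where ab: "s = ({North a, North b}, \<alpha>)" "a \<noteq> b" "a < n" "b < n" "\<alpha> < m"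
    using top_strand[OF w s] .
  have sw: "s \<in> w" using s by (simp add: top_arcs_def)
  have im: "i * p < m" using i m pm by (simp add: mult.commute)
  \<comment> \<open>Chosen so that the loop formed with \<open>s\<close> has label
    \<open>i * p\<close>.\<close>
  define \<beta> where "\<beta> = (i * p + (m - \<alpha>)) mod m"
  define k where "k = {s, ({South a, South b}, \<beta>)} \<union> (\<lambda>j. ({North j, South j}, 0)) ` ({..<n} - {a, b})"
  have \<beta>m: "\<beta> < m" using m by (simp add: \<beta>_def)
  have \<alpha>\<beta>: "(\<alpha> + \<beta>) mod m = i * p"
  proof -
    have "(\<alpha> + \<beta>) mod m = (\<alpha> + (i * p + (m - \<alpha>))) mod m" by (simp add: \<beta>_def mod_add_right_eq)
    also have "\<alpha> + (i * p + (m - \<alpha>)) = i * p + m" using ab(5) by simp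
    finally show ?thesis using im by simp
  qed
  have k: "k \<in> reduced_diagrams m n"
  proof (rule reducedI)
    fix t assume "t \<in> k"
    then show "fst t \<subseteq> nodes n \<and> card (fst t) = 2 \<and> snd t < m"
      using ab \<beta>m m by (auto simp: k_def)
  next
    fix v assume v: "v \<in> nodes n"
    show "\<exists>t\<in>k. v \<in> fst t"
    proof (cases v)
      case (North j)
      then show ?thesis using v ab(1) by (cases "j = a \<or> j = b") (auto simp: k_def)
    next
      case (South j)
      then show ?thesis using v ab(1) by (cases "j = a \<or> j = b") (auto simp: k_def)
    qed
  next
    fix t t' v assume "t \<in> k" "t' \<in> k" "v \<in> fst t" "v \<in> fst t'"
    then show "t = t'" using ab(1,2) unfolding k_def by (elim UnE insertE emptyE imageE; simp; blast?)
  qed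
  have sum: "(\<Sum>t\<in>k. snd t) = \<alpha> + \<beta>"
  proof -
    let ?R = "(\<lambda>j. ({North j, South j}, 0::nat)) ` ({..<n} - {a, b})"
    have "s \<notin> insert ({South a, South b}, \<beta>) ?R" "({South a, South b}, \<beta>) \<notin> ?R"
      using ab(1) by (auto simp: doubleton_eq_iff)
    moreover have "(\<Sum>t\<in>?R. snd t) = 0" by (rule sum.neutral) auto
    moreover have "k = insert s (insert ({South a, South b}, \<beta>) ?R)" by (auto simp: k_def)
    ultimately show ?thesis by (simp add: ab(1))
  qed
  have kD: "k \<in> brauer_diagrams m p n"
  proof -
    have "p dvd (\<alpha> + \<beta>) mod m" unfolding \<alpha>\<beta> by simp
    then have "p dvd \<alpha> + \<beta>" using pm by (simp add: dvd_mod_iff)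
    then show ?thesis using k sum by (simp add: brauer_diagrams_def)
  qed
  have sk: "s \<in> top_arcs k" using ab(1) by (auto simp: top_arcs_def k_def)
  have pres: "t \<in> concat_diagram m k y"
    if y: "y \<in> reduced_diagrams m n" and t: "t \<in> y" "t = s \<or> (North a \<notin> fst t \<and> North b \<notin> fst t)" for y t
  proof (cases "t = s")
    case True
    then show ?thesis using top_arcs_concat[OF k y] sk by (auto simp: top_arcs_def)
  next
    case False
    show ?thesis
    proof (rule transport_identity[OF k y t(1)])
      fix j assume j: "North j \<in> fst t"
      then have "j < n" "j \<noteq> a" "j \<noteq> b" using reduced_strand(1)[OF y t(1)] t(2) False by auto
      then show "({North j, South j}, 0) \<in> k" by (auto simp: k_def)
    qed
  qed
  have disj: "t = s \<or> (North a \<notin> fst t \<and> North b \<notin> fst t)"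
    if x: "x \<in> reduced_diagrams m n" and "s \<in> x" "t \<in> x" for x t
    using reduced_unique[OF x that(3,2), of "North a"] reduced_unique[OF x that(3,2), of "North b"] ab(1) by auto
  have unit: "concat_diagram m k x = x" if x: "x \<in> reduced_diagrams m n" and sx: "s \<in> x" for x
  proof (rule sym, rule reduced_subset_eq[OF x concat_reduced[OF m k x]])
    show "x \<subseteq> concat_diagram m k x" using pres[OF x] disj[OF x sx] by blast
  qed
  have fac: "loop_factor m p \<delta> k x = \<delta> (i * p)" if x: "x \<in> reduced_diagrams m n" and sx: "s \<in> x" for x
  proof -
    let ?C = "{Middle a, Middle b}"
    let ?r = "({South a, South b}, \<beta>)"
    have rk: "?r \<in> k" by (simp add: k_def)
    have kC: "t = ?r" if t: "t \<in> k" "above ` fst t \<inter> ?C \<noteq> {}" for t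
    proof -
      obtain u where u: "u \<in> fst t" "above u \<in> ?C" using t(2) by auto
      then have "u \<in> fst ?r" by (cases u) auto
      then show ?thesis using reduced_unique[OF k t(1) rk u(1)] by simp
    qed
    have xC: "t = s" if t: "t \<in> x" "below ` fst t \<inter> ?C \<noteq> {}" for t
    proof -
      obtain u where u: "u \<in> fst t" "below u \<in> ?C" using t(2) by auto
      then have "u \<in> fst s" using ab(1) by (cases u) auto
      then show ?thesis using reduced_unique[OF x t(1) sx u(1)] by simp
    qed
    have comp: "?C \<in> components k x"
    proof (rule componentI[where w = "Middle a"])
      show "?C \<subseteq> \<Union> (edges k above \<union> edges x below)"
        using rk unfolding edges_def by (force intro: bexI[of _ ?r])
      show "above ` fst t \<subseteq> ?C" if "t \<in> k" "above ` fst t \<inter> ?C \<noteq> {}" for t using kC[OF that] by simp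
      show "below ` fst t \<subseteq> ?C" if "t \<in> x" "below ` fst t \<inter> ?C \<noteq> {}" for t using xC[OF that] ab(1) by simp
      show "(u, Middle a) \<in> conn (edges k above \<union> edges x below)" if "u \<in> ?C" for u
      proof (rule conn_edge)
        show "above ` fst ?r \<in> edges k above \<union> edges x below" using rk unfolding edges_def by blast
      qed (use that in auto)
    qed simp
    have kset: "{t \<in> k. above ` fst t \<subseteq> ?C} = {?r}"
    proof (intro equalityI subsetI)
      fix t assume "t \<in> {t \<in> k. above ` fst t \<subseteq> ?C}"
      then have t: "t \<in> k" "above ` fst t \<subseteq> ?C" by auto
      then have "above ` fst t \<inter> ?C \<noteq> {}" using reduced_nonempty[OF k t(1)] by blast
      then show "t \<in> {?r}" using kC[OF t(1)] by blast
    qed (use rk in auto)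
    have xset: "{t \<in> x. below ` fst t \<subseteq> ?C} = {s}"
    proof (intro equalityI subsetI)
      fix t assume "t \<in> {t \<in> x. below ` fst t \<subseteq> ?C}"
      then have t: "t \<in> x" "below ` fst t \<subseteq> ?C" by auto
      then have "below ` fst t \<inter> ?C \<noteq> {}" using reduced_nonempty[OF x t(1)] by blast
      then show "t \<in> {s}" using xC[OF t(1)] by blast
    qed (use sx ab(1) in auto)
    have "label m k x ?C = i * p"
      unfolding label_eq label_within_def kset xset using \<alpha>\<beta> ab(1) by (simp add: add.commute)
    moreover have "closed_loops k x = {?C}"
    proof (intro equalityI subsetI)
      fix C assume C: "C \<in> closed_loops k x"
      obtain j t where t: "Middle j \<in> C" "t \<in> bottom_arcs k" "South j \<in> fst t"
        using closed_loop_ex[OF k x C] by blast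
      then have "t = ?r" using ab(1) by (auto simp: bottom_arcs_def k_def)
      then have "Middle j \<in> ?C" using t by auto
      moreover have "C \<in> components k x" using C by (simp add: closed_loops_def)
      ultimately have "C = ?C" using component_disjoint[OF _ comp t(1)] by blast
      then show "C \<in> {?C}" by simp
    qed (use comp in \<open>auto simp: closed_loops_def\<close>)
    ultimately show ?thesis by (simp add: loop_factor_def)
  qed
  show ?thesis
  proof (intro bexI[OF _ kD] exI[of _ "\<delta> (i * p)"] conjI ballI impI)
    fix y t assume "y \<in> reduced_diagrams m n" "t \<in> top_arcs w" "t \<in> y"
    then show "t \<in> concat_diagram m k y" using pres[of y t] disj[OF w sw, of t] by (simp add: top_arcs_def)
  qed (use i sk unit fac in auto)
qed

text \<open>A free node \<open>f\<close> allows a zigzag instead of a loop: the strand of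
  \<open>x\<close> at \<open>f\<close> is continued through the southern arc from \<open>f\<close>
  to \<open>a\<close>, the arc \<open>s\<close> of \<open>x\<close> from \<open>a\<close> to
  \<open>b\<close>, and the strand of \<open>k\<close> from \<open>b\<close> up to \<open>f\<close>.
  No loop arises, so no condition on \<open>\<delta>\<close> enters and \<open>c\<close> is 1. Arcs
  of \<open>w\<close> avoid \<open>f\<close> and survive.\<close>

lemma unit_step_free:
  fixes \<delta> :: "nat \<Rightarrow> 'k::field"
  assumes m: "m > 0" and pm: "p dvd m" and f: "f < n" "\<And>t. t \<in> top_arcs w \<Longrightarrow> North f \<notin> fst t"
    and w: "w \<in> reduced_diagrams m n" and s: "s \<in> top_arcs w"
  shows "\<exists>k\<in>brauer_diagrams m p n. \<exists>c. c \<noteq> 0 \<and> s \<in> top_arcs k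
    \<and> (\<forall>x\<in>reduced_diagrams m n. s \<in> x \<longrightarrow> concat_diagram m k x = x \<and> loop_factor m p \<delta> k x = c)
    \<and> (\<forall>y\<in>reduced_diagrams m n. \<forall>t\<in>top_arcs w. t \<in> y \<longrightarrow> t \<in> concat_diagram m k y)"
proof -
  obtain a b \<alpha> where ab: "s = ({North a, North b}, \<alpha>)" "a \<noteq> b" "a < n" "b < n" "\<alpha> < m"
    using top_strand[OF w s] .
  have fab: "f \<noteq> a" "f \<noteq> b" using f(2)[OF s] ab(1) by auto
  have sw: "s \<in> w" using s by (simp add: top_arcs_def)
  \<comment> \<open>The zigzag passes through \<open>s\<close> and picks up \<open>\<alpha>\<close>;
    \<open>\<beta>\<close> cancels it modulo \<open>m\<close>.\<close>
  define \<beta> where "\<beta> = (m - \<alpha>) mod m"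
  define R where "R = (\<lambda>j. ({North j, South j}, 0::nat)) ` ({..<n} - {a, b, f})"
  define r1 where "r1 = ({South f, South a}, 0::nat)"
  define r2 where "r2 = ({North f, South b}, \<beta>)"
  define k where "k = insert s (insert r1 (insert r2 R))"
  have \<beta>m: "\<beta> < m" using m by (simp add: \<beta>_def)
  have \<alpha>\<beta>: "m dvd \<alpha> + \<beta>"
  proof -
    have "(\<alpha> + \<beta>) mod m = (\<alpha> + (m - \<alpha>)) mod m" unfolding \<beta>_def by (simp add: mod_add_right_eq)
    then show ?thesis using ab(5) by (simp add: dvd_eq_mod_eq_0)
  qed
  note kd = k_def R_def r1_def r2_def
  have k: "k \<in> reduced_diagrams m n"
  proof (rule reducedI)
    fix t assume "t \<in> k"
    then show "fst t \<subseteq> nodes n \<and> card (fst t) = 2 \<and> snd t < m"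
      using ab \<beta>m m f(1) fab by (auto simp: kd)
  next
    fix v assume v: "v \<in> nodes n"
    show "\<exists>t\<in>k. v \<in> fst t"
    proof (cases v)
      case (North j)
      then show ?thesis using v ab(1) by (cases "j = a \<or> j = b \<or> j = f") (auto simp: kd)
    next
      case (South j)
      then show ?thesis using v ab(1) by (cases "j = a \<or> j = b \<or> j = f") (auto simp: kd)
    qed
  next
    fix t t' v assume "t \<in> k" "t' \<in> k" "v \<in> fst t" "v \<in> fst t'"
    then show "t = t'" using ab(1,2) fab unfolding kd by (elim insertE imageE; simp; blast?)
  qed
  have sum: "(\<Sum>t\<in>k. snd t) = \<alpha> + \<beta>"
  proof -
    have "s \<notin> insert r1 (insert r2 R)" "r1 \<notin> insert r2 R" "r2 \<notin> R"
      using ab(1,2) fab by (auto simp: kd doubleton_eq_iff)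
    moreover have "(\<Sum>t\<in>R. snd t) = 0" by (rule sum.neutral) (auto simp: R_def)
    moreover have "finite R" by (simp add: R_def)
    ultimately show ?thesis unfolding k_def by (simp add: ab(1) r1_def r2_def)
  qed
  have kD: "k \<in> brauer_diagrams m p n"
    using k sum dvd_trans[OF pm \<alpha>\<beta>] by (simp add: brauer_diagrams_def)
  have sk: "s \<in> top_arcs k" using ab(1) by (auto simp: top_arcs_def k_def)
  have pres: "t \<in> concat_diagram m k y"
    if y: "y \<in> reduced_diagrams m n" and t: "t \<in> y" "North f \<notin> fst t" "t = s \<or> (North a \<notin> fst t \<and> North b \<notin> fst t)" for y t
  proof (cases "t = s")
    case True
    then show ?thesis using top_arcs_concat[OF k y] sk by (auto simp: top_arcs_def)
  next
    case False
    show ?thesis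
    proof (rule transport_identity[OF k y t(1)])
      fix j assume j: "North j \<in> fst t"
      then have "j < n" "j \<noteq> a" "j \<noteq> b" "j \<noteq> f" using reduced_strand(1)[OF y t(1)] t(2,3) False by auto
      then show "({North j, South j}, 0) \<in> k" by (auto simp: kd)
    qed
  qed
  have disj: "t = s \<or> (North a \<notin> fst t \<and> North b \<notin> fst t)"
    if x: "x \<in> reduced_diagrams m n" and "s \<in> x" "t \<in> x" for x t
    using reduced_unique[OF x that(3,2), of "North a"] reduced_unique[OF x that(3,2), of "North b"] ab(1) by auto
  have nol: "closed_loops k x = {}" if x: "x \<in> reduced_diagrams m n" and sx: "s \<in> x" for x
  proof (rule equals0I)
    fix C assume C: "C \<in> closed_loops k x"
    have C': "C \<in> comps (edges k above \<union> edges x below)" using C by (simp add: closed_loops_def components_eq)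
    obtain j t where t: "Middle j \<in> C" "t \<in> bottom_arcs k" "South j \<in> fst t"
      using closed_loop_ex[OF k x C] by blast
    then have "t = r1" using ab(1) by (auto simp: bottom_arcs_def kd)
    have "above ` fst t \<inter> C \<noteq> {}" using t by force
    then have "above ` fst t \<subseteq> C" using closed_loop_bottom(2)[OF k C, of t] t(2) by (simp add: bottom_arcs_def)
    then have "Middle a \<in> C" using \<open>t = r1\<close> by (simp add: r1_def)
    then have "below ` fst s \<inter> C \<noteq> {}" using ab(1) by simp
    then have "below ` fst s \<subseteq> C" using comps_closed[OF C', of "below ` fst s"] sx by (simp add: edges_def)
    then have "Middle b \<in> C" using ab(1) by simp
    then have "above ` fst r2 \<inter> C \<noteq> {}" by (simp add: r2_def)
    then have "r2 \<in> bottom_arcs k" using closed_loop_bottom(1)[OF k C, of r2] by (simp add: k_def)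
    then show False by (auto simp: bottom_arcs_def r2_def)
  qed
  have unit: "concat_diagram m k x = x" if x: "x \<in> reduced_diagrams m n" and sx: "s \<in> x" for x
  proof -
    obtain r where r: "r \<in> x" "North f \<in> fst r" using reduced_cover[OF x, of "North f"] f(1) by auto
    have "x = concat_diagram m k x"
    \<comment> \<open>Only the strand at \<open>f\<close> takes the zigzag; instead of tracing it,
      it is recovered from the other strands and the label sum.\<close>
    proof (rule reduced_all_but_one[OF x concat_reduced[OF m k x] r(1)])
      show "x - {r} \<subseteq> concat_diagram m k x"
      proof
        fix t assume t: "t \<in> x - {r}"
        then have "North f \<notin> fst t" using reduced_unique[OF x r(1) _ r(2), of t] by auto
        then show "t \<in> concat_diagram m k x" using pres[OF x] disj[OF x sx] t by blast
      qed
      have "(\<Sum>s\<in>concat_diagram m k x. snd s) mod m = (\<alpha> + \<beta> + (\<Sum>s\<in>x. snd s)) mod m"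
        using sum_labels_cong[OF k x] nol[OF x sx] sum by simp
      also have "\<dots> = (\<Sum>s\<in>x. snd s) mod m" using \<alpha>\<beta> by (metis add_0 dvd_imp_mod_0 mod_add_left_eq)
      finally show "(\<Sum>s\<in>x. snd s) mod m = (\<Sum>s\<in>concat_diagram m k x. snd s) mod m" by simp
    qed
    then show ?thesis by simp
  qed
  show ?thesis
  proof (intro bexI[OF _ kD] exI[of _ 1] conjI ballI impI)
    fix y t assume "y \<in> reduced_diagrams m n" "t \<in> top_arcs w" "t \<in> y"
    then show "t \<in> concat_diagram m k y"
      using pres[of y t] disj[OF w sw, of t] f(2)[of t] by (simp add: top_arcs_def)
  qed (use sk unit loop_factor_no_loops[OF nol] in auto)
qed

text \<open>For odd \<open>n\<close> the northern arcs cover an even number of the \<open>n\<close>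
  northern nodes, so one is free; for even \<open>n\<close> the hypothesis provides a nonzero loop
  value.\<close>

lemma unit_step:
  fixes \<delta> :: "nat \<Rightarrow> 'k::field"
  assumes m: "m > 0" and pm: "m = p * d" and \<delta>: "even n \<longrightarrow> (\<exists>i<d. \<delta> (i * p) \<noteq> 0)"
    and w: "w \<in> reduced_diagrams m n" and s: "s \<in> top_arcs w"
  shows "\<exists>k\<in>brauer_diagrams m p n. \<exists>c. c \<noteq> 0 \<and> s \<in> top_arcs k
    \<and> (\<forall>x\<in>reduced_diagrams m n. s \<in> x \<longrightarrow> concat_diagram m k x = x \<and> loop_factor m p \<delta> k x = c)
    \<and> (\<forall>y\<in>reduced_diagrams m n. \<forall>t\<in>top_arcs w. t \<in> y \<longrightarrow> t \<in> concat_diagram m k y)"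
proof (cases "even n")
  case True
  then show ?thesis using unit_step_even[OF m pm _ _ w s] \<delta> by blast
next
  case False
  have "\<exists>f<n. \<forall>t\<in>top_arcs w. North f \<notin> fst t"
  proof (rule ccontr)
    assume "\<not> (\<exists>f<n. \<forall>t\<in>top_arcs w. North f \<notin> fst t)"
    then have "North ` {..<n} \<subseteq> (\<Union>t\<in>top_arcs w. fst t)" by auto
    moreover have "(\<Union>t\<in>top_arcs w. fst t) \<subseteq> North ` {..<n}"
      using reduced_strand(1)[OF w] by (fastforce simp: top_arcs_def nodes_def)
    ultimately have "North ` {..<n} = (\<Union>t\<in>top_arcs w. fst t)" by simp
    then have "n = card (\<Union>t\<in>top_arcs w. fst t)" by (metis card_image card_lessThan inj_onI node.inject(1))
    also have "\<dots> = (\<Sum>t\<in>top_arcs w. card (fst t))"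
    proof (rule card_UN_disjoint)
      show "finite (top_arcs w)" using w by (simp add: top_arcs_def)
      show "\<forall>t\<in>top_arcs w. finite (fst t)"
        using finite_subset[OF reduced_strand(1)[OF w]] by (auto simp: top_arcs_def)
      show "\<forall>t\<in>top_arcs w. \<forall>t'\<in>top_arcs w. t \<noteq> t' \<longrightarrow> fst t \<inter> fst t' = {}"
      proof (intro ballI impI)
        fix t t' assume "t \<in> top_arcs w" "t' \<in> top_arcs w" "t \<noteq> t'"
        then show "fst t \<inter> fst t' = {}" using reduced_unique[OF w, of t t'] by (auto simp: top_arcs_def)
      qed
    qed
    also have "\<dots> = (\<Sum>t\<in>top_arcs w. 2)"
      by (rule sum.cong[OF refl]) (use reduced_strand(2)[OF w] in \<open>simp add: top_arcs_def\<close>)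
    finally show False using False by simp
  qed
  then obtain f where "f < n" "\<And>t. t \<in> top_arcs w \<Longrightarrow> North f \<notin> fst t" by blast
  then show ?thesis using unit_step_free[OF m _ _ _ w s, of p f] pm by simp
qed

section \<open>The order of the group of diagrams without northern arcs\<close>

lemma card_complementary_residues:
  fixes p d s :: nat
  assumes p: "p > 0"
  shows "card {a. a < p * d \<and> p dvd s + a} = d"
proof -
  \<comment> \<open>The least \<open>r\<close> with \<open>p\<close> dividing \<open>s + r\<close>;
    the outer \<open>mod p\<close> covers the case that \<open>p\<close> divides
    \<open>s\<close>.\<close>
  define r where "r = (p - s mod p) mod p"
  have rp: "r < p" using p by (simp add: r_def)
  have "(s + r) mod p = (s mod p + (p - s mod p)) mod p" unfolding r_def by (simp add: mod_add_right_eq mod_add_left_eq)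
  also have "s mod p + (p - s mod p) = p" using p by (simp add: less_imp_le)
  finally have sr: "p dvd s + r" by (simp add: dvd_eq_mod_eq_0)
  have "{a. a < p * d \<and> p dvd s + a} = (\<lambda>j. r + p * j) ` {..<d}"
  proof (intro equalityI subsetI)
    fix a assume "a \<in> {a. a < p * d \<and> p dvd s + a}"
    then have a: "a < p * d" "p dvd s + a" by auto
    have "[s + a = s + r] (mod p)" using a(2) sr by (simp add: cong_def dvd_eq_mod_eq_0)
    then have "[a = r] (mod p)" by (simp only: cong_add_lcancel_nat)
    then have "a mod p = r" using rp by (simp add: cong_def)
    then have "a = r + p * (a div p)" by (metis add.commute mult_div_mod_eq)
    moreover have "a div p < d" using a(1) by (simp add: less_mult_imp_div_less mult.commute)
    ultimately show "a \<in> (\<lambda>j. r + p * j) ` {..<d}" by blast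
  next
    fix a assume "a \<in> (\<lambda>j. r + p * j) ` {..<d}"
    then obtain j where j: "j < d" "a = r + p * j" by auto
    have "p * Suc j \<le> p * d" using j(1) by (intro mult_le_mono2) simp
    then have "a < p * d" using j(2) rp by simp
    moreover have "p dvd s + a" using sr j(2) by (simp add: add.assoc[symmetric])
    ultimately show "a \<in> {a. a < p * d \<and> p dvd s + a}" by simp
  qed
  moreover have "inj_on (\<lambda>j. r + p * j) {..<d}" using p by (simp add: inj_on_def)
  ultimately show ?thesis by (simp add: card_image)
qed

text \<open>The first \<open>k\<close> entries are free, and the last one is then confined to a
  residue class modulo \<open>p\<close>, which has \<open>d\<close> members below
  \<open>p * d\<close>.\<close>

lemma card_divisible_sums:
  fixes p d m k :: nat
  assumes p: "p > 0" and m: "m = p * d"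
  shows "card {c \<in> {..<Suc k} \<rightarrow>\<^sub>E {..<m}. p dvd (\<Sum>i<Suc k. c i)} = m ^ k * d"
proof -
  let ?P = "{..<k} \<rightarrow>\<^sub>E {..<m}"
  let ?f = "\<lambda>(c, a). c(k := a)"
  let ?S = "SIGMA c:?P. {a. a < m \<and> p dvd (\<Sum>i<k. c i) + a}"
  have sum: "(\<Sum>i<Suc k. (c(k := a)) i) = (\<Sum>i<k. c i) + a" for c :: "nat \<Rightarrow> nat" and a
    by simp
  have "{c \<in> {..<Suc k} \<rightarrow>\<^sub>E {..<m}. p dvd (\<Sum>i<Suc k. c i)} = ?f ` ?S"
  proof -
    have "{..<Suc k} \<rightarrow>\<^sub>E {..<m} = (\<lambda>(a, c). c(k := a)) ` ({..<m} \<times> ?P)"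
      unfolding lessThan_Suc by (rule PiE_insert_eq)
    also have "\<dots> = ?f ` (?P \<times> {..<m})" by force
    finally have "{c \<in> {..<Suc k} \<rightarrow>\<^sub>E {..<m}. p dvd (\<Sum>i<Suc k. c i)}
        = ?f ` {x \<in> ?P \<times> {..<m}. p dvd (\<Sum>i<Suc k. ?f x i)}" by (simp only: filter_image)
    also have "{x \<in> ?P \<times> {..<m}. p dvd (\<Sum>i<Suc k. ?f x i)} = ?S"
    proof (rule Set.set_eqI)
      fix x :: "(nat \<Rightarrow> nat) \<times> nat"
      obtain c a where x: "x = (c, a)" by (cases x)
      have "(\<Sum>i<Suc k. ?f x i) = (\<Sum>i<k. c i) + a" unfolding x prod.case by (rule sum)
      then show "x \<in> {x \<in> ?P \<times> {..<m}. p dvd (\<Sum>i<Suc k. ?f x i)} \<longleftrightarrow> x \<in> ?S"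
        by (simp only: x mem_Collect_eq mem_Sigma_iff lessThan_iff conj_assoc)
    qed
    finally show ?thesis .
  qed
  moreover have "inj_on ?f ?S"
  proof (rule inj_onI, clarify)
    fix c a c' a' assume c: "c \<in> ?P" "c' \<in> ?P" and e: "c(k := a) = c'(k := a')"
    have "a = a'" using fun_cong[OF e, of k] by simp
    moreover have "c = c'"
    proof (rule PiE_ext[OF c])
      fix i assume "i \<in> {..<k}"
      then show "c i = c' i" using fun_cong[OF e, of i] by simp
    qed
    ultimately show "c = c' \<and> a = a'" by simp
  qed
  ultimately have "card {c \<in> {..<Suc k} \<rightarrow>\<^sub>E {..<m}. p dvd (\<Sum>i<Suc k. c i)} = card ?S"
    by (simp add: card_image)
  also have "\<dots> = (\<Sum>c\<in>?P. card {a. a < m \<and> p dvd (\<Sum>i<k. c i) + a})"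
    by (rule card_SigmaI) (simp_all add: finite_PiE)
  also have "\<dots> = m ^ k * d"
    unfolding m card_complementary_residues[OF p] by (simp add: card_PiE)
  finally show ?thesis .
qed

lemma invertible_diagrams_eq:
  assumes m: "m > 0"
  shows "{x \<in> brauer_diagrams m p n. top_arcs x = {}} = (\<lambda>(\<sigma>, c). perm_diagram n \<sigma> c) `
    ({\<sigma>. \<sigma> permutes {..<n}} \<times> {c \<in> {..<n} \<rightarrow>\<^sub>E {..<m}. p dvd (\<Sum>i<n. c i)})"
    (is "?L = ?F ` ?S")
proof -
  have sum: "(\<Sum>s\<in>perm_diagram n \<sigma> c. snd s) = (\<Sum>i<n. c i)" for \<sigma> c
  proof -
    have "inj_on (\<lambda>i. ({North (\<sigma> i), South i}, c i)) {..<n}" by (auto simp: inj_on_def doubleton_eq_iff)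
    then show ?thesis by (simp add: perm_diagram_def sum.reindex)
  qed
  show ?thesis
  proof (intro equalityI subsetI)
    fix x assume "x \<in> ?L"
    then have x: "x \<in> reduced_diagrams m n" "p dvd (\<Sum>s\<in>x. snd s)" "top_arcs x = {}"
      by (auto simp: brauer_diagrams_def)
    have b: "bottom_arcs x = {}"
      using card_top_bottom[OF x(1)] x(1,3) by (simp add: bottom_arcs_def)
    have "\<forall>i<n. \<exists>j a. ({North j, South i}, a) \<in> x"
    proof (intro allI impI)
      fix i assume "i < n"
      then obtain s where s: "s \<in> x" "South i \<in> fst s" using reduced_cover[OF x(1), of "South i"] by auto
      then obtain j i' where ij: "fst s = {North j, South i'}" using through_strand[OF x(1) s(1)] x(3) b by (metis empty_iff)
      then have "fst s = {North j, South i}" using s(2) by auto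
      then show "\<exists>j a. ({North j, South i}, a) \<in> x" using s(1) by (metis prod.collapse)
    qed
    then obtain \<sigma>0 c0 where \<sigma>0: "\<And>i. i < n \<Longrightarrow> ({North (\<sigma>0 i), South i}, c0 i) \<in> x" by metis
    \<comment> \<open>The identity outside \<open>{..<n}\<close> and the \<open>restrict\<close>
      below are the normal forms required by \<open>permutes\<close> and
      \<open>\<rightarrow>\<^sub>E\<close>, so that each diagram is counted once.\<close>
    define \<sigma> where "\<sigma> i = (if i < n then \<sigma>0 i else i)" for i
    define c where "c = restrict c0 {..<n}"
    have st: "({North (\<sigma> i), South i}, c i) \<in> x" if "i < n" for i using \<sigma>0[OF that] that by (simp add: \<sigma>_def c_def)
    have inj: "inj_on \<sigma> {..<n}"
    proof (rule inj_onI)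
      fix i j assume ij: "i \<in> {..<n}" "j \<in> {..<n}" "\<sigma> i = \<sigma> j"
      then have "({North (\<sigma> i), South i}, c i) = ({North (\<sigma> j), South j}, c j)"
        by (intro reduced_unique[OF x(1) st st, of i j "North (\<sigma> i)"]) auto
      then show "i = j" by (auto simp: doubleton_eq_iff)
    qed
    have lt: "\<sigma> i < n" "c i < m" if "i < n" for i using reduced_strand(1,3)[OF x(1) st[OF that]] by auto
    have surj: "\<sigma> ` {..<n} = {..<n}" by (rule endo_inj_surj[OF _ _ inj]) (use lt in auto)
    have "\<sigma> permutes {..<n}"
      by (rule bij_imp_permutes) (use inj surj in \<open>auto simp: bij_betw_def \<sigma>_def\<close>)
    moreover have "perm_diagram n \<sigma> c = x"
      by (rule reduced_subset_eq[OF perm_diagram_reduced[OF inj surj lt(2)] x(1)])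
        (use st in \<open>auto simp: perm_diagram_def\<close>)
    moreover from this have "p dvd (\<Sum>i<n. c i)" using x(2) sum by metis
    moreover have "c \<in> {..<n} \<rightarrow>\<^sub>E {..<m}" using lt(2) by (auto simp: c_def)
    ultimately show "x \<in> ?F ` ?S" by (intro rev_image_eqI[of "(\<sigma>, c)"]) auto
  next
    fix x assume "x \<in> ?F ` ?S"
    then obtain \<sigma> c where s: "\<sigma> permutes {..<n}" "c \<in> {..<n} \<rightarrow>\<^sub>E {..<m}" "p dvd (\<Sum>i<n. c i)" "x = perm_diagram n \<sigma> c"
      by auto
    have "x \<in> reduced_diagrams m n" unfolding s(4)
      by (rule perm_diagram_reduced) (use s in \<open>auto simp: permutes_inj_on permutes_image\<close>)
    then show "x \<in> ?L" using s sum perm_diagram_arcs by (auto simp: brauer_diagrams_def)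
  qed
qed

lemma card_invertible_diagrams:
  assumes p: "p > 0" and m: "m > 0" "m = p * d" and n: "n > 0"
  shows "card {x \<in> brauer_diagrams m p n. top_arcs x = {}} = fact n * (m ^ (n - 1) * d)"
proof -
  let ?S = "{\<sigma>. \<sigma> permutes {..<n}} \<times> {c \<in> {..<n} \<rightarrow>\<^sub>E {..<m}. p dvd (\<Sum>i<n. c i)}"
  have "inj_on (\<lambda>(\<sigma>, c). perm_diagram n \<sigma> c) ?S"
  proof (rule inj_onI, clarify)
    fix \<sigma> c \<sigma>' c'
    assume \<sigma>: "\<sigma> permutes {..<n}" "\<sigma>' permutes {..<n}" and c: "c \<in> {..<n} \<rightarrow>\<^sub>E {..<m}" "c' \<in> {..<n} \<rightarrow>\<^sub>E {..<m}"
      and e: "perm_diagram n \<sigma> c = perm_diagram n \<sigma>' c'"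
    have *: "\<sigma> i = \<sigma>' i \<and> c i = c' i" if "i < n" for i
    proof -
      have "({North (\<sigma> i), South i}, c i) \<in> perm_diagram n \<sigma>' c'"
        unfolding e[symmetric] using that by (simp add: perm_diagram_def)
      then show ?thesis by (auto simp: perm_diagram_def doubleton_eq_iff)
    qed
    have "\<sigma> i = \<sigma>' i" for i using * \<sigma> by (cases "i < n") (auto simp: permutes_def)
    moreover have "c = c'" using * by (intro PiE_ext[OF c]) simp
    ultimately show "\<sigma> = \<sigma>' \<and> c = c'" by auto
  qed
  then have "card {x \<in> brauer_diagrams m p n. top_arcs x = {}} = card ?S"
    unfolding invertible_diagrams_eq[OF m(1)] by (rule card_image)
  also have "\<dots> = fact n * (m ^ (n - 1) * d)"
    using card_divisible_sums[OF p m(2), of "n - 1"] n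
    by (simp add: card_cartesian_product card_permutations[of "{..<n}" n])
  finally show ?thesis .
qed


section \<open>Left ideals, radicals and dual bases\<close>

lemma (in ring) left_idealI:
  assumes "I \<subseteq> carrier R" "\<zero> \<in> I" "\<And>x y. x \<in> I \<Longrightarrow> y \<in> I \<Longrightarrow> x \<oplus> y \<in> I"
    and lc: "\<And>a x. a \<in> carrier R \<Longrightarrow> x \<in> I \<Longrightarrow> a \<otimes> x \<in> I"
  shows "left_ideal I R"
proof (intro left_ideal.intro left_ideal_axioms.intro)
  show "additive_subgroup I R"
  proof (rule additive_subgroup.intro, rule add.subgroupI)
    fix a assume a: "a \<in> I"
    then have "a \<in> carrier R" using assms(1) by auto
    then have "\<ominus> a = (\<ominus> \<one>) \<otimes> a" by (simp add: l_minus)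
    then show "\<ominus> a \<in> I" using lc[of "\<ominus> \<one>" a] a by simp
  qed (use assms in auto)
qed (use lc ring_axioms in auto)

lemma left_ideal_mem:
  assumes "left_ideal I R"
  shows "I \<subseteq> carrier R" "\<zero>\<^bsub>R\<^esub> \<in> I" "x \<in> I \<Longrightarrow> y \<in> I \<Longrightarrow> x \<oplus>\<^bsub>R\<^esub> y \<in> I"
    "a \<in> carrier R \<Longrightarrow> x \<in> I \<Longrightarrow> a \<otimes>\<^bsub>R\<^esub> x \<in> I"
proof -
  interpret left_ideal I R by fact
  show "I \<subseteq> carrier R" "\<zero>\<^bsub>R\<^esub> \<in> I" "x \<in> I \<Longrightarrow> y \<in> I \<Longrightarrow> x \<oplus>\<^bsub>R\<^esub> y \<in> I"
    "a \<in> carrier R \<Longrightarrow> x \<in> I \<Longrightarrow> a \<otimes>\<^bsub>R\<^esub> x \<in> I"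
    using a_subset left_closed by auto
qed

lemma (in ring) exists_maximal_left_ideal:
  assumes L: "left_ideal L R" "\<one> \<notin> L"
  shows "\<exists>M. maximal_left_ideal M R \<and> L \<subseteq> M"
proof -
  let ?A = "{M. left_ideal M R \<and> L \<subseteq> M \<and> \<one> \<notin> M}"
  have "\<exists>M\<in>?A. \<forall>X\<in>?A. M \<subseteq> X \<longrightarrow> X = M"
  proof (rule subset_Zorn_nonempty)
    show "?A \<noteq> {}" using L by auto
    fix \<C> assume ne: "\<C> \<noteq> {}" and "subset.chain ?A \<C>"
    then have c: "\<C> \<subseteq> ?A" "\<And>X Y. X \<in> \<C> \<Longrightarrow> Y \<in> \<C> \<Longrightarrow> X \<subseteq> Y \<or> Y \<subseteq> X" by (auto simp: subset_chain_def)
    obtain M0 where M0: "M0 \<in> \<C>" using ne by auto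
    have li: "left_ideal M R" if "M \<in> \<C>" for M using c(1) that by auto
    have "left_ideal (\<Union>\<C>) R"
    proof (rule left_idealI)
      show "\<Union>\<C> \<subseteq> carrier R" using left_ideal_mem(1)[OF li] by auto
      show "\<zero> \<in> \<Union>\<C>" using left_ideal_mem(2)[OF li[OF M0]] M0 by auto
      show "x \<oplus> y \<in> \<Union>\<C>" if xy: "x \<in> \<Union>\<C>" "y \<in> \<Union>\<C>" for x y
      proof -
        obtain X Y where XY: "X \<in> \<C>" "x \<in> X" "Y \<in> \<C>" "y \<in> Y" using xy by auto
        then obtain Z where "Z \<in> \<C>" "x \<in> Z" "y \<in> Z" using c(2)[of X Y] by auto
        then show ?thesis using left_ideal_mem(3)[OF li] by auto
      qed
      show "a \<otimes> x \<in> \<Union>\<C>" if ax: "a \<in> carrier R" "x \<in> \<Union>\<C>" for a x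
      proof -
        obtain X where "X \<in> \<C>" "x \<in> X" using ax by auto
        then show ?thesis using left_ideal_mem(4)[OF li] ax by auto
      qed
    qed
    then show "\<Union>\<C> \<in> ?A" using c(1) M0 by auto
  qed
  then obtain M where M: "left_ideal M R" "L \<subseteq> M" "\<one> \<notin> M"
    and max: "\<And>X. left_ideal X R \<Longrightarrow> L \<subseteq> X \<Longrightarrow> \<one> \<notin> X \<Longrightarrow> M \<subseteq> X \<Longrightarrow> X = M"
    by auto
  have "maximal_left_ideal M R" unfolding maximal_left_ideal_def
  proof (intro conjI allI impI)
    show "M \<noteq> carrier R" using M(3) by auto
    fix X assume X: "left_ideal X R \<and> M \<subseteq> X"
    show "X = M \<or> X = carrier R"
    proof (cases "\<one> \<in> X")
      case True
      then have "a \<in> X" if "a \<in> carrier R" for a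
        using left_ideal_mem(4)[of X R a \<one>] X that by simp
      then show ?thesis using left_ideal_mem(1)[of X R] X by auto
    next
      case False
      then show ?thesis using max X M(2) by auto
    qed
  qed (rule M)
  then show ?thesis using M by blast
qed

lemma (in ring) maximal_left_ideal_one:
  "maximal_left_ideal M R \<Longrightarrow> \<one> \<notin> M"
proof
  assume M: "maximal_left_ideal M R" and "\<one> \<in> M"
  then have "a \<in> M" if "a \<in> carrier R" for a
    using left_ideal_mem(4)[of M R a \<one>] that by (simp add: maximal_left_ideal_def)
  then show False using M left_ideal_mem(1)[of M R] by (auto simp: maximal_left_ideal_def)
qed

lemma (in ring) radical_left_ideal: "left_ideal (jacobson_radical R) R"
  unfolding jacobson_radical_def
proof (rule left_idealI)
  show "\<zero> \<in> carrier R \<inter> \<Inter> {L. maximal_left_ideal L R}"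
    using left_ideal_mem(2) by (auto simp: maximal_left_ideal_def)
  show "x \<oplus> y \<in> carrier R \<inter> \<Inter> {L. maximal_left_ideal L R}"
    if "x \<in> carrier R \<inter> \<Inter> {L. maximal_left_ideal L R}" "y \<in> carrier R \<inter> \<Inter> {L. maximal_left_ideal L R}" for x y
    using that left_ideal_mem(3) by (fastforce simp: maximal_left_ideal_def)
  show "a \<otimes> x \<in> carrier R \<inter> \<Inter> {L. maximal_left_ideal L R}"
    if "a \<in> carrier R" "x \<in> carrier R \<inter> \<Inter> {L. maximal_left_ideal L R}" for a x
    using that left_ideal_mem(4) by (fastforce simp: maximal_left_ideal_def)
qed auto

lemma (in ring) left_ideal_plus_principal:
  assumes L: "left_ideal L R" and x: "x \<in> carrier R"
  shows "left_ideal {b \<otimes> x \<oplus> l | b l. b \<in> carrier R \<and> l \<in> L} R" (is "left_ideal ?X R")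
proof (rule left_idealI)
  note Lc = subsetD[OF left_ideal_mem(1)[OF L]]
  show "?X \<subseteq> carrier R" using Lc x by auto
  have "\<zero> = \<zero> \<otimes> x \<oplus> \<zero>" using x by simp
  then show "\<zero> \<in> ?X" using left_ideal_mem(2)[OF L] by blast
  show "u \<oplus> v \<in> ?X" if uv: "u \<in> ?X" "v \<in> ?X" for u v
  proof -
    obtain b l b' l' where e: "u = b \<otimes> x \<oplus> l" "v = b' \<otimes> x \<oplus> l'" "b \<in> carrier R" "b' \<in> carrier R" "l \<in> L" "l' \<in> L"
      using uv by blast
    have "u \<oplus> v = (b \<oplus> b') \<otimes> x \<oplus> (l \<oplus> l')" using e x Lc[of l] Lc[of l'] by (simp add: l_distr a_ac)
    then show ?thesis using e left_ideal_mem(3)[OF L, of l l'] by blast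
  qed
  show "a \<otimes> u \<in> ?X" if au: "a \<in> carrier R" "u \<in> ?X" for a u
  proof -
    obtain b l where e: "u = b \<otimes> x \<oplus> l" "b \<in> carrier R" "l \<in> L" using au by blast
    have "a \<otimes> u = (a \<otimes> b) \<otimes> x \<oplus> a \<otimes> l" using e x au Lc[of l] by (simp add: r_distr m_assoc)
    then show ?thesis using e au left_ideal_mem(4)[OF L, of a l] by blast
  qed
qed

lemma (in ring) maximal_left_ideal_plus:
  assumes M: "maximal_left_ideal M R" and x: "x \<in> carrier R" "x \<notin> M" and y: "y \<in> carrier R"
  obtains b l where "b \<in> carrier R" "l \<in> M" "y = b \<otimes> x \<oplus> l"
proof -
  have L: "left_ideal M R" using M by (simp add: maximal_left_ideal_def)
  note Lc = subsetD[OF left_ideal_mem(1)[OF L]]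
  let ?X = "{b \<otimes> x \<oplus> l | b l. b \<in> carrier R \<and> l \<in> M}"
  have "left_ideal ?X R" by (rule left_ideal_plus_principal[OF L x(1)])
  moreover have "M \<subseteq> ?X"
  proof
    fix l assume l: "l \<in> M"
    then have "l = \<zero> \<otimes> x \<oplus> l" using x Lc by simp
    then show "l \<in> ?X" using l by blast
  qed
  moreover have "x \<in> ?X"
  proof -
    have "x = \<one> \<otimes> x \<oplus> \<zero>" using x by simp
    then show ?thesis using left_ideal_mem(2)[OF L] by blast
  qed
  ultimately have "?X = carrier R" using M x(2) unfolding maximal_left_ideal_def by blast
  then show ?thesis using y that by blast
qed

text \<open>The radical is defined by left ideals; that it is two-sided rests on this: for a maximal
  left ideal \<open>M\<close> and \<open>y\<close> outside it, the elements \<open>a\<close> with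
  \<open>a y\<close> in \<open>M\<close> form the kernel of a map onto the simple module
  \<open>R / M\<close>, hence again a maximal left ideal.\<close>

lemma (in ring) radical_right_closed:
  assumes r: "r \<in> jacobson_radical R" and y: "y \<in> carrier R"
  shows "r \<otimes> y \<in> jacobson_radical R"
proof -
  have rc: "r \<in> carrier R" using r by (simp add: jacobson_radical_def)
  have "r \<otimes> y \<in> M" if M: "maximal_left_ideal M R" for M
  proof (cases "y \<in> M")
    case True
    then show ?thesis using left_ideal_mem(4)[of M R r y] M rc by (simp add: maximal_left_ideal_def)
  next
    case False
    have L: "left_ideal M R" using M by (simp add: maximal_left_ideal_def)
    note Lc = subsetD[OF left_ideal_mem(1)[OF L]]
    let ?X = "{a \<in> carrier R. a \<otimes> y \<in> M}"
    have X: "left_ideal ?X R"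
      by (rule left_idealI) (use y left_ideal_mem[OF L] in \<open>auto simp: l_distr m_assoc\<close>)
    have "maximal_left_ideal ?X R" unfolding maximal_left_ideal_def
    proof (intro conjI allI impI)
      show "left_ideal ?X R" by (rule X)
      have "\<one> \<notin> ?X" using False y by simp
      then show "?X \<noteq> carrier R" by blast
      fix K assume K: "left_ideal K R \<and> ?X \<subseteq> K"
      show "K = ?X \<or> K = carrier R"
      proof (cases "K \<subseteq> ?X")
        case False
        then obtain a where a: "a \<in> K" "a \<notin> ?X" by auto
        have ac: "a \<in> carrier R" using a K left_ideal_mem(1) by blast
        have ay: "a \<otimes> y \<in> carrier R" "a \<otimes> y \<notin> M" using a ac y by auto
        obtain b l where bl: "b \<in> carrier R" "l \<in> M" "y = b \<otimes> (a \<otimes> y) \<oplus> l"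
          using maximal_left_ideal_plus[OF M ay y] .
        have "(\<one> \<ominus> b \<otimes> a) \<otimes> y = y \<ominus> b \<otimes> (a \<otimes> y)"
          using bl(1) ac y by (simp add: l_distr minus_eq l_minus m_assoc)
        also have "\<dots> = l"
        proof -
          have "b \<otimes> (a \<otimes> y) \<oplus> l \<ominus> b \<otimes> (a \<otimes> y) = l"
            using bl(1) ay(1) Lc[OF bl(2)] by (simp add: minus_eq a_ac r_neg2 add.inv_solve_right')
          then show ?thesis using bl(3) by simp
        qed
        finally have "\<one> \<ominus> b \<otimes> a \<in> K" using bl ac K by auto
        moreover have "b \<otimes> a \<in> K" using left_ideal_mem(4)[of K R b a] K bl(1) a(1) by simp
        ultimately have "(\<one> \<ominus> b \<otimes> a) \<oplus> b \<otimes> a \<in> K" using left_ideal_mem(3)[of K R] K by blast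
        then have "\<one> \<in> K" using bl(1) ac by (simp add: minus_eq a_assoc l_neg)
        then have "c \<in> K" if "c \<in> carrier R" for c using left_ideal_mem(4)[of K R c \<one>] K that by simp
        then show ?thesis using K left_ideal_mem(1)[of K R] by blast
      qed (use K in auto)
    qed
    then have "r \<in> ?X" using r by (auto simp: jacobson_radical_def)
    then show ?thesis by simp
  qed
  then show ?thesis using rc y by (simp add: jacobson_radical_def)
qed

text \<open>A maximal left ideal containing \<open>1 - t\<close> would contain \<open>t\<close> and
  hence 1. So \<open>1 - t\<close> has a left inverse, and multiplying \<open>b (1 - t) = 1\<close>
  by \<open>t\<close> on the right kills the left side.\<close>

lemma (in ring) radical_idempotent:
  assumes t: "t \<in> jacobson_radical R" and tt: "t \<otimes> t = t"
  shows "t = \<zero>"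
proof -
  have tc: "t \<in> carrier R" using t by (simp add: jacobson_radical_def)
  have "left_ideal {\<zero>} R" by (rule left_idealI) auto
  from left_ideal_plus_principal[OF this, of "\<one> \<ominus> t"]
  have X: "left_ideal {b \<otimes> (\<one> \<ominus> t) \<oplus> l | b l. b \<in> carrier R \<and> l \<in> {\<zero>}} R" (is "left_ideal ?X R") using tc by simp
  have tX: "\<one> \<ominus> t \<in> ?X"
  proof -
    have "\<one> \<ominus> t = \<one> \<otimes> (\<one> \<ominus> t) \<oplus> \<zero>" using tc by simp
    then show ?thesis by blast
  qed
  have ot: "(\<one> \<ominus> t) \<otimes> t = \<zero>" using tc tt by (simp add: minus_eq l_distr l_minus r_neg)
  show ?thesis
  proof (cases "\<one> \<in> ?X")
    case True
    then obtain b where b: "b \<in> carrier R" "\<one> = b \<otimes> (\<one> \<ominus> t) \<oplus> \<zero>" by blast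
    then have b1: "b \<otimes> (\<one> \<ominus> t) = \<one>" using tc by simp
    have "t = b \<otimes> (\<one> \<ominus> t) \<otimes> t" unfolding b1 using tc by simp
    also have "\<dots> = b \<otimes> ((\<one> \<ominus> t) \<otimes> t)" using b(1) tc by (simp add: m_assoc)
    finally show ?thesis using ot b by simp
  next
    case False
    then obtain M where M: "maximal_left_ideal M R" "?X \<subseteq> M" using exists_maximal_left_ideal[OF X] by blast
    have "t \<in> M" using t M by (auto simp: jacobson_radical_def)
    moreover have "\<one> \<ominus> t \<in> M" using tX M by blast
    ultimately have "(\<one> \<ominus> t) \<oplus> t \<in> M" using left_ideal_mem(3)[of M R] M(1) by (simp add: maximal_left_ideal_def)
    then have "\<one> \<in> M" using tc by (simp add: minus_eq a_assoc l_neg)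
    then show ?thesis using maximal_left_ideal_one[OF M(1)] by simp
  qed
qed

text \<open>If \<open>x\<close> in \<open>L\<close> were outside a maximal left ideal
  \<open>M\<close>, then \<open>1 - b x\<close> would lie in \<open>M\<close> for some
  \<open>b\<close>; as \<open>b x\<close> is again in \<open>L\<close>, it has a left inverse and 1
  lies in \<open>M\<close>.\<close>

lemma (in ring) radicalI:
  assumes L: "left_ideal L R" and inv: "\<And>x. x \<in> L \<Longrightarrow> \<exists>y\<in>carrier R. y \<otimes> (\<one> \<ominus> x) = \<one>"
  shows "L \<subseteq> jacobson_radical R"
proof
  fix x assume x: "x \<in> L"
  note xc = subsetD[OF left_ideal_mem(1)[OF L] x]
  have "x \<in> M" if M: "maximal_left_ideal M R" for M
  proof (rule ccontr)
    assume "x \<notin> M"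
    then obtain b l where bl: "b \<in> carrier R" "l \<in> M" "\<one> = b \<otimes> x \<oplus> l"
      using maximal_left_ideal_plus[OF M xc _ one_closed] by blast
    have Ml: "left_ideal M R" using M by (simp add: maximal_left_ideal_def)
    have lc: "l \<in> carrier R" using left_ideal_mem(1)[OF Ml] bl(2) by auto
    have "b \<otimes> x \<in> L" using left_ideal_mem(4)[OF L bl(1) x] .
    then obtain y where y: "y \<in> carrier R" "y \<otimes> (\<one> \<ominus> b \<otimes> x) = \<one>" using inv by blast
    have "b \<otimes> x \<oplus> l \<ominus> b \<otimes> x = l"
      using bl(1) xc lc by (simp add: minus_eq a_ac r_neg2 add.inv_solve_right')
    then have "\<one> \<ominus> b \<otimes> x = l" using bl(3) by simp
    then have "\<one> \<in> M" using y left_ideal_mem(4)[OF Ml y(1) bl(2)] by simp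
    then show False using maximal_left_ideal_one[OF M] by simp
  qed
  then show "x \<in> jacobson_radical R" using xc by (simp add: jacobson_radical_def)
qed

section \<open>Projectivity and dual bases\<close>

text \<open>The functionals \<open>\<phi>\<close> are the coordinates of an embedding into a free
  module, and the elements \<open>h\<close> define its splitting. The index set consists of ring
  elements because the definition of projectivity takes bases from the type of the module.\<close>

lemma (in ring) projective_from_dual_basis:
  fixes K :: "'a set"
  assumes J: "left_ideal J R" and K: "finite K"
    and \<phi>: "\<And>k x. k \<in> K \<Longrightarrow> x \<in> J \<Longrightarrow> \<phi> k x \<in> carrier R"
    and \<phi>_add: "\<And>k x y. k \<in> K \<Longrightarrow> x \<in> J \<Longrightarrow> y \<in> J \<Longrightarrow> \<phi> k (x \<oplus> y) = \<phi> k x \<oplus> \<phi> k y"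
    and \<phi>_mult: "\<And>k a x. k \<in> K \<Longrightarrow> a \<in> carrier R \<Longrightarrow> x \<in> J \<Longrightarrow> \<phi> k (a \<otimes> x) = a \<otimes> \<phi> k x"
    and h: "\<And>k. k \<in> K \<Longrightarrow> h k \<in> J"
    and dual: "\<And>x. x \<in> J \<Longrightarrow> x = (\<Oplus>k\<in>K. \<phi> k x \<otimes> h k)"
  shows "projective_left_module R (ideal_as_left_module R J)"
proof -
  let ?\<iota> = "\<lambda>x i. if i \<in> K then \<phi> i x else \<zero>" and ?\<pi> = "\<lambda>f. \<Oplus>k\<in>K. f k \<otimes> h k"
  have hc: "h k \<in> carrier R" if "k \<in> K" for k using h[OF that] left_ideal_mem(1)[OF J] by auto
  have sum_J: "(\<Oplus>k\<in>K'. g k \<otimes> h k) \<in> J" if "K' \<subseteq> K" "\<And>k. k \<in> K \<Longrightarrow> g k \<in> carrier R" for g K'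
    using finite_subset[OF that(1) K] that(1)
  proof (induction K' rule: finite_induct)
    case empty
    then show ?case using left_ideal_mem(2)[OF J] by simp
  next
    case (insert k F)
    have "(\<lambda>k. g k \<otimes> h k) \<in> F \<rightarrow> carrier R" using insert.prems that(2) hc by auto
    then have "(\<Oplus>k\<in>insert k F. g k \<otimes> h k) = g k \<otimes> h k \<oplus> (\<Oplus>k\<in>F. g k \<otimes> h k)"
      using insert that(2)[of k] hc[of k] by (subst finsum_insert) auto
    then show ?case using insert left_ideal_mem(3,4)[OF J] that(2)[of k] h[of k] by auto
  qed
  have 1: "?\<pi> (?\<iota> x) = x" if "x \<in> carrier (ideal_as_left_module R J)" for x
  proof -
    have xJ: "x \<in> J" using that by (simp add: ideal_as_left_module_def)
    have "?\<pi> (?\<iota> x) = (\<Oplus>k\<in>K. \<phi> k x \<otimes> h k)"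
      by (rule finsum_cong') (use xJ \<phi> hc in auto)
    then show ?thesis using dual[OF xJ] by simp
  qed
  have 2: "?\<iota> \<in> left_module_hom R (ideal_as_left_module R J) (free_left_module R K)"
    unfolding left_module_hom_def ideal_as_left_module_def free_left_module_def
    using \<phi> \<phi>_add \<phi>_mult K by (auto intro!: ext intro: finite_subset[of _ K])
  have 3: "?\<pi> \<in> left_module_hom R (free_left_module R K) (ideal_as_left_module R J)"
    unfolding left_module_hom_def ideal_as_left_module_def free_left_module_def
  proof (simp, intro conjI allI impI ballI)
    show "?\<pi> \<in> {f. (\<forall>i\<in>K. f i \<in> carrier R) \<and> (\<forall>i. i \<notin> K \<longrightarrow> f i = \<zero>) \<and> finite {i. f i \<noteq> \<zero>}} \<rightarrow> J"
      using sum_J[of K] by auto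
    fix f g assume f: "(\<forall>i\<in>K. f i \<in> carrier R) \<and> (\<forall>i. i \<notin> K \<longrightarrow> f i = \<zero>) \<and> finite {i. f i \<noteq> \<zero>}"
      and g: "(\<forall>i\<in>K. g i \<in> carrier R) \<and> (\<forall>i. i \<notin> K \<longrightarrow> g i = \<zero>) \<and> finite {i. g i \<noteq> \<zero>}"
    have "(\<Oplus>k\<in>K. (f k \<oplus> g k) \<otimes> h k) = (\<Oplus>k\<in>K. f k \<otimes> h k \<oplus> g k \<otimes> h k)"
      by (rule finsum_cong') (use f g hc in \<open>auto simp: l_distr\<close>)
    also have "\<dots> = (\<Oplus>k\<in>K. f k \<otimes> h k) \<oplus> (\<Oplus>k\<in>K. g k \<otimes> h k)"
      by (rule finsum_addf) (use f g hc in auto)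
    finally show "(\<Oplus>k\<in>K. (f k \<oplus> g k) \<otimes> h k) = (\<Oplus>k\<in>K. f k \<otimes> h k) \<oplus> (\<Oplus>k\<in>K. g k \<otimes> h k)" .
  next
    fix a f assume a: "a \<in> carrier R" 
      and f: "(\<forall>i\<in>K. f i \<in> carrier R) \<and> (\<forall>i. i \<notin> K \<longrightarrow> f i = \<zero>) \<and> finite {i. f i \<noteq> \<zero>}"
    have "(\<Oplus>k\<in>K. a \<otimes> f k \<otimes> h k) = (\<Oplus>k\<in>K. a \<otimes> (f k \<otimes> h k))"
      by (rule finsum_cong') (use a f hc in \<open>auto simp: m_assoc\<close>)
    also have "\<dots> = a \<otimes> (\<Oplus>k\<in>K. f k \<otimes> h k)"
      by (rule finsum_rdistr[symmetric]) (use a f hc K in auto)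
    finally show "(\<Oplus>k\<in>K. a \<otimes> f k \<otimes> h k) = a \<otimes> (\<Oplus>k\<in>K. f k \<otimes> h k)" .
  qed
  show ?thesis unfolding projective_left_module_def
    by (intro exI[of _ K] bexI[OF _ 2] bexI[OF _ 3] ballI 1)
qed

text \<open>The functionals are the coordinates of the embedding and the \<open>h k\<close> are the
  images of the standard basis. Finite generation, expressed through the left ideals containing
  \<open>Y\<close>, makes finitely many coordinates suffice, so that the expansion is a finite
  sum.\<close>

lemma (in ring) dual_basis_from_projective:
  assumes J: "left_ideal J R" and proj: "projective_left_module R (ideal_as_left_module R J)"
    and Y: "finite Y" "Y \<subseteq> J" and gen: "\<forall>S. left_ideal S R \<and> Y \<subseteq> S \<longrightarrow> J \<subseteq> S"
  shows "\<exists>(K :: 'a set) \<phi> h. finite K \<and> (\<forall>k\<in>K. h k \<in> J \<and> (\<forall>x\<in>J. \<phi> k x \<in> carrier R)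
      \<and> (\<forall>x\<in>J. \<forall>y\<in>J. \<phi> k (x \<oplus> y) = \<phi> k x \<oplus> \<phi> k y)
      \<and> (\<forall>a\<in>carrier R. \<forall>x\<in>J. \<phi> k (a \<otimes> x) = a \<otimes> \<phi> k x))
    \<and> (\<forall>x\<in>J. x = (\<Oplus>k\<in>K. \<phi> k x \<otimes> h k))"
proof -
  let ?M = "ideal_as_left_module R J"
  have carr: "carrier ?M = J" by (simp add: ideal_as_left_module_def)
  obtain I :: "'a set" and \<iota> \<pi> where \<iota>: "\<iota> \<in> left_module_hom R ?M (free_left_module R I)"
    and \<pi>: "\<pi> \<in> left_module_hom R (free_left_module R I) ?M" and \<pi>\<iota>: "\<And>x. x \<in> J \<Longrightarrow> \<pi> (\<iota> x) = x"
    using proj unfolding projective_left_module_def carr by blast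
  define F where "F = {f. (\<forall>i\<in>I. f i \<in> carrier R) \<and> (\<forall>i. i \<notin> I \<longrightarrow> f i = \<zero>) \<and> finite {i. f i \<noteq> \<zero>}}"
  have \<iota>F: "\<iota> x \<in> F" if "x \<in> J" for x
    using \<iota> that by (auto simp: left_module_hom_def free_left_module_def ideal_as_left_module_def F_def)
  have \<iota>a: "\<iota> (x \<oplus> y) = (\<lambda>i. \<iota> x i \<oplus> \<iota> y i)" if "x \<in> J" "y \<in> J" for x y
    using \<iota> that by (simp add: left_module_hom_def free_left_module_def ideal_as_left_module_def)
  have \<iota>m: "\<iota> (a \<otimes> x) = (\<lambda>i. a \<otimes> \<iota> x i)" if "a \<in> carrier R" "x \<in> J" for a x
    using \<iota> that by (simp add: left_module_hom_def free_left_module_def ideal_as_left_module_def)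
  have \<pi>J: "\<pi> f \<in> J" if "f \<in> F" for f
    using \<pi> that by (auto simp: left_module_hom_def free_left_module_def ideal_as_left_module_def F_def)
  have \<pi>a: "\<pi> (\<lambda>i. f i \<oplus> g i) = \<pi> f \<oplus> \<pi> g" if "f \<in> F" "g \<in> F" for f g
    using \<pi> that by (simp add: left_module_hom_def free_left_module_def ideal_as_left_module_def F_def)
  have \<pi>m: "\<pi> (\<lambda>i. a \<otimes> f i) = a \<otimes> \<pi> f" if "a \<in> carrier R" "f \<in> F" for a f
    using \<pi> that by (simp add: left_module_hom_def free_left_module_def ideal_as_left_module_def F_def)
  have Jc: "x \<in> carrier R" if "x \<in> J" for x using left_ideal_mem(1)[OF J] that by auto
  have Fc: "f i \<in> carrier R" if "f \<in> F" for f i using that by (cases "i \<in> I") (auto simp: F_def)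
  define K where "K = (\<Union>y\<in>Y. {i. \<iota> y i \<noteq> \<zero>})"
  have Kfin: "finite K" using Y \<iota>F by (auto simp: K_def F_def)
  have KI: "K \<subseteq> I"
  proof
    fix i assume "i \<in> K"
    then obtain y where "y \<in> Y" "\<iota> y i \<noteq> \<zero>" by (auto simp: K_def)
    then show "i \<in> I" using \<iota>F[of y] Y by (auto simp: F_def)
  qed
  \<comment> \<open>The elements whose coordinates vanish outside \<open>K\<close> form a left ideal
    containing the generators \<open>Y\<close>, hence all of \<open>J\<close>.\<close>
  have supp: "\<iota> x i = \<zero>" if "x \<in> J" "i \<notin> K" for x i
  proof -
    let ?S = "{x \<in> J. \<forall>i. i \<notin> K \<longrightarrow> \<iota> x i = \<zero>}"
    have z: "\<iota> \<zero> i = \<zero>" for i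
    proof -
      have "\<iota> \<zero> = (\<lambda>i. \<zero> \<otimes> \<iota> \<zero> i)" using \<iota>m[of \<zero> \<zero>] left_ideal_mem(2)[OF J] by simp
      then show ?thesis using Fc[OF \<iota>F[OF left_ideal_mem(2)[OF J]]] by (metis l_null)
    qed
    have "left_ideal ?S R"
      by (rule left_idealI) (use left_ideal_mem[OF J] \<iota>a \<iota>m z in auto)
    moreover have "Y \<subseteq> ?S" using Y(2) by (auto simp: K_def)
    ultimately have "J \<subseteq> ?S" using gen by blast
    then show ?thesis using that by blast
  qed
  define e where "e i = (\<lambda>j. if j = i then \<one> else \<zero>)" for i :: 'a
  have eF: "e i \<in> F" if "i \<in> I" for i
  proof -
    have "{j. e i j \<noteq> \<zero>} \<subseteq> {i}" by (auto simp: e_def)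
    then show ?thesis using that finite_subset[of "{j. e i j \<noteq> \<zero>}" "{i}"] by (auto simp: F_def e_def)
  qed
  have sum: "\<pi> f = (\<Oplus>k\<in>K'. f k \<otimes> \<pi> (e k))"
    if "K' \<subseteq> I" "finite K'" "f \<in> F" "\<And>i. i \<notin> K' \<Longrightarrow> f i = \<zero>" for K' f
    using that(2,1,3,4)
  proof (induction K' arbitrary: f rule: finite_induct)
    case empty
    then have "f = (\<lambda>i. \<zero> \<otimes> f i)" by (auto simp: Fc)
    then have "\<pi> f = \<zero> \<otimes> \<pi> f" using \<pi>m[of \<zero> f] empty by simp
    then show ?case using Jc[OF \<pi>J[OF empty(2)]] by simp
  next
    case (insert k K')
    let ?f = "f(k := \<zero>)"
    have "finite {i. ?f i \<noteq> \<zero>}"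
    proof (rule finite_subset)
      show "{i. ?f i \<noteq> \<zero>} \<subseteq> {i. f i \<noteq> \<zero>}" by auto
      show "finite {i. f i \<noteq> \<zero>}" using insert.prems(2) by (simp add: F_def)
    qed
    moreover have "(\<forall>i\<in>I. ?f i \<in> carrier R) \<and> (\<forall>i. i \<notin> I \<longrightarrow> ?f i = \<zero>)"
      using insert.prems(2) by (simp add: F_def)
    ultimately have fF: "?f \<in> F" unfolding F_def by blast
    have kI: "k \<in> I" using insert.prems(1) by simp
    have fk: "f k \<in> carrier R" using Fc[OF insert.prems(2)] .
    have gF: "(\<lambda>i. f k \<otimes> e k i) \<in> F"
    proof -
      have "{i. f k \<otimes> e k i \<noteq> \<zero>} \<subseteq> {k}" using fk by (auto simp: e_def)
      then show ?thesis using finite_subset[of _ "{k}"] fk kI by (auto simp: F_def e_def)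
    qed
    have "f = (\<lambda>i. f k \<otimes> e k i \<oplus> ?f i)"
      using Fc[OF insert.prems(2)] by (auto simp: e_def)
    then have "\<pi> f = f k \<otimes> \<pi> (e k) \<oplus> \<pi> ?f" using \<pi>a[OF gF fF] \<pi>m[OF fk eF[OF kI]] by simp
    also have "\<pi> ?f = (\<Oplus>j\<in>K'. ?f j \<otimes> \<pi> (e j))"
    proof (rule insert.IH)
      show "?f i = \<zero>" if "i \<notin> K'" for i using insert.prems(3)[of i] that by auto
      show "K' \<subseteq> I" using insert.prems(1) by simp
    qed (rule fF)
    also have "\<dots> = (\<Oplus>j\<in>K'. f j \<otimes> \<pi> (e j))"
      by (rule finsum_cong') (use insert Fc[OF insert.prems(2)] Jc \<pi>J eF in auto)
    also have "f k \<otimes> \<pi> (e k) \<oplus> (\<Oplus>j\<in>K'. f j \<otimes> \<pi> (e j)) = (\<Oplus>j\<in>insert k K'. f j \<otimes> \<pi> (e j))"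
    proof -
      have "(\<lambda>j. f j \<otimes> \<pi> (e j)) \<in> K' \<rightarrow> carrier R"
        using Fc[OF insert.prems(2)] Jc \<pi>J eF insert.prems(1) by auto
      then show ?thesis using insert fk Jc[OF \<pi>J[OF eF[OF kI]]] by (subst finsum_insert) auto
    qed
    finally show ?case .
  qed
  show ?thesis
  proof (intro exI[of _ K] exI[of _ "\<lambda>k x. \<iota> x k"] exI[of _ "\<lambda>k. \<pi> (e k)"] conjI ballI)
    show "x = (\<Oplus>k\<in>K. \<iota> x k \<otimes> \<pi> (e k))" if "x \<in> J" for x
      using sum[OF KI Kfin \<iota>F[OF that]] supp[OF that] \<pi>\<iota>[OF that] by simp
  qed (use Kfin Fc \<iota>F \<iota>a \<iota>m \<pi>J eF KI in auto)
qed


section \<open>Twisted monoid algebras and traces\<close>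

text \<open>Separating the product from the diagrams makes the opposite algebra an algebra of the
  same kind, with the arguments of \<open>cc\<close> and \<open>lam\<close> exchanged.\<close>

definition twisted_algebra ::
    "'d set \<Rightarrow> ('d \<Rightarrow> 'd \<Rightarrow> 'd) \<Rightarrow> ('d \<Rightarrow> 'd \<Rightarrow> 'k) \<Rightarrow> 'd \<Rightarrow> ('k::field, 'd \<Rightarrow> 'k) module"
  where
    "twisted_algebra D cc lam u =
      \<lparr>carrier = {f. \<forall>x. x \<notin> D \<longrightarrow> f x = 0},
       monoid.mult = (\<lambda>f g z. \<Sum>x\<in>D. \<Sum>y\<in>D. if cc x y = z then f x * g y * lam x y else 0),
       one = (\<lambda>z. if z = u then 1 else 0),
       zero = (\<lambda>z. 0),
       add = (\<lambda>f g z. f z + g z),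
       smult = (\<lambda>c f z. c * f z)\<rparr>"

definition scale :: "'k::field \<Rightarrow> ('d \<Rightarrow> 'k) \<Rightarrow> 'd \<Rightarrow> 'k"
  where "scale c f = (\<lambda>z. c * f z)"

definition basis_vector :: "'d \<Rightarrow> 'd \<Rightarrow> 'k::field"
  where "basis_vector d = (\<lambda>z. if z = d then 1 else 0)"

lemma scale_apply [simp]: "scale c f z = c * f z"
  by (simp add: scale_def)

interpretation V: vector_space "scale :: 'k::field \<Rightarrow> ('d \<Rightarrow> 'k) \<Rightarrow> 'd \<Rightarrow> 'k"
  by unfold_locales (auto simp: fun_eq_iff algebra_simps)

interpretation VP: vector_space_pair "scale :: 'k::field \<Rightarrow> ('d \<Rightarrow> 'k) \<Rightarrow> 'd \<Rightarrow> 'k"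
    "scale :: 'k::field \<Rightarrow> ('d \<Rightarrow> 'k) \<Rightarrow> 'd \<Rightarrow> 'k" ..

abbreviation lin :: "(('d \<Rightarrow> 'k::field) \<Rightarrow> ('d \<Rightarrow> 'k)) \<Rightarrow> bool"
  where "lin \<equiv> Vector_Spaces.linear scale scale"

lemma linI:
  "(\<And>f g. \<phi> (f + g) = \<phi> f + \<phi> g) \<Longrightarrow> (\<And>c f. \<phi> (scale c f) = scale c (\<phi> f)) \<Longrightarrow> lin \<phi>"
  unfolding Vector_Spaces.linear_iff using V.vector_space_axioms by blast

lemma lin_add: "lin \<phi> \<Longrightarrow> \<phi> (f + g) = \<phi> f + \<phi> g"
  and lin_scale: "lin \<phi> \<Longrightarrow> \<phi> (scale c f) = scale c (\<phi> f)"
  and lin_diff: "lin \<phi> \<Longrightarrow> \<phi> (f - g) = \<phi> f - \<phi> g"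
  and lin_zero: "lin \<phi> \<Longrightarrow> \<phi> 0 = 0"
  and lin_sum: "lin \<phi> \<Longrightarrow> \<phi> (\<Sum>i\<in>A. h i) = (\<Sum>i\<in>A. \<phi> (h i))"
  by (fact VP.linear_add VP.linear_scale VP.linear_diff VP.linear_0 VP.linear_sum)+

lemma lin_comp: "lin \<phi> \<Longrightarrow> lin \<psi> \<Longrightarrow> lin (\<lambda>f. \<phi> (\<psi> f))"
  by (rule linI) (simp_all add: lin_add[of \<phi>] lin_add[of \<psi>] lin_scale[of \<phi>] lin_scale[of \<psi>])

lemma lin_id: "lin (\<lambda>f. f)"
  by (rule linI) simp_all

lemma lin_minus: "lin \<phi> \<Longrightarrow> lin \<psi> \<Longrightarrow> lin (\<lambda>f. \<phi> f - \<psi> f)"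
  by (rule linI)
    (simp_all add: lin_add[of \<phi>] lin_add[of \<psi>] lin_scale[of \<phi>] lin_scale[of \<psi>] V.scale_right_diff_distrib)

lemma lin_sums: "(\<And>i. i \<in> A \<Longrightarrow> lin (\<phi> i)) \<Longrightarrow> lin (\<lambda>f. \<Sum>i\<in>A. \<phi> i f)"
proof (rule linI)
  assume \<phi>: "\<And>i. i \<in> A \<Longrightarrow> lin (\<phi> i)"
  show "(\<Sum>i\<in>A. \<phi> i (f + g)) = (\<Sum>i\<in>A. \<phi> i f) + (\<Sum>i\<in>A. \<phi> i g)" for f g
    unfolding sum.distrib[symmetric] by (rule sum.cong[OF refl]) (rule lin_add[OF \<phi>])
  show "(\<Sum>i\<in>A. \<phi> i (scale c f)) = scale c (\<Sum>i\<in>A. \<phi> i f)" for c f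
    unfolding V.scale_sum_right by (rule sum.cong[OF refl]) (rule lin_scale[OF \<phi>])
qed

text \<open>Some linear projection of the whole function space onto \<open>V\<close>. With it, maps
  on subspaces and subquotients become maps of one ambient space, where a trace is a sum of diagonal
  coefficients.\<close>

definition subspace_proj :: "('d \<Rightarrow> 'k::field) set \<Rightarrow> ('d \<Rightarrow> 'k) \<Rightarrow> 'd \<Rightarrow> 'k"
  where "subspace_proj V = (SOME \<pi>. lin \<pi> \<and> range \<pi> \<subseteq> V \<and> (\<forall>v\<in>V. \<pi> v = v))"

lemma subspace_proj:
  assumes "V.subspace V"
  shows lin_subspace_proj: "lin (subspace_proj V)" and subspace_proj_in: "subspace_proj V f \<in> V"
    and subspace_proj_id: "f \<in> V \<Longrightarrow> subspace_proj V f = f"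
proof -
  have "\<exists>\<pi>. lin \<pi> \<and> range \<pi> \<subseteq> V \<and> (\<forall>v\<in>V. \<pi> v = v)"
    using VP.linear_exists_left_inverse_on[OF lin_id assms] by auto
  from someI_ex[OF this] have "lin (subspace_proj V) \<and> range (subspace_proj V) \<subseteq> V \<and> (\<forall>v\<in>V. subspace_proj V v = v)"
    unfolding subspace_proj_def .
  then show "lin (subspace_proj V)" "subspace_proj V f \<in> V" "f \<in> V \<Longrightarrow> subspace_proj V f = f" by auto
qed

section \<open>Traces on subspaces and subquotients\<close>

locale function_space =
  fixes D :: "'d set"
  assumes finite_D: "finite D"
begin

definition W :: "('d \<Rightarrow> 'k::field) set"
  where "W = {f. \<forall>x. x \<notin> D \<longrightarrow> f x = 0}"

lemma W_zero: "f \<in> W \<Longrightarrow> x \<notin> D \<Longrightarrow> f x = 0"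
  by (simp add: W_def)

lemma subspace_W: "V.subspace W"
  by (auto simp: V.subspace_def W_def)

lemma W_add [simp]: "f \<in> W \<Longrightarrow> g \<in> W \<Longrightarrow> f + g \<in> W"
  and W_diff [simp]: "f \<in> W \<Longrightarrow> g \<in> W \<Longrightarrow> f - g \<in> W"
  and W_scale [simp]: "f \<in> W \<Longrightarrow> scale c f \<in> W"
  and W_0 [simp]: "0 \<in> W"
  and W_basis [simp]: "d \<in> D \<Longrightarrow> basis_vector d \<in> W"
  by (auto simp: W_def basis_vector_def)

lemma W_sum [simp]: "(\<And>i. i \<in> A \<Longrightarrow> h i \<in> W) \<Longrightarrow> (\<Sum>i\<in>A. h i) \<in> W"
  by (rule V.subspace_sum[OF subspace_W])

lemma sum_fun_apply: "(\<Sum>i\<in>A. h i) z = (\<Sum>i\<in>A. h i z)"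
  by (induction A rule: infinite_finite_induct) auto

lemma expand: assumes "f \<in> W" shows "f = (\<Sum>d\<in>D. scale (f d) (basis_vector d))"
proof
  fix z
  have "(\<Sum>d\<in>D. scale (f d) (basis_vector d)) z = (\<Sum>d\<in>D. if z = d then f d else 0)"
    unfolding sum_fun_apply by (rule sum.cong) (auto simp: basis_vector_def)
  also have "\<dots> = f z" using finite_D W_zero[OF assms, of z] by auto
  finally show "f z = (\<Sum>d\<in>D. scale (f d) (basis_vector d)) z" by simp
qed

lemma lin_expand: "lin \<phi> \<Longrightarrow> f \<in> W \<Longrightarrow> \<phi> f = (\<Sum>d\<in>D. scale (f d) (\<phi> (basis_vector d)))"
  by (subst expand, assumption) (simp add: lin_sum[of \<phi>] lin_scale[of \<phi>])

lemma lin_eq_on_basis: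
  assumes "lin \<phi>" "lin \<psi>" "\<And>d. d \<in> D \<Longrightarrow> \<phi> (basis_vector d) = \<psi> (basis_vector d)" "f \<in> W"
  shows "\<phi> f = \<psi> f"
  using lin_expand[OF assms(1,4)] lin_expand[OF assms(2,4)] assms(3) by simp

definition Tr :: "(('d \<Rightarrow> 'k::field) \<Rightarrow> 'd \<Rightarrow> 'k) \<Rightarrow> 'k"
  where "Tr \<phi> = (\<Sum>d\<in>D. \<phi> (basis_vector d) d)"

lemma Tr_diff: "Tr (\<lambda>f. \<phi> f - \<psi> f) = Tr \<phi> - Tr \<psi>"
  by (simp add: Tr_def sum_subtractf)

lemma Tr_sum: "Tr (\<lambda>f. \<Sum>i\<in>A. \<phi> i f) = (\<Sum>i\<in>A. Tr (\<phi> i))"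
  unfolding Tr_def sum_fun_apply by (rule sum.swap)

lemma Tr_cong: "(\<And>f. f \<in> W \<Longrightarrow> \<phi> f = \<psi> f) \<Longrightarrow> Tr \<phi> = Tr \<psi>"
  by (simp add: Tr_def)

lemma Tr_comp:
  assumes "lin \<phi>" "lin \<psi>" "\<And>f. f \<in> W \<Longrightarrow> \<psi> f \<in> W"
  shows "Tr (\<lambda>f. \<phi> (\<psi> f)) = (\<Sum>d\<in>D. \<Sum>d'\<in>D. \<psi> (basis_vector d) d' * \<phi> (basis_vector d') d)"
  unfolding Tr_def
proof (rule sum.cong[OF refl])
  fix d assume "d \<in> D"
  then have "\<phi> (\<psi> (basis_vector d)) = (\<Sum>d'\<in>D. scale (\<psi> (basis_vector d) d') (\<phi> (basis_vector d')))"
    by (rule lin_expand[OF assms(1) assms(3)[OF W_basis]])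
  then show "\<phi> (\<psi> (basis_vector d)) d = (\<Sum>d'\<in>D. \<psi> (basis_vector d) d' * \<phi> (basis_vector d') d)"
    by (simp add: sum_fun_apply)
qed

lemma Tr_comm:
  assumes "lin \<phi>" "lin \<psi>" "\<And>f. f \<in> W \<Longrightarrow> \<phi> f \<in> W" "\<And>f. f \<in> W \<Longrightarrow> \<psi> f \<in> W"
  shows "Tr (\<lambda>f. \<phi> (\<psi> f)) = Tr (\<lambda>f. \<psi> (\<phi> f))"
proof -
  have "Tr (\<lambda>f. \<phi> (\<psi> f)) = (\<Sum>d\<in>D. \<Sum>d'\<in>D. \<psi> (basis_vector d) d' * \<phi> (basis_vector d') d)"
    by (rule Tr_comp[OF assms(1,2)]) (rule assms(4))
  moreover have "Tr (\<lambda>f. \<psi> (\<phi> f)) = (\<Sum>d\<in>D. \<Sum>d'\<in>D. \<phi> (basis_vector d) d' * \<psi> (basis_vector d') d)"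
    by (rule Tr_comp[OF assms(2,1)]) (rule assms(3))
  ultimately show ?thesis by (simp add: mult.commute) (rule sum.swap)
qed

text \<open>On an invariant subspace, \<open>\<phi>\<close> has the same trace as its composition with any projection onto it.\<close>

definition tr :: "('d \<Rightarrow> 'k::field) set \<Rightarrow> (('d \<Rightarrow> 'k) \<Rightarrow> 'd \<Rightarrow> 'k) \<Rightarrow> 'k"
  where "tr V \<phi> = Tr (\<lambda>f. \<phi> (subspace_proj V f))"

lemma tr_W: "tr W \<phi> = Tr \<phi>"
  unfolding tr_def by (rule Tr_cong) (simp add: subspace_proj_id[OF subspace_W])

text \<open>Each of the two projections is the identity on the image of the other, so commuting
  factors under the trace exchanges them.\<close>

lemma tr_proj:
  assumes V: "V.subspace V" "V \<subseteq> W" and \<phi>: "lin \<phi>" "\<And>v. v \<in> V \<Longrightarrow> \<phi> v \<in> V"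
    and \<pi>: "lin \<pi>" "\<And>f. f \<in> W \<Longrightarrow> \<pi> f \<in> V" "\<And>v. v \<in> V \<Longrightarrow> \<pi> v = v"
  shows "tr V \<phi> = Tr (\<lambda>f. \<phi> (\<pi> f))"
proof -
  note p = subspace_proj[OF V(1)]
  have "tr V \<phi> = Tr (\<lambda>f. \<pi> (\<phi> (subspace_proj V f)))"
    unfolding tr_def by (rule Tr_cong) (simp add: p \<pi> \<phi>)
  also have "\<dots> = Tr (\<lambda>f. \<phi> (subspace_proj V (\<pi> f)))"
    by (rule Tr_comm[of \<pi> "\<lambda>f. \<phi> (subspace_proj V f)"])
      (use V(2) p \<pi> \<phi> in \<open>auto intro!: lin_comp[of \<phi>] dest: subsetD\<close>)
  also have "\<dots> = Tr (\<lambda>f. \<phi> (\<pi> f))"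
    by (rule Tr_cong) (simp add: p \<pi>)
  finally show ?thesis .
qed

text \<open>Subtracting the projection onto \<open>U\<close> models the quotient by
  \<open>U\<close>; the left side is the trace of the map induced on \<open>V / U\<close>.\<close>

lemma tr_quotient:
  assumes U: "V.subspace U" and V: "V.subspace V" "V \<subseteq> W" and UV: "U \<subseteq> V"
    and \<phi>: "lin \<phi>" "\<And>v. v \<in> V \<Longrightarrow> \<phi> v \<in> V" "\<And>v. v \<in> U \<Longrightarrow> \<phi> v \<in> U"
  shows "Tr (\<lambda>f. \<phi> (subspace_proj V f) - subspace_proj U (\<phi> (subspace_proj V f))) = tr V \<phi> - tr U \<phi>"
proof -
  note p = subspace_proj[OF V(1)] and q = subspace_proj[OF U]
  have UW: "U \<subseteq> W" using UV V(2) by simp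
  have "Tr (\<lambda>f. subspace_proj U (\<phi> (subspace_proj V f))) = Tr (\<lambda>f. \<phi> (subspace_proj V (subspace_proj U f)))"
    by (rule Tr_comm[of "subspace_proj U" "\<lambda>f. \<phi> (subspace_proj V f)"])
      (use V(2) UW p q \<phi> in \<open>auto intro!: lin_comp[of \<phi>] dest: subsetD\<close>)
  also have "\<dots> = tr U \<phi>"
    unfolding tr_def by (rule Tr_cong) (use p q UV in \<open>simp add: subset_iff\<close>)
  finally show ?thesis by (simp add: Tr_diff tr_def)
qed

text \<open>On \<open>V / U\<close> only the class of \<open>\<psi> v\<close> modulo
  \<open>U\<close> counts. So \<open>\<phi>\<close> can be replaced by a map that is easier to
  factor, such as an expansion in a dual basis.\<close>

lemma tr_quotient':
  assumes U: "V.subspace U" and V: "V.subspace V" "V \<subseteq> W" and UV: "U \<subseteq> V"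
    and \<phi>: "lin \<phi>" "\<And>v. v \<in> V \<Longrightarrow> \<phi> v \<in> V" "\<And>v. v \<in> U \<Longrightarrow> \<phi> v \<in> U"
    and \<psi>: "\<And>v. v \<in> V \<Longrightarrow> \<psi> v - \<phi> v \<in> U"
  shows "Tr (\<lambda>f. \<psi> (subspace_proj V f) - subspace_proj U (\<psi> (subspace_proj V f))) = tr V \<phi> - tr U \<phi>"
proof -
  note p = subspace_proj[OF V(1)] and q = subspace_proj[OF U]
  have "\<psi> v - subspace_proj U (\<psi> v) = \<phi> v - subspace_proj U (\<phi> v)" if "v \<in> V" for v
  proof -
    have "subspace_proj U (\<psi> v - \<phi> v) = \<psi> v - \<phi> v" using q(3) \<psi>[OF that] by simp
    then show ?thesis by (simp add: lin_diff[OF q(1)] algebra_simps)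
  qed
  then have "Tr (\<lambda>f. \<psi> (subspace_proj V f) - subspace_proj U (\<psi> (subspace_proj V f)))
      = Tr (\<lambda>f. \<phi> (subspace_proj V f) - subspace_proj U (\<phi> (subspace_proj V f)))"
    by (intro Tr_cong) (simp add: p)
  then show ?thesis using tr_quotient[OF U V UV \<phi>] by simp
qed

text \<open>\<open>\<psi>\<close> induces an isomorphism from \<open>L / L0\<close> onto \<open>V / U\<close> which intertwines \<open>\<phi>\<close>.\<close>

lemma tr_quotient_iso:
  assumes U: "V.subspace U" and V: "V.subspace V" "V \<subseteq> W" and UV: "U \<subseteq> V"
    and L0: "V.subspace L0" and L: "V.subspace L" "L \<subseteq> W"
    and L0_eq: "L0 = {x \<in> L. \<psi> x \<in> U}"
    and \<phi>: "lin \<phi>" "\<And>v. v \<in> V \<Longrightarrow> \<phi> v \<in> V" "\<And>v. v \<in> U \<Longrightarrow> \<phi> v \<in> U"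
      "\<And>v. v \<in> L \<Longrightarrow> \<phi> v \<in> L" "\<And>v. v \<in> L0 \<Longrightarrow> \<phi> v \<in> L0"
    and \<psi>: "lin \<psi>" "\<And>x. x \<in> L \<Longrightarrow> \<psi> x \<in> V" "\<And>x. x \<in> L \<Longrightarrow> \<psi> (\<phi> x) - \<phi> (\<psi> x) \<in> U"
      "\<And>v. v \<in> V \<Longrightarrow> \<exists>x\<in>L. v - \<psi> x \<in> U"
  shows "tr V \<phi> - tr U \<phi> = tr L \<phi> - tr L0 \<phi>"
proof -
  note p = subspace_proj[OF V(1)] and q = subspace_proj[OF U] and l = subspace_proj[OF L(1)] and l0 = subspace_proj[OF L0]
  define \<rho> where "\<rho> f = f - subspace_proj U f" for f
  define \<rho>0 where "\<rho>0 f = f - subspace_proj L0 f" for f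
  have lin\<rho>: "lin \<rho>" "lin \<rho>0" unfolding \<rho>_def \<rho>0_def by (rule lin_minus[OF lin_id q(1)], rule lin_minus[OF lin_id l0(1)])
  have \<rho>U: "\<rho> u = 0" if "u \<in> U" for u using q(3)[OF that] by (simp add: \<rho>_def)
  have \<rho>0L: "\<rho>0 u = 0" if "u \<in> L0" for u using l0(3)[OF that] by (simp add: \<rho>0_def)
  have \<rho>V: "\<rho> v \<in> V" if "v \<in> V" for v
    unfolding \<rho>_def using that q(2) UV by (intro V.subspace_diff[OF V(1)]) auto
  have \<rho>0_in: "\<rho>0 v \<in> L" if "v \<in> L" for v
    unfolding \<rho>0_def using that l0(2) L0_eq by (intro V.subspace_diff[OF L(1)]) auto
  have \<rho>id: "f - \<rho> f \<in> U" for f using q(2) by (simp add: \<rho>_def)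
  have \<rho>0id: "f - \<rho>0 f \<in> L0" for f using l0(2) by (simp add: \<rho>0_def)
  define \<theta> where "\<theta> f = \<rho> (\<psi> (subspace_proj L f))" for f
  have lin\<theta>: "lin \<theta>" unfolding \<theta>_def by (rule lin_comp[OF lin\<rho>(1) lin_comp[OF \<psi>(1) l(1)]])
  \<comment> \<open>A linear section of the map \<open>\<theta>\<close> from \<open>L\<close> onto
    representatives of \<open>V / U\<close>; modulo \<open>L0\<close> it inverts
    \<open>\<psi>\<close>.\<close>
  obtain \<sigma> where \<sigma>: "range \<sigma> \<subseteq> L" "lin \<sigma>" "\<And>v. v \<in> \<theta> ` L \<Longrightarrow> \<theta> (\<sigma> v) = v"
    using VP.linear_exists_right_inverse_on[OF lin\<theta> L(1)] by auto
  have \<sigma>L: "\<sigma> v \<in> L" for v using \<sigma>(1) by blast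
  have \<theta>L: "\<theta> x = \<rho> (\<psi> x)" if "x \<in> L" for x using that by (simp add: \<theta>_def l)
  have surj: "\<rho> v \<in> \<theta> ` L" if v: "v \<in> V" for v
  proof -
    obtain x where x: "x \<in> L" "v - \<psi> x \<in> U" using \<psi>(4)[OF v] by auto
    then have "\<rho> v = \<rho> (\<psi> x)" using \<rho>U[OF x(2)] lin_diff[OF lin\<rho>(1), of v "\<psi> x"] by simp
    then have "\<rho> v = \<theta> x" using \<theta>L[OF x(1)] by simp
    then show ?thesis using x(1) by (rule image_eqI)
  qed
  have \<sigma>\<rho>: "\<rho> (\<psi> (\<sigma> (\<rho> v))) = \<rho> v" if "v \<in> V" for v
  proof -
    have "\<sigma> (\<rho> v) \<in> L" using \<sigma>(1) by blast
    then show ?thesis using \<sigma>(3)[OF surj[OF that]] \<theta>L[of "\<sigma> (\<rho> v)"] by simp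
  qed
  have inL0: "\<rho>0 x = 0" if "x \<in> L" "\<rho> (\<psi> x) = 0" for x
  proof (rule \<rho>0L)
    have "\<psi> x \<in> U" using \<rho>id[of "\<psi> x"] that(2) by simp
    then show "x \<in> L0" using that(1) by (simp add: L0_eq)
  qed
  have \<sigma>\<psi>: "\<rho>0 (\<sigma> (\<rho> (\<psi> x))) = \<rho>0 x" if x: "x \<in> L" for x
  proof -
    have "\<rho> (\<psi> (\<sigma> (\<rho> (\<psi> x)) - x)) = 0"
      using \<sigma>\<rho>[OF \<psi>(2)[OF x]] by (simp add: lin_diff[OF \<psi>(1)] lin_diff[OF lin\<rho>(1)])
    moreover have "\<sigma> (\<rho> (\<psi> x)) - x \<in> L" using \<sigma>(1) x by (intro V.subspace_diff[OF L(1)]) auto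
    ultimately have "\<rho>0 (\<sigma> (\<rho> (\<psi> x)) - x) = 0" using inL0 by simp
    then show ?thesis by (simp add: lin_diff[OF lin\<rho>(2)])
  qed
  \<comment> \<open>On the quotients \<open>\<phi>\<close> equals
    \<open>\<psi> \<phi> \<sigma>\<close>. Moving \<open>\<psi>\<close> to the end under the trace
    gives \<open>\<phi> \<sigma> \<psi>\<close>, which is \<open>\<phi>\<close> on
    \<open>L / L0\<close>. The maps \<open>\<rho>\<close> and \<open>\<rho>0\<close> make the
    factors independent of representatives.\<close>
  have "tr V \<phi> - tr U \<phi> = Tr (\<lambda>f. \<rho> (\<phi> (subspace_proj V f)))"
    using tr_quotient[OF U V UV \<phi>(1-3)] by (simp add: \<rho>_def)
  also have "\<dots> = Tr (\<lambda>f. \<rho> (\<psi> (\<phi> (\<rho>0 (\<sigma> (\<rho> (subspace_proj V f)))))))"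
  proof (rule Tr_cong)
    fix f :: "'d \<Rightarrow> 'a"
    let ?v = "subspace_proj V f" let ?x = "\<sigma> (\<rho> ?v)"
    have v: "?v \<in> V" by (rule p)
    have x: "?x \<in> L" using \<sigma>(1) by auto
    have eq: "\<rho> a = \<rho> b" if "a - b \<in> U" for a b using \<rho>U[OF that] by (simp add: lin_diff[OF lin\<rho>(1)])
    have "\<rho> (\<psi> (\<phi> (\<rho>0 ?x))) = \<rho> (\<psi> (\<phi> ?x))"
    proof (rule eq)
      have "\<phi> (\<rho>0 ?x - ?x) \<in> L0" using \<rho>0id[of ?x] V.subspace_neg[OF L0] by (intro \<phi>(5)) (metis minus_diff_eq)
      then have "\<psi> (\<phi> (\<rho>0 ?x - ?x)) \<in> U" by (simp add: L0_eq)
      then show "\<psi> (\<phi> (\<rho>0 ?x)) - \<psi> (\<phi> ?x) \<in> U" by (simp add: lin_diff[OF \<phi>(1)] lin_diff[OF \<psi>(1)])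
    qed
    also have "\<dots> = \<rho> (\<phi> (\<psi> ?x))" by (rule eq) (rule \<psi>(3)[OF x])
    also have "\<dots> = \<rho> (\<phi> ?v)"
    proof (rule eq)
      have "\<rho> (\<psi> ?x - ?v) = 0" using \<sigma>\<rho>[OF v] by (simp add: lin_diff[OF lin\<rho>(1)])
      then have "\<psi> ?x - ?v \<in> U" using \<rho>id[of "\<psi> ?x - ?v"] by simp
      then have "\<phi> (\<psi> ?x - ?v) \<in> U" by (rule \<phi>(3))
      then show "\<phi> (\<psi> ?x) - \<phi> ?v \<in> U" by (simp add: lin_diff[OF \<phi>(1)])
    qed
    finally show "\<rho> (\<phi> ?v) = \<rho> (\<psi> (\<phi> (\<rho>0 ?x)))" by simp
  qed
  also have "\<dots> = Tr (\<lambda>f. \<rho> (\<psi> (subspace_proj L (\<phi> (\<rho>0 (\<sigma> (\<rho> (subspace_proj V f))))))))"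
    by (rule Tr_cong) (simp add: l(3) \<phi>(4) \<rho>0_in \<sigma>L)
  also have "\<dots> = Tr (\<lambda>f. \<phi> (\<rho>0 (\<sigma> (\<rho> (subspace_proj V (\<rho> (\<psi> (subspace_proj L f))))))))"
  proof (rule Tr_comm[of "\<lambda>f. \<rho> (\<psi> (subspace_proj L f))" "\<lambda>f. \<phi> (\<rho>0 (\<sigma> (\<rho> (subspace_proj V f))))"])
    show "lin (\<lambda>f. \<rho> (\<psi> (subspace_proj L f)))"
      by (rule lin_comp[OF lin\<rho>(1) lin_comp[OF \<psi>(1) l(1)]])
    show "lin (\<lambda>f. \<phi> (\<rho>0 (\<sigma> (\<rho> (subspace_proj V f)))))"
      by (rule lin_comp[OF \<phi>(1) lin_comp[OF lin\<rho>(2) lin_comp[OF \<sigma>(2) lin_comp[OF lin\<rho>(1) p(1)]]]])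
    show "\<rho> (\<psi> (subspace_proj L f)) \<in> W" for f using \<rho>V[OF \<psi>(2)[OF l(2)]] V(2) by auto
    show "\<phi> (\<rho>0 (\<sigma> (\<rho> (subspace_proj V f)))) \<in> W" for f using \<phi>(4)[OF \<rho>0_in[OF \<sigma>L]] L(2) by auto
  qed
  also have "\<dots> = Tr (\<lambda>f. \<phi> (\<rho>0 (subspace_proj L f)))"
  proof (rule Tr_cong)
    fix f :: "'d \<Rightarrow> 'a"
    let ?x = "subspace_proj L f"
    have x: "?x \<in> L" by (rule l)
    have v: "\<rho> (\<psi> ?x) \<in> V" by (intro \<rho>V \<psi> x)
    have "\<rho> (\<rho> (\<psi> ?x)) = \<rho> (\<psi> ?x)"
      using \<rho>U[OF \<rho>id[of "\<psi> ?x"]] by (simp add: lin_diff[OF lin\<rho>(1)])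
    then have "\<rho>0 (\<sigma> (\<rho> (subspace_proj V (\<rho> (\<psi> ?x))))) = \<rho>0 ?x" using p(3)[OF v] \<sigma>\<psi>[OF x] by simp
    then show "\<phi> (\<rho>0 (\<sigma> (\<rho> (subspace_proj V (\<rho> (\<psi> ?x)))))) = \<phi> (\<rho>0 ?x)" by simp
  qed
  also have "\<dots> = tr L \<phi> - tr L0 \<phi>"
  proof -
    have "tr L0 \<phi> = Tr (\<lambda>f. \<phi> (subspace_proj L0 (subspace_proj L f)))"
    proof (rule tr_proj[OF L0])
      show "L0 \<subseteq> W" using L0_eq L(2) by auto
      show "lin (\<lambda>f. subspace_proj L0 (subspace_proj L f))" by (rule lin_comp[OF l0(1) l(1)])
      show "subspace_proj L0 (subspace_proj L v) = v" if "v \<in> L0" for v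
      proof -
        have "v \<in> L" using that L0_eq by blast
        then show ?thesis using l(3)[of v] l0(3)[OF that] by simp
      qed
    qed (use \<phi> l0 in auto)
    then show ?thesis unfolding \<rho>0_def by (simp add: lin_diff[OF \<phi>(1)] Tr_diff tr_def)
  qed
  finally show ?thesis .
qed

end

section \<open>The ring of a twisted monoid and its ideals\<close>

text \<open>Closure is required only where \<open>lam\<close> is nonzero: removing a loop whose
  label is not divisible by \<open>p\<close> can lead to a diagram outside the basis. The condition
  on \<open>lam\<close> is the two-cocycle identity, with zero values allowed.\<close>

locale twisted_monoid = function_space D for D :: "'d set" +
  fixes cc :: "'d \<Rightarrow> 'd \<Rightarrow> 'd" and lam :: "'d \<Rightarrow> 'd \<Rightarrow> 'k::field" and u :: 'd
  assumes u_D: "u \<in> D"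
    and cc_closed: "\<And>x y. x \<in> D \<Longrightarrow> y \<in> D \<Longrightarrow> lam x y \<noteq> 0 \<Longrightarrow> cc x y \<in> D"
    and cc_assoc: "\<And>x y z. x \<in> D \<Longrightarrow> y \<in> D \<Longrightarrow> z \<in> D \<Longrightarrow> cc (cc x y) z = cc x (cc y z)"
    and lam_assoc: "\<And>x y z. x \<in> D \<Longrightarrow> y \<in> D \<Longrightarrow> z \<in> D \<Longrightarrow> lam x y * lam (cc x y) z = lam y z * lam x (cc y z)"
    and cc_unit: "\<And>x. x \<in> D \<Longrightarrow> cc u x = x" "\<And>x. x \<in> D \<Longrightarrow> cc x u = x"
    and lam_unit: "\<And>x. x \<in> D \<Longrightarrow> lam u x = 1" "\<And>x. x \<in> D \<Longrightarrow> lam x u = 1"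
begin

definition mul :: "('d \<Rightarrow> 'k) \<Rightarrow> ('d \<Rightarrow> 'k) \<Rightarrow> 'd \<Rightarrow> 'k"
  where "mul f g = (\<lambda>z. \<Sum>x\<in>D. \<Sum>y\<in>D. if cc x y = z then f x * g y * lam x y else 0)"

abbreviation R where "R \<equiv> twisted_algebra D cc lam u"

lemma R_simps [simp]:
  "carrier R = W" "monoid.mult R = mul" "monoid.one R = basis_vector u" "ring.zero R = 0" "ring.add R = (+)"
  by (auto simp: twisted_algebra_def W_def mul_def basis_vector_def fun_eq_iff)

lemma lin_mul_left: "lin (mul z)"
proof (rule linI)
  show "mul z (f + g) = mul z f + mul z g" for f g
    unfolding mul_def plus_fun_def sum.distrib[symmetric]
    by (intro ext sum.cong refl) (simp add: algebra_simps)
  show "mul z (scale c f) = scale c (mul z f)" for c f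
    unfolding mul_def scale_def sum_distrib_left
    by (intro ext sum.cong refl) (simp add: algebra_simps)
qed

lemma lin_mul_right: "lin (\<lambda>x. mul x a)"
proof (rule linI)
  show "mul (f + g) a = mul f a + mul g a" for f g
    unfolding mul_def plus_fun_def sum.distrib[symmetric]
    by (intro ext sum.cong refl) (simp add: algebra_simps)
  show "mul (scale c f) a = scale c (mul f a)" for c f
    unfolding mul_def scale_def sum_distrib_left
    by (intro ext sum.cong refl) (simp add: algebra_simps)
qed

lemmas mul_add_right = lin_add[OF lin_mul_left] and mul_add_left = lin_add[OF lin_mul_right]
lemmas mul_diff_right = lin_diff[OF lin_mul_left] and mul_diff_left = lin_diff[OF lin_mul_right]
lemmas mul_scale_right = lin_scale[OF lin_mul_left] and mul_scale_left = lin_scale[OF lin_mul_right]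
lemmas mul_zero_right = lin_zero[OF lin_mul_left] and mul_zero_left = lin_zero[OF lin_mul_right]
lemmas mul_sum_right = lin_sum[OF lin_mul_left] and mul_sum_left = lin_sum[OF lin_mul_right]

lemma mul_W [simp]: "mul f g \<in> W"
  unfolding W_def mul_def by (auto intro!: sum.neutral dest: cc_closed)

lemma mul_basis:
  assumes "a \<in> D" "b \<in> D"
  shows "mul (basis_vector a) (basis_vector b) = scale (lam a b) (basis_vector (cc a b))"
proof
  fix z
  have "mul (basis_vector a) (basis_vector b) z
      = (\<Sum>x\<in>D. if x = a then (\<Sum>y\<in>D. if y = b then (if cc a b = z then lam a b else 0) else 0) else 0)"
    unfolding mul_def basis_vector_def by (intro sum.cong refl) (auto intro!: sum.neutral sum.cong)
  also have "\<dots> = (if cc a b = z then lam a b else 0)" using assms finite_D by simp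
  finally show "mul (basis_vector a) (basis_vector b) z = scale (lam a b) (basis_vector (cc a b)) z"
    by (simp add: basis_vector_def)
qed

lemma mul_assoc:
  assumes "f \<in> W" "g \<in> W" "h \<in> W"
  shows "mul (mul f g) h = mul f (mul g h)"
proof -
  have basis: "mul (mul (basis_vector a) (basis_vector b)) (basis_vector c)
      = mul (basis_vector a) (mul (basis_vector b) (basis_vector c))"
    if abc: "a \<in> D" "b \<in> D" "c \<in> D" for a b c
  proof -
    have l: "mul (mul (basis_vector a) (basis_vector b)) (basis_vector c)
        = scale (lam a b * lam (cc a b) c) (basis_vector (cc (cc a b) c))"
      using cc_closed[OF abc(1,2)] abc
      by (cases "lam a b = 0") (simp_all add: mul_basis mul_scale_left mul_zero_left)
    have r: "mul (basis_vector a) (mul (basis_vector b) (basis_vector c))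
        = scale (lam b c * lam a (cc b c)) (basis_vector (cc a (cc b c)))"
      using cc_closed[OF abc(2,3)] abc
      by (cases "lam b c = 0") (simp_all add: mul_basis mul_scale_right mul_zero_right)
    show ?thesis unfolding l r using lam_assoc[OF abc] cc_assoc[OF abc] by simp
  qed
  have 1: "mul (mul (basis_vector a) (basis_vector b)) h = mul (basis_vector a) (mul (basis_vector b) h)"
    if "a \<in> D" "b \<in> D" for a b
    by (rule lin_eq_on_basis[OF lin_mul_left lin_comp[OF lin_mul_left lin_mul_left] basis[OF that] assms(3)])
  have 2: "mul (mul (basis_vector a) g) h = mul (basis_vector a) (mul g h)" if "a \<in> D" for a
    by (rule lin_eq_on_basis[OF lin_comp[OF lin_mul_right lin_mul_left] lin_comp[OF lin_mul_left lin_mul_right] 1[OF that] assms(2)])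
  show ?thesis
    by (rule lin_eq_on_basis[OF lin_comp[OF lin_mul_right lin_mul_right] lin_mul_right 2 assms(1)])
qed

lemma mul_one_left: "f \<in> W \<Longrightarrow> mul (basis_vector u) f = f"
  by (rule lin_eq_on_basis[OF lin_mul_left lin_id]) (simp_all add: mul_basis u_D cc_unit lam_unit)

lemma mul_one_right: "f \<in> W \<Longrightarrow> mul f (basis_vector u) = f"
  by (rule lin_eq_on_basis[OF lin_mul_right lin_id]) (simp_all add: mul_basis u_D cc_unit lam_unit)

lemma ring_R: "ring R"
proof (rule ringI)
  show "abelian_group R"
  proof (rule abelian_groupI)
    fix x assume "x \<in> carrier R"
    then have "- x \<in> W" using V.subspace_neg[OF subspace_W] by simp
    then show "\<exists>y\<in>carrier R. y \<oplus>\<^bsub>R\<^esub> x = \<zero>\<^bsub>R\<^esub>" by (intro bexI[of _ "- x"]) auto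
  qed (auto simp: add_ac)
  show "Group.monoid R"
    by (rule Group.monoid.intro) (auto simp: mul_assoc mul_one_left mul_one_right u_D)
qed (auto simp: mul_add_left mul_add_right)

sublocale R: ring R
  by (rule ring_R)

lemma R_minus: "x \<in> W \<Longrightarrow> \<ominus>\<^bsub>R\<^esub> x = - x"
  using R.minus_equality[of "- x" x] V.subspace_neg[OF subspace_W, of x] by simp

lemma R_diff: "x \<in> W \<Longrightarrow> y \<in> W \<Longrightarrow> x \<ominus>\<^bsub>R\<^esub> y = x - y"
  by (simp add: a_minus_def R_minus)

text \<open>Scalars act through multiples of the unit, so left ideals are subspaces.\<close>

lemma left_ideal_R:
  assumes "left_ideal V R"
  shows "V.subspace V" "V \<subseteq> W" "a \<in> W \<Longrightarrow> x \<in> V \<Longrightarrow> mul a x \<in> V"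
proof -
  note V = left_ideal_mem[OF assms, simplified]
  show W: "V \<subseteq> W" and m: "a \<in> W \<Longrightarrow> x \<in> V \<Longrightarrow> mul a x \<in> V" for a x using V by auto
  show "V.subspace V"
  proof (rule V.subspaceI)
    fix c x assume x: "x \<in> V"
    have "scale c x = mul (scale c (basis_vector u)) x"
      using x W by (simp add: mul_scale_left mul_one_left subset_iff)
    then show "scale c x \<in> V" using m[of "scale c (basis_vector u)" x] x u_D by simp
  qed (use V in auto)
qed

lemma left_ideal_RI:
  assumes "V.subspace V" "V \<subseteq> W" "\<And>a x. a \<in> W \<Longrightarrow> x \<in> V \<Longrightarrow> mul a x \<in> V"
  shows "left_ideal V R"
  by (rule R.left_idealI) (use assms V.subspace_0 V.subspace_add in auto)

lemma ideal_R:
  assumes "ideal I R"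
  shows ideal_left_ideal: "left_ideal I R" and ideal_mul_right: "x \<in> I \<Longrightarrow> a \<in> W \<Longrightarrow> mul x a \<in> I"
proof -
  interpret ideal I R by fact
  show "left_ideal I R"
    by (rule R.left_idealI) (use a_subset I_l_closed zero_closed a_closed in auto)
  show "x \<in> I \<Longrightarrow> a \<in> W \<Longrightarrow> mul x a \<in> I" using I_r_closed[of x a] by simp
qed

lemma ideal_RI:
  assumes "V.subspace I" "I \<subseteq> W" "\<And>a x. a \<in> W \<Longrightarrow> x \<in> I \<Longrightarrow> mul a x \<in> I" "\<And>a x. a \<in> W \<Longrightarrow> x \<in> I \<Longrightarrow> mul x a \<in> I"
  shows "ideal I R"
proof (rule idealI[OF ring_R])
  interpret left_ideal I R by (rule left_ideal_RI[OF assms(1-3)])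
  show "subgroup I (add_monoid R)" by (rule a_subgroup)
qed (use assms in auto)

end

section \<open>Quotients by an ideal, and traces on projective layers\<close>

locale twisted_quotient = twisted_monoid D cc lam u for D :: "'d set" and cc and lam :: "'d \<Rightarrow> 'd \<Rightarrow> 'k::field" and u +
  fixes I assumes ideal_I: "ideal I (twisted_algebra D cc lam u)"
begin

sublocale I: ideal I R by (rule ideal_I)

abbreviation Q where "Q \<equiv> R Quot I"
abbreviation q where "q x \<equiv> I +>\<^bsub>R\<^esub> x"

lemma subspace_I: "V.subspace I" and I_W: "I \<subseteq> W"
  using left_ideal_R[OF ideal_left_ideal[OF ideal_I]] by auto

lemma I_mul_left: "a \<in> W \<Longrightarrow> x \<in> I \<Longrightarrow> mul a x \<in> I"
  using left_ideal_R(3)[OF ideal_left_ideal[OF ideal_I]] .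

lemma I_mul_right: "a \<in> W \<Longrightarrow> x \<in> I \<Longrightarrow> mul x a \<in> I"
  using ideal_mul_right[OF ideal_I] .

sublocale Q: ring Q by (rule I.quotient_is_ring)

lemma q_closed [simp]: "x \<in> W \<Longrightarrow> q x \<in> carrier Q"
  using ring_hom_closed[OF I.rcos_ring_hom, of x] by simp

lemma q_mul: "x \<in> W \<Longrightarrow> y \<in> W \<Longrightarrow> q (mul x y) = q x \<otimes>\<^bsub>Q\<^esub> q y"
  using ring_hom_mult[OF I.rcos_ring_hom, of x y] by simp

lemma q_add: "x \<in> W \<Longrightarrow> y \<in> W \<Longrightarrow> q (x + y) = q x \<oplus>\<^bsub>Q\<^esub> q y"
  using ring_hom_add[OF I.rcos_ring_hom, of x y] by simp

lemma q_one: "q (basis_vector u) = \<one>\<^bsub>Q\<^esub>"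
  using ring_hom_one[OF I.rcos_ring_hom] by simp

lemma q_zero: "q 0 = \<zero>\<^bsub>Q\<^esub>"
  using R.a_coset_add_zero[OF I.a_subset] by (simp add: FactRing_def)

lemma q_eq_iff: "x \<in> W \<Longrightarrow> y \<in> W \<Longrightarrow> q x = q y \<longleftrightarrow> x - y \<in> I"
proof -
  assume xy: "x \<in> W" "y \<in> W"
  have "q x = q y \<longleftrightarrow> x \<in> q y"
    using xy I.a_repr_independence' I.a_rcos_self[of x] by (metis R_simps(1) I.a_repr_independence')
  also have "\<dots> \<longleftrightarrow> x - y \<in> I" using I.a_rcos_module_minus[OF ring_R, of y x] xy by (simp add: R_diff)
  finally show ?thesis .
qed

lemma q_zero_iff: "x \<in> W \<Longrightarrow> q x = \<zero>\<^bsub>Q\<^esub> \<longleftrightarrow> x \<in> I"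
  using q_eq_iff[of x 0] q_zero by simp

lemma q_diff: "x \<in> W \<Longrightarrow> y \<in> W \<Longrightarrow> q (x - y) = q x \<ominus>\<^bsub>Q\<^esub> q y"
proof -
  assume xy: "x \<in> W" "y \<in> W"
  then have "q (x - y) \<oplus>\<^bsub>Q\<^esub> q y = q x" using q_add[of "x - y" y] by simp
  then show ?thesis using xy by (metis Q.add.inv_solve_right a_minus_def q_closed W_diff)
qed

lemma Q_surj: "X \<in> carrier Q \<Longrightarrow> \<exists>x\<in>W. X = q x"
  by (auto simp: FactRing_def A_RCOSETS_def')

lemma q_sum:
  assumes "finite K" "\<And>k. k \<in> K \<Longrightarrow> f k \<in> W"
  shows "q (\<Sum>k\<in>K. f k) = (\<Oplus>\<^bsub>Q\<^esub>k\<in>K. q (f k))"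
  using assms
proof (induction K rule: finite_induct)
  case (insert k K)
  have "(\<lambda>k. q (f k)) \<in> K \<rightarrow> carrier Q" "q (f k) \<in> carrier Q" using insert.prems by auto
  then have "(\<Oplus>\<^bsub>Q\<^esub>j\<in>insert k K. q (f j)) = q (f k) \<oplus>\<^bsub>Q\<^esub> (\<Oplus>\<^bsub>Q\<^esub>j\<in>K. q (f j))"
    using insert.hyps by (rule_tac Q.finsum_insert) auto
  moreover have "q (sum f (insert k K)) = q (f k) \<oplus>\<^bsub>Q\<^esub> q (sum f K)"
    unfolding sum.insert[OF insert.hyps] by (rule q_add) (use insert.prems in auto)
  moreover have "q (sum f K) = (\<Oplus>\<^bsub>Q\<^esub>j\<in>K. q (f j))" by (rule insert.IH) (use insert.prems in auto)
  ultimately show ?case by (simp only:)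
qed (simp add: q_zero)

lemma left_ideal_image:
  assumes L: "left_ideal L R" shows "left_ideal (q ` L) Q"
proof (rule Q.left_idealI)
  note L' = left_ideal_R[OF L]
  show "q ` L \<subseteq> carrier Q" using L'(2) by auto
  show "\<zero>\<^bsub>Q\<^esub> \<in> q ` L" using V.subspace_0[OF L'(1)] q_zero by force
  show "x \<oplus>\<^bsub>Q\<^esub> y \<in> q ` L" if "x \<in> q ` L" "y \<in> q ` L" for x y
    using that L'(2) V.subspace_add[OF L'(1)] by (auto simp: q_add[symmetric] subset_iff)
  show "a \<otimes>\<^bsub>Q\<^esub> x \<in> q ` L" if a: "a \<in> carrier Q" "x \<in> q ` L" for a x
  proof -
    obtain b where "b \<in> W" "a = q b" using Q_surj[OF a(1)] by auto
    then show ?thesis using a(2) L'(2,3) by (auto simp: q_mul[symmetric] subset_iff)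
  qed
qed

lemma left_ideal_preimage:
  assumes S: "left_ideal S Q" shows "left_ideal {x \<in> W. q x \<in> S} R"
  by (rule R.left_idealI) (use left_ideal_mem[OF S] in \<open>auto simp: q_zero q_add q_mul\<close>)

text \<open>As \<open>rho\<close> vanishes on \<open>I\<close>, the choice of a representative in \<open>rep\<close> does not matter.\<close>

definition rho where "rho f = f - subspace_proj I f"

definition rep where "rep X = rho (SOME x. x \<in> W \<and> q x = X)"

lemma lin_rho: "lin rho"
  unfolding rho_def by (rule lin_minus[OF lin_id lin_subspace_proj[OF subspace_I]])

lemma rho_I: "x \<in> I \<Longrightarrow> rho x = 0"
  by (simp add: rho_def subspace_proj_id[OF subspace_I])

lemma rho_eq: "x - y \<in> I \<Longrightarrow> rho x = rho y"
  using rho_I[of "x - y"] lin_diff[OF lin_rho] by simp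

lemma rho_diff: "x - rho x \<in> I" "rho x - x \<in> I"
  using subspace_proj_in[OF subspace_I] V.subspace_neg[OF subspace_I] by (simp_all add: rho_def)

lemma rho_in: "V.subspace V \<Longrightarrow> I \<subseteq> V \<Longrightarrow> x \<in> V \<Longrightarrow> rho x \<in> V"
  unfolding rho_def using subspace_proj_in[OF subspace_I] by (intro V.subspace_diff) auto

lemma rep_q: assumes x: "x \<in> W" shows "rep (q x) = rho x"
proof -
  define y where "y = (SOME y. y \<in> W \<and> q y = q x)"
  have "y \<in> W \<and> q y = q x" unfolding y_def by (rule someI[of _ x]) (use x in simp)
  then have "y - x \<in> I" using q_eq_iff x by blast
  then show ?thesis unfolding rep_def y_def[symmetric] by (rule rho_eq)
qed

lemma rep_W: "X \<in> carrier Q \<Longrightarrow> rep X \<in> W"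
  using Q_surj[of X] rep_q rho_in[OF subspace_W I_W] by auto

lemma q_rep: "X \<in> carrier Q \<Longrightarrow> q (rep X) = X"
proof -
  assume "X \<in> carrier Q"
  then obtain x where x: "x \<in> W" "X = q x" using Q_surj by auto
  then show ?thesis using rho_diff(2)[of x] q_eq_iff[of "rho x" x] rho_in[OF subspace_W I_W] by (simp add: rep_q)
qed

lemma tr_rho:
  assumes "V.subspace V" "V \<subseteq> W" "I \<subseteq> V" "lin \<phi>" "\<And>v. v \<in> V \<Longrightarrow> \<phi> v \<in> V" "\<And>v. v \<in> I \<Longrightarrow> \<phi> v \<in> I"
    and "\<And>v. v \<in> V \<Longrightarrow> \<psi> v - \<phi> v \<in> I"
  shows "Tr (\<lambda>f. rho (\<psi> (subspace_proj V f))) = tr V \<phi> - tr I \<phi>"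
  unfolding rho_def by (rule tr_quotient'[OF subspace_I assms])

text \<open>On \<open>J / I\<close> a dual basis writes \<open>z x a\<close> as the sum of the
  \<open>\<phi> k (z x) (h k) a\<close>. Each term is a composite of
  \<open>x \<mapsto> \<phi> k (z x)\<close> into \<open>R / I\<close> and
  \<open>y \<mapsto> y (h k) a\<close> back into \<open>J / I\<close>. Commuting the two under the
  trace turns it into \<open>x \<mapsto> z x b\<close> on \<open>R / I\<close> with
  \<open>b = \<phi> k (h k a)\<close>, which is traceless by \<open>hyp\<close>.\<close>

lemma trace_projective_step:
  assumes J: "ideal J R" and IJ: "I \<subseteq> J" and z: "z \<in> W"
    and proj: "projective_left_module Q (ideal_as_left_module Q (q ` J))"
    and hyp: "\<And>a. a \<in> W \<Longrightarrow> tr W (\<lambda>x. mul (mul z x) a) = tr I (\<lambda>x. mul (mul z x) a)"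
    and a: "a \<in> W"
  shows "tr J (\<lambda>x. mul (mul z x) a) = tr I (\<lambda>x. mul (mul z x) a)"
proof -
  note J' = left_ideal_R[OF ideal_left_ideal[OF J]]
  note p = subspace_proj[OF J'(1)]
  note JQ = left_ideal_image[OF ideal_left_ideal[OF J]]
  define \<pi> where "\<pi> = subspace_proj J"
  have \<pi>: "lin \<pi>" "\<And>f. \<pi> f \<in> J" "\<And>f. f \<in> J \<Longrightarrow> \<pi> f = f" using p by (simp_all add: \<pi>_def)
  have \<pi>W: "\<pi> f \<in> W" for f using \<pi>(2) J'(2) by auto
  define Y where "Y = (\<lambda>d. q (\<pi> (basis_vector d))) ` D"
  have Y: "finite Y" "Y \<subseteq> q ` J" using finite_D \<pi>(2) by (auto simp: Y_def)
  have gen: "q ` J \<subseteq> S" if S: "left_ideal S Q" "Y \<subseteq> S" for S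
  proof (rule image_subsetI)
    fix x assume x: "x \<in> J"
    note P = left_ideal_R[OF left_ideal_preimage[OF S(1)]]
    have "x = (\<Sum>d\<in>D. scale (x d) (\<pi> (basis_vector d)))"
      using \<pi>(3)[OF x] lin_expand[OF \<pi>(1), of x] x J'(2) by auto
    also have "\<dots> \<in> {x \<in> W. q x \<in> S}"
    proof (intro V.subspace_sum[OF P(1)] V.subspace_scale[OF P(1)])
      fix d assume "d \<in> D"
      then show "\<pi> (basis_vector d) \<in> {x \<in> W. q x \<in> S}" using S(2) \<pi>W by (auto simp: Y_def)
    qed
    finally show "q x \<in> S" by simp
  qed
  have gen': "\<forall>S. left_ideal S Q \<and> Y \<subseteq> S \<longrightarrow> q ` J \<subseteq> S" using gen by simp
  obtain K :: "('d \<Rightarrow> 'k) set set" and \<phi> h where K: "finite K"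
    and Kh: "\<forall>k\<in>K. h k \<in> q ` J \<and> (\<forall>x\<in>q ` J. \<phi> k x \<in> carrier Q)
      \<and> (\<forall>x\<in>q ` J. \<forall>y\<in>q ` J. \<phi> k (x \<oplus>\<^bsub>Q\<^esub> y) = \<phi> k x \<oplus>\<^bsub>Q\<^esub> \<phi> k y)
      \<and> (\<forall>a\<in>carrier Q. \<forall>x\<in>q ` J. \<phi> k (a \<otimes>\<^bsub>Q\<^esub> x) = a \<otimes>\<^bsub>Q\<^esub> \<phi> k x)"
    and dual: "\<forall>x\<in>q ` J. x = (\<Oplus>\<^bsub>Q\<^esub>k\<in>K. \<phi> k x \<otimes>\<^bsub>Q\<^esub> h k)"
    using Q.dual_basis_from_projective[OF JQ proj Y gen'] by (elim exE conjE) (rule that)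
  have \<phi>: "\<phi> k x \<in> carrier Q" if "k \<in> K" "x \<in> q ` J" for k x using Kh that by blast
  have \<phi>_add: "\<phi> k (x \<oplus>\<^bsub>Q\<^esub> y) = \<phi> k x \<oplus>\<^bsub>Q\<^esub> \<phi> k y" if "k \<in> K" "x \<in> q ` J" "y \<in> q ` J" for k x y
    using Kh that by blast
  have \<phi>_mult: "\<phi> k (a \<otimes>\<^bsub>Q\<^esub> x) = a \<otimes>\<^bsub>Q\<^esub> \<phi> k x" if "k \<in> K" "a \<in> carrier Q" "x \<in> q ` J" for k a x
    using Kh that by blast
  have h: "h k \<in> q ` J" if "k \<in> K" for k using Kh that by blast
  have "\<forall>k\<in>K. \<exists>x\<in>J. h k = q x" using h by blast
  then obtain hl where hl: "\<And>k. k \<in> K \<Longrightarrow> hl k \<in> J" "\<And>k. k \<in> K \<Longrightarrow> h k = q (hl k)" by metis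
  have hlW: "hl k \<in> W" if "k \<in> K" for k using hl(1)[OF that] J'(2) by auto
  \<comment> \<open>A lift of the functional to the function space: \<open>\<pi>\<close> moves the
    argument into \<open>J\<close>, and \<open>rep\<close> picks representatives so that the lift is
    linear and vanishes on \<open>I\<close>.\<close>
  define \<phi>l where "\<phi>l k x = rep (\<phi> k (q (\<pi> x)))" for k x
  have q\<phi>: "q (\<phi>l k x) = \<phi> k (q x)" if "k \<in> K" "x \<in> J" for k x
    using that \<phi>[OF that(1)] \<pi>(3) by (simp add: \<phi>l_def q_rep)
  have \<phi>W: "\<phi>l k x \<in> W" if "k \<in> K" for k x
    unfolding \<phi>l_def using \<phi>[OF that] \<pi>(2) by (intro rep_W) auto
  have \<phi>lin: "lin (\<phi>l k)" if k: "k \<in> K" for k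
  proof (rule linI)
    fix f g
    have c: "\<phi> k (q (\<pi> f)) \<in> carrier Q" for f using \<phi>[OF k] \<pi>(2) by auto
    obtain v w where vw: "v \<in> W" "w \<in> W" "\<phi> k (q (\<pi> f)) = q v" "\<phi> k (q (\<pi> g)) = q w"
      using Q_surj[OF c] by metis
    have "\<phi> k (q (\<pi> (f + g))) = \<phi> k (q (\<pi> f) \<oplus>\<^bsub>Q\<^esub> q (\<pi> g))"
      by (simp add: lin_add[OF \<pi>(1)] q_add[OF \<pi>W \<pi>W])
    also have "\<dots> = q (v + w)" using \<phi>_add[OF k, of "q (\<pi> f)" "q (\<pi> g)"] \<pi>(2) vw by (simp add: q_add)
    finally show "\<phi>l k (f + g) = \<phi>l k f + \<phi>l k g"
      using vw by (simp add: \<phi>l_def rep_q lin_add[OF lin_rho])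
    fix c :: 'k
    have cW: "scale c (basis_vector u) \<in> W" using u_D by simp
    have "q (\<pi> (scale c f)) = q (scale c (basis_vector u)) \<otimes>\<^bsub>Q\<^esub> q (\<pi> f)"
      unfolding q_mul[OF cW \<pi>W, symmetric] by (simp add: lin_scale[OF \<pi>(1)] mul_scale_left mul_one_left[OF \<pi>W])
    then have "\<phi> k (q (\<pi> (scale c f))) = q (scale c (basis_vector u)) \<otimes>\<^bsub>Q\<^esub> q v"
      using \<phi>_mult[OF k q_closed[OF cW], of "q (\<pi> f)"] \<pi>(2) vw by simp
    also have "\<dots> = q (scale c v)" unfolding q_mul[OF cW vw(1), symmetric] 
      using vw(1) by (simp add: mul_scale_left mul_one_left)
    finally show "\<phi>l k (scale c f) = scale c (\<phi>l k f)"
      using vw by (simp add: \<phi>l_def rep_q lin_scale[OF lin_rho])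
  qed
  have \<phi>I: "\<phi>l k x = 0" if k: "k \<in> K" and x: "x \<in> I" for k x
  proof -
    have "x \<in> W" "x \<in> J" using x I_W IJ by auto
    have z: "\<zero>\<^bsub>Q\<^esub> \<in> q ` J" by (rule left_ideal_mem(2)[OF JQ])
    have "\<phi> k \<zero>\<^bsub>Q\<^esub> = \<phi> k (\<zero>\<^bsub>Q\<^esub> \<otimes>\<^bsub>Q\<^esub> \<zero>\<^bsub>Q\<^esub>)" by simp
    also have "\<dots> = \<zero>\<^bsub>Q\<^esub> \<otimes>\<^bsub>Q\<^esub> \<phi> k \<zero>\<^bsub>Q\<^esub>" by (rule \<phi>_mult[OF k _ z]) simp
    also have "\<dots> = \<zero>\<^bsub>Q\<^esub>" using \<phi>[OF k z] by simp
    finally have "\<phi> k (q x) = q 0" using q_zero_iff[OF \<open>x \<in> W\<close>] x q_zero by simp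
    then show ?thesis using \<pi>(3)[OF \<open>x \<in> J\<close>] rep_q[of 0] rho_I[of 0] V.subspace_0[OF subspace_I] by (simp add: \<phi>l_def)
  qed
  have dual': "x - (\<Sum>k\<in>K. mul (\<phi>l k x) (hl k)) \<in> I" if x: "x \<in> J" for x
  proof -
    have "q (\<Sum>k\<in>K. mul (\<phi>l k x) (hl k)) = (\<Oplus>\<^bsub>Q\<^esub>k\<in>K. q (mul (\<phi>l k x) (hl k)))"
      by (rule q_sum[OF K]) simp
    also have "\<dots> = (\<Oplus>\<^bsub>Q\<^esub>k\<in>K. \<phi> k (q x) \<otimes>\<^bsub>Q\<^esub> h k)"
      by (rule Q.finsum_cong') (use \<phi> h left_ideal_mem(1)[OF JQ] x hl \<phi>W hlW q\<phi> in \<open>auto simp: q_mul\<close>)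
    also have "\<dots> = q x" using dual x by simp
    finally have "q x = q (\<Sum>k\<in>K. mul (\<phi>l k x) (hl k))" by simp
    then show ?thesis using q_eq_iff[of x "\<Sum>k\<in>K. mul (\<phi>l k x) (hl k)"] x J'(2) by auto
  qed
  let ?M = "\<lambda>a x. mul (mul z x) a"
  have linM: "lin (?M a)" for a by (rule lin_comp[OF lin_mul_right lin_mul_left])
  have MI: "?M a x \<in> I" if "x \<in> I" "a \<in> W" for a x using that I_mul_left I_mul_right z by simp
  have JM: "mul (mul x (hl k)) a \<in> J" if "x \<in> W" "k \<in> K" for x k
    using that J'(3) hl(1) ideal_mul_right[OF J] a by simp
  define \<psi> where "\<psi> v = (\<Sum>k\<in>K. mul (mul (\<phi>l k (mul z v)) (hl k)) a)" for v
  have "tr J (?M a) - tr I (?M a) = Tr (\<lambda>f. rho (\<psi> (\<pi> f)))"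
    unfolding \<pi>_def
  proof (rule tr_rho[symmetric, OF J'(1,2) IJ linM])
    show "?M a v \<in> J" if "v \<in> J" for v using that J'(3)[OF z] ideal_mul_right[OF J _ a] by simp
    show "?M a v \<in> I" if "v \<in> I" for v using MI[OF that a] .
    show "\<psi> v - ?M a v \<in> I" if v: "v \<in> J" for v
    proof -
      have "mul z v \<in> J" using J'(3)[OF z v] .
      then have "mul (mul z v - (\<Sum>k\<in>K. mul (\<phi>l k (mul z v)) (hl k))) a \<in> I"
        by (rule I_mul_right[OF a dual'])
      then have "- (?M a v - \<psi> v) \<in> I"
        by (intro V.subspace_neg[OF subspace_I]) (simp add: mul_diff_left mul_sum_left \<psi>_def)
      then show ?thesis by simp
    qed
  qed
  also have "\<dots> = (\<Sum>k\<in>K. Tr (\<lambda>f. rho (mul (mul (\<phi>l k (mul z (\<pi> f))) (hl k)) a)))"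
    unfolding \<psi>_def lin_sum[OF lin_rho] by (rule Tr_sum)
  also have "\<dots> = (\<Sum>k\<in>K. 0)"
  proof (rule sum.cong[OF refl])
    fix k assume k: "k \<in> K"
    \<comment> \<open>After commuting, left linearity of \<open>\<phi> k\<close> moves
      \<open>z f\<close> out of \<open>\<phi> k (z f (h k) a)\<close> and leaves this right
      factor.\<close>
    define b where "b = \<phi>l k (mul (hl k) a)"
    have bW: "b \<in> W" by (simp add: b_def \<phi>W[OF k])
    let ?\<alpha> = "\<lambda>y. rho (mul (mul y (hl k)) a)" and ?\<beta> = "\<lambda>f. \<phi>l k (mul z (\<pi> f))"
    have "Tr (\<lambda>f. ?\<alpha> (?\<beta> f)) = Tr (\<lambda>f. ?\<beta> (?\<alpha> f))"
    proof (rule Tr_comm[of ?\<alpha> ?\<beta>])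
      show "lin ?\<alpha>" by (rule lin_comp[OF lin_rho lin_comp[OF lin_mul_right lin_mul_right]])
      show "lin ?\<beta>" by (rule lin_comp[OF \<phi>lin[OF k] lin_comp[OF lin_mul_left \<pi>(1)]])
      show "?\<alpha> f \<in> W" for f by (rule rho_in[OF subspace_W I_W mul_W])
      show "?\<beta> f \<in> W" for f by (rule \<phi>W[OF k])
    qed
    also have "\<dots> = Tr (\<lambda>f. rho (?M b (subspace_proj W f)))"
    proof (rule Tr_cong)
      fix f :: "'d \<Rightarrow> 'k" assume f: "f \<in> W"
      let ?w = "mul (mul f (hl k)) a"
      have w: "?w \<in> J" "?w \<in> W" using JM[OF f k] by auto
      have "?\<beta> (?\<alpha> f) = \<phi>l k (mul z (rho ?w))"
        using \<pi>(3)[OF rho_in[OF J'(1) IJ w(1)]] by simp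
      also have "\<dots> = \<phi>l k (mul z ?w)"
      proof -
        have "mul z (rho ?w - ?w) \<in> I" using rho_diff(2) I_mul_left[OF z] by simp
        then have "\<phi>l k (mul z (rho ?w) - mul z ?w) = 0" using \<phi>I[OF k] by (simp add: mul_diff_right)
        then show ?thesis using lin_diff[OF \<phi>lin[OF k]] by simp
      qed
      also have "mul z ?w = mul (mul z f) (mul (hl k) a)"
        using z f hlW[OF k] a by (simp add: mul_assoc)
      also have "\<phi>l k (mul (mul z f) (mul (hl k) a)) = rho (?M b f)"
      proof -
        have ha: "mul (hl k) a \<in> J" using ideal_mul_right[OF J hl(1)[OF k] a] .
        then have "mul (mul z f) (mul (hl k) a) \<in> J" using J'(3) by simp
        then have "\<phi>l k (mul (mul z f) (mul (hl k) a)) = rep (\<phi> k (q (mul z f) \<otimes>\<^bsub>Q\<^esub> q (mul (hl k) a)))"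
          by (simp add: \<phi>l_def \<pi>(3) q_mul)
        also have "\<phi> k (q (mul z f) \<otimes>\<^bsub>Q\<^esub> q (mul (hl k) a)) = q (mul z f) \<otimes>\<^bsub>Q\<^esub> \<phi> k (q (mul (hl k) a))"
          by (rule \<phi>_mult[OF k]) (use ha in auto)
        also have "\<dots> = q (?M b f)" using q\<phi>[OF k ha] bW by (simp add: q_mul b_def)
        finally show ?thesis by (simp add: rep_q)
      qed
      finally show "?\<beta> (?\<alpha> f) = rho (?M b (subspace_proj W f))"
        using subspace_proj_id[OF subspace_W f] by simp
    qed
    also have "\<dots> = tr W (?M b) - tr I (?M b)"
      by (rule tr_rho[OF subspace_W order_refl I_W linM]) (use MI bW V.subspace_0[OF subspace_I] in auto)
    also have "\<dots> = 0" using hyp[OF bW] by simp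
    finally show "Tr (\<lambda>f. rho (mul (mul (\<phi>l k (mul z (\<pi> f))) (hl k)) a)) = 0" .
  qed
  finally show ?thesis by simp
qed

end

context function_space
begin

lemma finite_independent:
  fixes B :: "('d \<Rightarrow> 'k::field) set"
  assumes "V.independent B" "B \<subseteq> W"
  shows "finite B"
proof -
  have "W \<subseteq> V.span (basis_vector ` D :: ('d \<Rightarrow> 'k) set)"
  proof
    fix f :: "'d \<Rightarrow> 'k" assume "f \<in> W"
    then have "f = (\<Sum>d\<in>D. scale (f d) (basis_vector d))" by (rule expand)
    also have "\<dots> \<in> V.span (basis_vector ` D)"
      by (intro V.span_sum V.span_scale V.span_base imageI)
    finally show "f \<in> V.span (basis_vector ` D)" .
  qed
  then show ?thesis using V.independent_span_bound[of "basis_vector ` D" B] assms finite_D by auto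
qed

lemma dim_strict_mono:
  assumes U: "V.subspace U" and V: "V \<subseteq> W" and UV: "U \<subset> V"
  shows "V.dim U < V.dim V"
proof -
  obtain B where B: "B \<subseteq> U" "V.independent B" "U \<subseteq> V.span B" "card B = V.dim U"
    using V.basis_exists by blast
  obtain v where v: "v \<in> V" "v \<notin> U" using UV by auto
  have "V.span B \<subseteq> U" by (rule V.span_minimal[OF B(1) U])
  then have iv: "V.independent (insert v B)" using v B(2) by (intro V.independent_insertI) auto
  obtain B' where B': "insert v B \<subseteq> B'" "B' \<subseteq> V" "V.independent B'" "V \<subseteq> V.span B'"
    using V.maximal_independent_subset_extend[OF _ iv, of V] B(1) UV v by auto
  have fin: "finite B'" using finite_independent[OF B'(3)] B'(2) V by blast
  have "card B' = V.dim V" by (rule V.basis_card_eq_dim[OF B'(2,4,3)])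
  moreover have "card (insert v B) \<le> card B'" by (rule card_mono[OF fin B'(1)])
  moreover have "v \<notin> B" using B(1) v by auto
  moreover have "finite B" using fin B'(1) finite_subset by auto
  ultimately show ?thesis using B(4) by simp
qed

end

section \<open>Traces on subquotients of the regular module\<close>

context twisted_quotient
begin

lemma left_ideal_product_add:
  assumes L: "left_ideal L R" and U: "left_ideal U R" and s: "s \<in> W"
  shows "left_ideal {mul l s + u | l u. l \<in> L \<and> u \<in> U} R"
proof -
  note L' = left_ideal_R[OF L] and U' = left_ideal_R[OF U]
  let ?X = "{mul l s + u | l u. l \<in> L \<and> u \<in> U}"
  show ?thesis
  proof (rule left_ideal_RI)
    show "V.subspace ?X"
    proof (rule V.subspaceI)
      have "0 = mul 0 s + 0" by (simp add: mul_zero_left)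
      then show "0 \<in> ?X" using V.subspace_0[OF L'(1)] V.subspace_0[OF U'(1)] by blast
      fix x y assume "x \<in> ?X" "y \<in> ?X"
      then obtain l u l' u' where e: "x = mul l s + u" "y = mul l' s + u'" "l \<in> L" "u \<in> U" "l' \<in> L" "u' \<in> U" by blast
      have "x + y = mul (l + l') s + (u + u')" by (simp only: e mul_add_left add_ac)
      then show "x + y \<in> ?X" using V.subspace_add[OF L'(1) e(3,5)] V.subspace_add[OF U'(1) e(4,6)] by blast
    next
      fix c x assume "x \<in> ?X"
      then obtain l u where e: "x = mul l s + u" "l \<in> L" "u \<in> U" by blast
      have "scale c x = mul (scale c l) s + scale c u" by (simp only: e mul_scale_left V.scale_right_distrib)
      then show "scale c x \<in> ?X" using V.subspace_scale[OF L'(1) e(2)] V.subspace_scale[OF U'(1) e(3)] by blast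
    qed
    show "?X \<subseteq> W"
    proof
      fix x assume "x \<in> ?X"
      then obtain l u where e: "x = mul l s + u" "u \<in> U" by blast
      then show "x \<in> W" using W_add[OF mul_W] U'(2) by blast
    qed
    fix a x :: "'d \<Rightarrow> 'k" assume a: "a \<in> W" and "x \<in> ?X"
    then obtain l u where e: "x = mul l s + u" "l \<in> L" "u \<in> U" by blast
    have "l \<in> W" using e L'(2) by auto
    then have "mul a x = mul (mul a l) s + mul a u" by (simp only: e mul_add_right mul_assoc[OF a _ s])
    then show "mul a x \<in> ?X" using L'(3)[OF a e(2)] U'(3)[OF a e(3)] by blast
  qed
qed

text \<open>A simple module \<open>V / U\<close> not annihilated by \<open>J\<close> is the head of the projective left ideal
  \<open>L\<close> modulo \<open>I\<close> below, and the radical \<open>L0\<close> of \<open>L\<close> is annihilated by \<open>J\<close>.\<close>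

lemma trace_simple:
  assumes J: "ideal J R" and IJ: "I \<subseteq> J" and z: "z \<in> W"
    and rad: "\<And>x r y. x \<in> J \<Longrightarrow> r \<in> W \<Longrightarrow> q r \<in> jacobson_radical Q \<Longrightarrow> y \<in> J \<Longrightarrow> mul (mul x r) y \<in> I"
    and hyp: "\<And>a. a \<in> W \<Longrightarrow> tr W (\<lambda>x. mul (mul z x) a) = tr I (\<lambda>x. mul (mul z x) a)"
    and IH: "\<And>U V. left_ideal U R \<Longrightarrow> left_ideal V R \<Longrightarrow> U \<subseteq> V \<Longrightarrow> (\<And>x v. x \<in> J \<Longrightarrow> v \<in> V \<Longrightarrow> mul x v \<in> U)
      \<Longrightarrow> tr V (mul z) = tr U (mul z)"
    and U: "left_ideal U R" and V: "left_ideal V R" and UV: "U \<subseteq> V"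
    and IV: "\<And>x v. x \<in> I \<Longrightarrow> v \<in> V \<Longrightarrow> mul x v \<in> U"
    and simple: "\<And>X. left_ideal X R \<Longrightarrow> U \<subseteq> X \<Longrightarrow> X \<subseteq> V \<Longrightarrow> X = U \<or> X = V"
    and JV: "x \<in> J" "v \<in> V" "mul x v \<notin> U"
  shows "tr V (mul z) = tr U (mul z)"
proof -
  note J' = left_ideal_R[OF ideal_left_ideal[OF J]]
  note U' = left_ideal_R[OF U] and V' = left_ideal_R[OF V]
  \<comment> \<open>Minimal dimension among the left ideals between \<open>I\<close> and
    \<open>J\<close> that do not annihilate \<open>V / U\<close>; by this minimality
    \<open>L\<close> has to coincide with several of its subideals below.\<close>
  let ?P = "\<lambda>L. left_ideal L R \<and> I \<subseteq> L \<and> L \<subseteq> J \<and> (\<exists>l\<in>L. \<exists>v\<in>V. mul l v \<notin> U)"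
  have "?P J" using ideal_left_ideal[OF J] IJ JV by blast
  then obtain L where PL: "?P L" and min: "\<And>L'. ?P L' \<Longrightarrow> V.dim L \<le> V.dim L'"
    using ex_has_least_nat[of ?P J V.dim] by blast
  have L: "left_ideal L R" "I \<subseteq> L" "L \<subseteq> J" using PL by auto
  note L' = left_ideal_R[OF L(1)]
  have minL: "X = L" if X: "left_ideal X R" "I \<subseteq> X" "X \<subseteq> L" "\<exists>l\<in>X. \<exists>v\<in>V. mul l v \<notin> U" for X
  proof (rule ccontr)
    assume "X \<noteq> L"
    then have "V.dim X < V.dim L" using X(3) by (intro dim_strict_mono[OF left_ideal_R(1)[OF X(1)] L'(2)]) auto
    moreover have "?P X" using X L(3) by auto
    ultimately show False using min[of X] by simp
  qed
  obtain l0 s where l0: "l0 \<in> L" "s \<in> V" "mul l0 s \<notin> U" using PL by blast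
  have W: "s \<in> W" "l0 \<in> W" using l0 V'(2) L'(2) by auto
  have LW: "l \<in> W" if "l \<in> L" for l using that L'(2) by auto
  have Ineg: "i \<in> I \<Longrightarrow> - i \<in> I" for i by (rule V.subspace_neg[OF subspace_I])
  have X: "{mul l s + u | l u. l \<in> L \<and> u \<in> U} = V"
  proof -
    let ?X = "{mul l s + u | l u. l \<in> L \<and> u \<in> U}"
    have "left_ideal ?X R" by (rule left_ideal_product_add[OF L(1) U W(1)])
    moreover have "U \<subseteq> ?X"
    proof
      fix u assume u: "u \<in> U"
      have "u = mul 0 s + u" by (simp add: mul_zero_left)
      then show "u \<in> ?X" using u V.subspace_0[OF L'(1)] by blast
    qed
    moreover have "?X \<subseteq> V"
    proof
      fix y assume "y \<in> ?X"
      then obtain l u where e: "y = mul l s + u" "l \<in> L" "u \<in> U" by blast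
      show "y \<in> V" unfolding e(1)
        using V'(3)[OF LW[OF e(2)] l0(2)] e(3) UV by (intro V.subspace_add[OF V'(1)]) auto
    qed
    moreover have "?X \<noteq> U"
    proof
      assume "?X = U"
      moreover have "mul l0 s = mul l0 s + 0" by simp
      then have "mul l0 s \<in> ?X" using l0(1) V.subspace_0[OF U'(1)] by blast
      ultimately show False using l0(3) by simp
    qed
    ultimately show ?thesis using simple by blast
  qed
  \<comment> \<open>As \<open>s\<close> itself lies in \<open>L s + U\<close>, some \<open>f\<close>
    in \<open>L\<close> fixes \<open>s\<close> modulo \<open>U\<close>. Modulo \<open>I\<close> it
    will be an idempotent that generates \<open>L\<close>.\<close>
  then obtain f us where fs: "s = mul f s + us" "f \<in> L" "us \<in> U" using l0(2) by blast
  have fW: "f \<in> W" using LW fs(2) .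
  have sfs: "s - mul f s \<in> U" using fs(3) fs(1) by (metis add_diff_cancel_left')
  have congU: "mul y s \<in> U \<longleftrightarrow> mul (mul y f) s \<in> U" if y: "y \<in> W" for y
  proof -
    have "mul y s - mul (mul y f) s \<in> U"
      using U'(3)[OF y sfs] by (simp only: mul_diff_right mul_assoc[OF y fW W(1)])
    then show ?thesis
      using V.subspace_add[OF U'(1), of "mul y s - mul (mul y f) s" "mul (mul y f) s"]
        V.subspace_diff[OF U'(1), of "mul y s" "mul y s - mul (mul y f) s"] by auto
  qed
  have IU: "mul i s \<in> U" if "i \<in> I" for i using IV[OF that l0(2)] .
  \<comment> \<open>The kernel of the map \<open>x \<mapsto> x s\<close> from \<open>L\<close> onto
    \<open>V / U\<close>.\<close>
  define L0 where "L0 = {x \<in> L. mul x s \<in> U}"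
  have L0: "left_ideal L0 R"
  proof (rule left_ideal_RI)
    show "V.subspace L0"
      unfolding L0_def using V.subspace_0[OF L'(1)] V.subspace_0[OF U'(1)] V.subspace_add[OF L'(1)] V.subspace_add[OF U'(1)]
        V.subspace_scale[OF L'(1)] V.subspace_scale[OF U'(1)]
      by (intro V.subspaceI) (auto simp only: mul_zero_left mul_add_left mul_scale_left mem_Collect_eq)
    show "L0 \<subseteq> W" using L'(2) by (auto simp: L0_def)
    fix a x :: "'d \<Rightarrow> 'k" assume ax: "a \<in> W" "x \<in> L0"
    then have "x \<in> L" "x \<in> W" "mul x s \<in> U" using L'(2) by (auto simp: L0_def)
    then show "mul a x \<in> L0" using L'(3)[OF ax(1)] U'(3)[OF ax(1)] by (simp add: L0_def mul_assoc ax W)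
  qed
  note L0' = left_ideal_R[OF L0]
  have IL0: "I \<subseteq> L0" using L(2) IU by (auto simp: L0_def)
  have L0L: "L0 \<subseteq> L" by (auto simp: L0_def)
  have L0J: "L0 \<subseteq> J" using L0L L(3) by auto
  \<comment> \<open>If \<open>L0\<close> moved any element of \<open>V\<close> out of
    \<open>U\<close>, it would equal \<open>L\<close> by minimality, although \<open>l0\<close> is
    not in it.\<close>
  have L0V: "mul x v \<in> U" if x: "x \<in> L0" and v: "v \<in> V" for x v
  proof (rule ccontr)
    assume "mul x v \<notin> U"
    then have "L0 = L" using x v by (intro minL[OF L0 IL0 L0L]) blast
    then show False using l0 by (auto simp: L0_def)
  qed
  \<comment> \<open>For \<open>x\<close> in \<open>L0\<close> the left ideal
    \<open>L (1 - x) + I\<close> still acts nontrivially, since \<open>x s\<close> lies in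
    \<open>U\<close>; hence it is \<open>L\<close>. Writing \<open>x = l (1 - x) + i\<close> shows
    that \<open>1 + l\<close> is a left inverse of \<open>1 - x\<close> modulo \<open>I\<close>, so
    \<open>L0\<close> falls into the radical of the quotient.\<close>
  have quasi: "\<exists>y\<in>carrier Q. y \<otimes>\<^bsub>Q\<^esub> (\<one>\<^bsub>Q\<^esub> \<ominus>\<^bsub>Q\<^esub> X) = \<one>\<^bsub>Q\<^esub>" if X: "X \<in> q ` L0" for X
  proof -
    obtain x where x: "x \<in> L0" "X = q x" using X by auto
    have xW: "x \<in> W" and xL: "x \<in> L" using x L0'(2) L0L by auto
    let ?e = "basis_vector u :: 'd \<Rightarrow> 'k"
    have eW: "?e \<in> W" using u_D by simp
    let ?X = "{mul l (?e - x) + i | l i. l \<in> L \<and> i \<in> I}"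
    have red: "mul l (?e - x) = l - mul l x" if "l \<in> L" for l
      by (simp only: mul_diff_right mul_one_right[OF LW[OF that]])
    have "?X = L"
    proof (rule minL)
      show "left_ideal ?X R" by (rule left_ideal_product_add[OF L(1) ideal_left_ideal[OF ideal_I]]) (use eW xW in simp)
      show "I \<subseteq> ?X"
      proof
        fix i assume i: "i \<in> I"
        have "i = mul 0 (?e - x) + i" by (simp add: mul_zero_left)
        then show "i \<in> ?X" using i V.subspace_0[OF L'(1)] by blast
      qed
      show "?X \<subseteq> L"
      proof
        fix y assume "y \<in> ?X"
        then obtain l i where e: "y = mul l (?e - x) + i" "l \<in> L" "i \<in> I" by blast
        have "l - mul l x \<in> L" using L'(3)[OF LW[OF e(2)] xL] e(2) by (intro V.subspace_diff[OF L'(1)])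
        then show "y \<in> L" unfolding e(1) red[OF e(2)] using e(3) L(2) by (intro V.subspace_add[OF L'(1)]) auto
      qed
      have "mul l0 (?e - x) = mul l0 (?e - x) + 0" by simp
      then have 1: "mul l0 (?e - x) \<in> ?X" using l0(1) V.subspace_0[OF subspace_I] by blast
      have "mul (mul l0 (?e - x)) s \<notin> U"
      proof
        assume "mul (mul l0 (?e - x)) s \<in> U"
        then have "mul l0 s - mul l0 (mul x s) \<in> U"
          unfolding red[OF l0(1)] by (simp only: mul_diff_left mul_assoc[OF W(2) xW W(1)])
        moreover have "mul l0 (mul x s) \<in> U" using U'(3)[OF W(2)] x by (simp add: L0_def)
        ultimately have "mul l0 s - mul l0 (mul x s) + mul l0 (mul x s) \<in> U" by (rule V.subspace_add[OF U'(1)])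
        then show False using l0(3) by (simp only: diff_add_cancel)
      qed
      then show "\<exists>l\<in>?X. \<exists>v\<in>V. mul l v \<notin> U" using 1 l0(2) by blast
    qed
    then obtain l i where e: "x = mul l (?e - x) + i" "l \<in> L" "i \<in> I" using xL by blast
    have lW: "l \<in> W" using LW e(2) .
    have "mul (?e + l) (?e - x) = ?e - i"
    proof -
      have "mul (?e + l) (?e - x) = (?e - x) + mul l (?e - x)"
        by (simp only: mul_add_left mul_one_left[OF W_diff[OF eW xW]])
      also have "mul l (?e - x) = x - i" using e(1) by (metis add_diff_cancel_right')
      finally show ?thesis by (simp only: add_diff_eq diff_add_cancel)
    qed
    then have "q (mul (?e + l) (?e - x)) = q ?e"
      using q_eq_iff[of "mul (?e + l) (?e - x)" ?e] eW Ineg[OF e(3)]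
        W_diff[OF eW subsetD[OF I_W e(3)]] by simp
    then have "q (?e + l) \<otimes>\<^bsub>Q\<^esub> (\<one>\<^bsub>Q\<^esub> \<ominus>\<^bsub>Q\<^esub> X) = \<one>\<^bsub>Q\<^esub>"
      unfolding q_mul[OF W_add[OF eW lW] W_diff[OF eW xW]] q_diff[OF eW xW] q_one x(2) .
    then show ?thesis using q_closed[OF W_add[OF eW lW]] by blast
  qed
  have L0rad: "q x \<in> jacobson_radical Q" if "x \<in> L0" for x
    using Q.radicalI[OF left_ideal_image[OF L0] quasi] that by blast
  \<comment> \<open>Right multiplication by \<open>f\<close> does not change the action on
    \<open>s\<close> modulo \<open>U\<close>, so \<open>L f + I\<close> acts nontrivially and
    minimality applies again.\<close>
  have Lf: "{mul l f + i | l i. l \<in> L \<and> i \<in> I} = L"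
  proof (rule minL)
    let ?X = "{mul l f + i | l i. l \<in> L \<and> i \<in> I}"
    show "left_ideal ?X R" by (rule left_ideal_product_add[OF L(1) ideal_left_ideal[OF ideal_I] fW])
    show "I \<subseteq> ?X"
    proof
      fix i assume i: "i \<in> I"
      have "i = mul 0 f + i" by (simp add: mul_zero_left)
      then show "i \<in> ?X" using i V.subspace_0[OF L'(1)] by blast
    qed
    show "?X \<subseteq> L"
    proof
      fix y assume "y \<in> ?X"
      then obtain l i where e: "y = mul l f + i" "l \<in> L" "i \<in> I" by blast
      show "y \<in> L" unfolding e(1) using L'(3)[OF LW[OF e(2)] fs(2)] e(3) L(2) by (intro V.subspace_add[OF L'(1)]) auto
    qed
    have "mul l0 f = mul l0 f + 0" by simp
    then have "mul l0 f \<in> ?X" using l0(1) V.subspace_0[OF subspace_I] by blast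
    moreover have "mul (mul l0 f) s \<notin> U" using congU[OF W(2)] l0(3) by simp
    ultimately show "\<exists>l\<in>?X. \<exists>v\<in>V. mul l v \<notin> U" using l0(2) by blast
  qed
  \<comment> \<open>Write \<open>x = y f + i\<close>. Then \<open>y f s\<close>, hence
    \<open>y s\<close>, lies in \<open>U\<close>, so \<open>y\<close> is in \<open>L0\<close> and
    thus radical; \<open>j y f\<close> is then a product of the form \<open>J N J\<close>.\<close>
  have JL0: "mul j x \<in> I" if j: "j \<in> J" and x: "x \<in> L0" for j x
  proof -
    have jW: "j \<in> W" using j J'(2) by auto
    have "x \<in> L" using x L0L by auto
    then obtain y i where e: "x = mul y f + i" "y \<in> L" "i \<in> I" using Lf by blast
    have yW: "y \<in> W" using LW e(2) .
    have "mul (mul y f) s \<in> U"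
    proof -
      have "mul (mul y f) s + mul i s \<in> U" using x unfolding e(1) by (simp add: L0_def mul_add_left)
      then have "mul (mul y f) s + mul i s - mul i s \<in> U" using IU[OF e(3)] by (rule V.subspace_diff[OF U'(1)])
      then show ?thesis by (simp only: add_diff_cancel_right')
    qed
    then have "y \<in> L0" using congU[OF yW] e(2) by (simp add: L0_def)
    then have "mul (mul j y) f \<in> I" using rad[OF j yW L0rad] fs(2) L(3) by blast
    moreover have "mul j x = mul (mul j y) f + mul j i" by (simp only: e(1) mul_add_right mul_assoc[OF jW yW fW])
    ultimately show ?thesis using I_mul_left[OF jW e(3)] V.subspace_add[OF subspace_I] by simp
  qed
  have tL0: "tr L0 (mul z) = tr I (mul z)"
    by (rule IH[OF ideal_left_ideal[OF ideal_I] L0 IL0 JL0])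
  \<comment> \<open>The defect \<open>f f - f\<close> lies in \<open>L0\<close> and is killed by
    \<open>J\<close> modulo \<open>I\<close>; so \<open>f\<close> is a right unit for
    \<open>L\<close> modulo \<open>I\<close>.\<close>
  have xf: "mul x f - x \<in> I" if x: "x \<in> L" for x
  proof -
    obtain y i where e: "x = mul y f + i" "y \<in> L" "i \<in> I" using Lf x by blast
    have yW: "y \<in> W" and iW: "i \<in> W" using LW e(2) e(3) I_W by auto
    have "mul f f - f \<in> L0"
    proof -
      have "mul f f - f \<in> L" using L'(3)[OF fW fs(2)] fs(2) by (intro V.subspace_diff[OF L'(1)])
      moreover have "mul (mul f f - f) s = - mul f (s - mul f s)"
        by (simp only: mul_diff_left mul_diff_right mul_assoc[OF fW fW W(1)] minus_diff_eq)
      ultimately show ?thesis using V.subspace_neg[OF U'(1) U'(3)[OF fW sfs]] by (simp only: L0_def mem_Collect_eq)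
    qed
    then have "mul y (mul f f - f) \<in> I" using JL0 e(2) L(3) by blast
    then have 1: "mul (mul y f) f - mul y f \<in> I" by (simp only: mul_diff_right mul_assoc[OF yW fW fW])
    have "mul x f - x = (mul (mul y f) f - mul y f) + (mul i f - i)"
      unfolding e(1) mul_add_left by (simp add: fun_eq_iff)
    moreover have "mul i f - i \<in> I" using I_mul_right[OF fW e(3)] e(3) by (rule V.subspace_diff[OF subspace_I])
    ultimately show ?thesis using V.subspace_add[OF subspace_I 1] by simp
  qed
  \<comment> \<open>On \<open>L / I\<close> multiplication by \<open>z\<close> agrees with
    \<open>x \<mapsto> z x f\<close>. That map sends all of \<open>W\<close> into \<open>L\<close>,
    so its trace on \<open>L\<close> is its trace on \<open>W\<close>, to which \<open>hyp\<close>
    applies.\<close>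
  have tL: "tr L (mul z) = tr I (mul z)"
  proof -
    let ?M = "\<lambda>x. mul (mul z x) f"
    have linM: "lin ?M" by (rule lin_comp[OF lin_mul_right lin_mul_left])
    have MinL: "?M x \<in> L" for x using L'(3)[OF mul_W fs(2)] .
    have MI: "?M x \<in> I" if "x \<in> I" for x using that I_mul_left[OF z] I_mul_right[OF fW] by simp
    note l = subspace_proj[OF L'(1)]
    have "tr W ?M = Tr (\<lambda>x. subspace_proj L (?M x))" unfolding tr_W by (rule Tr_cong) (simp only: l(3)[OF MinL])
    also have "\<dots> = Tr (\<lambda>x. ?M (subspace_proj L x))"
      by (rule Tr_comm[OF l(1) linM]) (use l(2) L'(2) in auto)
    finally have "tr L ?M = tr I ?M" using hyp[OF fW] by (simp add: tr_def)
    then have "Tr (\<lambda>x. rho (?M (subspace_proj L x))) = 0"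
      using tr_rho[OF L'(1,2) L(2) linM MinL MI, of ?M] V.subspace_0[OF subspace_I] by simp
    moreover have "Tr (\<lambda>x. rho (?M (subspace_proj L x))) = tr L (mul z) - tr I (mul z)"
    proof (rule tr_rho[OF L'(1,2) L(2) lin_mul_left])
      show "mul z v \<in> L" if "v \<in> L" for v using L'(3)[OF z that] .
      show "mul z v \<in> I" if "v \<in> I" for v using I_mul_left[OF z that] .
      show "?M v - mul z v \<in> I" if v: "v \<in> L" for v
        using I_mul_left[OF z xf[OF v]] by (simp only: mul_diff_right mul_assoc[OF z LW[OF v] fW])
    qed
    ultimately show ?thesis by simp
  qed
  have "tr V (mul z) - tr U (mul z) = tr L (mul z) - tr L0 (mul z)"
  proof (rule tr_quotient_iso[OF U'(1) V'(1,2) UV L0'(1) L'(1,2) L0_def lin_mul_left])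
    show "mul (mul z x) s - mul z (mul x s) \<in> U" if "x \<in> L" for x
      using V.subspace_0[OF U'(1)] by (simp add: mul_assoc[OF z LW[OF that] W(1)])
    show "\<exists>x\<in>L. v - mul x s \<in> U" if v: "v \<in> V" for v
    proof -
      obtain l w where "v = mul l s + w" "l \<in> L" "w \<in> U" using X v by blast
      then show ?thesis by (intro bexI[of _ l]) (simp_all only: add_diff_cancel_left')
    qed
    show "mul x s \<in> V" if "x \<in> L" for x using V'(3)[OF LW[OF that] l0(2)] .
  qed (use V'(3)[OF z] U'(3)[OF z] L'(3)[OF z] L0'(3)[OF z] lin_mul_right in auto)
  then show ?thesis using tL tL0 by simp
qed

text \<open>Equality of traces is additive along chains of left ideals, so induction on the
  dimension reduces to simple \<open>V / U\<close>. If \<open>J\<close> kills it, the assumption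
  \<open>IH\<close> applies; otherwise it is covered by \<open>trace_simple\<close>.\<close>

lemma trace_heredity_step:
  assumes J: "ideal J R" and IJ: "I \<subseteq> J" and z: "z \<in> W"
    and rad: "\<And>x r y. x \<in> J \<Longrightarrow> r \<in> W \<Longrightarrow> q r \<in> jacobson_radical Q \<Longrightarrow> y \<in> J \<Longrightarrow> mul (mul x r) y \<in> I"
    and hyp: "\<And>a. a \<in> W \<Longrightarrow> tr W (\<lambda>x. mul (mul z x) a) = tr I (\<lambda>x. mul (mul z x) a)"
    and IH: "\<And>U V. left_ideal U R \<Longrightarrow> left_ideal V R \<Longrightarrow> U \<subseteq> V \<Longrightarrow> (\<And>x v. x \<in> J \<Longrightarrow> v \<in> V \<Longrightarrow> mul x v \<in> U)
      \<Longrightarrow> tr V (mul z) = tr U (mul z)"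
  shows "left_ideal U R \<Longrightarrow> left_ideal V R \<Longrightarrow> U \<subseteq> V \<Longrightarrow> (\<And>x v. x \<in> I \<Longrightarrow> v \<in> V \<Longrightarrow> mul x v \<in> U)
      \<Longrightarrow> tr V (mul z) = tr U (mul z)"
proof (induction "V.dim V - V.dim U" arbitrary: U V rule: less_induct)
  case less
  note U = less.prems(1) and V = less.prems(2) and UV = less.prems(3) and IV = less.prems(4)
  note U' = left_ideal_R[OF U] and V' = left_ideal_R[OF V]
  show ?case
  proof (cases "\<exists>X. left_ideal X R \<and> U \<subset> X \<and> X \<subset> V")
    case True
    then obtain X where X: "left_ideal X R" "U \<subset> X" "X \<subset> V" by auto
    note X' = left_ideal_R[OF X(1)]
    have d: "V.dim U < V.dim X" "V.dim X < V.dim V"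
      using dim_strict_mono[OF U'(1) X'(2) X(2)] dim_strict_mono[OF X'(1) V'(2) X(3)] .
    have "tr V (mul z) = tr X (mul z)"
      by (rule less.hyps) (use d X V IV in auto)
    also have "\<dots> = tr U (mul z)"
      by (rule less.hyps) (use d X U IV in auto)
    finally show ?thesis .
  next
    case False
    then have simple: "X = U \<or> X = V" if "left_ideal X R" "U \<subseteq> X" "X \<subseteq> V" for X using that by blast
    show ?thesis
    proof (cases "\<exists>x\<in>J. \<exists>v\<in>V. mul x v \<notin> U")
      case True
      then obtain x v where xv: "x \<in> J" "v \<in> V" "mul x v \<notin> U" by auto
      show ?thesis
      proof (rule trace_simple[OF J IJ z _ _ _ U V UV _ _ xv])
        show "mul (mul x r) y \<in> I"
          if "x \<in> J" "r \<in> W" "q r \<in> jacobson_radical Q" "y \<in> J" for x r y using rad[OF that] .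
        show "tr W (\<lambda>x. mul (mul z x) a) = tr I (\<lambda>x. mul (mul z x) a)" if "a \<in> W" for a using hyp[OF that] .
        show "tr V (mul z) = tr U (mul z)" if "left_ideal U R" "left_ideal V R" "U \<subseteq> V"
          "\<And>x v. x \<in> J \<Longrightarrow> v \<in> V \<Longrightarrow> mul x v \<in> U" for U V by (rule IH) (use that in auto)
        show "mul x v \<in> U" if "x \<in> I" "v \<in> V" for x v using IV[OF that] .
        show "X = U \<or> X = V" if "left_ideal X R" "U \<subseteq> X" "X \<subseteq> V" for X using simple[OF that] .
      qed
    next
      case False
      then show ?thesis by (intro IH[OF U V UV]) auto
    qed
  qed
qed

end

section \<open>Descent of tracelessness along the heredity chain\<close>

text \<open>The chain is used twice. Going up, \<open>zeros\<close> carries the trace condition from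
  the whole algebra to every \<open>J i\<close>. Going down, equality of traces is shown for
  subquotients killed by \<open>J i\<close>: for \<open>J t\<close>, the whole algebra, these are
  zero, and for \<open>J 0\<close> they are all subquotients.\<close>

lemma (in twisted_monoid) quasi_hereditary_trace:
  assumes qh: "quasi_hereditary R" and z: "z \<in> W"
    and hyp: "\<And>a. a \<in> W \<Longrightarrow> tr W (\<lambda>x. mul (mul z x) a) = 0"
    and UV: "left_ideal U R" "left_ideal V R" "U \<subseteq> V"
  shows "tr V (mul z) = tr U (mul z)"
proof -
  obtain t J where J0: "J 0 = {0}" and Jt: "J t = W" and Ji: "\<And>i. i \<le> t \<Longrightarrow> ideal (J i) R"
    and step: "\<And>i. i < t \<Longrightarrow> J i \<subseteq> J (Suc i) \<and>
      heredity_ideal ((\<lambda>x. J i +>\<^bsub>R\<^esub> x) ` J (Suc i)) (R Quot (J i))"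
    using qh unfolding quasi_hereditary_def by auto
  have tq: "twisted_quotient D cc lam u (J i)" if "i \<le> t" for i
    by (intro twisted_quotient.intro twisted_quotient_axioms.intro twisted_monoid_axioms Ji[OF that])
  have tr0: "tr {0} \<phi> = 0" if "lin \<phi>" for \<phi> :: "('d \<Rightarrow> 'k) \<Rightarrow> 'd \<Rightarrow> 'k"
  proof -
    have "subspace_proj {0} f = 0" for f :: "'d \<Rightarrow> 'k"
      using subspace_proj_in[OF V.subspace_single_0] by simp
    then show ?thesis by (simp add: tr_def Tr_def lin_zero[OF that])
  qed
  have zeros: "\<forall>a\<in>W. tr (J i) (\<lambda>x. mul (mul z x) a) = 0" if "i \<le> t" for i
    using that
  proof (induction i)
    case 0
    then show ?case using tr0[OF lin_comp[OF lin_mul_right lin_mul_left]] by (simp add: J0)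
  next
    case (Suc i)
    then have IH: "\<forall>a\<in>W. tr (J i) (\<lambda>x. mul (mul z x) a) = 0" by simp
    interpret tq: twisted_quotient D cc lam u "J i" using tq Suc.prems by simp
    have h: "J i \<subseteq> J (Suc i)" "heredity_ideal ((\<lambda>x. J i +>\<^bsub>R\<^esub> x) ` J (Suc i)) (R Quot (J i))"
      using step[of i] Suc.prems by auto
    show ?case
    proof
      fix a :: "'d \<Rightarrow> 'k" assume a: "a \<in> W"
      have "tr (J (Suc i)) (\<lambda>x. mul (mul z x) a) = tr (J i) (\<lambda>x. mul (mul z x) a)"
        by (rule tq.trace_projective_step[OF Ji[OF Suc.prems] h(1) z _ _ a])
          (use h(2) hyp IH in \<open>auto simp: heredity_ideal_def\<close>)
      then show "tr (J (Suc i)) (\<lambda>x. mul (mul z x) a) = 0" using IH a by simp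
    qed
  qed
  have "\<forall>U V. left_ideal U R \<longrightarrow> left_ideal V R \<longrightarrow> U \<subseteq> V \<longrightarrow> (\<forall>x\<in>J (t - k). \<forall>v\<in>V. mul x v \<in> U)
      \<longrightarrow> tr V (mul z) = tr U (mul z)" if "k \<le> t" for k
    using that
  proof (induction k)
    case 0
    show ?case
    proof (intro allI impI)
      fix U V assume U: "left_ideal U R" "left_ideal V R" "U \<subseteq> V" and "\<forall>x\<in>J (t - 0). \<forall>v\<in>V. mul x v \<in> U"
      then have a: "\<forall>v\<in>V. mul (basis_vector u) v \<in> U" using Jt u_D by simp
      have "V \<subseteq> U"
      proof
        fix v assume v: "v \<in> V"
        then have "v \<in> W" using left_ideal_R(2)[OF U(2)] by auto
        then show "v \<in> U" using a v mul_one_left by metis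
      qed
      then show "tr V (mul z) = tr U (mul z)" using U(3) by (simp add: subset_antisym)
    qed
  next
    case (Suc k)
    define i where "i = t - Suc k"
    have i: "i < t" "t - k = Suc i" using Suc.prems by (auto simp: i_def)
    interpret tq: twisted_quotient D cc lam u "J i" using tq i by simp
    have h: "J i \<subseteq> J (Suc i)" "heredity_ideal ((\<lambda>x. J i +>\<^bsub>R\<^esub> x) ` J (Suc i)) (R Quot (J i))"
      using step[OF i(1)] by auto
    have JW: "J (Suc i) \<subseteq> W" using left_ideal_R(2)[OF ideal_left_ideal[OF Ji]] i(1) by simp
    have IH: "tr V (mul z) = tr U (mul z)" 
      if "left_ideal U R" "left_ideal V R" "U \<subseteq> V" "\<And>x v. x \<in> J (Suc i) \<Longrightarrow> v \<in> V \<Longrightarrow> mul x v \<in> U" for U V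
      using Suc.IH Suc.prems that by (simp add: i(2))
    have rad: "mul (mul x r) y \<in> J i"
      if x: "x \<in> J (Suc i)" and r: "r \<in> W" "tq.q r \<in> jacobson_radical (R Quot (J i))" and y: "y \<in> J (Suc i)" for x r y :: "'d \<Rightarrow> 'k"
    proof -
      have W: "x \<in> W" "y \<in> W" using x y JW by auto
      have "tq.q x \<otimes>\<^bsub>tq.Q\<^esub> tq.q r \<otimes>\<^bsub>tq.Q\<^esub> tq.q y = \<zero>\<^bsub>tq.Q\<^esub>"
        using h(2) x y r(2) unfolding heredity_ideal_def by blast
      then have "tq.q (mul (mul x r) y) = \<zero>\<^bsub>tq.Q\<^esub>" using W r(1) by (simp add: tq.q_mul)
      then show ?thesis using tq.q_zero_iff[of "mul (mul x r) y"] by simp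
    qed
    show ?case
    proof (intro allI impI)
      fix U V assume U: "left_ideal U R" "left_ideal V R" "U \<subseteq> V" and a: "\<forall>x\<in>J (t - Suc k). \<forall>v\<in>V. mul x v \<in> U"
      show "tr V (mul z) = tr U (mul z)"
      proof (rule tq.trace_heredity_step[OF _ h(1) z _ _ _ U])
        show "mul (mul x r) y \<in> J i"
          if "x \<in> J (Suc i)" "r \<in> W" "tq.q r \<in> jacobson_radical (R Quot (J i))" "y \<in> J (Suc i)" for x r y
          using rad[OF that] .
        show "tr V (mul z) = tr U (mul z)" if "left_ideal U R" "left_ideal V R" "U \<subseteq> V"
          "\<And>x v. x \<in> J (Suc i) \<Longrightarrow> v \<in> V \<Longrightarrow> mul x v \<in> U" for U V by (rule IH) (use that in auto)
        show "ideal (J (Suc i)) R" using Ji i by simp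
        show "tr W (\<lambda>x. mul (mul z x) b) = tr (J i) (\<lambda>x. mul (mul z x) b)" if "b \<in> W" for b
          using hyp[OF that] zeros[of i] that i by simp
        show "mul x v \<in> U" if "x \<in> J i" "v \<in> V" for x v using a that by (simp add: i_def)
      qed
    qed
  qed
  from this[of t] have "tr V (mul z) = tr U (mul z)" if "\<And>x v. x \<in> J 0 \<Longrightarrow> v \<in> V \<Longrightarrow> mul x v \<in> U"
    using UV that by simp
  moreover have "mul x v \<in> U" if "x \<in> J 0" for x v
    using that V.subspace_0[OF left_ideal_R(1)[OF UV(1)]] by (simp add: J0 mul_zero_left)
  ultimately show ?thesis by simp
qed


section \<open>Algebras of diagrams with arcs\<close>

text \<open>\<open>T\<close> and \<open>B\<close> play the role of the sets of arcs joining two northern and two southern nodes.\<close>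

locale diagram_algebra = twisted_monoid D cc lam u for D :: "'d set" and cc and lam :: "'d \<Rightarrow> 'd \<Rightarrow> 'k::field" and u +
  fixes T B :: "'d \<Rightarrow> 'e set"
  assumes finite_T: "\<And>x. x \<in> D \<Longrightarrow> finite (T x)" and finite_B: "\<And>x. x \<in> D \<Longrightarrow> finite (B x)"
    and card_T_B: "\<And>x. x \<in> D \<Longrightarrow> card (T x) = card (B x)"
    and T_mono: "\<And>x y. x \<in> D \<Longrightarrow> y \<in> D \<Longrightarrow> T x \<subseteq> T (cc x y)"
    and B_mono: "\<And>x y. x \<in> D \<Longrightarrow> y \<in> D \<Longrightarrow> B y \<subseteq> B (cc x y)"
    and lam_free: "\<And>x y. x \<in> D \<Longrightarrow> y \<in> D \<Longrightarrow> T x = {} \<or> T y = {} \<Longrightarrow> lam x y = 1"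
    and trans_left: "\<And>x y. x \<in> D \<Longrightarrow> y \<in> D \<Longrightarrow> B x = B y \<Longrightarrow> \<exists>g\<in>D. T g = {} \<and> cc g x = y"
    and trans_right: "\<And>x y. x \<in> D \<Longrightarrow> y \<in> D \<Longrightarrow> T x = T y \<Longrightarrow> \<exists>g\<in>D. T g = {} \<and> cc x g = y"
    and left_step: "\<And>w s. w \<in> D \<Longrightarrow> s \<in> T w \<Longrightarrow> \<exists>k\<in>D. \<exists>c. c \<noteq> 0 \<and> s \<in> T k
      \<and> (\<forall>x\<in>D. s \<in> T x \<longrightarrow> cc k x = x \<and> lam k x = c) \<and> (\<forall>y\<in>D. \<forall>t\<in>T w. t \<in> T y \<longrightarrow> t \<in> T (cc k y))"
    and right_step: "\<And>w s. w \<in> D \<Longrightarrow> s \<in> B w \<Longrightarrow> \<exists>k\<in>D. \<exists>c. c \<noteq> 0 \<and> s \<in> B k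
      \<and> (\<forall>x\<in>D. s \<in> B x \<longrightarrow> cc x k = x \<and> lam x k = c) \<and> (\<forall>y\<in>D. \<forall>t\<in>B w. t \<in> B y \<longrightarrow> t \<in> B (cc y k))"
begin

abbreviation e :: "'d \<Rightarrow> 'd \<Rightarrow> 'k" where "e \<equiv> basis_vector"

definition rk :: "'d \<Rightarrow> nat" where "rk d = card (T d)"

definition \<Gamma> :: "'d set" where "\<Gamma> = {x \<in> D. T x = {}}"

lemma rk_B: "x \<in> D \<Longrightarrow> rk x = card (B x)"
  by (simp add: rk_def card_T_B)

lemma B_empty: "x \<in> D \<Longrightarrow> B x = {} \<longleftrightarrow> T x = {}"
  using card_T_B[of x] card_0_eq[OF finite_T, of x] card_0_eq[OF finite_B, of x] by simp

lemma mul_support: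
  assumes "mul f g d \<noteq> 0"
  obtains x y where "x \<in> D" "y \<in> D" "f x \<noteq> 0" "g y \<noteq> 0" "cc x y = d" "d \<in> D"
proof -
  obtain x where x: "x \<in> D" "(\<Sum>y\<in>D. if cc x y = d then f x * g y * lam x y else 0) \<noteq> 0"
    using assms sum.not_neutral_contains_not_neutral unfolding mul_def by blast
  obtain y where y: "y \<in> D" "(if cc x y = d then f x * g y * lam x y else 0) \<noteq> 0"
    by (rule sum.not_neutral_contains_not_neutral[OF x(2)])
  then have "cc x y = d" "f x \<noteq> 0" "g y \<noteq> 0" "lam x y \<noteq> 0" by (auto split: if_splits)
  then show ?thesis using x(1) y(1) cc_closed[of x y] that by blast
qed

text \<open>One arc of \<open>T w\<close> is treated at a time by multiplying with its normalised
  diagram \<open>k\<close> from \<open>left_step\<close>. That \<open>k\<close> contributes the new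
  arc and keeps those already collected; on diagrams containing the whole of \<open>T w\<close>
  every factor acts as 1.\<close>

lemma left_unit:
  assumes w: "w \<in> D"
  shows "\<exists>E\<in>W. (\<forall>d. E d \<noteq> 0 \<longrightarrow> T w \<subseteq> T d) \<and> (\<forall>x\<in>D. T w \<subseteq> T x \<longrightarrow> mul E (e x) = e x)"
proof -
  have "\<exists>E\<in>W. (\<forall>d. E d \<noteq> 0 \<longrightarrow> S \<subseteq> T d) \<and> (\<forall>x\<in>D. T w \<subseteq> T x \<longrightarrow> mul E (e x) = e x)"
    if "finite S" "S \<subseteq> T w" for S
    using that
  proof (induction S rule: finite_induct)
    case empty
    then show ?case using u_D mul_one_left by (intro bexI[of _ "e u"]) auto
  next
    case (insert s S)
    then obtain E where E: "E \<in> W" "\<forall>d. E d \<noteq> 0 \<longrightarrow> S \<subseteq> T d" "\<forall>x\<in>D. T w \<subseteq> T x \<longrightarrow> mul E (e x) = e x"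
      by auto
    have s: "s \<in> T w" using insert.prems by simp
    obtain k c where k: "k \<in> D" "c \<noteq> 0" "s \<in> T k" "\<And>x. x \<in> D \<Longrightarrow> s \<in> T x \<Longrightarrow> cc k x = x \<and> lam k x = c"
      "\<And>y t. y \<in> D \<Longrightarrow> t \<in> T w \<Longrightarrow> t \<in> T y \<Longrightarrow> t \<in> T (cc k y)"
      using left_step[OF w s] by blast
    let ?E = "scale (1 / c) (mul (e k) E)"
    have "insert s S \<subseteq> T d" if d: "?E d \<noteq> 0" for d
    proof -
      have "mul (e k) E d \<noteq> 0" using d by auto
      then obtain x y where xy: "x \<in> D" "y \<in> D" "e k x \<noteq> 0" "E y \<noteq> 0" "cc x y = d" by (rule mul_support)
      have "x = k" using xy(3) by (auto simp: basis_vector_def split: if_splits)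
      then have "T k \<subseteq> T d" using T_mono[OF xy(1,2)] xy(5) by simp
      moreover have "t \<in> T d" if "t \<in> S" for t
        using k(5)[OF xy(2), of t] E(2) xy(4,5) insert.prems that \<open>x = k\<close> by auto
      ultimately show ?thesis using k(3) by blast
    qed
    moreover have "mul ?E (e x) = e x" if x: "x \<in> D" "T w \<subseteq> T x" for x
    proof -
      have "mul ?E (e x) = scale (1 / c) (mul (e k) (mul E (e x)))"
        using k(1) E(1) x(1) by (simp only: mul_scale_left mul_assoc[OF W_basis[OF k(1)] E(1) W_basis[OF x(1)]])
      also have "mul E (e x) = e x" using E(3) x by blast
      also have "mul (e k) (e x) = scale c (e x)" using mul_basis[OF k(1) x(1)] k(4)[OF x(1)] x(2) s by auto
      also have "scale (1 / c) (scale c (e x)) = e x" using k(2) by (simp add: V.scale_scale)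
      finally show ?thesis .
    qed
    moreover have "?E \<in> W" by (rule W_scale[OF mul_W])
    ultimately show ?case by blast
  qed
  from this[OF finite_T[OF w] order_refl] show ?thesis .
qed

text \<open>The axioms are invariant under reversing the product and exchanging \<open>T\<close> and
  \<open>B\<close>; since the two sets of arcs have equal size, both vanish for the same
  diagrams.\<close>

lemma op_diagram_algebra: "diagram_algebra D (\<lambda>x y. cc y x) (\<lambda>x y. lam y x) u B T"
proof
  show "lam y x * lam z (cc y x) = lam z y * lam (cc z y) x" if "x \<in> D" "y \<in> D" "z \<in> D" for x y z
    using lam_assoc[OF that(3,2,1)] by simp
  show "lam y x = 1" if "x \<in> D" "y \<in> D" "B x = {} \<or> B y = {}" for x y
    using lam_free[OF that(2,1)] that B_empty by blast
  show "\<exists>g\<in>D. B g = {} \<and> cc x g = y" if "x \<in> D" "y \<in> D" "T x = T y" for x y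
    using trans_right[OF that] B_empty by blast
  show "\<exists>g\<in>D. B g = {} \<and> cc g x = y" if "x \<in> D" "y \<in> D" "B x = B y" for x y
    using trans_left[OF that] B_empty by blast
qed (use finite_D u_D cc_closed cc_assoc cc_unit lam_unit finite_T finite_B card_T_B T_mono B_mono left_step right_step in auto)

lemma op_mul: "twisted_monoid.mul D (\<lambda>x y. cc y x) (\<lambda>x y. lam y x) f g = mul g f"
proof -
  interpret op: diagram_algebra D "\<lambda>x y. cc y x" "\<lambda>x y. lam y x" u B T by (rule op_diagram_algebra)
  show ?thesis unfolding op.mul_def mul_def
    by (rule ext, subst sum.swap) (auto intro!: sum.cong)
qed

lemma right_unit:
  assumes w: "w \<in> D"
  shows "\<exists>E\<in>W. (\<forall>d. E d \<noteq> 0 \<longrightarrow> B w \<subseteq> B d) \<and> (\<forall>x\<in>D. B w \<subseteq> B x \<longrightarrow> mul (e x) E = e x)"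
proof -
  interpret op: diagram_algebra D "\<lambda>x y. cc y x" "\<lambda>x y. lam y x" u B T by (rule op_diagram_algebra)
  show ?thesis using op.left_unit[OF w] unfolding op_mul .
qed

lemma T_u: "T u = {}"
proof -
  obtain g where "g \<in> D" "T g = {}" "cc g u = u" using trans_left[OF u_D u_D refl] by blast
  then show ?thesis using cc_unit(2)[of g] by simp
qed

lemma u_\<Gamma>: "u \<in> \<Gamma>"
  using T_u u_D by (simp add: \<Gamma>_def)

lemma \<Gamma>_act:
  assumes "g \<in> \<Gamma>" "x \<in> D"
  shows "cc g x \<in> D" "cc x g \<in> D" "mul (e g) (e x) = e (cc g x)" "mul (e x) (e g) = e (cc x g)"
proof -
  have g: "g \<in> D" "T g = {}" using assms by (auto simp: \<Gamma>_def)
  have l: "lam g x = 1" "lam x g = 1" using lam_free g assms(2) by auto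
  show "cc g x \<in> D" "cc x g \<in> D" using cc_closed g(1) assms(2) l by auto
  show "mul (e g) (e x) = e (cc g x)" "mul (e x) (e g) = e (cc x g)"
    using mul_basis g(1) assms(2) l by (simp_all add: V.scale_one)
qed

text \<open>Elements of \<open>\<Gamma>\<close> and the unit have the same (empty) set of southern
  arcs, so transitivity provides the inverse.\<close>

lemma \<Gamma>_left_inverse:
  assumes g: "g \<in> \<Gamma>" shows "\<exists>h\<in>\<Gamma>. cc h g = u"
proof -
  have "g \<in> D" "B g = B u" using g u_D T_u B_empty by (auto simp: \<Gamma>_def)
  then obtain h where "h \<in> D" "T h = {}" "cc h g = u" using trans_left[OF _ u_D] by blast
  then show ?thesis by (auto simp: \<Gamma>_def)
qed

lemma \<Gamma>_D: "g \<in> \<Gamma> \<Longrightarrow> g \<in> D"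
  by (simp add: \<Gamma>_def)

lemma B_\<Gamma>_act:
  assumes g: "g \<in> \<Gamma>" and x: "x \<in> D"
  shows "B (cc g x) = B x"
proof
  obtain h where h: "h \<in> \<Gamma>" "cc h g = u" using \<Gamma>_left_inverse[OF g] by blast
  have "cc h (cc g x) = x" using cc_assoc[OF \<Gamma>_D[OF h(1)] \<Gamma>_D[OF g] x] h(2) cc_unit x by simp
  then show "B (cc g x) \<subseteq> B x" using B_mono[OF \<Gamma>_D[OF h(1)] \<Gamma>_act(1)[OF g x]] by simp
  show "B x \<subseteq> B (cc g x)" by (rule B_mono[OF \<Gamma>_D[OF g] x])
qed

lemma T_\<Gamma>_act:
  assumes g: "g \<in> \<Gamma>" and x: "x \<in> D"
  shows "T (cc x g) = T x"
proof -
  interpret op: diagram_algebra D "\<lambda>x y. cc y x" "\<lambda>x y. lam y x" u B T by (rule op_diagram_algebra)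
  have "g \<in> op.\<Gamma>" using g B_empty by (auto simp: \<Gamma>_def op.\<Gamma>_def)
  from op.B_\<Gamma>_act[OF this x] show ?thesis .
qed

lemma \<Gamma>_closed: "g \<in> \<Gamma> \<Longrightarrow> h \<in> \<Gamma> \<Longrightarrow> cc g h \<in> \<Gamma>"
  using T_\<Gamma>_act[of h g] \<Gamma>_act(1)[of g h] by (simp add: \<Gamma>_def)

text \<open>Northern arcs of the upper and southern arcs of the lower factor persist in a product.
  Hence the diagrams outside \<open>\<Gamma>\<close> are closed under products with anything, which
  makes \<open>\<chi>\<close> multiplicative.\<close>

lemma \<Gamma>_factors:
  assumes "x \<in> D" "y \<in> D" "cc x y \<in> \<Gamma>"
  shows "x \<in> \<Gamma>" "y \<in> \<Gamma>"
proof -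
  have "T (cc x y) = {}" "B (cc x y) = {}" using assms(3) B_empty by (auto simp: \<Gamma>_def)
  then have "T x = {}" "B y = {}" using T_mono[OF assms(1,2)] B_mono[OF assms(1,2)] by auto
  then show "x \<in> \<Gamma>" "y \<in> \<Gamma>" using assms B_empty by (auto simp: \<Gamma>_def)
qed

lemma \<Gamma>_cancel:
  assumes "g \<in> \<Gamma>" "h \<in> D" "cc g h = g"
  shows "h = u"
proof -
  obtain g' where g': "g' \<in> \<Gamma>" "cc g' g = u" using \<Gamma>_left_inverse[OF assms(1)] by blast
  have "h = cc (cc g' g) h" using g'(2) cc_unit assms(2) by simp
  also have "\<dots> = cc g' (cc g h)" by (rule cc_assoc[OF \<Gamma>_D[OF g'(1)] \<Gamma>_D[OF assms(1)] assms(2)])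
  finally show ?thesis using assms(3) g'(2) by simp
qed

lemma finite_\<Gamma>: "finite \<Gamma>"
  using finite_D by (simp add: \<Gamma>_def)

text \<open>The trivial representation: diagrams outside \<open>\<Gamma>\<close> act by zero.\<close>

definition \<chi> :: "('d \<Rightarrow> 'k) \<Rightarrow> 'k" where "\<chi> f = (\<Sum>g\<in>\<Gamma>. f g)"

lemma \<chi>_linear: "\<chi> (f + g) = \<chi> f + \<chi> g" "\<chi> (f - g) = \<chi> f - \<chi> g" "\<chi> (scale c f) = c * \<chi> f" "\<chi> 0 = 0"
  by (simp_all add: \<chi>_def sum.distrib sum_subtractf sum_distrib_left)

lemma \<chi>_basis: "d \<in> D \<Longrightarrow> \<chi> (e d) = (if d \<in> \<Gamma> then 1 else 0)"
  using finite_\<Gamma> by (simp add: \<chi>_def basis_vector_def)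

lemma \<chi>_mul: "\<chi> (mul f g) = \<chi> f * \<chi> g"
proof -
  have "\<chi> (mul f g) = (\<Sum>x\<in>D. \<Sum>y\<in>D. \<Sum>z\<in>\<Gamma>. if cc x y = z then f x * g y * lam x y else 0)"
    unfolding \<chi>_def mul_def by (subst sum.swap, rule sum.cong[OF refl], rule sum.swap)
  also have "\<dots> = (\<Sum>x\<in>D. \<Sum>y\<in>D. (if x \<in> \<Gamma> then f x else 0) * (if y \<in> \<Gamma> then g y else 0))"
  proof (intro sum.cong refl)
    fix x y assume xy: "x \<in> D" "y \<in> D"
    have "(\<Sum>z\<in>\<Gamma>. if cc x y = z then f x * g y * lam x y else 0) = (if cc x y \<in> \<Gamma> then f x * g y * lam x y else 0)"
      using finite_\<Gamma> by simp
    also have "\<dots> = (if x \<in> \<Gamma> then f x else 0) * (if y \<in> \<Gamma> then g y else 0)"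
    proof (cases "x \<in> \<Gamma> \<and> y \<in> \<Gamma>")
      case True
      then have "cc x y \<in> \<Gamma>" "lam x y = 1" using \<Gamma>_closed lam_free[OF xy] by (auto simp: \<Gamma>_def)
      then show ?thesis using True by simp
    next
      case False
      then have "cc x y \<notin> \<Gamma>" using \<Gamma>_factors[OF xy] by blast
      then show ?thesis using False by auto
    qed
    finally show "(\<Sum>z\<in>\<Gamma>. if cc x y = z then f x * g y * lam x y else 0)
      = (if x \<in> \<Gamma> then f x else 0) * (if y \<in> \<Gamma> then g y else 0)" .
  qed
  also have "\<dots> = (\<Sum>x\<in>D. if x \<in> \<Gamma> then f x else 0) * (\<Sum>y\<in>D. if y \<in> \<Gamma> then g y else 0)"
    by (simp add: sum_product)
  also have "\<dots> = \<chi> f * \<chi> g"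
  proof -
    have "D \<inter> \<Gamma> = \<Gamma>" by (auto simp: \<Gamma>_def)
    then show ?thesis using finite_D by (simp add: \<chi>_def sum.If_cases)
  qed
  finally show ?thesis .
qed

lemma trace_trivial:
  shows "left_ideal {f \<in> W. \<chi> f = 0} R"
    and "tr W (mul z) - tr {f \<in> W. \<chi> f = 0} (mul z) = \<chi> z"
proof -
  let ?K = "{f \<in> W. \<chi> f = 0}"
  show li: "left_ideal ?K R"
    by (rule R.left_idealI) (auto simp: \<chi>_linear \<chi>_mul)
  note K = left_ideal_R[OF li]
  note k = subspace_proj[OF K(1)]
  have \<chi>u: "\<chi> (e u) = 1" using u_D u_\<Gamma> by (simp add: \<chi>_basis)
  \<comment> \<open>Modulo the kernel of \<open>\<chi>\<close> every \<open>v\<close> is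
    \<open>\<chi> v\<close> times the unit, so multiplication by \<open>z\<close> may be replaced by
    this map of rank at most one.\<close>
  define \<psi> where "\<psi> v = scale (\<chi> (mul z v)) (e u)" for v
  define w where "w = e u - subspace_proj ?K (e u)"
  have "Tr (\<lambda>f. \<psi> (subspace_proj W f) - subspace_proj ?K (\<psi> (subspace_proj W f)))
      = tr W (mul z) - tr ?K (mul z)"
  proof (rule tr_quotient'[OF K(1) subspace_W order_refl K(2) lin_mul_left])
    show "\<psi> v - mul z v \<in> ?K" if "v \<in> W" for v
      using u_D \<chi>u by (simp add: \<psi>_def \<chi>_linear)
  qed (simp_all add: \<chi>_mul)
  moreover have "Tr (\<lambda>f. \<psi> (subspace_proj W f) - subspace_proj ?K (\<psi> (subspace_proj W f))) = \<chi> z"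
  proof -
    have "Tr (\<lambda>f. \<psi> (subspace_proj W f) - subspace_proj ?K (\<psi> (subspace_proj W f)))
        = (\<Sum>d\<in>D. \<chi> z * \<chi> (e d) * w d)"
      unfolding Tr_def
    proof (rule sum.cong[OF refl])
      fix d assume "d \<in> D"
      then have "subspace_proj W (e d :: 'd \<Rightarrow> 'k) = e d" by (simp add: subspace_proj_id[OF subspace_W])
      moreover have "\<psi> (e d) - subspace_proj ?K (\<psi> (e d)) = scale (\<chi> z * \<chi> (e d)) w"
        unfolding \<psi>_def w_def lin_scale[OF k(1)] \<chi>_mul by (rule V.scale_right_diff_distrib[symmetric])
      ultimately show "(\<psi> (subspace_proj W (e d)) - subspace_proj ?K (\<psi> (subspace_proj W (e d)))) d = \<chi> z * \<chi> (e d) * w d"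
        by simp
    qed
    also have "\<dots> = (\<Sum>d\<in>D. if d \<in> \<Gamma> then \<chi> z * w d else 0)"
      by (rule sum.cong) (simp_all add: \<chi>_basis)
    also have "\<dots> = \<chi> z * \<chi> w"
    proof -
      have "D \<inter> \<Gamma> = \<Gamma>" by (auto simp: \<Gamma>_def)
      then show ?thesis using finite_D by (simp add: \<chi>_def sum.If_cases sum_distrib_left)
    qed
    also have "\<chi> w = 1" unfolding w_def \<chi>_linear using k(2)[of "e u"] \<chi>u by simp
    finally show ?thesis by (simp only: mult_1_right)
  qed
  ultimately show "tr W (mul z) - tr ?K (mul z) = \<chi> z" by simp
qed

section \<open>An element traceless on all projectives but not on the trivial representation\<close>

text \<open>Since northern arcs of a left factor survive, only diagrams \<open>x\<close> with
  \<open>T x \<subseteq> T d\<close> contribute to the coefficient at \<open>d\<close>.\<close>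

lemma mul_eq_zero_at:
  assumes "\<And>x. f x \<noteq> 0 \<Longrightarrow> x \<in> D \<Longrightarrow> \<not> T x \<subseteq> T d"
  shows "mul f g d = 0"
proof (rule ccontr)
  assume "mul f g d \<noteq> 0"
  then obtain x y where "x \<in> D" "y \<in> D" "f x \<noteq> 0" "cc x y = d" by (rule mul_support)
  then show False using assms T_mono by blast
qed

text \<open>The element \<open>z\<close> is corrected rank by rank: \<open>y\<close> acts on the diagrams of rank \<open>n\<close> with the same
  traces as \<open>z\<close> and does not affect those of smaller rank.\<close>

lemma traceless_element:
  assumes char: "of_nat (card \<Gamma>) = (0::'k)"
  shows "\<exists>z\<in>W. \<chi> z = 1 \<and> (\<forall>a\<in>W. (\<Sum>d | d \<in> D \<and> rk d < Suc n. mul (mul z (e d)) a d) = 0)"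
proof (induction n)
  case 0
  have \<Gamma>: "{d. d \<in> D \<and> rk d < Suc 0} = \<Gamma>" using finite_T by (auto simp: rk_def \<Gamma>_def)
  have "(\<Sum>d\<in>\<Gamma>. mul (mul (e u) (e d)) a d) = 0" if a: "a \<in> W" for a
  proof -
    \<comment> \<open>In the group \<open>\<Gamma>\<close> the product of \<open>d\<close> and
      \<open>y\<close> is \<open>d\<close> only for \<open>y = u\<close>. So every diagonal
      coefficient is \<open>a u\<close>, and their sum is \<open>card \<Gamma>\<close> times
      it.\<close>
    have "mul (mul (e u) (e d)) a d = a u" if d: "d \<in> \<Gamma>" for d
    proof -
      have dD: "d \<in> D" by (rule \<Gamma>_D[OF d])
      have "mul (mul (e u) (e d)) a = (\<Sum>y\<in>D. scale (a y) (e (cc d y)))"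
      proof -
        have "mul (e d) a = (\<Sum>y\<in>D. scale (a y) (mul (e d) (e y)))" by (rule lin_expand[OF lin_mul_left a])
        also have "\<dots> = (\<Sum>y\<in>D. scale (a y) (e (cc d y)))" by (rule sum.cong) (simp_all add: \<Gamma>_act(3)[OF d])
        finally show ?thesis using mul_one_left dD by simp
      qed
      then have "mul (mul (e u) (e d)) a d = (\<Sum>y\<in>D. a y * (if d = cc d y then 1 else 0))"
        by (simp add: sum_fun_apply basis_vector_def)
      also have "\<dots> = (\<Sum>y\<in>D. if y = u then a y else 0)"
      proof (rule sum.cong[OF refl])
        fix y assume y: "y \<in> D"
        have "d = cc d y \<longleftrightarrow> y = u" using \<Gamma>_cancel[OF d y] cc_unit(2)[OF dD] by metis
        then show "a y * (if d = cc d y then 1 else 0) = (if y = u then a y else 0)" by simp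
      qed
      also have "\<dots> = a u" using finite_D u_D by simp
      finally show ?thesis .
    qed
    then show ?thesis using char by simp
  qed
  then show ?case unfolding \<Gamma> using u_D u_\<Gamma> \<chi>_basis[OF u_D] by (intro bexI[of _ "e u"]) auto
next
  case (Suc n)
  then obtain z where z: "z \<in> W" "\<chi> z = 1"
    and z0: "\<And>a. a \<in> W \<Longrightarrow> (\<Sum>d | d \<in> D \<and> rk d < Suc n. mul (mul z (e d)) a d) = 0" by blast
  \<comment> \<open>The restricted sum in \<open>z0\<close> is the trace on the quotient by the span
    of the diagrams of rank at least \<open>N\<close>; the new rank to be treated is
    \<open>N\<close>.\<close>
  define N where "N = Suc n"
  define U where "U = T ` {d \<in> D. rk d = N}"
  have finU: "finite U" using finite_D by (simp add: U_def)
  have "\<forall>t\<in>U. \<exists>E\<in>W. (\<forall>d. E d \<noteq> 0 \<longrightarrow> t \<subseteq> T d) \<and> (\<forall>x\<in>D. t \<subseteq> T x \<longrightarrow> mul E (e x) = e x)"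
    using left_unit by (auto simp: U_def)
  then obtain E where E: "\<And>t. t \<in> U \<Longrightarrow> E t \<in> W" "\<And>t d. t \<in> U \<Longrightarrow> E t d \<noteq> 0 \<Longrightarrow> t \<subseteq> T d"
    "\<And>t x. t \<in> U \<Longrightarrow> x \<in> D \<Longrightarrow> t \<subseteq> T x \<Longrightarrow> mul (E t) (e x) = e x" by metis
  \<comment> \<open>For each arc set \<open>t\<close> of size \<open>N\<close>, \<open>y\<close>
    takes from \<open>z E t\<close> only the coefficients at diagrams with northern arcs exactly
    \<open>t\<close>. One element thus serves all \<open>t\<close> at once.\<close>
  define y where "y d = (if T d \<in> U then mul z (E (T d)) d else 0)" for d
  have yW: "y \<in> W" using W_zero[OF mul_W] by (auto simp: W_def y_def)
  have y_rk: "rk d = N" if "y d \<noteq> 0" for d using that by (auto simp: y_def U_def rk_def split: if_splits)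
  have E_rk: "N \<le> rk d" if t: "t \<in> U" and d: "mul z (E t) d \<noteq> 0" for t d
  proof -
    obtain v x where vx: "v \<in> D" "x \<in> D" "E t x \<noteq> 0" "cc v x = d" "d \<in> D" using d by (rule mul_support)
    have "N = card t" using t by (auto simp: U_def rk_def)
    also have "\<dots> \<le> card (T x)" using E(2)[OF t vx(3)] finite_T[OF vx(2)] by (rule card_mono[rotated])
    also have "\<dots> = card (B x)" by (rule card_T_B[OF vx(2)])
    also have "\<dots> \<le> card (B d)" using B_mono[OF vx(1,2)] finite_B[OF vx(5)] vx(4) by (auto intro: card_mono)
    also have "\<dots> = rk d" using rk_B[OF vx(5)] by simp
    finally show ?thesis .
  qed
  have low: "mul (mul y (e d)) a d = 0" if d: "d \<in> D" "rk d < N" and a: "a \<in> W" for d a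
  proof -
    have "mul y (mul (e d) a) d = 0"
    proof (rule mul_eq_zero_at)
      fix x assume x: "y x \<noteq> 0" "x \<in> D"
      show "\<not> T x \<subseteq> T d" using card_mono[OF finite_T[OF d(1)], of "T x"] y_rk[OF x(1)] d(2) by (auto simp: rk_def)
    qed
    then show ?thesis using mul_assoc[OF yW W_basis[OF d(1)] a] by simp
  qed
  \<comment> \<open>The element \<open>y - z E (T d)\<close> is supported on ranks at least
    \<open>N\<close> and vanishes where the northern arcs are \<open>T d\<close>, so it does not
    contribute at \<open>d\<close>. And \<open>E (T d)\<close> fixes \<open>d\<close>.\<close>
  have top: "mul (mul y (e d)) a d = mul (mul z (e d)) a d" if d: "d \<in> D" "rk d = N" and a: "a \<in> W" for d a
  proof -
    have t: "T d \<in> U" using d by (auto simp: U_def)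
    let ?v = "mul z (E (T d))"
    have "mul (y - ?v) (mul (e d) a) d = 0"
    proof (rule mul_eq_zero_at)
      fix x assume x: "(y - ?v) x \<noteq> 0" "x \<in> D"
      show "\<not> T x \<subseteq> T d"
      proof
        assume sub: "T x \<subseteq> T d"
        have "y x \<noteq> 0 \<or> ?v x \<noteq> 0" using x(1) by auto
        then have "N \<le> card (T x)" using y_rk[of x] E_rk[OF t, of x] by (auto simp: rk_def)
        then have "T x = T d" using sub finite_T[OF d(1)] d(2) by (intro card_seteq) (auto simp: rk_def)
        then show False using x(1) t by (simp add: y_def)
      qed
    qed
    then have "mul y (mul (e d) a) d = mul ?v (mul (e d) a) d" by (simp add: mul_diff_left)
    moreover have "mul ?v (mul (e d) a) = mul (mul z (e d)) a"
      using E(3)[OF t d(1) order_refl] z(1) E(1)[OF t] d(1) a by (metis mul_assoc W_basis mul_W)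
    ultimately show ?thesis using mul_assoc[OF yW W_basis[OF d(1)] a] by simp
  qed
  have "(\<Sum>d | d \<in> D \<and> rk d < Suc N. mul (mul (z - y) (e d)) a d) = 0" if a: "a \<in> W" for a
  proof -
    have split: "{d. d \<in> D \<and> rk d < Suc N} = {d. d \<in> D \<and> rk d < Suc n} \<union> {d. d \<in> D \<and> rk d = N}"
      by (auto simp: N_def)
    have lin: "mul (mul (z - y) (e d)) a d = mul (mul z (e d)) a d - mul (mul y (e d)) a d" for d
      by (simp add: mul_diff_left)
    have "(\<Sum>d | d \<in> D \<and> rk d < Suc N. mul (mul (z - y) (e d)) a d)
        = (\<Sum>d | d \<in> D \<and> rk d < Suc n. mul (mul (z - y) (e d)) a d) + (\<Sum>d | d \<in> D \<and> rk d = N. mul (mul (z - y) (e d)) a d)"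
      unfolding split by (rule sum.union_disjoint) (use finite_D in \<open>auto simp: N_def\<close>)
    also have "(\<Sum>d | d \<in> D \<and> rk d < Suc n. mul (mul (z - y) (e d)) a d) = (\<Sum>d | d \<in> D \<and> rk d < Suc n. mul (mul z (e d)) a d)"
      by (rule sum.cong) (use low a in \<open>auto simp: lin N_def\<close>)
    also have "\<dots> = 0" by (rule z0[OF a])
    also have "(\<Sum>d | d \<in> D \<and> rk d = N. mul (mul (z - y) (e d)) a d) = 0"
      by (rule sum.neutral) (use top a in \<open>auto simp: lin\<close>)
    finally show ?thesis by (simp only: add_0_left)
  qed
  moreover have "\<chi> y = 0" unfolding \<chi>_def
  proof (rule sum.neutral, rule ballI)
    fix g assume "g \<in> \<Gamma>"
    then have "rk g \<noteq> N" by (simp add: \<Gamma>_def rk_def N_def)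
    then show "y g = 0" using y_rk by blast
  qed
  then have "\<chi> (z - y) = 1" unfolding \<chi>_linear z(2) by simp
  ultimately show ?case using W_diff[OF z(1) yW] unfolding N_def by blast
qed

theorem quasi_hereditary_imp_card:
  assumes "quasi_hereditary R"
  shows "of_nat (card \<Gamma>) \<noteq> (0::'k)"
proof
  assume char: "of_nat (card \<Gamma>) = (0::'k)"
  \<comment> \<open>A crude bound for all ranks, so that the restricted trace becomes the full
    one.\<close>
  define n where "n = (\<Sum>d\<in>D. rk d)"
  have n: "{d. d \<in> D \<and> rk d < Suc n} = D"
    using member_le_sum[of _ D rk] finite_D by (auto simp: n_def less_Suc_eq_le)
  obtain z where z: "z \<in> W" "\<chi> z = 1" "\<And>a. a \<in> W \<Longrightarrow> (\<Sum>d\<in>D. mul (mul z (e d)) a d) = 0"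
    using traceless_element[OF char, of n] unfolding n by blast
  have "left_ideal W R" by (rule left_ideal_RI[OF subspace_W order_refl]) simp
  then have "tr W (mul z) = tr {f \<in> W. \<chi> f = 0} (mul z)"
    by (intro quasi_hereditary_trace[OF assms z(1)] trace_trivial(1)) (auto simp: tr_W Tr_def z(3))
  then show False using trace_trivial(2)[of z] z(2) by simp
qed

end

section \<open>The ideals of diagrams with at least a given number of arcs\<close>

context diagram_algebra
begin

definition ideal_ge :: "nat \<Rightarrow> ('d \<Rightarrow> 'k) set"
  where "ideal_ge n = {f \<in> W. \<forall>d. f d \<noteq> 0 \<longrightarrow> n \<le> rk d}"

lemma mul_rk:
  assumes "mul f g d \<noteq> 0"
  obtains x y where "x \<in> D" "y \<in> D" "f x \<noteq> 0" "g y \<noteq> 0" "cc x y = d" "rk x \<le> rk d" "rk y \<le> rk d"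
proof -
  obtain x y where xy: "x \<in> D" "y \<in> D" "f x \<noteq> 0" "g y \<noteq> 0" "cc x y = d" "d \<in> D"
    using assms by (rule mul_support)
  have "rk x \<le> rk d" unfolding rk_def using T_mono[OF xy(1,2)] xy(5) finite_T[OF xy(6)] by (auto intro: card_mono)
  moreover have "rk y \<le> rk d" unfolding rk_B[OF xy(2)] rk_B[OF xy(6)]
    using B_mono[OF xy(1,2)] xy(5) finite_B[OF xy(6)] by (auto intro: card_mono)
  ultimately show ?thesis using xy that by blast
qed

lemma subspace_support: "V.subspace {f :: 'd \<Rightarrow> 'k. f \<in> W \<and> (\<forall>d. f d \<noteq> 0 \<longrightarrow> P d)}"
proof (rule V.subspaceI)
  show "x + y \<in> {f \<in> W. \<forall>d. f d \<noteq> 0 \<longrightarrow> P d}"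
    if "x \<in> {f \<in> W. \<forall>d. f d \<noteq> 0 \<longrightarrow> P d}" "y \<in> {f \<in> W. \<forall>d. f d \<noteq> 0 \<longrightarrow> P d}" for x y :: "'d \<Rightarrow> 'k"
  proof -
    have "P d" if "(x + y) d \<noteq> 0" for d
    proof -
      have "x d \<noteq> 0 \<or> y d \<noteq> 0" using that by auto
      then show ?thesis using \<open>x \<in> _\<close> \<open>y \<in> _\<close> by auto
    qed
    then show ?thesis using that W_add by blast
  qed
qed auto

lemma ideal_ge: "ideal (ideal_ge n) R"
proof (rule ideal_RI)
  show "V.subspace (ideal_ge n)" unfolding ideal_ge_def by (rule subspace_support)
  show "ideal_ge n \<subseteq> W" by (auto simp: ideal_ge_def)
  show "mul a x \<in> ideal_ge n" if "x \<in> ideal_ge n" for a x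
  proof -
    have "n \<le> rk d" if "mul a x d \<noteq> 0" for d
      using that by (rule mul_rk) (use \<open>x \<in> ideal_ge n\<close> in \<open>fastforce simp: ideal_ge_def\<close>)
    then show ?thesis by (simp add: ideal_ge_def)
  qed
  show "mul x a \<in> ideal_ge n" if "x \<in> ideal_ge n" for a x
  proof -
    have "n \<le> rk d" if "mul x a d \<noteq> 0" for d
      using that by (rule mul_rk) (use \<open>x \<in> ideal_ge n\<close> in \<open>fastforce simp: ideal_ge_def\<close>)
    then show ?thesis by (simp add: ideal_ge_def)
  qed
qed

lemma ideal_ge_mono: "ideal_ge (Suc n) \<subseteq> ideal_ge n"
  by (auto simp: ideal_ge_def)

lemma basis_support: "e x d \<noteq> 0 \<Longrightarrow> d = x"
  by (auto simp: basis_vector_def split: if_splits)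

text \<open>Packaged as a group record for Lagrange's theorem, by which orders of subgroups of
  \<open>\<Gamma>\<close> are invertible in \<open>k\<close> as soon as \<open>card \<Gamma>\<close>
  is.\<close>

definition \<G> where "\<G> = \<lparr>carrier = \<Gamma>, monoid.mult = cc, one = u\<rparr>"

lemma group_\<G>: "group \<G>"
  unfolding \<G>_def
  by (rule groupI) (use \<Gamma>_closed u_\<Gamma> cc_assoc \<Gamma>_D cc_unit \<Gamma>_left_inverse in auto)

end

section \<open>The radical in a layer\<close>

locale diagram_layer = diagram_algebra D cc lam u T B
  for D :: "'d set" and cc and lam :: "'d \<Rightarrow> 'd \<Rightarrow> 'k::field" and u and T B :: "'d \<Rightarrow> 'e set" +
  fixes n :: nat
begin

sublocale twisted_quotient D cc lam u "ideal_ge (Suc n)"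
  by (intro twisted_quotient.intro twisted_monoid_axioms twisted_quotient_axioms.intro ideal_ge)

lemma I_iff: "x \<in> ideal_ge (Suc n) \<longleftrightarrow> x \<in> W \<and> (\<forall>d. x d \<noteq> 0 \<longrightarrow> n < rk d)"
  by (simp add: ideal_ge_def Suc_le_eq)

lemma radical_mul:
  assumes "a \<in> W" "r \<in> W" "q r \<in> jacobson_radical Q"
  shows "q (mul a r) \<in> jacobson_radical Q" "q (mul r a) \<in> jacobson_radical Q"
proof -
  show "q (mul a r) \<in> jacobson_radical Q"
    using left_ideal_mem(4)[OF Q.radical_left_ideal, of "q a" "q r"] assms by (simp add: q_mul)
  show "q (mul r a) \<in> jacobson_radical Q"
    using Q.radical_right_closed[OF assms(3), of "q a"] assms by (simp add: q_mul)
qed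

text \<open>Maschke's theorem for the stabiliser \<open>G\<close> of \<open>T b\<close> in the group \<open>\<Gamma>\<close>: averaging over \<open>G\<close> makes a
  projection onto the radical part of a layer equivariant, hence the right multiplication by some \<open>f0\<close>.\<close>

lemma radical_layer:
  assumes char: "of_nat (card \<Gamma>) \<noteq> (0::'k)"
    and b: "b \<in> D" "rk b = n"
    and f: "f \<in> W" "\<And>d. f d \<noteq> 0 \<Longrightarrow> T d = T b \<and> B d = B b" "q f \<in> jacobson_radical Q"
  shows "f = 0"
proof -
  \<comment> \<open>The diagrams with the same arcs on both sides as \<open>b\<close>;
    \<open>S\<close> is their span, and \<open>f\<close> belongs to it.\<close>
  define \<Lambda> where "\<Lambda> = {x \<in> D. T x = T b \<and> B x = B b}"
  define S where "S = {f :: 'd \<Rightarrow> 'k. f \<in> W \<and> (\<forall>d. f d \<noteq> 0 \<longrightarrow> T d = T b \<and> B d = B b)}"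
  define G where "G = {g \<in> \<Gamma>. T (cc g b) = T b}"
  interpret \<G>: group \<G> by (rule group_\<G>)
  have \<G>s: "carrier \<G> = \<Gamma>" "\<And>x y. x \<otimes>\<^bsub>\<G>\<^esub> y = cc x y" "\<one>\<^bsub>\<G>\<^esub> = u" by (simp_all add: \<G>_def)
  have b\<Lambda>: "b \<in> \<Lambda>" using b by (simp add: \<Lambda>_def)
  have \<Lambda>D: "x \<in> D" if "x \<in> \<Lambda>" for x using that by (simp add: \<Lambda>_def)
  have G\<Gamma>: "g \<in> \<Gamma>" if "g \<in> G" for g using that by (simp add: G_def)
  \<comment> \<open>Every \<open>x\<close> in \<open>\<Lambda>\<close> is \<open>b h\<close> with
    \<open>h\<close> in \<open>\<Gamma>\<close>, and right multiplication by \<open>h\<close> keeps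
    northern arcs; so stabilising \<open>T b\<close> through \<open>b\<close> is the same as through
    \<open>x\<close>.\<close>
  have G\<Lambda>: "cc g x \<in> \<Lambda>" if g: "g \<in> G" and x: "x \<in> \<Lambda>" for g x
  proof -
    obtain h where h: "h \<in> D" "T h = {}" "cc b h = x" using trans_right[OF b(1) \<Lambda>D[OF x]] x by (auto simp: \<Lambda>_def)
    have h\<Gamma>: "h \<in> \<Gamma>" using h by (simp add: \<Gamma>_def)
    have "cc g x = cc (cc g b) h" using cc_assoc[OF \<Gamma>_D[OF G\<Gamma>[OF g]] b(1) h(1)] h(3) by simp
    then have "T (cc g x) = T b" using T_\<Gamma>_act[OF h\<Gamma> \<Gamma>_act(1)[OF G\<Gamma>[OF g] b(1)]] g by (simp add: G_def)
    moreover have "B (cc g x) = B b" using B_\<Gamma>_act[OF G\<Gamma>[OF g] \<Lambda>D[OF x]] x by (simp add: \<Lambda>_def)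
    ultimately show ?thesis using \<Gamma>_act(1)[OF G\<Gamma>[OF g] \<Lambda>D[OF x]] by (simp add: \<Lambda>_def)
  qed
  have invG: "inv\<^bsub>\<G>\<^esub> g \<in> G" if g: "g \<in> G" for g
  proof -
    have i: "inv\<^bsub>\<G>\<^esub> g \<in> \<Gamma>" using \<G>.inv_closed[of g] G\<Gamma>[OF g] \<G>s by simp
    have ig: "cc (inv\<^bsub>\<G>\<^esub> g) g = u" using \<G>.l_inv[of g] G\<Gamma>[OF g] \<G>s by simp
    have x: "cc g b \<in> \<Lambda>" by (rule G\<Lambda>[OF g b\<Lambda>])
    obtain h where h: "h \<in> D" "T h = {}" "cc b h = cc g b" using trans_right[OF b(1) \<Lambda>D[OF x]] x by (auto simp: \<Lambda>_def)
    have h\<Gamma>: "h \<in> \<Gamma>" using h by (simp add: \<Gamma>_def)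
    have "b = cc (cc (inv\<^bsub>\<G>\<^esub> g) g) b" using ig cc_unit b(1) by simp
    also have "\<dots> = cc (inv\<^bsub>\<G>\<^esub> g) (cc b h)" using cc_assoc[OF \<Gamma>_D[OF i] \<Gamma>_D[OF G\<Gamma>[OF g]] b(1)] h(3) by simp
    also have "\<dots> = cc (cc (inv\<^bsub>\<G>\<^esub> g) b) h" using cc_assoc[OF \<Gamma>_D[OF i] b(1) h(1)] by simp
    finally have "T b = T (cc (inv\<^bsub>\<G>\<^esub> g) b)" using T_\<Gamma>_act[OF h\<Gamma> \<Gamma>_act(1)[OF i b(1)]] by simp
    then show ?thesis using i by (simp add: G_def)
  qed
  have G_closed: "cc g h \<in> G" if "g \<in> G" "h \<in> G" for g h
  proof -
    have "cc (cc g h) b = cc g (cc h b)" by (rule cc_assoc[OF \<Gamma>_D[OF G\<Gamma>[OF that(1)]] \<Gamma>_D[OF G\<Gamma>[OF that(2)]] b(1)])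
    then show ?thesis using G\<Lambda>[OF that(1) G\<Lambda>[OF that(2) b\<Lambda>]] \<Gamma>_closed[OF G\<Gamma>[OF that(1)] G\<Gamma>[OF that(2)]]
      by (simp add: G_def \<Lambda>_def)
  qed
  have uG: "u \<in> G" using u_\<Gamma> cc_unit b(1) by (simp add: G_def)
  have "subgroup G \<G>"
    by (rule \<G>.subgroupI) (use G\<Gamma> uG invG G_closed \<G>s in auto)
  then have "card (rcosets\<^bsub>\<G>\<^esub> G) * card G = card \<Gamma>"
    using \<G>.lagrange by (simp add: order_def \<G>s(1))
  then have cG: "of_nat (card G) \<noteq> (0::'k)" using char by (metis mult_zero_right of_nat_mult)
  have finG: "finite G" using finite_\<Gamma> by (simp add: G_def)
  have S: "V.subspace S" unfolding S_def by (rule subspace_support)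
  have SW: "x \<in> W" if "x \<in> S" for x using that by (simp add: S_def)
  have S_expand: "x = (\<Sum>d\<in>\<Lambda>. scale (x d) (e d))" if x: "x \<in> S" for x
  proof -
    have "x = (\<Sum>d\<in>D. scale (x d) (e d))" by (rule expand[OF SW[OF x]])
    also have "\<dots> = (\<Sum>d\<in>\<Lambda>. scale (x d) (e d))"
    proof (rule sum.mono_neutral_right[OF finite_D])
      show "\<Lambda> \<subseteq> D" by (auto simp: \<Lambda>_def)
      show "\<forall>d\<in>D - \<Lambda>. scale (x d) (e d) = 0"
      proof
        fix d assume "d \<in> D - \<Lambda>"
        then have "x d = 0" using x by (auto simp: S_def \<Lambda>_def)
        then show "scale (x d) (e d) = 0" by (simp only: V.scale_zero_left)
      qed
    qed
    finally show ?thesis .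
  qed
  have e\<Lambda>: "e x \<in> S" if "x \<in> \<Lambda>" for x
    using that basis_support by (fastforce simp: S_def \<Lambda>_def)
  have GS: "mul (e g) x \<in> S" if g: "g \<in> G" and x: "x \<in> S" for g x
  proof -
    have "mul (e g) x = (\<Sum>d\<in>\<Lambda>. scale (x d) (e (cc g d)))"
      by (subst S_expand[OF x]) (simp add: mul_sum_right mul_scale_right \<Gamma>_act(3)[OF G\<Gamma>[OF g]] \<Lambda>D)
    also have "\<dots> \<in> S" by (intro V.subspace_sum[OF S] V.subspace_scale[OF S] e\<Lambda> G\<Lambda> g)
    finally show ?thesis .
  qed
  \<comment> \<open>The part of \<open>S\<close> that is radical modulo
    \<open>ideal_ge (Suc n)\<close>, a \<open>G\<close>-stable subspace; the goal amounts to
    \<open>K = 0\<close>.\<close>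
  define K where "K = S \<inter> {x \<in> W. q x \<in> jacobson_radical Q}"
  have K: "V.subspace K" unfolding K_def
    by (rule V.subspace_inter[OF S left_ideal_R(1)[OF left_ideal_preimage[OF Q.radical_left_ideal]]])
  have KS: "x \<in> S" if "x \<in> K" for x using that by (simp add: K_def)
  have GK: "mul (e g) x \<in> K" if g: "g \<in> G" and x: "x \<in> K" for g x
    using GS[OF g] x radical_mul(1)[of "e g" x] \<Gamma>_D[OF G\<Gamma>[OF g]] by (simp add: K_def)
  define \<pi> where "\<pi> = subspace_proj K"
  have \<pi>: "lin \<pi>" "\<And>x. \<pi> x \<in> K" "\<And>x. x \<in> K \<Longrightarrow> \<pi> x = x" using subspace_proj[OF K] by (simp_all add: \<pi>_def)
  define P where "P x = scale (1 / of_nat (card G)) (\<Sum>g\<in>G. mul (e g) (\<pi> (mul (e (inv\<^bsub>\<G>\<^esub> g)) x)))" for x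
  have linP: "lin P"
  proof -
    have l: "lin (\<lambda>x. \<Sum>g\<in>G. mul (e g) (\<pi> (mul (e (inv\<^bsub>\<G>\<^esub> g)) x)))"
      by (rule lin_sums) (rule lin_comp[OF lin_mul_left lin_comp[OF \<pi>(1) lin_mul_left]])
    show ?thesis
    proof (rule linI)
      show "P (x + y) = P x + P y" for x y
        unfolding P_def lin_add[OF l] by (rule V.scale_right_distrib)
      show "P (scale c x) = scale c (P x)" for c x
        unfolding P_def lin_scale[OF l] by (rule V.scale_left_commute)
    qed
  qed
  have PK: "P x \<in> K" for x
    unfolding P_def by (intro V.subspace_scale[OF K] V.subspace_sum[OF K] GK \<pi>(2))
  have invm: "mul (e g) (mul (e (inv\<^bsub>\<G>\<^esub> g)) x) = x" if g: "g \<in> G" and x: "x \<in> W" for g x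
  proof -
    have i: "inv\<^bsub>\<G>\<^esub> g \<in> D" using \<Gamma>_D[OF G\<Gamma>[OF invG[OF g]]] .
    have "cc g (inv\<^bsub>\<G>\<^esub> g) = u" using \<G>.r_inv[of g] G\<Gamma>[OF g] \<G>s by simp
    then have "mul (e g) (e (inv\<^bsub>\<G>\<^esub> g)) = e u" using \<Gamma>_act(3)[OF G\<Gamma>[OF g] i] by simp
    then show ?thesis using mul_assoc[OF W_basis[OF \<Gamma>_D[OF G\<Gamma>[OF g]]] W_basis[OF i] x] mul_one_left[OF x] by simp
  qed
  have P_id: "P x = x" if x: "x \<in> K" for x
  proof -
    have "(\<Sum>g\<in>G. mul (e g) (\<pi> (mul (e (inv\<^bsub>\<G>\<^esub> g)) x))) = (\<Sum>g\<in>G. x)"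
      by (rule sum.cong[OF refl]) (simp only: \<pi>(3)[OF GK[OF invG x]] invm SW[OF KS[OF x]])
    also have "\<dots> = scale (of_nat (card G)) x" by (rule V.sum_constant_scale)
    finally have "P x = scale (1 / of_nat (card G)) (scale (of_nat (card G)) x)" by (simp only: P_def)
    also have "\<dots> = x" using cG by (simp only: V.scale_scale) simp
    finally show ?thesis .
  qed
  have P_equiv: "P (mul (e h) x) = mul (e h) (P x)" if h: "h \<in> G" and x: "x \<in> W" for h x
  proof -
    have hD: "h \<in> D" using \<Gamma>_D[OF G\<Gamma>[OF h]] .
    have "(\<Sum>g\<in>G. mul (e g) (\<pi> (mul (e (inv\<^bsub>\<G>\<^esub> g)) (mul (e h) x))))
        = (\<Sum>g\<in>G. mul (e (cc h g)) (\<pi> (mul (e (inv\<^bsub>\<G>\<^esub> (cc h g))) (mul (e h) x))))"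
    proof (rule sum.reindex_bij_betw[symmetric], rule bij_betw_byWitness[where f' = "\<lambda>g. cc (inv\<^bsub>\<G>\<^esub> h) g"])
      have c: "cc (inv\<^bsub>\<G>\<^esub> h) (cc h g) = g" "cc h (cc (inv\<^bsub>\<G>\<^esub> h) g) = g" if "g \<in> G" for g
        using \<G>.inv_solve_left[of g h] \<G>.l_inv_ex \<G>.m_assoc[of "inv\<^bsub>\<G>\<^esub> h" h g] \<G>.m_assoc[of h "inv\<^bsub>\<G>\<^esub> h" g]
          \<G>.l_inv[of h] \<G>.r_inv[of h] \<G>.l_one[of g] \<G>.inv_closed[of h] G\<Gamma>[OF that] G\<Gamma>[OF h] \<G>s by simp_all
      show "\<forall>g\<in>G. cc (inv\<^bsub>\<G>\<^esub> h) (cc h g) = g" "\<forall>g\<in>G. cc h (cc (inv\<^bsub>\<G>\<^esub> h) g) = g" using c by blast+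
      show "cc h ` G \<subseteq> G" using G_closed[OF h] by blast
      show "cc (inv\<^bsub>\<G>\<^esub> h) ` G \<subseteq> G" using G_closed[OF invG[OF h]] by blast
    qed
    also have "\<dots> = (\<Sum>g\<in>G. mul (e h) (mul (e g) (\<pi> (mul (e (inv\<^bsub>\<G>\<^esub> g)) x))))"
    proof (rule sum.cong[OF refl])
      fix g assume g: "g \<in> G"
      have gD: "g \<in> D" "inv\<^bsub>\<G>\<^esub> g \<in> D" "cc h g \<in> \<Gamma>" "inv\<^bsub>\<G>\<^esub> (cc h g) \<in> \<Gamma>"
        using \<Gamma>_D G\<Gamma> g invG G_closed[OF h g] by blast+
      have "cc (inv\<^bsub>\<G>\<^esub> (cc h g)) h = inv\<^bsub>\<G>\<^esub> g"
      proof -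
        have "inv\<^bsub>\<G>\<^esub> (cc h g) = cc (inv\<^bsub>\<G>\<^esub> g) (inv\<^bsub>\<G>\<^esub> h)"
          using \<G>.inv_mult_group[of h g] G\<Gamma>[OF g] G\<Gamma>[OF h] \<G>s by simp
        then show ?thesis
          using \<G>.m_assoc[of "inv\<^bsub>\<G>\<^esub> g" "inv\<^bsub>\<G>\<^esub> h" h] \<G>.l_inv[of h] \<G>.r_one[of "inv\<^bsub>\<G>\<^esub> g"]
            \<G>.inv_closed[of g] \<G>.inv_closed[of h] G\<Gamma>[OF g] G\<Gamma>[OF h] \<G>s by simp
      qed
      then have 1: "mul (e (inv\<^bsub>\<G>\<^esub> (cc h g))) (mul (e h) x) = mul (e (inv\<^bsub>\<G>\<^esub> g)) x"
        using mul_assoc[OF W_basis[OF \<Gamma>_D[OF gD(4)]] W_basis[OF hD] x] \<Gamma>_act(3)[OF gD(4) hD] by simp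
      have "mul (e (cc h g)) y = mul (e h) (mul (e g) y)" if "y \<in> W" for y
        using mul_assoc[OF W_basis[OF hD] W_basis[OF gD(1)] that] \<Gamma>_act(3)[OF G\<Gamma>[OF h] gD(1)] by simp
      then show "mul (e (cc h g)) (\<pi> (mul (e (inv\<^bsub>\<G>\<^esub> (cc h g))) (mul (e h) x)))
          = mul (e h) (mul (e g) (\<pi> (mul (e (inv\<^bsub>\<G>\<^esub> g)) x)))"
        unfolding 1 using SW[OF KS[OF \<pi>(2)]] by blast
    qed
    also have "\<dots> = mul (e h) (\<Sum>g\<in>G. mul (e g) (\<pi> (mul (e (inv\<^bsub>\<G>\<^esub> g)) x)))" by (rule mul_sum_right[symmetric])
    finally show ?thesis by (simp only: P_def mul_scale_right)
  qed
  have "\<forall>z\<in>\<Lambda>. \<exists>h. h \<in> \<Gamma> \<and> cc b h = z"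
  proof
    fix z assume z: "z \<in> \<Lambda>"
    then obtain h where "h \<in> D" "T h = {}" "cc b h = z" using trans_right[OF b(1) \<Lambda>D[OF z]] by (auto simp: \<Lambda>_def)
    then show "\<exists>h. h \<in> \<Gamma> \<and> cc b h = z" by (auto simp: \<Gamma>_def)
  qed
  then obtain hz where hz: "\<And>z. z \<in> \<Lambda> \<Longrightarrow> hz z \<in> \<Gamma>" "\<And>z. z \<in> \<Lambda> \<Longrightarrow> cc b (hz z) = z" by metis
  \<comment> \<open>Each \<open>z\<close> in \<open>\<Lambda>\<close> is \<open>b (hz z)\<close>, so
    \<open>P (e b)\<close> is \<open>b\<close> times a combination of elements of
    \<open>\<Gamma>\<close>.\<close>
  define f0 where "f0 = (\<Sum>z\<in>\<Lambda>. scale (P (e b) z) (e (hz z)))"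
  have f0W: "f0 \<in> W" unfolding f0_def by (intro W_sum W_scale W_basis \<Gamma>_D hz)
  have bf0: "mul (e b) f0 = P (e b)"
  proof -
    have "mul (e b) f0 = (\<Sum>z\<in>\<Lambda>. scale (P (e b) z) (e z))"
      unfolding f0_def mul_sum_right mul_scale_right
      by (rule sum.cong[OF refl]) (simp only: \<Gamma>_act(4)[OF hz(1) b(1)] hz(2))
    then show ?thesis using S_expand[OF KS[OF PK]] by simp
  qed
  \<comment> \<open>\<open>G\<close> acts transitively on \<open>\<Lambda>\<close> from the left,
    and both \<open>P\<close> and right multiplication by \<open>f0\<close> commute with
    \<open>G\<close>; agreement at \<open>b\<close> therefore suffices.\<close>
  have xf0: "mul x f0 = P x" if x: "x \<in> S" for x
  proof -
    have "mul (e z) f0 = P (e z)" if z: "z \<in> \<Lambda>" for z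
    proof -
      obtain h where h: "h \<in> D" "T h = {}" "cc h b = z" using trans_left[OF b(1) \<Lambda>D[OF z]] z by (auto simp: \<Lambda>_def)
      have h\<Gamma>: "h \<in> \<Gamma>" and hG: "h \<in> G" using h z by (auto simp: \<Gamma>_def G_def \<Lambda>_def)
      have ez: "e z = mul (e h) (e b)" using \<Gamma>_act(3)[OF h\<Gamma> b(1)] h(3) by simp
      have "mul (e z) f0 = mul (e h) (mul (e b) f0)" unfolding ez by (rule mul_assoc[OF W_basis[OF h(1)] W_basis[OF b(1)] f0W])
      also have "\<dots> = P (e z)" unfolding bf0 ez P_equiv[OF hG W_basis[OF b(1)]] ..
      finally show ?thesis .
    qed
    then have "(\<Sum>d\<in>\<Lambda>. scale (x d) (mul (e d) f0)) = (\<Sum>d\<in>\<Lambda>. scale (x d) (P (e d)))"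
      by (intro sum.cong refl) simp
    moreover have "mul x f0 = (\<Sum>d\<in>\<Lambda>. scale (x d) (mul (e d) f0))"
      by (subst S_expand[OF x]) (simp only: mul_sum_left mul_scale_left)
    moreover have "P x = (\<Sum>d\<in>\<Lambda>. scale (x d) (P (e d)))"
      by (subst S_expand[OF x]) (simp only: lin_sum[OF linP] lin_scale[OF linP])
    ultimately show ?thesis by simp
  qed
  \<comment> \<open>A right unit for the southern arcs of \<open>b\<close>. Its terms with further
    southern arcs lie in \<open>ideal_ge (Suc n)\<close>, so the truncation \<open>F'\<close> is
    still a right unit on \<open>S\<close> modulo that ideal.\<close>
  obtain F where F: "F \<in> W" "\<And>d. F d \<noteq> 0 \<Longrightarrow> B b \<subseteq> B d" "\<And>x. x \<in> D \<Longrightarrow> B b \<subseteq> B x \<Longrightarrow> mul (e x) F = e x"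
    using right_unit[OF b(1)] by blast
  define F' where "F' d = (if B d = B b then F d else 0)" for d
  have F'W: "F' \<in> W" using F(1) by (auto simp: W_def F'_def)
  have FF': "F - F' \<in> ideal_ge (Suc n)"
  proof -
    have "n < rk d" if d: "(F - F') d \<noteq> 0" for d
    proof -
      have "F d \<noteq> 0" "B d \<noteq> B b" using d by (auto simp: F'_def split: if_splits)
      then have "B b \<subset> B d" using F(2) by blast
      moreover have dD: "d \<in> D" using W_zero[OF F(1), of d] \<open>F d \<noteq> 0\<close> by blast
      ultimately have "card (B b) < card (B d)" by (intro psubset_card_mono finite_B)
      then show ?thesis using rk_B[OF b(1)] rk_B[OF dD] b(2) by simp
    qed
    then show ?thesis using W_diff[OF F(1) F'W] I_iff by blast
  qed
  have SF: "mul x F' - x \<in> ideal_ge (Suc n)" if x: "x \<in> S" for x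
  proof -
    have "mul x F = x"
    proof -
      have "mul x F = (\<Sum>d\<in>\<Lambda>. scale (x d) (mul (e d) F))"
        by (subst S_expand[OF x]) (simp only: mul_sum_left mul_scale_left)
      also have "\<dots> = (\<Sum>d\<in>\<Lambda>. scale (x d) (e d))"
        by (rule sum.cong[OF refl]) (use F(3) in \<open>simp add: \<Lambda>_def\<close>)
      finally show ?thesis using S_expand[OF x] by simp
    qed
    then have "mul x F' - x = - mul x (F - F')" by (simp only: mul_diff_right minus_diff_eq)
    then show ?thesis using V.subspace_neg[OF subspace_I I_mul_left[OF SW[OF x] FF']] by simp
  qed
  have "\<forall>z\<in>{z \<in> D. B z = B b}. \<exists>h. h \<in> \<Gamma> \<and> cc h b = z"
  proof
    fix z assume z: "z \<in> {z \<in> D. B z = B b}"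
    then obtain h where "h \<in> D" "T h = {}" "cc h b = z" using trans_left[OF b(1), of z] by auto
    then show "\<exists>h. h \<in> \<Gamma> \<and> cc h b = z" by (auto simp: \<Gamma>_def)
  qed
  then obtain \<gamma>z where \<gamma>z: "\<And>z. z \<in> D \<Longrightarrow> B z = B b \<Longrightarrow> \<gamma>z z \<in> \<Gamma>" "\<And>z. z \<in> D \<Longrightarrow> B z = B b \<Longrightarrow> cc (\<gamma>z z) b = z" 
    by (metis (mono_tags, lifting) mem_Collect_eq)
  \<comment> \<open>Factoring \<open>F'\<close> as \<open>\<gamma> b\<close> turns
    \<open>F' f0\<close> into \<open>\<gamma> P (e b)\<close>, a multiple of an element of
    \<open>K\<close>.\<close>
  define \<gamma> where "\<gamma> = (\<Sum>z | z \<in> D \<and> B z = B b. scale (F z) (e (\<gamma>z z)))"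
  have \<gamma>W: "\<gamma> \<in> W" unfolding \<gamma>_def by (rule W_sum) (use \<gamma>z(1) \<Gamma>_D in auto)
  have \<gamma>b: "mul \<gamma> (e b) = F'"
  proof -
    have "mul \<gamma> (e b) = (\<Sum>z | z \<in> D \<and> B z = B b. scale (F z) (e z))"
      unfolding \<gamma>_def mul_sum_left mul_scale_left
      by (rule sum.cong[OF refl]) (use \<Gamma>_act(3)[OF \<gamma>z(1) b(1)] \<gamma>z(2) in simp)
    also have "\<dots> = (\<Sum>z\<in>D. scale (F' z) (e z))"
      by (rule sum.mono_neutral_cong_left) (use finite_D in \<open>auto simp: F'_def\<close>)
    finally show ?thesis using expand[OF F'W] by simp
  qed
  define Pb where "Pb = P (e b)"
  have PbK: "Pb \<in> K" and PbW: "Pb \<in> W" using PK SW KS by (auto simp: Pb_def)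
  \<comment> \<open>As \<open>\<gamma> P (e b)\<close> it is radical; as \<open>F' f0\<close> it
    acts on \<open>S\<close> from the right like the projection \<open>P\<close>, modulo higher
    rank.\<close>
  define \<theta> where "\<theta> = mul \<gamma> Pb"
  have \<theta>W: "\<theta> \<in> W" by (simp add: \<theta>_def)
  have \<theta>rad: "q \<theta> \<in> jacobson_radical Q"
    unfolding \<theta>_def by (rule radical_mul(1)[OF \<gamma>W PbW]) (use PbK in \<open>simp add: K_def\<close>)
  have \<theta>F: "\<theta> = mul F' f0"
    unfolding \<theta>_def Pb_def bf0[symmetric] \<gamma>b[symmetric] by (rule mul_assoc[OF \<gamma>W W_basis[OF b(1)] f0W, symmetric])
  \<comment> \<open>With \<open>Pb = P (e b)\<close>:
    \<open>\<theta> \<theta> = \<gamma> (Pb F') f0\<close>, where \<open>Pb F'\<close> is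
    \<open>Pb\<close> modulo higher rank and \<open>Pb f0 = P Pb = Pb\<close>. So
    \<open>\<theta>\<close> is a radical idempotent modulo \<open>ideal_ge (Suc n)\<close>, hence
    zero there.\<close>
  have "mul \<theta> \<theta> - \<theta> \<in> ideal_ge (Suc n)"
  proof -
    have "mul \<theta> \<theta> = mul \<gamma> (mul (mul Pb F') f0)"
      unfolding \<theta>F[unfolded \<theta>_def, symmetric] 
      by (subst (2) \<theta>F) (simp only: \<theta>_def mul_assoc[OF \<gamma>W PbW mul_W] mul_assoc[OF PbW F'W f0W])
    moreover have "\<theta> = mul \<gamma> (mul Pb f0)" using xf0[OF KS[OF PbK]] P_id[OF PbK] by (simp add: \<theta>_def)
    ultimately have "mul \<theta> \<theta> - \<theta> = mul \<gamma> (mul (mul Pb F' - Pb) f0)"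
      by (simp only: mul_diff_left mul_diff_right)
    then show ?thesis using I_mul_left[OF \<gamma>W I_mul_right[OF f0W SF[OF KS[OF PbK]]]] by simp
  qed
  then have "q \<theta> \<otimes>\<^bsub>Q\<^esub> q \<theta> = q \<theta>" using q_eq_iff[of "mul \<theta> \<theta>" \<theta>] \<theta>W by (simp add: q_mul)
  then have "q \<theta> = \<zero>\<^bsub>Q\<^esub>" by (rule Q.radical_idempotent[OF \<theta>rad])
  then have \<theta>I: "\<theta> \<in> ideal_ge (Suc n)" using q_zero_iff[OF \<theta>W] by simp
  \<comment> \<open>Finally \<open>f = P f = f f0\<close>, which is
    \<open>f F' f0 = f \<theta>\<close> up to higher rank, hence of higher rank; but
    \<open>f\<close> is supported in rank \<open>n\<close>.\<close>
  have fK: "f \<in> K" using f by (auto simp: K_def S_def)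
  have "f = mul f f0" using xf0[OF KS[OF fK]] P_id[OF fK] by simp
  also have "\<dots> = mul f \<theta> - mul (mul f F' - f) f0"
    unfolding \<theta>F by (simp only: mul_diff_left mul_assoc[OF f(1) F'W f0W] diff_diff_eq2 add_diff_cancel_left')
  also have "\<dots> \<in> ideal_ge (Suc n)"
    by (intro V.subspace_diff[OF subspace_I] I_mul_left[OF f(1) \<theta>I] I_mul_right[OF f0W SF[OF KS[OF fK]]])
  finally have fI: "f \<in> ideal_ge (Suc n)" .
  have "f d = 0" for d
  proof (rule ccontr)
    assume d: "f d \<noteq> 0"
    then have "n < rk d" "T d = T b" using fI f(2) I_iff by auto
    then show False using b(2) by (simp add: rk_def)
  qed
  then show "f = 0" by (simp add: fun_eq_iff)
qed

text \<open>By bilinearity it suffices to take diagrams \<open>d\<close>, \<open>d'\<close> of rank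
  \<open>n\<close> on the two sides. Up to higher rank, \<open>d r d'\<close> is supported on
  diagrams with northern arcs \<open>T d\<close> and southern arcs \<open>B d'\<close>; being
  radical, this part vanishes by \<open>radical_layer\<close>.\<close>

lemma radical_sandwich:
  assumes char: "of_nat (card \<Gamma>) \<noteq> (0::'k)"
    and x: "x \<in> ideal_ge n" and y: "y \<in> ideal_ge n" and r: "r \<in> W" "q r \<in> jacobson_radical Q"
  shows "mul (mul x r) y \<in> ideal_ge (Suc n)"
proof -
  have xW: "x \<in> W" and yW: "y \<in> W" using x y by (auto simp: ideal_ge_def)
  have I_basis: "e d \<in> ideal_ge (Suc n)" if d: "d \<in> D" "n < rk d" for d
  proof -
    have "n < rk d'" if "e d d' \<noteq> 0" for d' using basis_support[OF that] d(2) by simp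
    then show ?thesis using W_basis[OF d(1)] unfolding I_iff by blast
  qed
  have basis: "mul (mul (e d) r) (e d') \<in> ideal_ge (Suc n)"
    if d: "d \<in> D" "n \<le> rk d" and d': "d' \<in> D" "n \<le> rk d'" for d d'
  proof (cases "n < rk d \<or> n < rk d'")
    case True
    then show ?thesis
    proof
      assume "n < rk d"
      then show ?thesis by (rule I_mul_right[OF W_basis[OF d'(1)] I_mul_right[OF r(1) I_basis[OF d(1)]]])
    next
      assume "n < rk d'"
      then show ?thesis by (rule I_mul_left[OF mul_W I_basis[OF d'(1)]])
    qed
  next
    case False
    then have rk: "rk d = n" "rk d' = n" using d d' by auto
    let ?w = "mul (mul (e d) r) (e d')"
    \<comment> \<open>The rank \<open>n\<close> part of the product; it differs from the product by
      an element of the ideal, so it has the same radical class.\<close>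
    define w where "w z = (if rk z = n then ?w z else 0)" for z
    have wW: "w \<in> W" using W_zero[OF mul_W] by (auto simp: W_def w_def)
    have supp: "T z = T d \<and> B z = B d' \<and> z \<in> D" if z: "w z \<noteq> 0" for z
    proof -
      have z': "rk z = n" "?w z \<noteq> 0" using z by (auto simp: w_def split: if_splits)
      obtain a b where ab: "a \<in> D" "b \<in> D" "mul (e d) r a \<noteq> 0" "e d' b \<noteq> 0" "cc a b = z" "z \<in> D"
        using z'(2) by (rule mul_support)
      obtain a' b' where ab': "a' \<in> D" "b' \<in> D" "e d a' \<noteq> 0" "cc a' b' = a"
        using ab(3) by (rule mul_support)
      have "T d \<subseteq> T z" using T_mono[OF ab'(1,2)] T_mono[OF ab(1,2)] ab(5) ab'(4) basis_support[OF ab'(3)] by blast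
      moreover have "B d' \<subseteq> B z" using B_mono[OF ab(1,2)] ab(5) basis_support[OF ab(4)] by blast
      moreover have "card (T z) = card (T d)" "card (B z) = card (B d')"
        using z'(1) rk rk_B[OF ab(6)] rk_B[OF d'(1)] by (simp_all add: rk_def)
      ultimately have "T d = T z" "B d' = B z"
        using card_subset_eq[OF finite_T[OF ab(6)], of "T d"] card_subset_eq[OF finite_B[OF ab(6)], of "B d'"] by simp_all
      then show ?thesis using ab(6) by simp
    qed
    have diff: "?w - w \<in> ideal_ge (Suc n)"
    proof -
      have "n < rk z" if z: "(?w - w) z \<noteq> 0" for z
      proof -
        have z': "?w z \<noteq> 0" "rk z \<noteq> n" using z by (auto simp: w_def split: if_splits)
        have "mul (mul (e d) r) (e d') \<in> ideal_ge n"
          using ideal_mul_right[OF ideal_ge, of "mul (e d) r" n "e d'"] ideal_mul_right[OF ideal_ge, of "e d" n r]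
            d d' r(1) basis_support by (fastforce simp: ideal_ge_def[of n])
        then have "n \<le> rk z" using z'(1) by (simp add: ideal_ge_def)
        then show ?thesis using z'(2) by simp
      qed
      then show ?thesis using W_diff[OF mul_W wW] I_iff by blast
    qed
    have "w = 0"
    proof (cases "\<exists>b. w b \<noteq> 0")
      case True
      then obtain b where b: "w b \<noteq> 0" by auto
      have "q w = q ?w" using q_eq_iff[OF mul_W wW] diff by (rule iffD2[THEN sym])
      moreover have "q ?w \<in> jacobson_radical Q"
        by (rule radical_mul(2)[OF W_basis[OF d'(1)] mul_W radical_mul(1)[OF W_basis[OF d(1)] r]])
      ultimately show ?thesis
        using radical_layer[OF char _ _ wW, of b] supp[OF b] supp b by (force simp: w_def split: if_splits)
    qed (auto simp: fun_eq_iff)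
    then show ?thesis using diff by simp
  qed
  have "mul (mul x r) y = (\<Sum>d\<in>D. scale (x d) (mul (mul (e d) r) y))"
    by (rule lin_expand[OF lin_comp[OF lin_mul_right lin_mul_right] xW])
  also have "\<dots> = (\<Sum>d\<in>D. scale (x d) (\<Sum>d'\<in>D. scale (y d') (mul (mul (e d) r) (e d'))))"
    by (intro sum.cong refl arg_cong[where f = "scale _"] lin_expand[OF lin_mul_left yW])
  also have "\<dots> \<in> ideal_ge (Suc n)"
  proof (rule V.subspace_sum[OF subspace_I])
    fix d assume d: "d \<in> D"
    show "scale (x d) (\<Sum>d'\<in>D. scale (y d') (mul (mul (e d) r) (e d'))) \<in> ideal_ge (Suc n)"
    proof (cases "x d = 0")
      case True
      then show ?thesis using V.subspace_0[OF subspace_I] by (simp only: V.scale_zero_left)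
    next
      case False
      show ?thesis
      proof (rule V.subspace_scale[OF subspace_I], rule V.subspace_sum[OF subspace_I])
        fix d' assume d': "d' \<in> D"
        show "scale (y d') (mul (mul (e d) r) (e d')) \<in> ideal_ge (Suc n)"
        proof (cases "y d' = 0")
          case True
          then show ?thesis using V.subspace_0[OF subspace_I] by (simp only: V.scale_zero_left)
        next
          case False
          then show ?thesis using \<open>x d \<noteq> 0\<close> x y d d'
            by (intro V.subspace_scale[OF subspace_I] basis) (auto simp: ideal_ge_def)
        qed
      qed
    qed
  qed
  finally show ?thesis .
qed

end

section \<open>Layers are projective and idempotent\<close>

context diagram_layer
begin

text \<open>Modulo higher rank, left multiplication keeps the southern arcs, so a layer is the
  direct sum of these columns as a left module.\<close>

definition column :: "'e set \<Rightarrow> ('d \<Rightarrow> 'k) \<Rightarrow> 'd \<Rightarrow> 'k"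
  where "column v f = (\<lambda>d. if B d = v then f d else 0)"

lemma lin_column: "lin (column v)"
  by (rule linI) (auto simp: column_def fun_eq_iff)

lemma column_W: "f \<in> W \<Longrightarrow> column v f \<in> W"
  by (auto simp: W_def column_def)

lemma column_ideal: "f \<in> ideal_ge i \<Longrightarrow> column v f \<in> ideal_ge i"
  using column_W[of f v] by (auto simp: ideal_ge_def column_def)

lemma mul_column:
  assumes f: "f \<in> W" and F: "\<And>x. x \<in> D \<Longrightarrow> v \<subseteq> B x \<Longrightarrow> mul (e x) F = e x"
  shows "mul (column v f) F = column v f"
proof -
  have "mul (column v f) F = (\<Sum>d\<in>D. scale (column v f d) (mul (e d) F))"
    by (rule lin_expand[OF lin_mul_right column_W[OF f]])
  also have "\<dots> = (\<Sum>d\<in>D. scale (column v f d) (e d))"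
  proof (rule sum.cong[OF refl])
    fix d assume d: "d \<in> D"
    show "scale (column v f d) (mul (e d) F) = scale (column v f d) (e d)"
    proof (cases "B d = v")
      case True
      then show ?thesis using F[OF d] by simp
    next
      case False
      then have "column v f d = 0" by (simp add: column_def)
      then show ?thesis by (simp only: V.scale_zero_left)
    qed
  qed
  also have "\<dots> = column v f" by (rule expand[OF column_W[OF f], symmetric])
  finally show ?thesis .
qed

text \<open>The number of southern arcs is the rank, so a column belonging to rank \<open>n\<close>
  sees nothing of higher rank.\<close>

lemma column_zero:
  assumes b: "b \<in> D" "rk b = n" and f: "f \<in> ideal_ge (Suc n)"
  shows "column (B b) f = 0"
proof -
  have "f d = 0" if d: "B d = B b" for d
  proof (rule ccontr)
    assume fd: "f d \<noteq> 0"
    then have "d \<in> D" "n < rk d" using f W_zero[of f d] I_iff by blast+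
    then show False using rk_B[OF b(1)] rk_B[of d] b(2) d by simp
  qed
  then show ?thesis by (auto simp: column_def fun_eq_iff)
qed

text \<open>A product \<open>x y\<close> contains the southern arcs of \<open>y\<close>. If
  \<open>y\<close> has rank at least \<open>n\<close> and the product rank at most \<open>n\<close>,
  the two sets of southern arcs coincide by size.\<close>

lemma column_mul:
  assumes f: "f \<in> ideal_ge n"
  shows "column v (mul a f) - mul a (column v f) \<in> ideal_ge (Suc n)"
proof -
  have eq: "column v (mul a f) d = mul a (column v f) d" if d: "d \<in> D" "rk d \<le> n" for d
  proof -
    have t: "(if B d = v then a x * f y * lam x y else 0) = a x * column v f y * lam x y"
      if xy: "x \<in> D" "y \<in> D" "cc x y = d" for x y
    proof (cases "f y = 0")
      case False
      then have "n \<le> card (B y)" using f unfolding rk_B[OF xy(2), symmetric] ideal_ge_def by blast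
      moreover have "B y \<subseteq> B d" using B_mono[OF xy(1,2)] xy(3) by simp
      ultimately have "B y = B d" using card_seteq[OF finite_B[OF d(1)], of "B y"] rk_B[OF d(1)] d(2) by simp
      then show ?thesis by (simp add: column_def)
    qed (simp add: column_def)
    have "mul a (column v f) d
        = (\<Sum>x\<in>D. \<Sum>y\<in>D. if B d = v then (if cc x y = d then a x * f y * lam x y else 0) else 0)"
      unfolding mul_def
    proof (intro sum.cong refl)
      fix x y assume xy: "x \<in> D" "y \<in> D"
      show "(if cc x y = d then a x * column v f y * lam x y else 0)
          = (if B d = v then (if cc x y = d then a x * f y * lam x y else 0) else 0)"
      proof (cases "cc x y = d")
        case True
        show ?thesis unfolding if_P[OF True] using t[OF xy True] by (rule sym)
      qed simp
    qed
    then show ?thesis by (simp add: column_def mul_def)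
  qed
  have W: "column v (mul a f) - mul a (column v f) \<in> W"
    by (rule W_diff[OF column_W[OF mul_W] mul_W])
  have "n < rk d" if d: "(column v (mul a f) - mul a (column v f)) d \<noteq> 0" for d
  proof (rule ccontr)
    assume "\<not> n < rk d"
    moreover have "d \<in> D" using W_zero[OF W, of d] d by blast
    ultimately show False using d eq[of d] by simp
  qed
  then show ?thesis using W unfolding I_iff by blast
qed

text \<open>Each \<open>f\<close> in the layer is, up to higher rank, the sum of its columns
  multiplied by the corresponding right units \<open>F b\<close>. Both factors lie in the layer,
  which gives \<open>J J = J\<close>, and the columns together with the \<open>F b\<close> form a
  dual basis, which gives projectivity.\<close>

lemma heredity_layer:
  assumes char: "of_nat (card \<Gamma>) \<noteq> (0::'k)"
  shows "heredity_ideal (q ` ideal_ge n) Q"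
proof -
  let ?J = "q ` ideal_ge n"
  note JL = ideal_left_ideal[OF ideal_ge[of n]]
  have JW: "f \<in> W" if "f \<in> ideal_ge n" for f using that by (simp add: ideal_ge_def)
  have LJ: "left_ideal ?J Q" by (rule left_ideal_image[OF JL])
  have JE: "\<exists>f. f \<in> ideal_ge n \<and> X = q f" if "X \<in> ?J" for X using that unfolding image_iff by blast
  have ideal_J: "ideal ?J Q"
  proof (rule idealI)
    interpret J: left_ideal ?J Q by (rule LJ)
    show "ring Q" by (rule Q.ring_axioms)
    show "subgroup ?J (add_monoid Q)" by (rule J.a_subgroup)
    show "x \<otimes>\<^bsub>Q\<^esub> a \<in> ?J" if "a \<in> ?J" "x \<in> carrier Q" for a x using J.left_closed that by blast
    show "a \<otimes>\<^bsub>Q\<^esub> x \<in> ?J" if a: "a \<in> ?J" and x: "x \<in> carrier Q" for a x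
    proof -
      obtain a' x' where a': "a' \<in> ideal_ge n" "a = q a'" using JE[OF a] by blast
      obtain x' where x': "x' \<in> W" "x = q x'" using Q_surj[OF x] by blast
      have "q (mul a' x') \<in> ?J" by (rule imageI[OF ideal_mul_right[OF ideal_ge a'(1) x'(1)]])
      then show ?thesis unfolding a'(2) x'(2) q_mul[OF JW[OF a'(1)] x'(1)] .
    qed
  qed
  have sandwich: "x \<otimes>\<^bsub>Q\<^esub> r \<otimes>\<^bsub>Q\<^esub> y = \<zero>\<^bsub>Q\<^esub>"
    if x: "x \<in> ?J" and r: "r \<in> jacobson_radical Q" and y: "y \<in> ?J" for x r y
  proof -
    have "r \<in> carrier Q" using r by (simp add: jacobson_radical_def)
    from Q_surj[OF this] obtain r' where r': "r' \<in> W" "r = q r'" by blast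
    obtain x' where x': "x' \<in> ideal_ge n" "x = q x'" using JE[OF x] by blast
    obtain y' where y': "y' \<in> ideal_ge n" "y = q y'" using JE[OF y] by blast
    have "q (mul (mul x' r') y') = \<zero>\<^bsub>Q\<^esub>"
      using radical_sandwich[OF char x'(1) y'(1) r'(1)] r r'(2) q_zero_iff[OF mul_W] by simp
    then show ?thesis unfolding x'(2) y'(2) r'(2) q_mul[OF mul_W JW[OF y'(1)]] q_mul[OF JW[OF x'(1)] r'(1)] .
  qed
  have "B ` {d \<in> D. rk d = n} \<subseteq> B ` {d \<in> D. rk d = n}" by (rule order_refl)
  \<comment> \<open>\<open>M\<close> contains one diagram for each set of southern arcs occurring in
    rank \<open>n\<close>; it indexes the columns.\<close>
  from iffD1[OF subset_image_inj this] obtain M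
    where M: "M \<subseteq> {d \<in> D. rk d = n}" "inj_on B M" "B ` {d \<in> D. rk d = n} = B ` M" by (elim exE conjE)
  have MD: "b \<in> D" "rk b = n" if "b \<in> M" for b using M(1) that by auto
  have finM: "finite M" using finite_subset[OF M(1)] finite_D by simp
  have "\<forall>b\<in>M. \<exists>F. F \<in> W \<and> (\<forall>d. F d \<noteq> 0 \<longrightarrow> B b \<subseteq> B d) \<and> (\<forall>x\<in>D. B b \<subseteq> B x \<longrightarrow> mul (e x) F = e x)"
    using right_unit MD(1) by blast
  then obtain F where F: "\<forall>b\<in>M. F b \<in> W \<and> (\<forall>d. F b d \<noteq> 0 \<longrightarrow> B b \<subseteq> B d)
      \<and> (\<forall>x\<in>D. B b \<subseteq> B x \<longrightarrow> mul (e x) (F b) = e x)"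
    by (rule bchoice[THEN exE])
  have FJ: "F b \<in> ideal_ge n" if b: "b \<in> M" for b
  proof -
    have FW: "F b \<in> W" using F b by blast
    have "n \<le> rk d" if d: "F b d \<noteq> 0" for d
    proof -
      have "d \<in> D" using W_zero[OF FW, of d] d by blast
      moreover have "B b \<subseteq> B d" using F b d by blast
      ultimately show ?thesis using card_mono[OF finite_B, of d "B b"] rk_B[of d] rk_B[OF MD(1)[OF b]] MD(2)[OF b] by simp
    qed
    then show ?thesis using FW by (simp add: ideal_ge_def)
  qed
  have cF: "mul (column (B b) f) (F b) = column (B b) f" if "b \<in> M" "f \<in> W" for b f
    by (rule mul_column[OF that(2)]) (use F that(1) in blast)
  have decomp: "q f = q (\<Sum>b\<in>M. mul (column (B b) f) (F b))" if f: "f \<in> ideal_ge n" for f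
  proof -
    let ?s = "\<Sum>b\<in>M. column (B b) f"
    have s: "(\<Sum>b\<in>M. mul (column (B b) f) (F b)) = ?s"
      by (rule sum.cong[OF refl]) (rule cF[OF _ JW[OF f]])
    have sW: "?s \<in> W" by (rule W_sum) (rule column_W[OF JW[OF f]])
    have "n < rk d" if d: "(f - ?s) d \<noteq> 0" for d
    proof (rule ccontr)
      assume rk: "\<not> n < rk d"
      have sd: "?s d = (\<Sum>b\<in>M. column (B b) f d)" by (rule sum_fun_apply)
      show False
      proof (cases "f d = 0")
        case True
        then have "?s d = 0" unfolding sd by (intro sum.neutral) (simp add: column_def)
        then show False using d True by simp
      next
        case False
        have dD: "d \<in> D" "rk d = n" using W_zero[OF JW[OF f], of d] False f rk by (auto simp: ideal_ge_def)
        then obtain b where b: "b \<in> M" "B d = B b" using M(3) by blast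
        have "?s d = (\<Sum>b'\<in>M. if b' = b then f d else 0)"
          unfolding sd by (rule sum.cong[OF refl]) (use b inj_onD[OF M(2)] in \<open>auto simp: column_def\<close>)
        also have "\<dots> = f d" using b(1) finM by simp
        finally show False using d by simp
      qed
    qed
    then have "f - ?s \<in> ideal_ge (Suc n)" using W_diff[OF JW[OF f] sW] unfolding I_iff by blast
    then show ?thesis unfolding s by (rule iffD2[OF q_eq_iff[OF JW[OF f] sW]])
  qed
  have idem: "?J \<cdot>\<^bsub>Q\<^esub> ?J = ?J"
  proof
    show "?J \<cdot>\<^bsub>Q\<^esub> ?J \<subseteq> ?J" using Q.ideal_prod_inter[OF ideal_J ideal_J] by blast
    interpret P: ideal "?J \<cdot>\<^bsub>Q\<^esub> ?J" Q by (rule Q.ideal_prod_is_ideal[OF ideal_J ideal_J])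
    show "?J \<subseteq> ?J \<cdot>\<^bsub>Q\<^esub> ?J"
    proof
      fix X assume X: "X \<in> ?J"
      obtain f where f: "f \<in> ideal_ge n" "X = q f" using JE[OF X] by blast
      have "q (\<Sum>b\<in>M'. mul (column (B b) f) (F b)) \<in> ?J \<cdot>\<^bsub>Q\<^esub> ?J" if "finite M'" "M' \<subseteq> M" for M'
        using that
      proof (induction M' rule: finite_induct)
        case empty
        show ?case unfolding sum.empty q_zero by (rule P.zero_closed)
      next
        case (insert b M')
        then have b: "b \<in> M" by simp
        have "q (mul (column (B b) f) (F b)) = q (column (B b) f) \<otimes>\<^bsub>Q\<^esub> q (F b)"
          by (rule q_mul[OF column_W[OF JW[OF f(1)]] JW[OF FJ[OF b]]])
        also have "\<dots> \<in> ?J \<cdot>\<^bsub>Q\<^esub> ?J"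
          by (intro ideal_prod.prod imageI column_ideal f(1) FJ b)
        finally have 1: "q (mul (column (B b) f) (F b)) \<in> ?J \<cdot>\<^bsub>Q\<^esub> ?J" .
        have 2: "q (\<Sum>b\<in>M'. mul (column (B b) f) (F b)) \<in> ?J \<cdot>\<^bsub>Q\<^esub> ?J" by (rule insert.IH) (use insert.prems in simp)
        have "q (\<Sum>b\<in>insert b M'. mul (column (B b) f) (F b))
            = q (mul (column (B b) f) (F b)) \<oplus>\<^bsub>Q\<^esub> q (\<Sum>b\<in>M'. mul (column (B b) f) (F b))"
          unfolding sum.insert[OF insert.hyps] by (rule q_add[OF mul_W W_sum[OF mul_W]])
        then show ?case using ideal_prod.sum[OF 1 2] by (simp only:)
      qed
      from this[OF finM order_refl] show "X \<in> ?J \<cdot>\<^bsub>Q\<^esub> ?J" unfolding f(2) decomp[OF f(1)] .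
    qed
  qed
  have col_rep: "q (column (B b) (rep (q f))) = q (column (B b) f)" if b: "b \<in> M" and f: "f \<in> W" for b f
  proof -
    have "column (B b) f - column (B b) (rho f) = 0"
      unfolding lin_diff[OF lin_column, symmetric] by (rule column_zero[OF MD[OF b] rho_diff(1)])
    then have "column (B b) f = column (B b) (rho f)" by (rule iffD1[OF right_minus_eq])
    then show ?thesis unfolding rep_q[OF f] by (rule arg_cong[OF sym])
  qed
  \<comment> \<open>Elements of the quotient ring are sets of functions, and a dual basis has to be
    indexed by objects of that type; the singletons serve merely as names for the members of
    \<open>M\<close>.\<close>
  let ?K = "(\<lambda>b. {e b}) ` M"
  have injK: "inj_on (\<lambda>b. {e b}) M"
  proof (rule inj_onI)
    fix a b assume "{e a} = {e b}"
    then have "e a a = e b a" by simp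
    then show "a = b" by (simp add: basis_vector_def split: if_splits)
  qed
  define \<kappa> where "\<kappa> = inv_into M (\<lambda>b. {e b})"
  have \<kappa>: "\<kappa> {e b} = b" if "b \<in> M" for b
    unfolding \<kappa>_def by (rule inv_into_f_f[OF injK that])
  have \<kappa>M: "\<kappa> k \<in> M" if "k \<in> ?K" for k using that \<kappa> by auto
  have proj: "projective_left_module Q (ideal_as_left_module Q ?J)"
  proof (rule Q.projective_from_dual_basis[where K = ?K and \<phi> = "\<lambda>k X. q (column (B (\<kappa> k)) (rep X))"
        and h = "\<lambda>k. q (F (\<kappa> k))", OF LJ])
    have JC: "X \<in> carrier Q" if "X \<in> ?J" for X using that JW by auto
    show "finite ?K" using finM by simp
    show "q (column (B (\<kappa> k)) (rep X)) \<in> carrier Q" if "k \<in> ?K" "X \<in> ?J" for k X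
      by (intro q_closed column_W rep_W JC that)
    show "q (F (\<kappa> k)) \<in> ?J" if "k \<in> ?K" for k
      by (intro imageI FJ \<kappa>M that)
    show "q (column (B (\<kappa> k)) (rep (X \<oplus>\<^bsub>Q\<^esub> Y))) = q (column (B (\<kappa> k)) (rep X)) \<oplus>\<^bsub>Q\<^esub> q (column (B (\<kappa> k)) (rep Y))"
      if k: "k \<in> ?K" and X: "X \<in> ?J" and Y: "Y \<in> ?J" for k X Y
    proof -
      obtain f g where f: "f \<in> ideal_ge n" "X = q f" using JE[OF X] by blast
      obtain g where g: "g \<in> ideal_ge n" "Y = q g" using JE[OF Y] by blast
      note fg = JW[OF f(1)] JW[OF g(1)]
      show ?thesis
        unfolding f(2) g(2) q_add[OF fg, symmetric] col_rep[OF \<kappa>M[OF k] W_add[OF fg]] col_rep[OF \<kappa>M[OF k] fg(1)]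
          col_rep[OF \<kappa>M[OF k] fg(2)] lin_add[OF lin_column]
        by (rule q_add[OF column_W[OF fg(1)] column_W[OF fg(2)]])
    qed
    show "q (column (B (\<kappa> k)) (rep (A \<otimes>\<^bsub>Q\<^esub> X))) = A \<otimes>\<^bsub>Q\<^esub> q (column (B (\<kappa> k)) (rep X))"
      if k: "k \<in> ?K" and A: "A \<in> carrier Q" and X: "X \<in> ?J" for k A X
    proof -
      obtain f a where f: "f \<in> ideal_ge n" "X = q f" using JE[OF X] by blast
      obtain a where a: "a \<in> W" "A = q a" using Q_surj[OF A] by blast
      note fW = JW[OF f(1)]
      have "q (column (B (\<kappa> k)) (mul a f)) = q (mul a (column (B (\<kappa> k)) f))"
        by (rule iffD2[OF q_eq_iff[OF column_W[OF mul_W] mul_W] column_mul[OF f(1)]])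
      then show ?thesis
        unfolding f(2) a(2) q_mul[OF a(1) fW, symmetric] col_rep[OF \<kappa>M[OF k] mul_W] col_rep[OF \<kappa>M[OF k] fW]
          q_mul[OF a(1) column_W[OF fW], symmetric] .
    qed
    show "X = (\<Oplus>\<^bsub>Q\<^esub>k\<in>?K. q (column (B (\<kappa> k)) (rep X)) \<otimes>\<^bsub>Q\<^esub> q (F (\<kappa> k)))" if X: "X \<in> ?J" for X
    proof -
      obtain f where f: "f \<in> ideal_ge n" "X = q f" using JE[OF X] by blast
      note fW = JW[OF f(1)]
      have t: "q (column (B (\<kappa> k)) (rep X)) \<otimes>\<^bsub>Q\<^esub> q (F (\<kappa> k)) = q (mul (column (B (\<kappa> k)) f) (F (\<kappa> k)))"
        if k: "k \<in> ?K" for k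
        unfolding f(2) col_rep[OF \<kappa>M[OF k] fW] by (rule q_mul[OF column_W[OF fW] JW[OF FJ[OF \<kappa>M[OF k]]], symmetric])
      have "X = q (\<Sum>b\<in>M. mul (column (B b) f) (F b))" unfolding f(2) by (rule decomp[OF f(1)])
      also have "(\<Sum>b\<in>M. mul (column (B b) f) (F b)) = (\<Sum>k\<in>?K. mul (column (B (\<kappa> k)) f) (F (\<kappa> k)))"
        unfolding sum.reindex[OF injK] by (rule sum.cong[OF refl]) (simp add: \<kappa>)
      also have "q \<dots> = (\<Oplus>\<^bsub>Q\<^esub>k\<in>?K. q (mul (column (B (\<kappa> k)) f) (F (\<kappa> k))))"
        by (rule q_sum[OF finite_imageI[OF finM] mul_W])
      also have "\<dots> = (\<Oplus>\<^bsub>Q\<^esub>k\<in>?K. q (column (B (\<kappa> k)) (rep X)) \<otimes>\<^bsub>Q\<^esub> q (F (\<kappa> k)))"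
        by (rule Q.finsum_cong') (auto simp: t)
      finally show ?thesis .
    qed
  qed
  show ?thesis unfolding heredity_ideal_def using ideal_J idem sandwich proj by blast
qed

end

theorem (in diagram_algebra) quasi_hereditary_iff_card:
  "quasi_hereditary R \<longleftrightarrow> of_nat (card \<Gamma>) \<noteq> (0::'k)"
proof
  show "of_nat (card \<Gamma>) \<noteq> (0::'k)" if "quasi_hereditary R" using that by (rule quasi_hereditary_imp_card)
  assume char: "of_nat (card \<Gamma>) \<noteq> (0::'k)"
  define N where "N = Suc (\<Sum>d\<in>D. rk d)"
  have N: "rk d < N" if "d \<in> D" for d
    using member_le_sum[of d D rk] finite_D that by (simp add: N_def less_Suc_eq_le)
  \<comment> \<open>\<open>N\<close> exceeds every rank, so the chain starts at zero and the ideals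
    grow as the required number of arcs falls.\<close>
  define J where "J i = ideal_ge (N - i)" for i
  have "J 0 = {\<zero>\<^bsub>R\<^esub>}"
  proof
    show "J 0 \<subseteq> {\<zero>\<^bsub>R\<^esub>}"
    proof
      fix f assume f: "f \<in> J 0"
      have "f d = 0" for d
      proof (rule ccontr)
        assume "f d \<noteq> 0"
        then have "d \<in> D" "N \<le> rk d" using f W_zero[of f d] by (auto simp: J_def ideal_ge_def)
        then show False using N[of d] by simp
      qed
      then show "f \<in> {\<zero>\<^bsub>R\<^esub>}" by (simp add: fun_eq_iff)
    qed
    show "{\<zero>\<^bsub>R\<^esub>} \<subseteq> J 0" by (simp add: J_def ideal_ge_def)
  qed
  moreover have "J N = carrier R" by (simp add: J_def ideal_ge_def)
  moreover have "J i \<subseteq> J (Suc i) \<and> heredity_ideal ((\<lambda>x. J i +>\<^bsub>R\<^esub> x) ` J (Suc i)) (R Quot J i)" if i: "i < N" for i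
  proof -
    define n where "n = N - Suc i"
    have n: "J i = ideal_ge (Suc n)" "J (Suc i) = ideal_ge n" using i by (simp_all add: J_def n_def Suc_diff_Suc)
    interpret diagram_layer D cc lam u T B n by unfold_locales
    show ?thesis unfolding n using heredity_layer[OF char] ideal_ge_mono by blast
  qed
  moreover have "ideal (J i) R" for i unfolding J_def by (rule ideal_ge)
  ultimately show "quasi_hereditary R" unfolding quasi_hereditary_def by blast
qed


section \<open>Brauer algebras\<close>

lemma finite_arcs:
  assumes "x \<in> reduced_diagrams m n"
  shows "finite (top_arcs x)" "finite (bottom_arcs x)"
  using reduced_finite assms by (auto simp: top_arcs_def bottom_arcs_def)

text \<open>The reflected form of \<open>unit_step\<close>; \<open>\<phi>\<close> is the reflection
  of a single strand.\<close>

lemma right_unit_step: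
  fixes \<delta> :: "nat \<Rightarrow> 'k::field"
  assumes m: "m > 0" and pm: "m = p * d" and \<delta>: "even n \<longrightarrow> (\<exists>i<d. \<delta> (i * p) \<noteq> 0)"
    and w: "w \<in> reduced_diagrams m n" and s: "s \<in> bottom_arcs w"
  shows "\<exists>k\<in>brauer_diagrams m p n. \<exists>c. c \<noteq> 0 \<and> s \<in> bottom_arcs k
    \<and> (\<forall>x\<in>reduced_diagrams m n. s \<in> x \<longrightarrow> concat_diagram m x k = x \<and> loop_factor m p \<delta> x k = c)
    \<and> (\<forall>y\<in>reduced_diagrams m n. \<forall>t\<in>bottom_arcs w. t \<in> y \<longrightarrow> t \<in> concat_diagram m y k)"
proof -
  define \<phi> :: "node set \<times> nat \<Rightarrow> node set \<times> nat" where "\<phi> t = (flip_node ` fst t, snd t)" for t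
  have \<phi>\<phi>: "\<phi> (\<phi> t) = t" for t by (simp add: \<phi>_def image_image)
  have flip: "flip x = \<phi> ` x" for x by (simp add: flip_def \<phi>_def[abs_def])
  have \<phi>_flip: "\<phi> t \<in> flip x" if "t \<in> x" for t x using that unfolding flip by (rule imageI)
  have \<phi>_flip': "t \<in> x" if "\<phi> t \<in> flip x" for t x using \<phi>_flip[OF that] by (simp add: \<phi>\<phi>)
  have "\<phi> s \<in> top_arcs (flip w)" unfolding top_arcs_flip by (rule \<phi>_flip[OF s])
  from unit_step[OF m pm \<delta> flip_reduced[OF w] this]
  obtain k c where k: "k \<in> brauer_diagrams m p n" "c \<noteq> 0" "\<phi> s \<in> top_arcs k"
    and kx: "\<forall>x\<in>reduced_diagrams m n. \<phi> s \<in> x \<longrightarrow> concat_diagram m k x = x \<and> loop_factor m p \<delta> k x = c"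
    and ky: "\<forall>y\<in>reduced_diagrams m n. \<forall>t\<in>top_arcs (flip w). t \<in> y \<longrightarrow> t \<in> concat_diagram m k y"
    by (elim bexE exE conjE)
  have "s \<in> bottom_arcs (flip k)" unfolding bottom_arcs_flip using \<phi>_flip[OF k(3)] by (simp only: \<phi>\<phi>)
  moreover have "concat_diagram m x (flip k) = x \<and> loop_factor m p \<delta> x (flip k) = c"
    if x: "x \<in> reduced_diagrams m n" "s \<in> x" for x
    using bspec[OF kx flip_reduced[OF x(1)]] \<phi>_flip[OF x(2)] concat_flip[of m "flip k" x] loop_factor_flip[of m p \<delta> "flip k" x]
    by (metis flip_flip)
  moreover have "t \<in> concat_diagram m y (flip k)"
    if y: "y \<in> reduced_diagrams m n" and t: "t \<in> bottom_arcs w" "t \<in> y" for y t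
  proof (rule \<phi>_flip')
    have "\<phi> t \<in> top_arcs (flip w)" unfolding top_arcs_flip by (rule \<phi>_flip[OF t(1)])
    then have "\<phi> t \<in> concat_diagram m k (flip y)" using bspec[OF bspec[OF ky flip_reduced[OF y]]] \<phi>_flip[OF t(2)] by blast
    then show "\<phi> t \<in> flip (concat_diagram m y (flip k))" using concat_flip[of m "flip k" y] by simp
  qed
  ultimately show ?thesis using flip_brauer[OF k(1)] k(2) by blast
qed

lemma brauer_algebra_twisted:
  "brauer_algebra m p n \<delta> =
    twisted_algebra (brauer_diagrams m p n) (concat_diagram m) (loop_factor m p \<delta>) (identity_diagram n)"
  by (simp add: brauer_algebra_def twisted_algebra_def)

lemma brauer_diagram_algebra:
  fixes \<delta> :: "nat \<Rightarrow> 'k::field"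
  assumes m: "m > 0" and pm: "m = p * d" and \<delta>: "even n \<longrightarrow> (\<exists>i<d. \<delta> (i * p) \<noteq> 0)"
  shows "diagram_algebra (brauer_diagrams m p n) (concat_diagram m) (loop_factor m p \<delta>) (identity_diagram n)
    top_arcs bottom_arcs"
proof
  let ?D = "brauer_diagrams m p n"
  have p: "p dvd m" using pm by simp
  note r = brauer_reduced
  show "finite ?D" by (rule finite_brauer)
  show u: "identity_diagram n \<in> ?D" by (rule identity_brauer[OF m])
  fix x assume x: "x \<in> ?D"
  show "concat_diagram m (identity_diagram n) x = x" "concat_diagram m x (identity_diagram n) = x"
    using concat_identity_left[OF m r[OF x]] concat_identity_right[OF m r[OF x]] by blast+
  show "loop_factor m p \<delta> (identity_diagram n) x = 1" "loop_factor m p \<delta> x (identity_diagram n) = 1"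
    using loop_factor_no_loops no_loops_bottom[OF r[OF u] r[OF x]] no_loops_top[OF r[OF x] r[OF u]] identity_arcs by blast+
  show "finite (top_arcs x)" "finite (bottom_arcs x)" using finite_arcs[OF r[OF x]] by blast+
  show ct: "card (top_arcs x) = card (bottom_arcs x)" by (rule card_top_bottom[OF r[OF x]])
  show "\<exists>k\<in>?D. \<exists>c. c \<noteq> 0 \<and> s \<in> top_arcs k
      \<and> (\<forall>y\<in>?D. s \<in> top_arcs y \<longrightarrow> concat_diagram m k y = y \<and> loop_factor m p \<delta> k y = c)
      \<and> (\<forall>y\<in>?D. \<forall>t\<in>top_arcs x. t \<in> top_arcs y \<longrightarrow> t \<in> top_arcs (concat_diagram m k y))"
    if s: "s \<in> top_arcs x" for s
  proof -
    obtain k c where k: "k \<in> ?D" "c \<noteq> 0" "s \<in> top_arcs k"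
      and kx: "\<forall>x\<in>reduced_diagrams m n. s \<in> x \<longrightarrow> concat_diagram m k x = x \<and> loop_factor m p \<delta> k x = c"
      and ky: "\<forall>y\<in>reduced_diagrams m n. \<forall>t\<in>top_arcs x. t \<in> y \<longrightarrow> t \<in> concat_diagram m k y"
      using unit_step[OF m pm \<delta> r[OF x] s] by (elim bexE exE conjE)
    have "concat_diagram m k y = y \<and> loop_factor m p \<delta> k y = c" if "y \<in> ?D" "s \<in> top_arcs y" for y
      using bspec[OF kx r[OF that(1)]] that(2) by (simp add: top_arcs_def)
    moreover have "t \<in> top_arcs (concat_diagram m k y)" if "y \<in> ?D" "t \<in> top_arcs x" "t \<in> top_arcs y" for y t
      using bspec[OF bspec[OF ky r[OF that(1)]] that(2)] that(3) by (simp add: top_arcs_def)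
    ultimately show ?thesis using k by blast
  qed
  show "\<exists>k\<in>?D. \<exists>c. c \<noteq> 0 \<and> s \<in> bottom_arcs k
      \<and> (\<forall>y\<in>?D. s \<in> bottom_arcs y \<longrightarrow> concat_diagram m y k = y \<and> loop_factor m p \<delta> y k = c)
      \<and> (\<forall>y\<in>?D. \<forall>t\<in>bottom_arcs x. t \<in> bottom_arcs y \<longrightarrow> t \<in> bottom_arcs (concat_diagram m y k))"
    if s: "s \<in> bottom_arcs x" for s
  proof -
    obtain k c where k: "k \<in> ?D" "c \<noteq> 0" "s \<in> bottom_arcs k"
      and kx: "\<forall>x\<in>reduced_diagrams m n. s \<in> x \<longrightarrow> concat_diagram m x k = x \<and> loop_factor m p \<delta> x k = c"
      and ky: "\<forall>y\<in>reduced_diagrams m n. \<forall>t\<in>bottom_arcs x. t \<in> y \<longrightarrow> t \<in> concat_diagram m y k"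
      using right_unit_step[OF m pm \<delta> r[OF x] s] by (elim bexE exE conjE)
    have "concat_diagram m y k = y \<and> loop_factor m p \<delta> y k = c" if "y \<in> ?D" "s \<in> bottom_arcs y" for y
      using bspec[OF kx r[OF that(1)]] that(2) by (simp add: bottom_arcs_def)
    moreover have "t \<in> bottom_arcs (concat_diagram m y k)" if "y \<in> ?D" "t \<in> bottom_arcs x" "t \<in> bottom_arcs y" for y t
      using bspec[OF bspec[OF ky r[OF that(1)]] that(2)] that(3) by (simp add: bottom_arcs_def)
    ultimately show ?thesis using k by blast
  qed
  fix y assume y: "y \<in> ?D"
  show "loop_factor m p \<delta> x y \<noteq> 0 \<Longrightarrow> concat_diagram m x y \<in> ?D" by (rule concat_brauer[OF m p x y])
  show "top_arcs x \<subseteq> top_arcs (concat_diagram m x y)" by (rule top_arcs_concat[OF r[OF x] r[OF y]])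
  show "bottom_arcs y \<subseteq> bottom_arcs (concat_diagram m x y)" by (rule bottom_arcs_concat[OF r[OF x] r[OF y]])
  show "loop_factor m p \<delta> x y = 1" if "top_arcs x = {} \<or> top_arcs y = {}"
  proof -
    have "bottom_arcs x = {} \<or> top_arcs y = {}" using that ct finite_arcs(2)[OF r[OF x]] by (metis card.empty card_0_eq)
    then have "closed_loops x y = {}" using no_loops_bottom[OF r[OF x] r[OF y]] no_loops_top[OF r[OF x] r[OF y]] by blast
    then show ?thesis by (rule loop_factor_no_loops)
  qed
  show "bottom_arcs x = bottom_arcs y \<Longrightarrow> \<exists>g\<in>?D. top_arcs g = {} \<and> concat_diagram m g x = y"
    by (rule brauer_transitive_left[OF m p x y])
  show "top_arcs x = top_arcs y \<Longrightarrow> \<exists>g\<in>?D. top_arcs g = {} \<and> concat_diagram m x g = y"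
    by (rule brauer_transitive_right[OF m p x y])
  fix z assume z: "z \<in> ?D"
  show "concat_diagram m (concat_diagram m x y) z = concat_diagram m x (concat_diagram m y z)"
    by (rule concat_assoc[OF m r[OF x] r[OF y] r[OF z]])
  show "loop_factor m p \<delta> x y * loop_factor m p \<delta> (concat_diagram m x y) z
      = loop_factor m p \<delta> y z * loop_factor m p \<delta> x (concat_diagram m y z)"
    by (rule loop_factor_assoc[OF m r[OF x] r[OF y] r[OF z]])
qed

theorem theorem3p1p1:
  fixes m p d n :: nat
    and \<delta> :: "nat \<Rightarrow> 'k::field"
  assumes "m > 0" "p > 0" "d > 0" "n \<ge> 2"
    and "m = p * d"
    and "even n \<Longrightarrow> \<exists>i<d. \<delta> (i * p) \<noteq> 0"
  shows "quasi_hereditary (brauer_algebra m p n \<delta>) \<longleftrightarrow>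
    CHAR('k) = 0 \<or> (CHAR('k) > n \<and> \<not> CHAR('k) dvd m)"
proof -
  interpret diagram_algebra "brauer_diagrams m p n" "concat_diagram m" "loop_factor m p \<delta>" "identity_diagram n"
    top_arcs bottom_arcs
    by (rule brauer_diagram_algebra[OF assms(1,5)]) (use assms(6) in blast)
  have "card \<Gamma> = fact n * (m ^ (n - 1) * d)"
    unfolding \<Gamma>_def by (rule card_invertible_diagrams) (use assms in auto)
  then have "quasi_hereditary (brauer_algebra m p n \<delta>) \<longleftrightarrow> \<not> CHAR('k) dvd fact n * (m ^ (n - 1) * d)"
    unfolding brauer_algebra_twisted quasi_hereditary_iff_card by (simp only: of_nat_eq_0_iff_char_dvd)
  also have "\<dots> \<longleftrightarrow> CHAR('k) = 0 \<or> (CHAR('k) > n \<and> \<not> CHAR('k) dvd m)"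
  proof (cases "CHAR('k) = 0")
    case False
    then have c: "prime CHAR('k)" using prime_CHAR_semidom by blast
    \<comment> \<open>As \<open>d\<close> divides \<open>m\<close> and the exponent
      \<open>n - 1\<close> is positive for \<open>n \<ge> 2\<close>, a prime divides
      \<open>m ^ (n - 1) * d\<close> exactly when it divides \<open>m\<close>.\<close>
    have "CHAR('k) dvd m ^ (n - 1) * d \<longleftrightarrow> CHAR('k) dvd m"
      using prime_dvd_mult_iff[OF c] prime_dvd_power_iff[OF c, of "n - 1" m] assms(4,5) by auto
    then have "CHAR('k) dvd fact n * (m ^ (n - 1) * d) \<longleftrightarrow> CHAR('k) \<le> n \<or> CHAR('k) dvd m"
      using prime_dvd_mult_iff[OF c] prime_dvd_fact_iff[OF c, of n] by simp
    then show ?thesis using False by auto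
  qed (use assms in simp)
  finally show ?thesis .
qed

end
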